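(* Assume (A1) and (A2) hold and that $\mathcal H_0$ holds. If for some $\delta>0$ $$\max\Big\{\sup_{i,j}\mathbb E\big(|h(X_i,X_j)|^{2+\delta}\big),\ \int\int_{\mathbb R^2}|h(x,y)|^{2+\delta}\,dF_1(x)\,dF_1(y)\Big\}<\infty,$$ then $\sigma_{pr}<\infty$ for all $p,r\in\{1,2\}$. If in addition $\sigma_{pr}>0$ for all $1\le p,r\le 2$, then the sequence of processes $\{\mathcal Z_n(t_1,\dots,t_k);\ t_1,\dots,t_k\in[0,1]\}_{n\in\mathbb N}$ converges in distribution to the process $\mathcal Z$ defined for $t=(t_1,\dots,t_k)\in[0,1]^k$ by $$\mathcal Z(t)=\sum_{l=1}^k\Big\{(t_{l+1}-t_l)\big[W_1(t_l)-W_1(t_{l-1})\big]+(t_l-t_{l-1})\big[W_2(t_{l+1})-W_2(t_l)\big]\Big\}\ \text{ if } t\in\Theta_k,\qquad \mathcal Z(t)=0 \text{ if } t\notin\Theta_k,$$ with $t_0=0$, $t_{k+1}=1$, where $\{(W_1(t),W_2(t))\}_{0\le t\le1}$ is a two-dimensional zero-mean Brownian motion with $\mathrm{Cov}(W_p(s),W_r(t))=\min(s,t)\,\sigma_{pr}$, $p,r=1,2$, $s,t\in[0,1]$.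
   Context: Let $k\ge1$ be a fixed integer and $h:\mathbb R^2\to\mathbb R$ a measurable kernel. For cumulative distribution functions (cdfs) $Q,R$ on $\mathbb R$ put $\theta_h(Q,R)=\int\int h(x,y)\,dQ(x)\,dR(y)$. The observations $X_1,\dots,X_n$ are real random variables; $F_i$ denotes the cdf of $X_i$. $[x]$ is the integer part of $x$, and $\Theta_k=\{(t_1,\dots,t_k)\in[0,1]^k:\ 0<t_1<\dots<t_k<1\}$. Define the process $$\mathcal Z_n(t_1,\dots,t_k)=n^{-3/2}\sum_{l=1}^k\sum_{i=[nt_{l-1}]+1}^{[nt_l]}\sum_{j=[nt_l]+1}^{[nt_{l+1}]}\{h(X_i,X_j)-\theta_h(F_1,F_1)\}$$ for $(t_1,\dots,t_k)\in\Theta_k$ and $\mathcal Z_n=0$ outside $\Theta_k$, with the convention $[nt_0]=1$, $[nt_{k+1}]=n$. Put $h_{F_1,1}(x)=\int h(x,y)\,dF_1(y)-\theta_h(F_1,F_1)$, $h_{F_1,2}(y)=\int h(x,y)\,dF_1(x)-\theta_h(F_1,F_1)$, and for $p,r\in\{1,2\}$ $$\sigma_{pr}=\mathbb E[h_{F_1,p}(X_1)h_{F_1,r}(X_1)]+2\sum_{i=1}^\infty\mathrm{Cov}\big(h_{F_1,p}(X_1),h_{F_1,r}(X_{i+1})\big).$$ A (not necessarily stationary) triangular array $\{V_{ni},1\le i\le n,n\ge1\}$ is absolutely regular if $\beta(m)=\sup_{n}\sup_{m\le n}\max_{1\le j\le n-m}\mathbb E\{\sup_{A\in\mathcal A^{\infty}_{n,j+m}}|\mathbb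 P(A\mid\mathcal A^j_{n,0})-\mathbb P(A)|\}\to0$ as $m\to\infty$, where $\mathcal A^j_{n,i}$ is the $\sigma$-algebra generated by $V_{ni},\dots,V_{nj}$. (A1): $(X_i)_{i\in\mathbb N}$ is stationary and absolutely regular with $\beta(n)=O(\tau^n)$ for some $0<\tau<1$. (A2): $\dot F_1=F_1,\dot F_2,\dots,\dot F_k$ are cdfs and, for each $l=1,\dots,k$, $(Y^l_i)_{1\le i\le n}$ is a stationary absolutely regular sequence with rate $\beta(n)=O(\tau^n)$, $0<\tau<1$, and cdf $\dot F_l$; for any $i,j$ the absolutely regular dependence between $Y^l_i$ and $Y^l_j$ is the same as that between $X_i$ and $X_j$; the $Y^1_i$ have the same law as the $X_i$. $\mathcal H_0$: the cdf of $X_i$ is $F_1$ for all $i\in\{1,\dots,n\}$.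
   Formalization: The formula for σ_pr need not be symmetric in p and r, so the prescribed covariance of W_1 and W_2 can be inconsistent; the formal statement uses min(s,t)(σ_12+σ_21)/2 for the cross-covariance, which agrees with the text when σ_12=σ_21. *)

theory Defs
  imports "HOL-Probability.Probability"
begin

definition gen_sigma :: "'a measure \<Rightarrow> (nat \<Rightarrow> 'a \<Rightarrow> real) \<Rightarrow> nat set \<Rightarrow> 'a set set" where
  "gen_sigma M X I = sigma_sets (space M) {X i -` B \<inter> space M | i B. i \<in> I \<and> B \<in> sets borel}"

definition beta_coef :: "'a measure \<Rightarrow> 'a set set \<Rightarrow> 'a set set \<Rightarrow> real" where
  "beta_coef M F G = Sup {(1/2) * (\<Sum>i<n. \<Sum>j<n.
        \<bar>measure M (A i \<inter> B j) - measure M (A i) * measure M (B j)\<bar>) | (n::nat) A B.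
      (\<forall>i<n. A i \<in> F \<and> B i \<in> G) \<and> disjoint_family_on A {..<n} \<and> disjoint_family_on B {..<n}
      \<and> (\<Union>i<n. A i) = space M \<and> (\<Union>i<n. B i) = space M}"

definition beta_mix :: "'a measure \<Rightarrow> (nat \<Rightarrow> 'a \<Rightarrow> real) \<Rightarrow> nat \<Rightarrow> real" where
  "beta_mix M X m = Sup {beta_coef M (gen_sigma M X {1..j}) (gen_sigma M X {j+m..}) | j. j \<ge> 1}"

definition geom_abs_regular :: "'a measure \<Rightarrow> (nat \<Rightarrow> 'a \<Rightarrow> real) \<Rightarrow> bool" where
  "geom_abs_regular M X \<longleftrightarrow>
     (\<exists>\<tau> C N. 0 < \<tau> \<and> \<tau> < 1 \<and> (\<forall>m\<ge>N. \<bar>beta_mix M X m\<bar> \<le> C * \<tau> ^ m))"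

definition fdd :: "'a measure \<Rightarrow> (nat \<Rightarrow> 'a \<Rightarrow> real) \<Rightarrow> nat set \<Rightarrow> (nat \<Rightarrow> real) measure" where
  "fdd M X I = distr M (PiM I (\<lambda>_. borel)) (\<lambda>\<omega>. \<lambda>i\<in>I. X i \<omega>)"

definition stationary_seq :: "'a measure \<Rightarrow> (nat \<Rightarrow> 'a \<Rightarrow> real) \<Rightarrow> bool" where
  "stationary_seq M X \<longleftrightarrow> (\<forall>s I. finite I \<and> I \<subseteq> {1..} \<longrightarrow> fdd M (\<lambda>i. X (i + s)) I = fdd M X I)"

definition theta_h :: "(real \<Rightarrow> real \<Rightarrow> real) \<Rightarrow> real measure \<Rightarrow> real measure \<Rightarrow> real" where
  "theta_h h Q R = (\<integral>y. (\<integral>x. h x y \<partial>Q) \<partial>R)"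

text \<open>h_{F,1} (p = 1) and h_{F,2} (p = 2); mu is the law with cdf F.\<close>
definition hF :: "(real \<Rightarrow> real \<Rightarrow> real) \<Rightarrow> real measure \<Rightarrow> nat \<Rightarrow> real \<Rightarrow> real" where
  "hF h \<mu> p z = (if p = 1 then (\<integral>y. h z y \<partial>\<mu>) else (\<integral>x. h x z \<partial>\<mu>)) - theta_h h \<mu> \<mu>"

definition covar :: "'a measure \<Rightarrow> ('a \<Rightarrow> real) \<Rightarrow> ('a \<Rightarrow> real) \<Rightarrow> real" where
  "covar M U V = (\<integral>\<omega>. U \<omega> * V \<omega> \<partial>M) - (\<integral>\<omega>. U \<omega> \<partial>M) * (\<integral>\<omega>. V \<omega> \<partial>M)"

text \<open>Long-run covariance sigma_pr, with X 1 the first observation.\<close>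
definition lrv :: "'a measure \<Rightarrow> (nat \<Rightarrow> 'a \<Rightarrow> real) \<Rightarrow> (real \<Rightarrow> real \<Rightarrow> real) \<Rightarrow> nat \<Rightarrow> nat \<Rightarrow> real" where
  "lrv M X h p r =
     (let \<mu> = distr M borel (X 1) in
      (\<integral>\<omega>. hF h \<mu> p (X 1 \<omega>) * hF h \<mu> r (X 1 \<omega>) \<partial>M)
      + 2 * (\<Sum>i. covar M (\<lambda>\<omega>. hF h \<mu> p (X 1 \<omega>)) (\<lambda>\<omega>. hF h \<mu> r (X (i + 2) \<omega>))))"

text \<open>sigma_pr is a well-defined finite real number: all expectations exist and the
  covariance series converges.\<close>
definition lrv_finite :: "'a measure \<Rightarrow> (nat \<Rightarrow> 'a \<Rightarrow> real) \<Rightarrow> (real \<Rightarrow> real \<Rightarrow> real) \<Rightarrow> nat \<Rightarrow> nat \<Rightarrow> bool" where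
  "lrv_finite M X h p r \<longleftrightarrow>
     (let \<mu> = distr M borel (X 1) in
       integrable M (\<lambda>\<omega>. hF h \<mu> p (X 1 \<omega>)) \<and>
       (\<forall>i\<ge>1. integrable M (\<lambda>\<omega>. hF h \<mu> r (X i \<omega>))) \<and>
       (\<forall>i\<ge>1. integrable M (\<lambda>\<omega>. hF h \<mu> p (X 1 \<omega>) * hF h \<mu> r (X i \<omega>))) \<and>
       summable (\<lambda>i. covar M (\<lambda>\<omega>. hF h \<mu> p (X 1 \<omega>)) (\<lambda>\<omega>. hF h \<mu> r (X (i + 2) \<omega>))))"

definition cube :: "nat \<Rightarrow> (nat \<Rightarrow> real) set" where
  "cube k = {t. (\<forall>l\<in>{1..k}. 0 \<le> t l \<and> t l \<le> 1) \<and> (\<forall>l. l \<notin> {1..k} \<longrightarrow> t l = 0)}"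

definition Theta :: "nat \<Rightarrow> (nat \<Rightarrow> real) set" where
  "Theta k = {t \<in> cube k. 0 < t 1 \<and> (\<forall>l\<in>{1..<k}. t l < t (Suc l)) \<and> t k < 1}"

definition idx :: "nat \<Rightarrow> nat \<Rightarrow> (nat \<Rightarrow> real) \<Rightarrow> nat \<Rightarrow> nat" where
  "idx k n t l = (if l = 0 then 1 else if l = Suc k then n else nat \<lfloor>real n * t l\<rfloor>)"

definition Zn :: "nat \<Rightarrow> (real \<Rightarrow> real \<Rightarrow> real) \<Rightarrow> real \<Rightarrow> (nat \<Rightarrow> 'a \<Rightarrow> real) \<Rightarrow> nat
    \<Rightarrow> 'a \<Rightarrow> (nat \<Rightarrow> real) \<Rightarrow> real" where
  "Zn k h \<theta> X n \<omega> t = (if t \<in> Theta k then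
      real n powr (-3/2) * (\<Sum>l\<in>{1..k}. \<Sum>i\<in>{idx k n t (l - 1) + 1 .. idx k n t l}.
         \<Sum>j\<in>{idx k n t l + 1 .. idx k n t (Suc l)}. (h (X i \<omega>) (X j \<omega>) - \<theta>))
    else 0)"

definition text_ext :: "nat \<Rightarrow> (nat \<Rightarrow> real) \<Rightarrow> nat \<Rightarrow> real" where
  "text_ext k t l = (if l = 0 then 0 else if l = Suc k then 1 else t l)"

definition Zlim :: "nat \<Rightarrow> (nat \<Rightarrow> real \<Rightarrow> 'b \<Rightarrow> real) \<Rightarrow> 'b \<Rightarrow> (nat \<Rightarrow> real) \<Rightarrow> real" where
  "Zlim k W \<omega> t = (if t \<in> Theta k then
      (\<Sum>l\<in>{1..k}. (text_ext k t (Suc l) - text_ext k t l)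
              * (W 1 (text_ext k t l) \<omega> - W 1 (text_ext k t (l - 1)) \<omega>)
          + (text_ext k t l - text_ext k t (l - 1))
              * (W 2 (text_ext k t (Suc l)) \<omega> - W 2 (text_ext k t l) \<omega>))
    else 0)"

definition centered_gauss :: "real \<Rightarrow> real measure" where
  "centered_gauss v = (if v \<le> 0 then return borel 0 else density lborel (normal_density 0 (sqrt v)))"

definition brownian2 :: "'b measure \<Rightarrow> (nat \<Rightarrow> real \<Rightarrow> 'b \<Rightarrow> real) \<Rightarrow> (nat \<Rightarrow> nat \<Rightarrow> real) \<Rightarrow> bool" where
  "brownian2 N W \<sigma> \<longleftrightarrow> prob_space N \<and>
     (\<forall>p\<in>{1,2}. \<forall>t\<in>{0..1}. W p t \<in> borel_measurable N) \<and>
     (\<forall>p\<in>{1,2}. \<forall>\<omega>\<in>space N. continuous_on {0..1} (\<lambda>t. W p t \<omega>)) \<and>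
     (\<forall>(n::nat) a q s. (\<forall>j<n. q j \<in> {1,2} \<and> s j \<in> {0..1}) \<longrightarrow>
        distr N borel (\<lambda>\<omega>. \<Sum>j<n. a j * W (q j) (s j) \<omega>)
        = centered_gauss (\<Sum>j<n. \<Sum>m<n. a j * a m * min (s j) (s m) * \<sigma> (q j) (q m)))"

section \<open>Convergence in distribution of processes (Hoffmann-Joergensen, sup-norm)\<close>

definition bounded_on :: "(nat \<Rightarrow> real) set \<Rightarrow> ((nat \<Rightarrow> real) \<Rightarrow> real) \<Rightarrow> bool" where
  "bounded_on T x \<longleftrightarrow> bdd_above ((\<lambda>t. \<bar>x t\<bar>) ` T)"

definition sup_dist :: "(nat \<Rightarrow> real) set \<Rightarrow> ((nat \<Rightarrow> real) \<Rightarrow> real) \<Rightarrow> ((nat \<Rightarrow> real) \<Rightarrow> real) \<Rightarrow> real" where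
  "sup_dist T x y = (SUP t\<in>T. \<bar>x t - y t\<bar>)"

definition bc_functional :: "(nat \<Rightarrow> real) set \<Rightarrow> (((nat \<Rightarrow> real) \<Rightarrow> real) \<Rightarrow> real) \<Rightarrow> bool" where
  "bc_functional T f \<longleftrightarrow> (\<exists>B. \<forall>x. \<bar>f x\<bar> \<le> B) \<and>
     (\<forall>x. bounded_on T x \<longrightarrow> (\<forall>\<epsilon>>0. \<exists>\<delta>>0. \<forall>y. bounded_on T y \<longrightarrow> sup_dist T x y < \<delta>
          \<longrightarrow> \<bar>f x - f y\<bar> < \<epsilon>))"

definition outer_exp :: "'a measure \<Rightarrow> ('a \<Rightarrow> real) \<Rightarrow> real" where
  "outer_exp M g = Inf {integral\<^sup>L M U | U. integrable M U \<and> (\<forall>\<omega>\<in>space M. g \<omega> \<le> U \<omega>)}"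

definition conv_dist :: "(nat \<Rightarrow> real) set \<Rightarrow> 'a measure \<Rightarrow> (nat \<Rightarrow> 'a \<Rightarrow> (nat \<Rightarrow> real) \<Rightarrow> real)
    \<Rightarrow> 'b measure \<Rightarrow> ('b \<Rightarrow> (nat \<Rightarrow> real) \<Rightarrow> real) \<Rightarrow> bool" where
  "conv_dist T M Zs N Z \<longleftrightarrow> (\<forall>f. bc_functional T f \<longrightarrow>
      (\<lambda>n. outer_exp M (\<lambda>\<omega>. f (Zs n \<omega>))) \<longlonglongrightarrow> outer_exp N (\<lambda>\<omega>. f (Z \<omega>)))"

end

theory Submission
  imports Defs "HOL-Real_Asymp.Real_Asymp"
begin

text \<open>
  Hoeffding's decomposition writes the centred kernel as a sum of two one-variable functions and a
  completely degenerate remainder. Under beta-mixing the law of \<open>(past, future)\<close> is close in total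
  variation to the product law, so covariances are controlled for functions with \<open>q > 2\<close> moments.

  The degenerate remainder is negligible: a fourfold product whose smallest or largest index is far from
  the others has almost vanishing expectation, which bounds the second moment of block sums, and a
  two-dimensional Rademacher--Menshov chaining makes the bound uniform in the rectangle.
  The one-variable partial sums converge jointly by Bernstein blocks (finite-dimensional laws) and an
  Ottaviani inequality (tightness). Since the candidate limit is given with continuous paths, convergence in the
  sup-norm follows by comparing both processes with their discretisations on a grid: for Lipschitz
  functionals this is an estimate, general bounded continuous functionals are reached by Lipschitz
  regularisation from below and above, and on a grid the functional is one of a finite vector, treated with
  characteristic functions and Stone--Weierstrass.
\<close>

text \<open>Only moments of order \<open>q\<close>, between two and three, are available, and this
  shapes the estimates. A product of two kernel values has moments of order \<open>q/2\<close>,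
  barely above one; total variation therefore acts after a truncation, and the geometric rate
  survives with a worse base. Tightness is the other obstacle: over one of \<open>K\<close> grid
  cells a second-moment bound for the increment is of order 1/K, which is lost when \<open>K\<close>
  cells are added. Here the sample size grows first, the increment becomes Gaussian, and the
  Gaussian fourth moment gives order 1/K^2 per cell; the limits are thus taken in the order
  \<open>n\<close>, then \<open>K\<close>. Separating gaps are of order log n or (log n)^2: the
  mixing error beats the required power of n, while only powers of a logarithm are paid, which the
  room between \<open>q\<close> and 2, or between n^2 and n^3 in the degenerate part, absorbs.
  Rounding of n t_l and the convention [n t_0] = 1 change the sums by order n only, against the
  normalisation n^(3/2).\<close>

section \<open>Total variation on product \<sigma>-algebras\<close>

text \<open>A finite union of boxes of a rectangular partition. The partitions are encoded by
  labellings and the union by a relation on labels, so that a complement negates \<open>P\<close>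
  and a union pairs labels. One bound \<open>n\<close> serves both sides because
  \<open>beta_coef\<close> uses as many cells on the left as on the right.\<close>

definition grid_set :: "'b measure \<Rightarrow> 'c measure \<Rightarrow> ('b \<times> 'c) set \<Rightarrow> bool" where
  "grid_set A B D \<longleftrightarrow> (\<exists>(a :: 'b \<Rightarrow> nat) (b :: 'c \<Rightarrow> nat) P n.
     a \<in> measurable A (count_space UNIV) \<and> b \<in> measurable B (count_space UNIV) \<and>
     (\<forall>x. a x < n) \<and> (\<forall>y. b y < n) \<and>
     D = {z \<in> space (A \<Otimes>\<^sub>M B). P (a (fst z)) (b (snd z))})"

lemma grid_set_Diff:
  assumes "grid_set A B D" shows "grid_set A B (space (A \<Otimes>\<^sub>M B) - D)"
proof -
  obtain a b P and n :: nat where *: "a \<in> measurable A (count_space UNIV)" "b \<in> measurable B (count_space UNIV)"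
     "\<forall>x. a x < n" "\<forall>y. b y < n" "D = {z \<in> space (A \<Otimes>\<^sub>M B). P (a (fst z)) (b (snd z))}"
    using assms unfolding grid_set_def by blast
  show ?thesis unfolding grid_set_def
    by (intro exI[of _ a] exI[of _ b] exI[of _ "\<lambda>i j. \<not> P i j"] exI[of _ n]) (use * in auto)
qed

lemma grid_set_Un:
  assumes "grid_set A B D" "grid_set A B D'" shows "grid_set A B (D \<union> D')"
proof -
  obtain a b P and n :: nat where *: "a \<in> measurable A (count_space UNIV)" "b \<in> measurable B (count_space UNIV)"
     "\<forall>x. a x < n" "\<forall>y. b y < n" "D = {z \<in> space (A \<Otimes>\<^sub>M B). P (a (fst z)) (b (snd z))}"
    using assms(1) unfolding grid_set_def by blast
  obtain a' b' P' and n' :: nat where **: "a' \<in> measurable A (count_space UNIV)" "b' \<in> measurable B (count_space UNIV)"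
     "\<forall>x. a' x < n'" "\<forall>y. b' y < n'" "D' = {z \<in> space (A \<Otimes>\<^sub>M B). P' (a' (fst z)) (b' (snd z))}"
    using assms(2) unfolding grid_set_def by blast
  \<comment> \<open>The pairs of old labels index the common refinement; \<open>prod_encode\<close>
    turns them back into natural numbers, and \<open>N\<close> bounds the finitely many codes that
    occur.\<close>
  let ?c = "\<lambda>x. prod_encode (a x, a' x)" and ?d = "\<lambda>y. prod_encode (b y, b' y)"
  let ?S = "prod_encode ` ({..<n} \<times> {..<n'})"
  obtain N where N: "\<And>s. s \<in> ?S \<Longrightarrow> s < N"
    using finite_nat_bounded[of ?S] by auto
  have m: "?c \<in> measurable A (count_space UNIV)" "?d \<in> measurable B (count_space UNIV)"
    using measurable_Pair[OF *(1) **(1)] measurable_Pair[OF *(2) **(2)]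
    by (auto intro!: measurable_compose[where g=prod_encode and N="count_space UNIV \<Otimes>\<^sub>M count_space UNIV"]
             simp: pair_measure_countable)
  show ?thesis unfolding grid_set_def
    by (intro exI[of _ ?c] exI[of _ ?d]
        exI[of _ "\<lambda>i j. P (fst (prod_decode i)) (fst (prod_decode j)) \<or> P' (snd (prod_decode i)) (snd (prod_decode j))"]
        exI[of _ N]) (use * ** m N in auto)
qed

lemma grid_set_rect:
  assumes "S \<in> sets A" "S' \<in> sets B" shows "grid_set A B (S \<times> S')"
  unfolding grid_set_def
proof (intro exI[of _ "\<lambda>x. if x \<in> S then 1 else 0"] exI[of _ "\<lambda>x. if x \<in> S' then 1 else 0"]
    exI[of _ "\<lambda>i j. i = 1 \<and> j = 1"] exI[of _ 2] conjI)
  show "S \<times> S' = {z \<in> space (A \<Otimes>\<^sub>M B). (if fst z \<in> S then 1 else 0) = (1::nat) \<and> (if snd z \<in> S' then 1 else 0) = (1::nat)}"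
    using sets.sets_into_space[OF assms(1)] sets.sets_into_space[OF assms(2)]
    by (auto simp: space_pair_measure split: if_splits)
qed (use assms in \<open>auto intro!: measurable_If_set\<close>)

lemma grid_set_in_sets:
  assumes "grid_set A B D" shows "D \<in> sets (A \<Otimes>\<^sub>M B)"
proof -
  obtain a :: "'a \<Rightarrow> nat" and b :: "'b \<Rightarrow> nat" and P where *: "a \<in> measurable A (count_space UNIV)" "b \<in> measurable B (count_space UNIV)"
     "D = {z \<in> space (A \<Otimes>\<^sub>M B). P (a (fst z)) (b (snd z))}"
    using assms(1) unfolding grid_set_def by blast
  have [measurable]: "(\<lambda>z. a (fst z)) \<in> measurable (A \<Otimes>\<^sub>M B) (count_space UNIV)"
     "(\<lambda>z. b (snd z)) \<in> measurable (A \<Otimes>\<^sub>M B) (count_space UNIV)"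
    using measurable_compose[OF measurable_fst *(1)] measurable_compose[OF measurable_snd *(2)] by auto
  show ?thesis unfolding *(3) by measurable
qed

definition sdiff :: "'b set \<Rightarrow> 'b set \<Rightarrow> 'b set" where
  "sdiff C D = (C - D) \<union> (D - C)"

lemma sdiff_sets[measurable]: "C \<in> sets M \<Longrightarrow> D \<in> sets M \<Longrightarrow> sdiff C D \<in> sets M"
  by (auto simp: sdiff_def)

lemma (in finite_measure) abs_measure_diff_le_sdiff:
  assumes "C \<in> sets M" "D \<in> sets M"
  shows "\<bar>measure M C - measure M D\<bar> \<le> measure M (sdiff C D)"
proof -
  have "measure M C \<le> measure M (D \<union> sdiff C D)" "measure M D \<le> measure M (C \<union> sdiff C D)"
    by (rule finite_measure_mono; use assms in \<open>auto simp: sdiff_def\<close>)+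
  moreover have "measure M (D \<union> sdiff C D) \<le> measure M D + measure M (sdiff C D)"
    "measure M (C \<union> sdiff C D) \<le> measure M C + measure M (sdiff C D)"
    by (auto intro!: measure_Un_le sdiff_sets simp: assms)
  ultimately show ?thesis by linarith
qed

text \<open>The sets that can be approximated form a sigma-algebra containing the rectangles. The
  same \<open>D\<close> must work for both measures, since the two laws are afterwards compared on
  \<open>D\<close> in place of \<open>C\<close>.\<close>

lemma grid_approx:
  assumes \<mu>: "finite_measure \<mu>" "sets \<mu> = sets (A \<Otimes>\<^sub>M B)"
    and \<nu>: "finite_measure \<nu>" "sets \<nu> = sets (A \<Otimes>\<^sub>M B)"
    and C: "C \<in> sets (A \<Otimes>\<^sub>M B)"
  shows "\<forall>\<epsilon>>0. \<exists>D. grid_set A B D \<and> measure \<mu> (sdiff C D) < \<epsilon> \<and> measure \<nu> (sdiff C D) < \<epsilon>"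
proof -
  interpret m: finite_measure \<mu> by fact
  interpret v: finite_measure \<nu> by fact
  let ?Q = "\<lambda>C. C \<in> sets (A \<Otimes>\<^sub>M B) \<and>
     (\<forall>\<epsilon>>0. \<exists>D. grid_set A B D \<and> measure \<mu> (sdiff C D) < \<epsilon> \<and> measure \<nu> (sdiff C D) < \<epsilon>)"
  have gs: "D \<in> sets \<mu>" "D \<in> sets \<nu>" if "grid_set A B D" for D
    using grid_set_in_sets[OF that] \<mu>(2) \<nu>(2) by auto
  have un: "?Q (C \<union> D)" if Q: "?Q C" "?Q D" for C D
  proof (intro conjI allI impI)
    show "C \<union> D \<in> sets (A \<Otimes>\<^sub>M B)" using that by auto
    fix \<epsilon> :: real assume e: "\<epsilon> > 0"
    then have e2: "\<epsilon>/2 > 0" by simp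
    from Q(1) e2 obtain C' where C': "grid_set A B C'" "measure \<mu> (sdiff C C') < \<epsilon>/2" "measure \<nu> (sdiff C C') < \<epsilon>/2" by blast
    from Q(2) e2 obtain D' where D': "grid_set A B D'" "measure \<mu> (sdiff D D') < \<epsilon>/2" "measure \<nu> (sdiff D D') < \<epsilon>/2" by blast
    have sub: "sdiff (C \<union> D) (C' \<union> D') \<subseteq> sdiff C C' \<union> sdiff D D'" by (auto simp: sdiff_def)
    have "C \<in> sets \<mu>" "D \<in> sets \<mu>" "C \<in> sets \<nu>" "D \<in> sets \<nu>" using Q \<mu> \<nu> by auto
    note st = this gs(1)[OF C'(1)] gs(1)[OF D'(1)] gs(2)[OF C'(1)] gs(2)[OF D'(1)]
    have "measure \<mu> (sdiff (C \<union> D) (C' \<union> D')) \<le> measure \<mu> (sdiff C C') + measure \<mu> (sdiff D D')"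
      by (rule order_trans[OF m.finite_measure_mono[OF sub] measure_Un_le]) (use st in auto)
    moreover have "measure \<nu> (sdiff (C \<union> D) (C' \<union> D')) \<le> measure \<nu> (sdiff C C') + measure \<nu> (sdiff D D')"
      by (rule order_trans[OF v.finite_measure_mono[OF sub] measure_Un_le]) (use st in auto)
    ultimately show "\<exists>E. grid_set A B E \<and> measure \<mu> (sdiff (C \<union> D) E) < \<epsilon> \<and> measure \<nu> (sdiff (C \<union> D) E) < \<epsilon>"
      using grid_set_Un[OF C'(1) D'(1)] C' D' by (intro exI[of _ "C' \<union> D'"]) auto
  qed
  have basic: "?Q C" if "grid_set A B C" for C
    using that grid_set_in_sets[OF that] by (auto simp: sdiff_def intro!: exI[of _ C])
  have "C \<in> sigma_sets (space A \<times> space B) {a \<times> b |a b. a \<in> sets A \<and> b \<in> sets B}"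
    using C by (simp add: sets_pair_measure)
  then have "?Q C"
  proof (induction rule: sigma_sets.induct)
    case (Basic a)
    then obtain S S' where "a = S \<times> S'" "S \<in> sets A" "S' \<in> sets B" by blast
    then show ?case using basic[OF grid_set_rect[of S A S' B]] by blast
  next
    case Empty
    show ?case using basic[OF grid_set_rect[of "{}" A "{}" B]] by simp
  next
    case (Compl a)
    have sp: "space (A \<Otimes>\<^sub>M B) = space A \<times> space B" by (simp add: space_pair_measure)
    show ?case
    proof (intro conjI allI impI)
      show "space A \<times> space B - a \<in> sets (A \<Otimes>\<^sub>M B)" using Compl.IH sets.compl_sets[of a "A \<Otimes>\<^sub>M B"] sp by simp
      fix \<epsilon> :: real assume e: "\<epsilon> > 0"
      then obtain D where D: "grid_set A B D" "measure \<mu> (sdiff a D) < \<epsilon>" "measure \<nu> (sdiff a D) < \<epsilon>" using Compl.IH by blast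
      have "a \<subseteq> space A \<times> space B" "D \<subseteq> space A \<times> space B"
        using Compl.IH grid_set_in_sets[OF D(1)] sets.sets_into_space[of _ "A \<Otimes>\<^sub>M B"] unfolding sp by blast+
      then have "sdiff (space A \<times> space B - a) (space A \<times> space B - D) = sdiff a D" by (auto simp: sdiff_def)
      then show "\<exists>E. grid_set A B E \<and> measure \<mu> (sdiff (space A \<times> space B - a) E) < \<epsilon> \<and> measure \<nu> (sdiff (space A \<times> space B - a) E) < \<epsilon>"
        using grid_set_Diff[OF D(1)] D unfolding sp by (intro exI[of _ "space A \<times> space B - D"]) simp
    qed
  next
    case (Union a)
    \<comment> \<open>A countable union is first cut off at a finite stage that is good for both
      measures, by continuity from below; the finite union is then approximated.\<close>
    define U where "U n = (\<Union>i<n. a i)" for n :: nat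
    have QU: "?Q (U n)" for n
    proof (induction n)
      case 0
      then show ?case using basic[OF grid_set_rect[of "{}" A "{}" B]] by (simp add: U_def)
    next
      case (Suc n)
      have "U (Suc n) = U n \<union> a n" by (auto simp: U_def lessThan_Suc)
      then show ?case using un[OF Suc.IH Union.IH[of n]] by simp
    qed
    have ms: "U n \<in> sets \<mu>" "U n \<in> sets \<nu>" "(\<Union>(range U)) \<in> sets \<mu>" "(\<Union>(range U)) \<in> sets \<nu>" for n
      using QU \<mu> \<nu> by auto
    have inc: "incseq U" by (auto simp: incseq_def U_def) (meson lessThan_iff order_less_le_trans)
    have UU: "(\<Union>n. a n) = (\<Union>n. U n)" by (auto simp: U_def)
    show ?case
    proof (intro conjI allI impI)
      show "\<Union> (range a) \<in> sets (A \<Otimes>\<^sub>M B)" using Union.IH by blast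
      fix \<epsilon> :: real assume e: "\<epsilon> > 0"
      then have e2: "\<epsilon>/2 > 0" by simp
      have l1: "(\<lambda>n. measure \<mu> (U n)) \<longlonglongrightarrow> measure \<mu> (\<Union>n. U n)"
        using m.finite_Lim_measure_incseq[of U] inc ms by auto
      have l2: "(\<lambda>n. measure \<nu> (U n)) \<longlonglongrightarrow> measure \<nu> (\<Union>n. U n)"
        using v.finite_Lim_measure_incseq[of U] inc ms by auto
      have "\<forall>\<^sub>F n in sequentially. measure \<mu> (U n) > measure \<mu> (\<Union>n. U n) - \<epsilon>/2"
        using order_tendstoD(1)[OF l1] e2 by simp
      moreover have "\<forall>\<^sub>F n in sequentially. measure \<nu> (U n) > measure \<nu> (\<Union>n. U n) - \<epsilon>/2"
        using order_tendstoD(1)[OF l2] e2 by simp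
      ultimately have "\<forall>\<^sub>F n in sequentially. measure \<mu> (U n) > measure \<mu> (\<Union>n. U n) - \<epsilon>/2 \<and> measure \<nu> (U n) > measure \<nu> (\<Union>n. U n) - \<epsilon>/2"
        by eventually_elim simp
      then obtain n where n: "measure \<mu> (U n) > measure \<mu> (\<Union>n. U n) - \<epsilon>/2" "measure \<nu> (U n) > measure \<nu> (\<Union>n. U n) - \<epsilon>/2"
        by (auto dest: eventually_happens)
      from QU[of n] e2 obtain D where D: "grid_set A B D" "measure \<mu> (sdiff (U n) D) < \<epsilon>/2" "measure \<nu> (sdiff (U n) D) < \<epsilon>/2" by blast
      have sub: "sdiff (\<Union>n. U n) D \<subseteq> ((\<Union>n. U n) - U n) \<union> sdiff (U n) D" by (auto simp: sdiff_def)
      have "measure \<mu> (sdiff (\<Union>n. U n) D) \<le> measure \<mu> ((\<Union>n. U n) - U n) + measure \<mu> (sdiff (U n) D)"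
        by (rule order_trans[OF m.finite_measure_mono[OF sub] measure_Un_le]) (use ms gs(1)[OF D(1)] in auto)
      moreover have "measure \<mu> ((\<Union>n. U n) - U n) = measure \<mu> (\<Union>n. U n) - measure \<mu> (U n)"
        by (rule m.finite_measure_Diff) (use ms in auto)
      moreover have "measure \<nu> (sdiff (\<Union>n. U n) D) \<le> measure \<nu> ((\<Union>n. U n) - U n) + measure \<nu> (sdiff (U n) D)"
        by (rule order_trans[OF v.finite_measure_mono[OF sub] measure_Un_le]) (use ms gs(2)[OF D(1)] in auto)
      moreover have "measure \<nu> ((\<Union>n. U n) - U n) = measure \<nu> (\<Union>n. U n) - measure \<nu> (U n)"
        by (rule v.finite_measure_Diff) (use ms in auto)
      ultimately show "\<exists>E. grid_set A B E \<and> measure \<mu> (sdiff (\<Union>(range a)) E) < \<epsilon> \<and> measure \<nu> (sdiff (\<Union>(range a)) E) < \<epsilon>"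
        using D n unfolding UU by (intro exI[of _ D]) linarith
    qed
  qed
  then show ?thesis by blast
qed

subsection \<open>The coefficient of absolute regularity as a total variation distance\<close>

text \<open>\<open>beta_coef\<close> is a supremum of reals, so it needs a bounded nonempty set: the
  two terms of the differences sum to one each over all cells, hence the bound 1, and the partition
  in the hypotheses is the witness of nonemptiness.\<close>

lemma beta_coef_upper:
  assumes "prob_space M" "F \<subseteq> sets M" "G \<subseteq> sets M"
    and "\<And>i. i < (n::nat) \<Longrightarrow> A i \<in> F \<and> B i \<in> G" "disjoint_family_on A {..<n}" "disjoint_family_on B {..<n}"
    "(\<Union>i<n. A i) = space M" "(\<Union>i<n. B i) = space M"
  shows "(1/2) * (\<Sum>i<n. \<Sum>j<n. \<bar>measure M (A i \<inter> B j) - measure M (A i) * measure M (B j)\<bar>) \<le> beta_coef M F G"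
    and "beta_coef M F G \<le> 1"
proof -
  interpret prob_space M by fact
  let ?T = "{(1/2) * (\<Sum>i<n. \<Sum>j<n.
        \<bar>measure M (A i \<inter> B j) - measure M (A i) * measure M (B j)\<bar>) | (n::nat) A B.
      (\<forall>i<n. A i \<in> F \<and> B i \<in> G) \<and> disjoint_family_on A {..<n} \<and> disjoint_family_on B {..<n}
      \<and> (\<Union>i<n. A i) = space M \<and> (\<Union>i<n. B i) = space M}"
  have bd: "x \<le> 1" if "x \<in> ?T" for x
  proof -
    from that obtain n :: nat and A B where x: "x = (1/2) * (\<Sum>i<n. \<Sum>j<n. \<bar>prob (A i \<inter> B j) - prob (A i) * prob (B j)\<bar>)"
      and AB: "\<forall>i<n. A i \<in> F \<and> B i \<in> G" "disjoint_family_on A {..<n}" "disjoint_family_on B {..<n}"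
        "(\<Union>i<n. A i) = space M" "(\<Union>i<n. B i) = space M" by blast
    have AS: "A i \<in> events" "B i \<in> events" if "i < n" for i using AB(1) that assms by auto
    have sA: "(\<Sum>i<n. prob (A i)) = 1"
      using finite_measure_finite_Union[of "{..<n}" A, OF _ _ AB(2)] AB(4) AS prob_space by (simp add: image_subset_iff)
    have sB: "(\<Sum>i<n. prob (B i)) = 1"
      using finite_measure_finite_Union[of "{..<n}" B, OF _ _ AB(3)] AB(5) AS prob_space by (simp add: image_subset_iff)
    have sAB: "(\<Sum>j<n. prob (A i \<inter> B j)) = prob (A i)" if "i < n" for i
    proof -
      have "prob (A i) = prob (\<Union>j<n. A i \<inter> B j)"
        using sets.sets_into_space[OF AS(1)[OF that]] AB(5) by (intro arg_cong[of _ _ prob]) auto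
      also have "\<dots> = (\<Sum>j<n. prob (A i \<inter> B j))"
      proof (rule finite_measure_finite_Union)
        show "disjoint_family_on (\<lambda>j. A i \<inter> B j) {..<n}"
        unfolding disjoint_family_on_def proof (intro ballI impI)
          fix a b assume "a \<in> {..<n}" "b \<in> {..<n}" "a \<noteq> b"
          then have "B a \<inter> B b = {}" by (rule disjoint_family_onD[OF AB(3)])
          then show "A i \<inter> B a \<inter> (A i \<inter> B b) = {}" by auto
        qed
      qed (use AS that in auto)
      finally show ?thesis by simp
    qed
    have "(\<Sum>i<n. \<Sum>j<n. \<bar>prob (A i \<inter> B j) - prob (A i) * prob (B j)\<bar>) \<le> (\<Sum>i<n. \<Sum>j<n. prob (A i \<inter> B j) + prob (A i) * prob (B j))"
      by (intro sum_mono) (auto intro!: order_trans[OF abs_triangle_ineq4])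
    also have "\<dots> = 2"
      by (simp add: sum.distrib sAB sA sB sum_distrib_left[symmetric])
    finally show ?thesis unfolding x by simp
  qed
  have mem: "(1/2) * (\<Sum>i<n. \<Sum>j<n. \<bar>measure M (A i \<inter> B j) - measure M (A i) * measure M (B j)\<bar>) \<in> ?T"
    apply (rule CollectI, rule exI[of _ n], rule exI[of _ A], rule exI[of _ B], intro conjI)
    using assms(4-) by simp_all
  have bdd: "bdd_above ?T" using bd by (rule bdd_aboveI)
  show "(1/2) * (\<Sum>i<n. \<Sum>j<n. \<bar>measure M (A i \<inter> B j) - measure M (A i) * measure M (B j)\<bar>) \<le> beta_coef M F G"
    unfolding beta_coef_def by (rule cSup_upper[OF mem bdd])
  have "?T \<noteq> {}" using mem by (metis empty_iff)
  then show "beta_coef M F G \<le> 1"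
    unfolding beta_coef_def by (rule cSup_least) (rule bd)
qed

lemma measurable_nat_partition:
  fixes a :: "'b \<Rightarrow> nat"
  assumes "a \<in> measurable A (count_space UNIV)"
  shows "{x \<in> space A. a x = i} \<in> sets A"
  using assms by measurable

text \<open>On a grid set the difference of joint law and product law is a partial sum of the
  differences that define \<open>beta_coef\<close>; general sets follow by
  \<open>grid_approx\<close>. The factor 2 cancels the factor 1/2 of the definition, and signs are
  not exploited.\<close>

lemma total_variation_le_beta_coef:
  assumes M: "prob_space M" and F: "F \<subseteq> sets M" and G: "G \<subseteq> sets M"
    and U: "U \<in> measurable M A" "\<And>S. S \<in> sets A \<Longrightarrow> U -` S \<inter> space M \<in> F"
    and V: "V \<in> measurable M B" "\<And>S. S \<in> sets B \<Longrightarrow> V -` S \<inter> space M \<in> G"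
    and C: "C \<in> sets (A \<Otimes>\<^sub>M B)"
  shows "\<bar>measure (distr M (A \<Otimes>\<^sub>M B) (\<lambda>\<omega>. (U \<omega>, V \<omega>))) C - measure (distr M A U \<Otimes>\<^sub>M distr M B V) C\<bar> \<le> 2 * beta_coef M F G"
proof -
  interpret prob_space M by fact
  let ?\<mu> = "distr M (A \<Otimes>\<^sub>M B) (\<lambda>\<omega>. (U \<omega>, V \<omega>))" and ?\<nu> = "distr M A U \<Otimes>\<^sub>M distr M B V"
  have UV[measurable]: "(\<lambda>\<omega>. (U \<omega>, V \<omega>)) \<in> measurable M (A \<Otimes>\<^sub>M B)" using U(1) V(1) by simp
  interpret m: prob_space ?\<mu> by (rule prob_space_distr) fact
  interpret pU: prob_space "distr M A U" by (rule prob_space_distr) fact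
  interpret pV: prob_space "distr M B V" by (rule prob_space_distr) fact
  interpret v: pair_prob_space "distr M A U" "distr M B V" by unfold_locales
  have sn: "sets ?\<nu> = sets (A \<Otimes>\<^sub>M B)" by (simp cong: sets_pair_measure_cong)
  have spn: "space (A \<Otimes>\<^sub>M B) = space A \<times> space B" by (simp add: space_pair_measure)
  have grid: "\<bar>measure ?\<mu> D - measure ?\<nu> D\<bar> \<le> 2 * beta_coef M F G" if "grid_set A B D" for D
  proof -
    obtain a b P and n :: nat where *: "a \<in> measurable A (count_space UNIV)" "b \<in> measurable B (count_space UNIV)"
     "\<And>x. a x < n" "\<And>y. b y < n" "D = {z \<in> space (A \<Otimes>\<^sub>M B). P (a (fst z)) (b (snd z))}"
      using \<open>grid_set A B D\<close> unfolding grid_set_def by blast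
    define S where "S i = {x \<in> space A. a x = i}" for i
    define T where "T i = {x \<in> space B. b x = i}" for i
    have ST: "S i \<in> sets A" "T i \<in> sets B" for i unfolding S_def T_def using measurable_nat_partition * by blast+
    define S' where "S' i = U -` S i \<inter> space M" for i
    define T' where "T' i = V -` T i \<inter> space M" for i
    have S'T': "S' i \<in> F" "T' i \<in> G" for i using U V ST unfolding S'_def T'_def by auto
    define I where "I = {(i,j) \<in> {..<n} \<times> {..<n}. P i j}"
    have fI: "finite I" unfolding I_def by (rule finite_subset[of _ "{..<n} \<times> {..<n}"]) auto
    have D: "D = (\<Union>(i,j)\<in>I. S i \<times> T j)"
      unfolding *(5) I_def S_def T_def spn using *(3,4) by auto
    have dj: "disjoint_family_on (\<lambda>(i,j). S i \<times> T j) I"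
      by (auto simp: disjoint_family_on_def S_def T_def)
    have "measure ?\<mu> D = (\<Sum>(i,j)\<in>I. measure ?\<mu> (S i \<times> T j))"
      unfolding D using m.finite_measure_finite_Union[OF fI _ dj] ST by (auto simp: case_prod_unfold)
    also have "\<dots> = (\<Sum>(i,j)\<in>I. prob (S' i \<inter> T' j))"
      by (intro sum.cong refl) (auto simp: measure_distr ST S'_def T'_def intro!: arg_cong[of _ _ prob])
    finally have 1: "measure ?\<mu> D = (\<Sum>(i,j)\<in>I. prob (S' i \<inter> T' j))" .
    have "measure ?\<nu> D = (\<Sum>(i,j)\<in>I. measure ?\<nu> (S i \<times> T j))"
      unfolding D using v.finite_measure_finite_Union[OF fI _ dj] ST by (auto simp: case_prod_unfold)
    also have "\<dots> = (\<Sum>(i,j)\<in>I. prob (S' i) * prob (T' j))"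
    proof (intro sum.cong refl, clarify)
      fix i j
      have "measure ?\<nu> (S i \<times> T j) = measure (distr M A U) (S i) * measure (distr M B V) (T j)"
        using ST by (subst measure_def) (simp add: pV.emeasure_pair_measure_Times pU.emeasure_eq_measure pV.emeasure_eq_measure ennreal_mult[symmetric])
      then show "measure ?\<nu> (S i \<times> T j) = prob (S' i) * prob (T' j)"
        using U V ST by (simp add: measure_distr S'_def T'_def)
    qed
    finally have 2: "measure ?\<nu> D = (\<Sum>(i,j)\<in>I. prob (S' i) * prob (T' j))" .
    have "\<bar>measure ?\<mu> D - measure ?\<nu> D\<bar> \<le> (\<Sum>(i,j)\<in>I. \<bar>prob (S' i \<inter> T' j) - prob (S' i) * prob (T' j)\<bar>)"
      unfolding 1 2 sum_subtractf[symmetric] case_prod_unfold by (rule sum_abs)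
    also have "\<dots> \<le> (\<Sum>(i,j)\<in>{..<n}\<times>{..<n}. \<bar>prob (S' i \<inter> T' j) - prob (S' i) * prob (T' j)\<bar>)"
      by (rule sum_mono2) (auto simp: I_def)
    also have "\<dots> = 2 * ((1/2) * (\<Sum>i<n. \<Sum>j<n. \<bar>prob (S' i \<inter> T' j) - prob (S' i) * prob (T' j)\<bar>))"
      by (simp add: sum.cartesian_product)
    also have "\<dots> \<le> 2 * beta_coef M F G"
    proof (intro mult_left_mono beta_coef_upper(1)[OF M F G])
      show "(\<Union>i<n. S' i) = space M" using measurable_space[OF U(1)] *(3) unfolding S'_def S_def by auto
      show "(\<Union>i<n. T' i) = space M" using measurable_space[OF V(1)] *(4) unfolding T'_def T_def by auto
    qed (use S'T' in \<open>auto simp: disjoint_family_on_def S'_def S_def T'_def T_def\<close>)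
    finally show ?thesis .
  qed
  show ?thesis
  proof (rule field_le_epsilon)
    fix \<epsilon> :: real assume "\<epsilon> > 0"
    then have "\<epsilon>/2 > 0" by simp
    moreover note grid_approx[of ?\<mu> A B ?\<nu> C, OF m.finite_measure_axioms sets_distr v.finite_measure_axioms sn C]
    ultimately obtain D where D: "grid_set A B D" "measure ?\<mu> (sdiff C D) < \<epsilon>/2" "measure ?\<nu> (sdiff C D) < \<epsilon>/2"
      by blast
    have "\<bar>measure ?\<mu> C - measure ?\<mu> D\<bar> \<le> measure ?\<mu> (sdiff C D)"
      by (rule m.abs_measure_diff_le_sdiff) (use C grid_set_in_sets[OF D(1)] in auto)
    moreover have "\<bar>measure ?\<nu> C - measure ?\<nu> D\<bar> \<le> measure ?\<nu> (sdiff C D)"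
      by (rule v.abs_measure_diff_le_sdiff) (use C grid_set_in_sets[OF D(1)] sn in auto)
    ultimately show "\<bar>measure ?\<mu> C - measure ?\<nu> C\<bar> \<le> 2 * beta_coef M F G + \<epsilon>"
      using grid[OF D(1)] D(2,3) by linarith
  qed
qed

section \<open>From total variation to expectations\<close>

lemma unit_integral_diff_le:
  fixes f :: "'b \<Rightarrow> real"
  assumes \<mu>: "prob_space \<mu>" and \<nu>: "prob_space \<nu>" and s: "sets \<mu> = sets \<nu>"
    and d: "\<And>C. C \<in> sets \<mu> \<Longrightarrow> \<bar>measure \<mu> C - measure \<nu> C\<bar> \<le> b"
    and f: "f \<in> borel_measurable \<mu>" "\<And>x. 0 \<le> f x" "\<And>x. f x \<le> 1"
  shows "\<bar>(\<integral>x. f x \<partial>\<mu>) - (\<integral>x. f x \<partial>\<nu>)\<bar> \<le> b"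
proof (rule field_le_epsilon)
  interpret m: prob_space \<mu> by fact
  interpret v: prob_space \<nu> by fact
  fix \<epsilon> :: real assume e: "\<epsilon> > 0"
  then obtain N :: nat where N: "N > 0" "2 / real N < \<epsilon>"
    using reals_Archimedean2[of "2/\<epsilon>"] by (metis divide_less_eq less_numeral_extra(3) linorder_neqE_nat mult.commute not_less_zero of_nat_0 of_nat_0_less_iff divide_pos_pos order_less_trans zero_less_numeral)
  have sp: "space \<mu> = space \<nu>" using sets_eq_imp_space_eq[OF s] .
  have fv: "f \<in> borel_measurable \<nu>" using f(1) measurable_cong_sets[OF s refl] by blast
  define C where "C k = {x \<in> space \<mu>. real k \<le> real N * f x}" for k
  have C: "C k \<in> sets \<mu>" for k unfolding C_def using f(1) by measurable
  \<comment> \<open>Layers: \<open>f\<close> is within 1/N of the average \<open>g\<close> of the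
    indicators of the sets \<open>C k\<close>. The integrals of each indicator differ by at most
    \<open>b\<close>, and averaging keeps \<open>b\<close>.\<close>
  define g where "g x = (\<Sum>k=1..N. indicator (C k) x) / real N" for x
  have g: "\<bar>f x - g x\<bar> \<le> 1 / real N" if x: "x \<in> space \<mu>" for x
  proof -
    define K where "K = nat \<lfloor>real N * f x\<rfloor>"
    have nn: "real N * f x \<ge> 0" using f(2) by simp
    have "real N * f x \<le> real N" using f(3)[of x] N by simp
    then have KN: "K \<le> N" unfolding K_def by linarith
    have "{k\<in>{1..N}. real k \<le> real N * f x} = {1..K}"
      using KN nn unfolding K_def by (auto simp: le_nat_floor) linarith+
    moreover have "(\<Sum>k=1..N. indicator (C k) x :: real) = card {k\<in>{1..N}. real k \<le> real N * f x}"
      using x by (simp add: C_def indicator_def sum.If_cases Int_def)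
    ultimately have "(\<Sum>k=1..N. indicator (C k) x :: real) = K" by simp
    moreover have "\<bar>real N * f x - K\<bar> \<le> 1" using nn unfolding K_def by linarith
    moreover have "f x - K / real N = (real N * f x - K) / real N" using N by (simp add: field_simps)
    ultimately show ?thesis unfolding g_def using N by (simp add: divide_right_mono)
  qed
  have gi: "(\<integral>x. g x \<partial>\<mu>) = (\<Sum>k=1..N. measure \<mu> (C k)) / real N" "integrable \<mu> g"
    unfolding g_def using C by (auto simp: Bochner_Integration.integral_sum m.emeasure_eq_measure intro!: integrable_divide_zero Bochner_Integration.integrable_sum)
  have gv: "(\<integral>x. g x \<partial>\<nu>) = (\<Sum>k=1..N. measure \<nu> (C k)) / real N" "integrable \<nu> g"
    unfolding g_def using C s by (auto simp: Bochner_Integration.integral_sum v.emeasure_eq_measure intro!: integrable_divide_zero Bochner_Integration.integrable_sum)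
  have fi: "integrable \<mu> f" using f by (intro m.integrable_const_bound[of _ 1]) auto
  have fvi: "integrable \<nu> f" using f fv by (intro v.integrable_const_bound[of _ 1]) auto
  have "\<bar>(\<integral>x. g x \<partial>\<mu>) - (\<integral>x. g x \<partial>\<nu>)\<bar> = \<bar>\<Sum>k=1..N. measure \<mu> (C k) - measure \<nu> (C k)\<bar> / real N"
    unfolding gi gv by (simp add: sum_subtractf diff_divide_distrib[symmetric])
  also have "\<dots> \<le> (\<Sum>k=1..N. b) / real N"
    by (intro divide_right_mono order_trans[OF sum_abs] sum_mono d C) auto
  also have "\<dots> = b" using N by simp
  finally have 1: "\<bar>(\<integral>x. g x \<partial>\<mu>) - (\<integral>x. g x \<partial>\<nu>)\<bar> \<le> b" .
  have "\<bar>(\<integral>x. f x \<partial>\<mu>) - (\<integral>x. g x \<partial>\<mu>)\<bar> \<le> (\<integral>x. \<bar>f x - g x\<bar> \<partial>\<mu>)"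
    using integral_abs_bound[of \<mu> "\<lambda>x. f x - g x"] fi gi by (simp add: Bochner_Integration.integral_diff)
  also have "\<dots> \<le> 1 / real N"
    by (rule m.integral_le_const) (use g fi gi in auto)
  finally have 2: "\<bar>(\<integral>x. f x \<partial>\<mu>) - (\<integral>x. g x \<partial>\<mu>)\<bar> \<le> 1 / real N" .
  have "\<bar>(\<integral>x. f x \<partial>\<nu>) - (\<integral>x. g x \<partial>\<nu>)\<bar> \<le> (\<integral>x. \<bar>f x - g x\<bar> \<partial>\<nu>)"
    using integral_abs_bound[of \<nu> "\<lambda>x. f x - g x"] fvi gv by (simp add: Bochner_Integration.integral_diff)
  also have "\<dots> \<le> 1 / real N"
    by (rule v.integral_le_const) (use g fvi gv sp in auto)
  finally have 3: "\<bar>(\<integral>x. f x \<partial>\<nu>) - (\<integral>x. g x \<partial>\<nu>)\<bar> \<le> 1 / real N" .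
  show "\<bar>(\<integral>x. f x \<partial>\<mu>) - (\<integral>x. f x \<partial>\<nu>)\<bar> \<le> b + \<epsilon>"
    using 1 2 3 N(2) by linarith
qed

lemma bounded_integral_diff_le:
  fixes f :: "'b \<Rightarrow> real"
  assumes \<mu>: "prob_space \<mu>" and \<nu>: "prob_space \<nu>" and s: "sets \<mu> = sets \<nu>"
    and d: "\<And>C. C \<in> sets \<mu> \<Longrightarrow> \<bar>measure \<mu> C - measure \<nu> C\<bar> \<le> b"
    and f: "f \<in> borel_measurable \<mu>" "\<And>x. \<bar>f x\<bar> \<le> T" and T: "T > 0"
  shows "\<bar>(\<integral>x. f x \<partial>\<mu>) - (\<integral>x. f x \<partial>\<nu>)\<bar> \<le> 2 * T * b"
proof -
  interpret m: prob_space \<mu> by fact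
  interpret v: prob_space \<nu> by fact
  have fv: "f \<in> borel_measurable \<nu>" using f(1) measurable_cong_sets[OF s refl] by blast
  have fi: "integrable \<mu> f" using f by (intro m.integrable_const_bound[of _ T]) auto
  have fvi: "integrable \<nu> f" using f fv by (intro v.integrable_const_bound[of _ T]) auto
  have "\<bar>(\<integral>x. (f x + T) / (2*T) \<partial>\<mu>) - (\<integral>x. (f x + T) / (2*T) \<partial>\<nu>)\<bar> \<le> b"
  proof (rule unit_integral_diff_le[OF \<mu> \<nu> s d])
    fix x show "0 \<le> (f x + T) / (2*T)" "(f x + T) / (2*T) \<le> 1"
      using f(2)[of x] T by (auto simp: field_simps)
  qed (use f in auto)
  moreover have "(\<integral>x. (f x + T) / (2*T) \<partial>\<mu>) - (\<integral>x. (f x + T) / (2*T) \<partial>\<nu>) = ((\<integral>x. f x \<partial>\<mu>) - (\<integral>x. f x \<partial>\<nu>)) / (2*T)"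
    using fi fvi by (simp add: m.prob_space v.prob_space diff_divide_distrib[symmetric])
  ultimately show ?thesis using T by (simp add: abs_divide field_simps)
qed

text \<open>Truncation at level \<open>T\<close>: above it |f| is at most T^(1-r) |f|^r, so the part
  cut off costs \<open>D * T powr (1 - r)\<close> under each of the two measures. \<open>T\<close>
  stays free, to be balanced against \<open>b\<close> later.\<close>

lemma Lp_integral_diff_le:
  fixes f :: "'b \<Rightarrow> real"
  assumes \<mu>: "prob_space \<mu>" and \<nu>: "prob_space \<nu>" and s: "sets \<mu> = sets \<nu>"
    and d: "\<And>C. C \<in> sets \<mu> \<Longrightarrow> \<bar>measure \<mu> C - measure \<nu> C\<bar> \<le> b"
    and f: "f \<in> borel_measurable \<mu>" and T: "T > 0" and r: "r > 1"
    and fm: "integrable \<mu> (\<lambda>x. \<bar>f x\<bar> powr r)" "(\<integral>x. \<bar>f x\<bar> powr r \<partial>\<mu>) \<le> D"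
    and fn: "integrable \<nu> (\<lambda>x. \<bar>f x\<bar> powr r)" "(\<integral>x. \<bar>f x\<bar> powr r \<partial>\<nu>) \<le> D"
  shows "\<bar>(\<integral>x. f x \<partial>\<mu>) - (\<integral>x. f x \<partial>\<nu>)\<bar> \<le> 2 * T * b + 2 * D * T powr (1 - r)"
proof -
  interpret m: prob_space \<mu> by fact
  interpret v: prob_space \<nu> by fact
  have fv: "f \<in> borel_measurable \<nu>" using f(1) measurable_cong_sets[OF s refl] by blast
  define g where "g x = max (-T) (min T (f x))" for x
  have pw: "\<bar>f x\<bar> \<le> 1 + \<bar>f x\<bar> powr r" for x
  proof (cases "\<bar>f x\<bar> \<le> 1")
    case False
    then have "\<bar>f x\<bar> powr 1 \<le> \<bar>f x\<bar> powr r" using r by (intro powr_mono) auto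
    then show ?thesis using False by auto
  qed (simp add: add_increasing2)
  have fi: "integrable \<mu> f" by (rule Bochner_Integration.integrable_bound[of _ "\<lambda>x. 1 + \<bar>f x\<bar> powr r"]) (use fm f pw in \<open>auto simp: abs_of_nonneg add_nonneg_nonneg\<close>)
  have fvi: "integrable \<nu> f" by (rule Bochner_Integration.integrable_bound[of _ "\<lambda>x. 1 + \<bar>f x\<bar> powr r"]) (use fn fv pw in \<open>auto simp: abs_of_nonneg add_nonneg_nonneg\<close>)
  have gb: "\<bar>g x\<bar> \<le> T" for x using T by (auto simp: g_def)
  have gm: "g \<in> borel_measurable \<mu>" "g \<in> borel_measurable \<nu>" unfolding g_def using f fv by auto
  have gi: "integrable \<mu> g" using gb gm by (intro m.integrable_const_bound[of _ T]) auto
  have gvi: "integrable \<nu> g" using gb gm by (intro v.integrable_const_bound[of _ T]) auto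
  have fg: "\<bar>f x - g x\<bar> \<le> T powr (1 - r) * \<bar>f x\<bar> powr r" for x
  proof (cases "\<bar>f x\<bar> \<le> T")
    case True then have "g x = f x" using T by (auto simp: g_def)
    then show ?thesis using T by simp
  next
    case False
    then have pos: "\<bar>f x\<bar> > 0" using T by linarith
    have "\<bar>f x - g x\<bar> \<le> \<bar>f x\<bar>" using False T by (auto simp: g_def min_def max_def)
    also have "\<dots> = \<bar>f x\<bar> powr (1 - r) * \<bar>f x\<bar> powr r"
      using pos by (simp add: powr_add[symmetric])
    also have "\<dots> \<le> T powr (1 - r) * \<bar>f x\<bar> powr r"
      using False T r by (intro mult_right_mono powr_mono2') auto
    finally show ?thesis .
  qed
  have 1: "\<bar>(\<integral>x. g x \<partial>\<mu>) - (\<integral>x. g x \<partial>\<nu>)\<bar> \<le> 2 * T * b"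
    by (rule bounded_integral_diff_le[OF \<mu> \<nu> s d gm(1) gb T])
  have est: "\<bar>(\<integral>x. f x \<partial>\<kappa>) - (\<integral>x. g x \<partial>\<kappa>)\<bar> \<le> D * T powr (1 - r)"
    if "integrable \<kappa> f" "integrable \<kappa> g" "integrable \<kappa> (\<lambda>x. \<bar>f x\<bar> powr r)" "(\<integral>x. \<bar>f x\<bar> powr r \<partial>\<kappa>) \<le> D" for \<kappa>
  proof -
    have "\<bar>(\<integral>x. f x \<partial>\<kappa>) - (\<integral>x. g x \<partial>\<kappa>)\<bar> \<le> (\<integral>x. \<bar>f x - g x\<bar> \<partial>\<kappa>)"
      using integral_abs_bound[of \<kappa> "\<lambda>x. f x - g x"] that by (simp add: Bochner_Integration.integral_diff)
    also have "\<dots> \<le> (\<integral>x. T powr (1 - r) * \<bar>f x\<bar> powr r \<partial>\<kappa>)"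
      by (rule integral_mono) (use that fg in auto)
    also have "\<dots> \<le> T powr (1 - r) * D" using that by (simp add: mult_left_mono)
    finally show ?thesis by (simp add: mult.commute)
  qed
  show ?thesis using 1 est[OF fi gi fm] est[OF fvi gvi fn] by linarith
qed

section \<open>Geometrically absolutely regular stationary sequences\<close>

text \<open>\<open>geom_abs_regular\<close> in a usable form: a bound for every past and future and
  for every gap, including the small gaps, where the trivial bound 1 is absorbed by
  \<open>Cb\<close>.\<close>

locale mixing_seq = prob_space M for M :: "'a measure" +
  fixes X :: "nat \<Rightarrow> 'a \<Rightarrow> real" and \<tau> Cb :: real
  assumes X_rv[measurable]: "\<And>i. X i \<in> borel_measurable M"
    and stat: "stationary_seq M X"
    and \<tau>: "0 < \<tau>" "\<tau> < 1"
    and beta: "\<And>j m. j \<ge> 1 \<Longrightarrow> beta_coef M (gen_sigma M X {1..j}) (gen_sigma M X {j+m..}) \<le> Cb * \<tau> ^ m"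
    and Cb: "0 < Cb"
begin

text \<open>The sets of \<open>gen_sigma\<close>, packaged as a measure so that dependence on a set
  of indices becomes a \<open>measurable\<close> statement.\<close>

definition gs :: "nat set \<Rightarrow> 'a measure" where
  "gs I = sigma (space M) {X i -` B \<inter> space M | i B. i \<in> I \<and> B \<in> sets borel}"

lemma space_gs[simp]: "space (gs I) = space M"
  by (simp add: gs_def space_measure_of_conv)

lemma sets_gs: "sets (gs I) = gen_sigma M X I"
  unfolding gs_def gen_sigma_def by (rule sets_measure_of) auto

lemma gs_le: "sets (gs I) \<subseteq> sets M"
  unfolding sets_gs gen_sigma_def
  by (rule sets.sigma_sets_subset) (use X_rv in \<open>auto simp: measurable_sets\<close>)

lemma X_gs: "i \<in> I \<Longrightarrow> X i \<in> borel_measurable (gs I)"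
  by (rule measurableI) (auto simp: sets_gs gen_sigma_def)

lemma gs_mono: "I \<subseteq> J \<Longrightarrow> sets (gs I) \<subseteq> sets (gs J)"
  unfolding sets_gs gen_sigma_def by (rule sigma_sets_mono') auto

lemma measurable_gs_mono: "f \<in> measurable (gs I) N \<Longrightarrow> I \<subseteq> J \<Longrightarrow> f \<in> measurable (gs J) N"
  using gs_mono[of I J] by (auto simp: measurable_def)

lemma measurable_gsD: "f \<in> measurable (gs I) N \<Longrightarrow> f \<in> measurable M N"
  using gs_le[of I] by (auto simp: measurable_def)

lemma measurable_gs_vimage: "U \<in> measurable (gs I) A \<Longrightarrow> S \<in> sets A \<Longrightarrow> U -` S \<inter> space M \<in> gen_sigma M X I"
  using measurable_sets[of U "gs I" A S] by (simp add: sets_gs)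

section \<open>Replacing past and future by independent copies\<close>

lemma decouple_tv:
  assumes j: "j \<ge> 1" and U: "U \<in> measurable (gs {1..j}) A" and V: "V \<in> measurable (gs {j+m..}) B"
    and C: "C \<in> sets (A \<Otimes>\<^sub>M B)"
  shows "\<bar>measure (distr M (A \<Otimes>\<^sub>M B) (\<lambda>\<omega>. (U \<omega>, V \<omega>))) C - measure (distr M A U \<Otimes>\<^sub>M distr M B V) C\<bar> \<le> 2 * (Cb * \<tau> ^ m)"
proof -
  have "\<bar>measure (distr M (A \<Otimes>\<^sub>M B) (\<lambda>\<omega>. (U \<omega>, V \<omega>))) C - measure (distr M A U \<Otimes>\<^sub>M distr M B V) C\<bar> \<le> 2 * beta_coef M (gen_sigma M X {1..j}) (gen_sigma M X {j+m..})"
    by (rule total_variation_le_beta_coef[OF prob_space_axioms])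
       (use gs_le[of "{1..j}"] gs_le[of "{j+m..}"] measurable_gs_vimage[OF U] measurable_gs_vimage[OF V]
          measurable_gsD[OF U] measurable_gsD[OF V] C in \<open>auto simp: sets_gs\<close>)
  then show ?thesis using beta[OF j, of m] by linarith
qed

lemma decouple_spaces:
  assumes U: "U \<in> measurable M A" and V: "V \<in> measurable M B"
  shows "prob_space (distr M (A \<Otimes>\<^sub>M B) (\<lambda>\<omega>. (U \<omega>, V \<omega>)))" "prob_space (distr M A U \<Otimes>\<^sub>M distr M B V)"
    "sets (distr M (A \<Otimes>\<^sub>M B) (\<lambda>\<omega>. (U \<omega>, V \<omega>))) = sets (distr M A U \<Otimes>\<^sub>M distr M B V)"
    "pair_prob_space (distr M A U) (distr M B V)"
proof -
  interpret U: prob_space "distr M A U" by (rule prob_space_distr) fact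
  interpret V: prob_space "distr M B V" by (rule prob_space_distr) fact
  show pp: "pair_prob_space (distr M A U) (distr M B V)" by unfold_locales
  interpret p: pair_prob_space "distr M A U" "distr M B V" by fact
  show "prob_space (distr M (A \<Otimes>\<^sub>M B) (\<lambda>\<omega>. (U \<omega>, V \<omega>)))"
    using U V by (intro prob_space_distr) simp
  show "prob_space (distr M A U \<Otimes>\<^sub>M distr M B V)" by unfold_locales
  show "sets (distr M (A \<Otimes>\<^sub>M B) (\<lambda>\<omega>. (U \<omega>, V \<omega>))) = sets (distr M A U \<Otimes>\<^sub>M distr M B V)"
    by (simp cong: sets_pair_measure_cong)
qed

lemma decouple_bounded:
  assumes j: "j \<ge> 1" and U: "U \<in> measurable (gs {1..j}) A" and V: "V \<in> measurable (gs {j+m..}) B"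
    and f[measurable]: "f \<in> borel_measurable (A \<Otimes>\<^sub>M B)" and b: "\<And>z. \<bar>f z\<bar> \<le> (T::real)" and T: "T > 0"
  shows "\<bar>(\<integral>\<omega>. f (U \<omega>, V \<omega>) \<partial>M) - (\<integral>z. f z \<partial>(distr M A U \<Otimes>\<^sub>M distr M B V))\<bar> \<le> 4 * T * (Cb * \<tau> ^ m)"
proof -
  note UM[measurable] = measurable_gsD[OF U] and VM[measurable] = measurable_gsD[OF V]
  note sp = decouple_spaces[OF UM VM]
  have "\<bar>(\<integral>z. f z \<partial>distr M (A \<Otimes>\<^sub>M B) (\<lambda>\<omega>. (U \<omega>, V \<omega>))) - (\<integral>z. f z \<partial>(distr M A U \<Otimes>\<^sub>M distr M B V))\<bar> \<le> 2 * T * (2 * (Cb * \<tau> ^ m))"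
    by (rule bounded_integral_diff_le[OF sp(1,2,3)]) (use decouple_tv[OF j U V] b T in auto)
  then show ?thesis by (simp add: integral_distr)
qed

text \<open>With the truncation level \<tau>^(-m/2) the two errors in \<open>decouple_Lp\<close> are
  of order \<tau>^(m/2) and \<tau>^(m(r-1)/2); \<open>rho r\<close> is \<tau> raised to the smaller
  of the exponents 1/2 and (r-1)/2.\<close>

definition rho :: "real \<Rightarrow> real" where "rho r = \<tau> powr (min 1 (r - 1) / 2)"

lemma rho: "r > 1 \<Longrightarrow> 0 < rho r" "r > 1 \<Longrightarrow> rho r < 1"
  using \<tau> by (auto simp: rho_def powr01_less_one)

lemma decouple_Lp:
  assumes j: "j \<ge> 1" and U: "U \<in> measurable (gs {1..j}) A" and V: "V \<in> measurable (gs {j+m..}) B"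
    and f[measurable]: "f \<in> borel_measurable (A \<Otimes>\<^sub>M B)" and r: "r > 1"
    and m1: "integrable M (\<lambda>\<omega>. \<bar>f (U \<omega>, V \<omega>)\<bar> powr r)" "(\<integral>\<omega>. \<bar>f (U \<omega>, V \<omega>)\<bar> powr r \<partial>M) \<le> D"
    and m2: "integrable (distr M A U \<Otimes>\<^sub>M distr M B V) (\<lambda>z. \<bar>f z\<bar> powr r)" "(\<integral>z. \<bar>f z\<bar> powr r \<partial>(distr M A U \<Otimes>\<^sub>M distr M B V)) \<le> D"
  shows "\<bar>(\<integral>\<omega>. f (U \<omega>, V \<omega>) \<partial>M) - (\<integral>z. f z \<partial>(distr M A U \<Otimes>\<^sub>M distr M B V))\<bar> \<le> (4 * Cb + 2 * D) * rho r ^ m"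
proof -
  note UM[measurable] = measurable_gsD[OF U] and VM[measurable] = measurable_gsD[OF V]
  note sp = decouple_spaces[OF UM VM]
  have fM: "f \<in> borel_measurable (distr M (A \<Otimes>\<^sub>M B) (\<lambda>\<omega>. (U \<omega>, V \<omega>)))" using f by simp
  define T where "T = \<tau> powr (- real m / 2)"
  have T: "T > 0" using \<tau> by (simp add: T_def)
  have D: "D \<ge> 0" using m1(2) by (rule order_trans[rotated]) simp
  have "\<bar>(\<integral>z. f z \<partial>distr M (A \<Otimes>\<^sub>M B) (\<lambda>\<omega>. (U \<omega>, V \<omega>))) - (\<integral>z. f z \<partial>(distr M A U \<Otimes>\<^sub>M distr M B V))\<bar> \<le> 2 * T * (2 * (Cb * \<tau> ^ m)) + 2 * D * T powr (1 - r)"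
    by (rule Lp_integral_diff_le[OF sp(1,2,3) _ fM T r])
       (use decouple_tv[OF j U V] m1 m2 in \<open>auto simp: integrable_distr_eq integral_distr\<close>)
  then have 1: "\<bar>(\<integral>\<omega>. f (U \<omega>, V \<omega>) \<partial>M) - (\<integral>z. f z \<partial>(distr M A U \<Otimes>\<^sub>M distr M B V))\<bar> \<le> 4 * Cb * (T * \<tau> ^ m) + 2 * D * T powr (1 - r)"
    by (simp add: integral_distr algebra_simps)
  have rr: "rho r ^ m = \<tau> powr (real m * (min 1 (r - 1) / 2))"
    using \<tau> by (simp add: rho_def powr_powr mult.commute flip: powr_realpow)
  have "T * \<tau> ^ m = \<tau> powr (real m / 2)" unfolding T_def using \<tau> by (simp add: powr_add[symmetric] flip: powr_realpow)
  also have "\<dots> \<le> rho r ^ m" unfolding rr using \<tau> mult_left_mono[of "min 1 (r - 1)" 1 "real m"] by (intro powr_mono') auto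
  finally have 2: "T * \<tau> ^ m \<le> rho r ^ m" .
  have "T powr (1 - r) = \<tau> powr (real m * ((r - 1) / 2))" unfolding T_def using \<tau> by (simp add: powr_powr algebra_simps diff_divide_distrib)
  also have "\<dots> \<le> rho r ^ m" unfolding rr using \<tau> by (intro powr_mono' mult_left_mono divide_right_mono) auto
  finally have 3: "T powr (1 - r) \<le> rho r ^ m" .
  have "4 * Cb * (T * \<tau> ^ m) + 2 * D * T powr (1 - r) \<le> 4 * Cb * rho r ^ m + 2 * D * rho r ^ m"
    using 2 3 D Cb by (intro add_mono mult_left_mono) auto
  then show ?thesis using 1 by (simp add: algebra_simps)
qed

lemma powr_mult_le:
  fixes x y :: real assumes "r > 0" shows "\<bar>x * y\<bar> powr r \<le> \<bar>x\<bar> powr (2*r) + \<bar>y\<bar> powr (2*r)"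
proof -
  have "\<bar>x * y\<bar> powr r = \<bar>x\<bar> powr r * \<bar>y\<bar> powr r" by (simp add: abs_mult powr_mult)
  also have "\<dots> \<le> (\<bar>x\<bar> powr r)^2 + (\<bar>y\<bar> powr r)^2"
    using sum_squares_bound[of "\<bar>x\<bar> powr r" "\<bar>y\<bar> powr r"] mult_nonneg_nonneg[of "\<bar>x\<bar> powr r" "\<bar>y\<bar> powr r"] powr_ge_zero[of "\<bar>x\<bar>" r] powr_ge_zero[of "\<bar>y\<bar>" r] by linarith
  also have "\<dots> = \<bar>x\<bar> powr (2*r) + \<bar>y\<bar> powr (2*r)"
    by (simp add: power2_eq_square powr_add[symmetric])
  finally show ?thesis .
qed

lemma (in -) powr_le_one_plus_powr: assumes "0 \<le> p" "p \<le> q" shows "\<bar>x::real\<bar> powr p \<le> 1 + \<bar>x\<bar> powr q"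
proof (cases "\<bar>x\<bar> \<le> 1")
  case True
  then have "\<bar>x\<bar> powr p \<le> 1" using assms by (cases "x = 0") (auto simp: powr_le1)
  then show ?thesis by (simp add: add_increasing2)
next
  case False then show ?thesis using assms by (simp add: add_increasing powr_mono)
qed

lemma (in -) powr_one_abs_le: assumes "q \<ge> 1" shows "\<bar>x::real\<bar> \<le> 1 + \<bar>x\<bar> powr q"
  using assms
proof (cases "\<bar>x\<bar> \<le> 1")
  case False
  then have "\<bar>x\<bar> powr 1 \<le> \<bar>x\<bar> powr q" using assms by (intro powr_mono) auto
  then show ?thesis using False by auto
qed (simp add: add_increasing2)

lemma (in -) powr_two_le: assumes "q \<ge> 2" shows "(x::real)^2 \<le> 1 + \<bar>x\<bar> powr q"
proof (cases "\<bar>x\<bar> \<le> 1")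
  case True then show ?thesis by (simp add: abs_square_le_1 add_increasing2)
next
  case False
  then have "\<bar>x\<bar> powr 2 \<le> \<bar>x\<bar> powr q" using assms by (intro powr_mono) auto
  moreover have "\<bar>x\<bar> powr 2 = x^2" using False by (subst powr_numeral) auto
  ultimately show ?thesis by auto
qed

lemma integrable_of_powr:
  assumes "Y \<in> borel_measurable M" "integrable M (\<lambda>\<omega>. \<bar>Y \<omega>\<bar> powr q)" "(q::real) \<ge> 1"
  shows "integrable M Y"
  by (rule Bochner_Integration.integrable_bound[of _ "\<lambda>x. 1 + \<bar>Y x\<bar> powr q"]) (use assms powr_one_abs_le[OF assms(3)] in auto)

lemma integrable_square_of_powr:
  assumes "Y \<in> borel_measurable M" "integrable M (\<lambda>\<omega>. \<bar>Y \<omega>\<bar> powr q)" "(q::real) \<ge> 2"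
  shows "integrable M (\<lambda>\<omega>. (Y \<omega>)^2)"
  by (rule Bochner_Integration.integrable_bound[of _ "\<lambda>x. 1 + \<bar>Y x\<bar> powr q"]) (use assms powr_two_le[OF assms(3)] in auto)

lemma (in -) abs_mult_le_squares: "\<bar>(x::real) * y\<bar> \<le> x^2 + y^2"
  using sum_squares_bound[of "\<bar>x\<bar>" "\<bar>y\<bar>"] mult_nonneg_nonneg[of "\<bar>x\<bar>" "\<bar>y\<bar>"] unfolding abs_mult power2_abs by linarith

lemma (in -) integrable_mult_of_squares:
  fixes Y Z :: "'b \<Rightarrow> real"
  assumes "Y \<in> borel_measurable N" "Z \<in> borel_measurable N" "integrable N (\<lambda>\<omega>. (Y \<omega>)^2)" "integrable N (\<lambda>\<omega>. (Z \<omega>)^2)"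
  shows "integrable N (\<lambda>\<omega>. Y \<omega> * Z \<omega>)"
  by (rule Bochner_Integration.integrable_bound[of _ "\<lambda>x. (Y x)^2 + (Z x)^2"]) (use assms abs_mult_le_squares in auto)

text \<open>The product has only moments of order q/2, so the decoupling is used with that exponent,
  which exceeds 1 because q > 2. The bound \<open>2 * D\<close> on the moment comes from |x y|^(q/2)
  being at most |x|^q + |y|^q.\<close>

lemma cov_decay:
  assumes j: "j \<ge> 1" and Y: "Y \<in> borel_measurable (gs {1..j})" and Z: "Z \<in> borel_measurable (gs {j+m..})"
    and q: "q > 2"
    and Yq: "integrable M (\<lambda>\<omega>. \<bar>Y \<omega>\<bar> powr q)" "(\<integral>\<omega>. \<bar>Y \<omega>\<bar> powr q \<partial>M) \<le> D"
    and Zq: "integrable M (\<lambda>\<omega>. \<bar>Z \<omega>\<bar> powr q)" "(\<integral>\<omega>. \<bar>Z \<omega>\<bar> powr q \<partial>M) \<le> D"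
  shows "\<bar>(\<integral>\<omega>. Y \<omega> * Z \<omega> \<partial>M) - (\<integral>\<omega>. Y \<omega> \<partial>M) * (\<integral>\<omega>. Z \<omega> \<partial>M)\<bar> \<le> (4 * Cb + 4 * D) * rho (q/2) ^ m"
proof -
  note YM[measurable] = measurable_gsD[OF Y] and ZM[measurable] = measurable_gsD[OF Z]
  note sp = decouple_spaces[OF YM ZM]
  interpret p: pair_prob_space "distr M borel Y" "distr M borel Z" by (rule sp(4))
  define f where "f z = fst z * snd z" for z :: "real \<times> real"
  have f[measurable]: "f \<in> borel_measurable (borel \<Otimes>\<^sub>M borel)" unfolding f_def by measurable
  have fst_q: "integrable (distr M borel Y \<Otimes>\<^sub>M distr M borel Z) (\<lambda>z. \<bar>fst z\<bar> powr q)"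
     "(\<integral>z. \<bar>fst z\<bar> powr q \<partial>(distr M borel Y \<Otimes>\<^sub>M distr M borel Z)) = (\<integral>\<omega>. \<bar>Y \<omega>\<bar> powr q \<partial>M)"
    and snd_q: "integrable (distr M borel Y \<Otimes>\<^sub>M distr M borel Z) (\<lambda>z. \<bar>snd z\<bar> powr q)"
     "(\<integral>z. \<bar>snd z\<bar> powr q \<partial>(distr M borel Y \<Otimes>\<^sub>M distr M borel Z)) = (\<integral>\<omega>. \<bar>Z \<omega>\<bar> powr q \<partial>M)"
    and fst_1: "integrable (distr M borel Y \<Otimes>\<^sub>M distr M borel Z) (\<lambda>z. fst z * snd z)"
      "(\<integral>z. f z \<partial>(distr M borel Y \<Otimes>\<^sub>M distr M borel Z)) = (\<integral>\<omega>. Y \<omega> \<partial>M) * (\<integral>\<omega>. Z \<omega> \<partial>M)"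
  proof -
    have 1: "integrable (distr M borel Y) (\<lambda>x. \<bar>x\<bar> powr q)" using Yq by (simp add: integrable_distr_eq)
    have 2: "integrable (distr M borel Z) (\<lambda>x. \<bar>x\<bar> powr q)" using Zq by (simp add: integrable_distr_eq)
    have a: "distr (distr M borel Y \<Otimes>\<^sub>M distr M borel Z) (distr M borel Y) fst = distr M borel Y"
      by (rule prob_space.distr_pair_fst[OF p.M2.prob_space_axioms])
    show "integrable (distr M borel Y \<Otimes>\<^sub>M distr M borel Z) (\<lambda>z. \<bar>fst z\<bar> powr q)"
      using integrable_distr_eq[of fst "distr M borel Y \<Otimes>\<^sub>M distr M borel Z" "distr M borel Y" "\<lambda>x. \<bar>x\<bar> powr q"] 1 unfolding a by simp
    show "(\<integral>z. \<bar>fst z\<bar> powr q \<partial>(distr M borel Y \<Otimes>\<^sub>M distr M borel Z)) = (\<integral>\<omega>. \<bar>Y \<omega>\<bar> powr q \<partial>M)"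
      using integral_distr[of fst "distr M borel Y \<Otimes>\<^sub>M distr M borel Z" "distr M borel Y" "\<lambda>x. \<bar>x\<bar> powr q"] unfolding a by (simp add: integral_distr)
    have b: "distr (distr M borel Y \<Otimes>\<^sub>M distr M borel Z) (distr M borel Z) snd = distr M borel Z"
    proof -
      have "distr (distr M borel Y \<Otimes>\<^sub>M distr M borel Z) (distr M borel Z) snd = distr (distr (distr M borel Z \<Otimes>\<^sub>M distr M borel Y) (distr M borel Y \<Otimes>\<^sub>M distr M borel Z) (\<lambda>(x, y). (y, x))) (distr M borel Z) snd"
        using p.distr_pair_swap by simp
      also have "\<dots> = distr (distr M borel Z \<Otimes>\<^sub>M distr M borel Y) (distr M borel Z) fst"
        by (subst distr_distr) (auto simp: comp_def case_prod_unfold)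
      also have "\<dots> = distr M borel Z" by (rule prob_space.distr_pair_fst[OF p.M1.prob_space_axioms])
      finally show ?thesis .
    qed
    show "integrable (distr M borel Y \<Otimes>\<^sub>M distr M borel Z) (\<lambda>z. \<bar>snd z\<bar> powr q)"
      using integrable_distr_eq[of snd "distr M borel Y \<Otimes>\<^sub>M distr M borel Z" "distr M borel Z" "\<lambda>x. \<bar>x\<bar> powr q"] 2 unfolding b by simp
    show "(\<integral>z. \<bar>snd z\<bar> powr q \<partial>(distr M borel Y \<Otimes>\<^sub>M distr M borel Z)) = (\<integral>\<omega>. \<bar>Z \<omega>\<bar> powr q \<partial>M)"
      using integral_distr[of snd "distr M borel Y \<Otimes>\<^sub>M distr M borel Z" "distr M borel Z" "\<lambda>x. \<bar>x\<bar> powr q"] unfolding b by (simp add: integral_distr)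
    have i1: "integrable (distr M borel Y) (\<lambda>x. x)" "integrable (distr M borel Z) (\<lambda>x. x)"
      using integrable_of_powr[OF YM Yq(1)] integrable_of_powr[OF ZM Zq(1)] q by (auto simp: integrable_distr_eq)
    show ii: "integrable (distr M borel Y \<Otimes>\<^sub>M distr M borel Z) (\<lambda>z. fst z * snd z)"
    proof (rule Bochner_Integration.integrable_bound[of _ "\<lambda>z. 2 + \<bar>fst z\<bar> powr q + \<bar>snd z\<bar> powr q"])
      show "AE z in distr M borel Y \<Otimes>\<^sub>M distr M borel Z. norm (fst z * snd z) \<le> norm (2 + \<bar>fst z\<bar> powr q + \<bar>snd z\<bar> powr q)"
      proof (rule AE_I2)
        fix z :: "real \<times> real"
        have "\<bar>fst z * snd z\<bar> \<le> (1 + \<bar>fst z\<bar> powr q) + (1 + \<bar>snd z\<bar> powr q)"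
          using abs_mult_le_squares[of "fst z" "snd z"] powr_two_le[of q "fst z"] powr_two_le[of q "snd z"] q by linarith
        then show "norm (fst z * snd z) \<le> norm (2 + \<bar>fst z\<bar> powr q + \<bar>snd z\<bar> powr q)" by simp
      qed
    qed (use \<open>integrable (distr M borel Y \<Otimes>\<^sub>M distr M borel Z) (\<lambda>z. \<bar>fst z\<bar> powr q)\<close> \<open>integrable (distr M borel Y \<Otimes>\<^sub>M distr M borel Z) (\<lambda>z. \<bar>snd z\<bar> powr q)\<close> in auto)
    have "(\<integral>z. f z \<partial>(distr M borel Y \<Otimes>\<^sub>M distr M borel Z)) = (\<integral>x. \<integral>y. x * y \<partial>distr M borel Z \<partial>distr M borel Y)"
      using p.integral_fst[of "\<lambda>x y. x * y"] ii by (simp add: case_prod_unfold f_def)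
    also have "\<dots> = (\<integral>\<omega>. Y \<omega> \<partial>M) * (\<integral>\<omega>. Z \<omega> \<partial>M)" by (simp add: integral_distr)
    finally show "(\<integral>z. f z \<partial>(distr M borel Y \<Otimes>\<^sub>M distr M borel Z)) = (\<integral>\<omega>. Y \<omega> \<partial>M) * (\<integral>\<omega>. Z \<omega> \<partial>M)" .
  qed
  have le: "\<bar>x * y\<bar> powr (q/2) \<le> \<bar>x\<bar> powr q + \<bar>y\<bar> powr q" for x y :: real
    using powr_mult_le[of "q/2" x y] q by simp
  have i2: "integrable M (\<lambda>\<omega>. \<bar>Y \<omega> * Z \<omega>\<bar> powr (q/2))"
    by (rule Bochner_Integration.integrable_bound[of _ "\<lambda>\<omega>. \<bar>Y \<omega>\<bar> powr q + \<bar>Z \<omega>\<bar> powr q"]) (use Yq Zq le in auto)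
  have e2: "(\<integral>\<omega>. \<bar>Y \<omega> * Z \<omega>\<bar> powr (q/2) \<partial>M) \<le> (\<integral>\<omega>. \<bar>Y \<omega>\<bar> powr q + \<bar>Z \<omega>\<bar> powr q \<partial>M)"
    by (rule integral_mono) (use i2 Yq Zq le in auto)
  have i3: "integrable (distr M borel Y \<Otimes>\<^sub>M distr M borel Z) (\<lambda>z. \<bar>f z\<bar> powr (q/2))"
    by (rule Bochner_Integration.integrable_bound[of _ "\<lambda>z. \<bar>fst z\<bar> powr q + \<bar>snd z\<bar> powr q"]) (use fst_q snd_q le in \<open>auto simp: f_def\<close>)
  have e3: "(\<integral>z. \<bar>f z\<bar> powr (q/2) \<partial>(distr M borel Y \<Otimes>\<^sub>M distr M borel Z)) \<le> (\<integral>z. \<bar>fst z\<bar> powr q + \<bar>snd z\<bar> powr q \<partial>(distr M borel Y \<Otimes>\<^sub>M distr M borel Z))"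
    by (rule integral_mono) (use i3 fst_q snd_q le in \<open>auto simp: f_def\<close>)
  have "\<bar>(\<integral>\<omega>. f (Y \<omega>, Z \<omega>) \<partial>M) - (\<integral>z. f z \<partial>(distr M borel Y \<Otimes>\<^sub>M distr M borel Z))\<bar> \<le> (4 * Cb + 2 * (2 * D)) * rho (q/2) ^ m"
  proof (rule decouple_Lp[OF j Y Z f])
    show "(\<integral>\<omega>. \<bar>f (Y \<omega>, Z \<omega>)\<bar> powr (q/2) \<partial>M) \<le> 2 * D"
      using e2 Yq Zq by (simp add: f_def)
    show "(\<integral>z. \<bar>f z\<bar> powr (q/2) \<partial>(distr M borel Y \<Otimes>\<^sub>M distr M borel Z)) \<le> 2 * D"
      using e3 Yq Zq fst_q snd_q by simp
  qed (use i2 i3 q in \<open>auto simp: f_def\<close>)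
  then show ?thesis unfolding fst_1(2) by (simp add: f_def)
qed

text \<open>Real and imaginary part are decoupled separately, each with error
  \<open>4 * (Cb * \<tau> ^ m)\<close>, whence the 8.\<close>

lemma decouple_complex:
  fixes Y Z :: "'a \<Rightarrow> complex"
  assumes j: "j \<ge> 1" and Y: "Y \<in> borel_measurable (gs {1..j})" and Z: "Z \<in> borel_measurable (gs {j+m..})"
    and b: "\<And>\<omega>. cmod (Y \<omega>) \<le> 1" "\<And>\<omega>. cmod (Z \<omega>) \<le> 1"
  shows "cmod ((\<integral>\<omega>. Y \<omega> * Z \<omega> \<partial>M) - (\<integral>\<omega>. Y \<omega> \<partial>M) * (\<integral>\<omega>. Z \<omega> \<partial>M)) \<le> 8 * (Cb * \<tau> ^ m)"
proof -
  note YM[measurable] = measurable_gsD[OF Y] and ZM[measurable] = measurable_gsD[OF Z]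
  note sp = decouple_spaces[OF YM ZM]
  interpret p: pair_prob_space "distr M borel Y" "distr M borel Z" by (rule sp(4))
  \<comment> \<open>\<open>decouple_bounded\<close> wants a function bounded on the whole product
    space; \<open>c\<close> cuts the factors off outside the unit disc, which the values of
    \<open>Y\<close> and \<open>Z\<close> never leave.\<close>
  define c where "c z = (if cmod z \<le> 1 then z else 0)" for z :: complex
  have c[measurable]: "c \<in> borel_measurable borel" unfolding c_def by measurable
  have cb: "cmod (c z) \<le> 1" for z by (simp add: c_def)
  have cY: "c (Y \<omega>) = Y \<omega>" "c (Z \<omega>) = Z \<omega>" for \<omega> using b by (auto simp: c_def)
  define g where "g z = c (fst z) * c (snd z)" for z
  have g[measurable]: "g \<in> borel_measurable (borel \<Otimes>\<^sub>M borel)" unfolding g_def by measurable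
  have gb: "cmod (g z) \<le> 1" for z unfolding g_def norm_mult using cb by (simp add: mult_le_one)
  have gi: "integrable (distr M borel Y \<Otimes>\<^sub>M distr M borel Z) g"
    by (rule p.integrable_const_bound[of _ 1]) (use gb in auto)
  have YZi: "integrable M (\<lambda>\<omega>. Y \<omega> * Z \<omega>)"
    by (rule integrable_const_bound[of _ 1]) (use b in \<open>auto simp: norm_mult mult_le_one\<close>)
  have "(\<integral>z. g z \<partial>(distr M borel Y \<Otimes>\<^sub>M distr M borel Z)) = (\<integral>x. \<integral>y. c x * c y \<partial>distr M borel Z \<partial>distr M borel Y)"
    using p.integral_fst[of "\<lambda>x y. c x * c y"] gi by (simp add: case_prod_unfold g_def[abs_def])
  also have "\<dots> = (\<integral>\<omega>. Y \<omega> \<partial>M) * (\<integral>\<omega>. Z \<omega> \<partial>M)" by (simp add: integral_distr cY)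
  finally have ge: "(\<integral>z. g z \<partial>(distr M borel Y \<Otimes>\<^sub>M distr M borel Z)) = (\<integral>\<omega>. Y \<omega> \<partial>M) * (\<integral>\<omega>. Z \<omega> \<partial>M)" .
  have gYZ: "g (Y \<omega>, Z \<omega>) = Y \<omega> * Z \<omega>" for \<omega> by (simp add: g_def cY)
  let ?d = "(\<integral>\<omega>. Y \<omega> * Z \<omega> \<partial>M) - (\<integral>\<omega>. Y \<omega> \<partial>M) * (\<integral>\<omega>. Z \<omega> \<partial>M)"
  have "\<bar>(\<integral>\<omega>. Re (g (Y \<omega>, Z \<omega>)) \<partial>M) - (\<integral>z. Re (g z) \<partial>(distr M borel Y \<Otimes>\<^sub>M distr M borel Z))\<bar> \<le> 4 * 1 * (Cb * \<tau> ^ m)"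
    by (rule decouple_bounded[OF j Y Z]) (use gb order_trans[OF abs_Re_le_cmod] in auto)
  moreover have "(\<integral>\<omega>. Re (g (Y \<omega>, Z \<omega>)) \<partial>M) - (\<integral>z. Re (g z) \<partial>(distr M borel Y \<Otimes>\<^sub>M distr M borel Z)) = Re ?d"
    unfolding gYZ integral_Re[OF YZi] integral_Re[OF gi] ge by simp
  ultimately have 1: "\<bar>Re ?d\<bar> \<le> 4 * (Cb * \<tau> ^ m)" by simp
  have "\<bar>(\<integral>\<omega>. Im (g (Y \<omega>, Z \<omega>)) \<partial>M) - (\<integral>z. Im (g z) \<partial>(distr M borel Y \<Otimes>\<^sub>M distr M borel Z))\<bar> \<le> 4 * 1 * (Cb * \<tau> ^ m)"
    by (rule decouple_bounded[OF j Y Z]) (use gb order_trans[OF abs_Im_le_cmod] in auto)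
  moreover have "(\<integral>\<omega>. Im (g (Y \<omega>, Z \<omega>)) \<partial>M) - (\<integral>z. Im (g z) \<partial>(distr M borel Y \<Otimes>\<^sub>M distr M borel Z)) = Im ?d"
    unfolding gYZ integral_Im[OF YZi] integral_Im[OF gi] ge by simp
  ultimately have 2: "\<bar>Im ?d\<bar> \<le> 4 * (Cb * \<tau> ^ m)" by simp
  show ?thesis using cmod_le[of ?d] 1 2 by linarith
qed

text \<open>Induction that splits off the last factor: the earlier ones depend on indices up to
  \<open>r (n - 1)\<close>, the last one on indices from \<open>r (n - 1) + m\<close> on. Since
  every factor has modulus at most 1, the errors simply add up.\<close>

lemma factorize_complex:
  fixes Z :: "nat \<Rightarrow> 'a \<Rightarrow> complex"
  assumes Z: "\<And>b. b < n \<Longrightarrow> Z b \<in> borel_measurable (gs {l b..r b})"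
    and bd: "\<And>b \<omega>. b < n \<Longrightarrow> cmod (Z b \<omega>) \<le> 1"
    and r1: "\<And>b. b < n \<Longrightarrow> 1 \<le> l b" "\<And>b. b < n \<Longrightarrow> 1 \<le> r b"
    and sep: "\<And>b. Suc b < n \<Longrightarrow> r b + m \<le> l (Suc b)" and inc: "\<And>b. Suc b < n \<Longrightarrow> r b \<le> r (Suc b)"
  shows "cmod ((\<integral>\<omega>. (\<Prod>b<n. Z b \<omega>) \<partial>M) - (\<Prod>b<n. \<integral>\<omega>. Z b \<omega> \<partial>M)) \<le> real n * (8 * (Cb * \<tau> ^ m))"
  using assms
proof (induction n)
  case 0 then show ?case by (simp add: prob_space)
next
  case (Suc n)
  have IH: "cmod ((\<integral>\<omega>. (\<Prod>b<n. Z b \<omega>) \<partial>M) - (\<Prod>b<n. \<integral>\<omega>. Z b \<omega> \<partial>M)) \<le> real n * (8 * (Cb * \<tau> ^ m))"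
    by (rule Suc.IH) (use Suc.prems in auto)
  have pos: "8 * (Cb * \<tau> ^ m) \<ge> 0" using Cb \<tau> by auto
  have ZM: "Z b \<in> borel_measurable M" if "b \<le> n" for b using Suc.prems(1)[of b] that measurable_gsD by auto
  have EZ: "cmod (\<integral>\<omega>. Z n \<omega> \<partial>M) \<le> 1"
  proof -
    have "integrable M (Z n)" by (rule integrable_const_bound[of _ 1]) (use ZM Suc.prems in auto)
    have "cmod (\<integral>\<omega>. Z n \<omega> \<partial>M) \<le> (\<integral>\<omega>. cmod (Z n \<omega>) \<partial>M)" by simp
    also have "\<dots> \<le> 1" by (rule integral_le_const) (use \<open>integrable M (Z n)\<close> Suc.prems in auto)
    finally show ?thesis .
  qed
  show ?case
  proof (cases "n = 0")
    case True then show ?thesis using pos by simp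
  next
    case False
    have mono: "r b \<le> r (n - 1)" if "b < n" for b
    proof -
      have "b \<le> n - 1" using that by simp
      then show ?thesis
      proof (induction rule: inc_induct)
        case (step i) then show ?case using Suc.prems(6)[of i] by force
      qed simp
    qed
    have P: "(\<lambda>\<omega>. \<Prod>b<n. Z b \<omega>) \<in> borel_measurable (gs {1..r (n-1)})"
    proof (rule borel_measurable_prod)
      fix b assume "b \<in> {..<n}"
      then show "Z b \<in> borel_measurable (gs {1..r (n-1)})"
        using measurable_gs_mono[OF Suc.prems(1)[of b], of "{1..r (n-1)}"] mono[of b] Suc.prems(3)[of b] by auto
    qed
    have Q: "Z n \<in> borel_measurable (gs {r (n-1) + m..})"
      using measurable_gs_mono[OF Suc.prems(1)[of n], of "{r (n-1) + m..}"] Suc.prems(5)[of "n - 1"] False by auto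
    have Pb: "cmod (\<Prod>b<n. Z b \<omega>) \<le> 1" for \<omega>
      unfolding prod_norm[symmetric] by (rule prod_le_1) (use Suc.prems in auto)
    have "cmod ((\<integral>\<omega>. (\<Prod>b<n. Z b \<omega>) * Z n \<omega> \<partial>M) - (\<integral>\<omega>. (\<Prod>b<n. Z b \<omega>) \<partial>M) * (\<integral>\<omega>. Z n \<omega> \<partial>M)) \<le> 8 * (Cb * \<tau> ^ m)"
      by (rule decouple_complex[OF _ P Q Pb]) (use Suc.prems False in auto)
    moreover have "cmod ((\<integral>\<omega>. (\<Prod>b<n. Z b \<omega>) \<partial>M) * (\<integral>\<omega>. Z n \<omega> \<partial>M) - (\<Prod>b<n. \<integral>\<omega>. Z b \<omega> \<partial>M) * (\<integral>\<omega>. Z n \<omega> \<partial>M)) \<le> real n * (8 * (Cb * \<tau> ^ m)) * 1"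
      unfolding left_diff_distrib[symmetric] norm_mult by (rule mult_mono[OF IH EZ]) (use pos in auto)
    ultimately have "cmod (((\<integral>\<omega>. (\<Prod>b<n. Z b \<omega>) * Z n \<omega> \<partial>M) - (\<integral>\<omega>. (\<Prod>b<n. Z b \<omega>) \<partial>M) * (\<integral>\<omega>. Z n \<omega> \<partial>M)) + ((\<integral>\<omega>. (\<Prod>b<n. Z b \<omega>) \<partial>M) * (\<integral>\<omega>. Z n \<omega> \<partial>M) - (\<Prod>b<n. \<integral>\<omega>. Z b \<omega> \<partial>M) * (\<integral>\<omega>. Z n \<omega> \<partial>M))) \<le> 8 * (Cb * \<tau> ^ m) + real n * (8 * (Cb * \<tau> ^ m))"
      by (intro order_trans[OF norm_triangle_ineq]) simp
    then show ?thesis by (simp add: algebra_simps)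
  qed
qed

subsection \<open>Stationarity\<close>

text \<open>Stationarity is stated for vectors in \<open>PiM I\<close>, so a functional of finitely
  many observations has to be written as \<open>F\<close> applied to the restriction to
  \<open>I\<close> before it can be shifted.\<close>

lemma stat_distr:
  assumes I: "finite I" "I \<subseteq> {1..}" and F: "F \<in> measurable (PiM I (\<lambda>_. borel)) N"
  shows "distr M N (\<lambda>\<omega>. F (\<lambda>i\<in>I. X (i + s) \<omega>)) = distr M N (\<lambda>\<omega>. F (\<lambda>i\<in>I. X i \<omega>))"
proof -
  have "fdd M (\<lambda>i. X (i + s)) I = fdd M X I" using stat I unfolding stationary_seq_def by blast
  then have "distr (fdd M (\<lambda>i. X (i + s)) I) N F = distr (fdd M X I) N F" by simp
  then show ?thesis unfolding fdd_def
    by (subst (asm) distr_distr[OF F], measurable, subst (asm) distr_distr[OF F], measurable) (simp add: comp_def)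
qed

lemma stat_one: assumes "i \<ge> 1" shows "distr M borel (X i) = distr M borel (X 1)"
  using stat_distr[of "{1}" "\<lambda>x. x 1" borel "i - 1"] assms by simp

lemma stat_one_expect:
  fixes f :: "real \<Rightarrow> 'b::{banach, second_countable_topology}"
  assumes "i \<ge> 1" and [measurable]: "f \<in> borel_measurable borel"
  shows "integrable M (\<lambda>\<omega>. f (X i \<omega>)) \<longleftrightarrow> integrable M (\<lambda>\<omega>. f (X 1 \<omega>))" "(\<integral>\<omega>. f (X i \<omega>) \<partial>M) = (\<integral>\<omega>. f (X 1 \<omega>) \<partial>M)"
  using integrable_distr_eq[of "X i" M borel f] integrable_distr_eq[of "X 1" M borel f] integral_distr[of "X i" M borel f] integral_distr[of "X 1" M borel f]
  by (simp_all add: stat_one[OF assms(1)])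

lemma stat_two:
  assumes [measurable]: "case_prod f \<in> borel_measurable (borel \<Otimes>\<^sub>M borel)" and i: "i \<ge> 1"
  shows "(\<integral>\<omega>. f (X i \<omega>) (X (i + k) \<omega>) \<partial>M) = (\<integral>\<omega>. (f (X 1 \<omega>) (X (1 + k) \<omega>) :: real) \<partial>M)"
proof -
  have F: "(\<lambda>x. f (x 1) (x (1 + k))) \<in> borel_measurable (PiM {1, 1 + k} (\<lambda>_. borel))" by measurable
  have "distr M borel (\<lambda>\<omega>. f (X i \<omega>) (X (i + k) \<omega>)) = distr M borel (\<lambda>\<omega>. f (X 1 \<omega>) (X (1 + k) \<omega>))"
    using stat_distr[OF _ _ F, of "i - 1"] i by (simp add: add.commute)
  from arg_cong[OF this, of "\<lambda>M. \<integral>x. x \<partial>M"] show ?thesis by (simp add: integral_distr)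
qed

lemma stat_sum:
  assumes [measurable]: "u \<in> borel_measurable borel"
  shows "distr M borel (\<lambda>\<omega>. \<Sum>i\<in>{a<..a + N}. u (X i \<omega>) :: real) = distr M borel (\<lambda>\<omega>. \<Sum>i\<in>{1..N}. u (X i \<omega>))"
proof -
  have F: "(\<lambda>x. \<Sum>i\<in>{1..N}. u (x i)) \<in> borel_measurable (PiM {1..N} (\<lambda>_. borel))" by measurable
  have "(\<Sum>i\<in>{a<..a + N}. u (X i \<omega>)) = (\<Sum>i\<in>{1..N}. u (X (i + a) \<omega>))" for \<omega>
    by (rule sum.reindex_bij_witness[of _ "\<lambda>i. i + a" "\<lambda>i. i - a"]) auto
  then show ?thesis using stat_distr[OF _ _ F, of a] by simp
qed

end

section \<open>The central limit theorem by Bernstein's blocks\<close>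

lemma sum_geometric_inj_le:
  fixes r :: real
  assumes "0 < r" "r < 1" "finite B" "inj_on f B"
  shows "(\<Sum>j\<in>B. r ^ f j) \<le> 1 / (1 - r)"
proof -
  have "(\<Sum>j\<in>B. r ^ f j) = (\<Sum>k\<in>f ` B. r ^ k)" by (simp add: sum.reindex[OF assms(4)])
  also have "\<dots> \<le> (\<Sum>k. r ^ k)" by (rule sum_le_suminf) (use assms in \<open>auto intro: summable_geometric\<close>)
  also have "\<dots> = 1 / (1 - r)" using assms by (simp add: suminf_geometric)
  finally show ?thesis .
qed

text \<open>With truncated subtraction \<open>(i - j) + (j - i)\<close> is the distance of i and j;
  each distance occurs at most once on either side of i.\<close>

lemma sum_geometric_dist_le:
  fixes r :: real
  assumes r: "0 < r" "r < 1" and A: "finite A"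
  shows "(\<Sum>j\<in>A. r ^ ((i - j) + (j - i))) \<le> 2 / (1 - r)"
proof -
  have "(\<Sum>j\<in>A. r ^ ((i - j) + (j - i))) = (\<Sum>j\<in>A \<inter> {..i}. r ^ ((i - j) + (j - i))) + (\<Sum>j\<in>A \<inter> {i<..}. r ^ ((i - j) + (j - i)))"
    by (subst sum.union_disjoint[symmetric]) (use A in \<open>auto intro!: sum.cong\<close>)
  also have "(\<Sum>j\<in>A \<inter> {..i}. r ^ ((i - j) + (j - i))) = (\<Sum>j\<in>A \<inter> {..i}. r ^ (i - j))" by (rule sum.cong) auto
  also have "\<dots> \<le> 1 / (1 - r)" by (rule sum_geometric_inj_le) (use r A in \<open>auto simp: inj_on_def\<close>)
  also have "(\<Sum>j\<in>A \<inter> {i<..}. r ^ ((i - j) + (j - i))) = (\<Sum>j\<in>A \<inter> {i<..}. r ^ (j - i))" by (rule sum.cong) auto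
  also have "\<dots> \<le> 1 / (1 - r)" by (rule sum_geometric_inj_le) (use r A in \<open>auto simp: inj_on_def\<close>)
  finally show ?thesis by simp
qed

text \<open>Comparison with the largest summand. The bound is crude in the number of terms, but it
  serves blocks of logarithmic length and sums with a fixed number of terms.\<close>

lemma abs_sum_powr_le:
  fixes x :: "'i \<Rightarrow> real"
  assumes "finite A" "q > 0"
  shows "\<bar>\<Sum>i\<in>A. x i\<bar> powr q \<le> real (card A) powr q * (\<Sum>i\<in>A. \<bar>x i\<bar> powr q)"
proof (cases "A = {}")
  case False
  define m where "m = Max ((\<lambda>i. \<bar>x i\<bar>) ` A)"
  have "m \<in> (\<lambda>i. \<bar>x i\<bar>) ` A" unfolding m_def using assms False by (intro Max_in) auto
  then obtain j where j: "j \<in> A" "m = \<bar>x j\<bar>" by auto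
  have "\<bar>\<Sum>i\<in>A. x i\<bar> \<le> (\<Sum>i\<in>A. \<bar>x i\<bar>)" by (rule sum_abs)
  also have "\<dots> \<le> (\<Sum>i\<in>A. m)" unfolding m_def by (intro sum_mono Max_ge) (use assms in auto)
  finally have "\<bar>\<Sum>i\<in>A. x i\<bar> \<le> card A * m" by simp
  then have "\<bar>\<Sum>i\<in>A. x i\<bar> powr q \<le> (card A * m) powr q" using assms by (intro powr_mono2) auto
  also have "\<dots> = real (card A) powr q * \<bar>x j\<bar> powr q" using j by (simp add: powr_mult)
  also have "\<dots> \<le> real (card A) powr q * (\<Sum>i\<in>A. \<bar>x i\<bar> powr q)"
    by (intro mult_left_mono member_le_sum) (use assms j in auto)
  finally show ?thesis .
qed simp

text \<open>Interpolates between the cubic Taylor error, used for |x| at most 1, and the quadratic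
  one beyond, because only moments of an order between 2 and 3 are at hand.\<close>

lemma iexp_approx_powr:
  assumes "2 \<le> q" "q \<le> 3"
  shows "cmod (iexp x - (1 + \<i> * x - x^2 / 2)) \<le> \<bar>x\<bar> powr q"
proof -
  have s: "(\<Sum>k\<le>2. (\<i> * complex_of_real x)^k / fact k) = 1 + \<i> * x - x^2 / 2"
    by (simp add: eval_nat_numeral power_mult_distrib)
  have 1: "cmod (iexp x - (1 + \<i> * x - x^2 / 2)) \<le> \<bar>x\<bar>^3 / 6"
    using iexp_approx1[of x 2] unfolding s by (simp add: eval_nat_numeral)
  have 2: "cmod (iexp x - (1 + \<i> * x - x^2 / 2)) \<le> \<bar>x\<bar>^2"
    using iexp_approx2[of x 2] unfolding s by (simp add: eval_nat_numeral)
  show ?thesis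
  proof (cases "x = 0")
    case True then show ?thesis using 2 by simp
  next
    case x: False
    show ?thesis
    proof (cases "\<bar>x\<bar> \<le> 1")
      case True
      have "\<bar>x\<bar>^3 / 6 \<le> \<bar>x\<bar>^3" by simp
      also have "\<dots> = \<bar>x\<bar> powr 3" using x by (subst powr_numeral) auto
      also have "\<dots> \<le> \<bar>x\<bar> powr q" using True x assms by (intro powr_mono') auto
      finally show ?thesis using 1 by linarith
    next
      case False
      have "\<bar>x\<bar>^2 = \<bar>x\<bar> powr 2" using x by (subst powr_numeral) auto
      also have "\<dots> \<le> \<bar>x\<bar> powr q" using False assms by (intro powr_mono) auto
      finally show ?thesis using 2 by linarith
    qed
  qed
qed

lemma cmod_iexp_diff_le: "cmod (iexp a - iexp b) \<le> \<bar>a - b\<bar>"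
proof -
  have "iexp a = iexp b * iexp (a - b)"
    unfolding exp_add[symmetric] by (simp add: algebra_simps)
  then have "iexp a - iexp b = iexp b * (iexp (a - b) - 1)" by (simp add: algebra_simps)
  then have "cmod (iexp a - iexp b) = cmod (iexp (a - b) - 1)" by (simp add: norm_mult)
  also have "\<dots> \<le> \<bar>a - b\<bar>" using iexp_approx1[of "a - b" 0] by simp
  finally show ?thesis .
qed

lemma exp_minus_approx: "0 \<le> x \<Longrightarrow> \<bar>exp (- x) - (1 - x)\<bar> \<le> (x::real)^2"
proof -
  assume x: "0 \<le> x"
  have 1: "1 - x \<le> exp (- x)" using exp_ge_add_one_self[of "-x"] by simp
  have "(1 + x) * exp (- x) \<le> exp x * exp (- x)" by (intro mult_right_mono) auto
  then have "(1 + x) * exp (- x) \<le> 1" by (simp add: exp_minus_inverse)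
  then have "exp (- x) \<le> 1 / (1 + x)" using x by (simp add: field_simps)
  also have "\<dots> \<le> 1 - x + x^2" using x by (simp add: field_simps power2_eq_square)
  finally show ?thesis using 1 by simp
qed

text \<open>The variance of |Y| is nonnegative.\<close>

lemma (in prob_space) expectation_abs_le_sqrt:
  assumes "Y \<in> borel_measurable M" "integrable M (\<lambda>x. (Y x)^2 :: real)"
  shows "integrable M Y" "expectation (\<lambda>x. \<bar>Y x\<bar>) \<le> sqrt (expectation (\<lambda>x. (Y x)^2))"
proof -
  show i: "integrable M Y"
    by (rule Bochner_Integration.integrable_bound[of _ "\<lambda>x. 1 + (Y x)^2"]) (use assms abs_mult_le_squares[of "Y _" 1] in \<open>auto simp: add.commute\<close>)
  have "0 \<le> variance (\<lambda>x. \<bar>Y x\<bar>)" by (rule variance_positive)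
  also have "\<dots> = expectation (\<lambda>x. (Y x)^2) - (expectation (\<lambda>x. \<bar>Y x\<bar>))^2"
    using variance_eq[of "\<lambda>x. \<bar>Y x\<bar>"] i assms by simp
  finally show "expectation (\<lambda>x. \<bar>Y x\<bar>) \<le> sqrt (expectation (\<lambda>x. (Y x)^2))"
    by (intro real_le_rsqrt) simp
qed

text \<open>The cap q at most 3 is what \<open>iexp_approx_powr\<close> relies on, and it makes the
  powers of log n in the limit arguments independent of q.\<close>

locale mixing_fun = mixing_seq +
  fixes u :: "real \<Rightarrow> real" and q :: real
  assumes u[measurable]: "u \<in> borel_measurable borel" and q: "2 < q" "q \<le> 3"
    and uq: "integrable M (\<lambda>\<omega>. \<bar>u (X 1 \<omega>)\<bar> powr q)" and u0: "(\<integral>\<omega>. u (X 1 \<omega>) \<partial>M) = 0"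
begin

definition "Dq = (\<integral>\<omega>. \<bar>u (X 1 \<omega>)\<bar> powr q \<partial>M)"
definition "Kc = 4 * Cb + 4 * Dq"
definition "r0 = rho (q / 2)"
definition "cv k = (\<integral>\<omega>. u (X 1 \<omega>) * u (X (1 + k) \<omega>) \<partial>M)" for k
definition "SA A \<omega> = (\<Sum>i\<in>A. u (X i \<omega>))" for A \<omega>
definition "Cv = Kc * (2 / (1 - r0))"
text \<open>\<open>vv\<close> is the long-run variance. \<open>Cw\<close> bounds the distance of the
  variance of a block sum from its length times \<open>vv\<close>, independently of the length: a
  double geometric sum, over the tail of the covariance series and over the steps of the
  block.\<close>

definition "vv = cv 0 + 2 * (\<Sum>k. cv (k + 1))"
definition "Cw = 2 * Kc / (1 - r0) * (1 / (1 - r0))"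

lemma Dq: "Dq \<ge> 0" by (simp add: Dq_def)
lemma Kc: "Kc > 0" using Cb Dq by (simp add: Kc_def)
lemma r0: "0 < r0" "r0 < 1" using rho[of "q/2"] q by (auto simp: r0_def)
lemma Cv: "Cv > 0" using Kc r0 by (simp add: Cv_def)
lemma Cw: "Cw > 0" using Kc r0 by (simp add: Cw_def)

lemma SA_meas[measurable]: "SA A \<in> borel_measurable M" unfolding SA_def by measurable

lemma SA_gs: "A \<subseteq> I \<Longrightarrow> SA A \<in> borel_measurable (gs I)"
  unfolding SA_def by (intro borel_measurable_sum measurable_compose[OF X_gs u]) auto

lemma u_q: assumes "i \<ge> 1" shows "integrable M (\<lambda>\<omega>. \<bar>u (X i \<omega>)\<bar> powr q)" "(\<integral>\<omega>. \<bar>u (X i \<omega>)\<bar> powr q \<partial>M) = Dq"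
  using stat_one_expect[OF assms, of "\<lambda>x. \<bar>u x\<bar> powr q"] uq by (auto simp: Dq_def)

lemma u_int: assumes "i \<ge> 1" shows "integrable M (\<lambda>\<omega>. u (X i \<omega>))" "(\<integral>\<omega>. u (X i \<omega>) \<partial>M) = 0" "integrable M (\<lambda>\<omega>. (u (X i \<omega>))^2)"
proof -
  show "integrable M (\<lambda>\<omega>. u (X i \<omega>))" by (rule integrable_of_powr[OF _ u_q(1)[OF assms]]) (use q in auto)
  show "integrable M (\<lambda>\<omega>. (u (X i \<omega>))^2)" by (rule integrable_square_of_powr[OF _ u_q(1)[OF assms]]) (use q in auto)
  show "(\<integral>\<omega>. u (X i \<omega>) \<partial>M) = 0" using stat_one_expect(2)[OF assms u] u0 by simp
qed

lemma uu_int: assumes "i \<ge> 1" "j \<ge> 1" shows "integrable M (\<lambda>\<omega>. u (X i \<omega>) * u (X j \<omega>))"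
  by (rule integrable_mult_of_squares) (use u_int(3) assms in auto)

lemma cv_pair: "i \<ge> 1 \<Longrightarrow> (\<integral>\<omega>. u (X i \<omega>) * u (X (i + k) \<omega>) \<partial>M) = cv k"
  unfolding cv_def by (rule stat_two) auto

lemma cv_dist: assumes "i \<ge> 1" "j \<ge> 1" shows "(\<integral>\<omega>. u (X i \<omega>) * u (X j \<omega>) \<partial>M) = cv ((i - j) + (j - i))"
proof (cases "i \<le> j")
  case True then show ?thesis using cv_pair[of i "j - i"] assms by simp
next
  case False then show ?thesis using cv_pair[of j "i - j"] assms by (simp add: mult.commute)
qed

lemma cv_bound: "\<bar>cv k\<bar> \<le> Kc * r0 ^ k"
proof -
  have "\<bar>(\<integral>\<omega>. u (X 1 \<omega>) * u (X (1 + k) \<omega>) \<partial>M) - (\<integral>\<omega>. u (X 1 \<omega>) \<partial>M) * (\<integral>\<omega>. u (X (1 + k) \<omega>) \<partial>M)\<bar> \<le> (4 * Cb + 4 * Dq) * rho (q/2) ^ k"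
  proof (rule cov_decay)
    show "(\<lambda>\<omega>. u (X 1 \<omega>)) \<in> borel_measurable (gs {1..1})" "(\<lambda>\<omega>. u (X (1 + k) \<omega>)) \<in> borel_measurable (gs {1 + k..})"
      by (auto intro!: measurable_compose[OF X_gs u])
  qed (use q u_q[of 1] u_q[of "1 + k"] in auto)
  then show ?thesis using u0 by (simp add: cv_def Kc_def r0_def)
qed

lemma cv_summable: "summable (\<lambda>k. cv (k + 1))" "summable (\<lambda>k. cv k)"
proof -
  show "summable (\<lambda>k. cv k)"
    by (rule summable_comparison_test'[of "\<lambda>k. Kc * r0 ^ k" 0]) (use cv_bound r0 in \<open>auto intro!: summable_mult summable_geometric\<close>)
  then show "summable (\<lambda>k. cv (k + 1))" using summable_ignore_initial_segment[of "\<lambda>k. cv k" 1] by simp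
qed

lemma SA_square: assumes "A \<subseteq> {1..}" "finite A"
  shows "integrable M (\<lambda>\<omega>. (SA A \<omega>)^2)" "(\<integral>\<omega>. (SA A \<omega>)^2 \<partial>M) = (\<Sum>i\<in>A. \<Sum>j\<in>A. cv ((i - j) + (j - i)))"
    "integrable M (SA A)" "(\<integral>\<omega>. SA A \<omega> \<partial>M) = 0"
proof -
  have e: "(SA A \<omega>)^2 = (\<Sum>i\<in>A. \<Sum>j\<in>A. u (X i \<omega>) * u (X j \<omega>))" for \<omega>
    by (simp add: SA_def power2_eq_square sum_product)
  have i1: "i \<ge> 1" if "i \<in> A" for i using assms that by auto
  show "integrable M (\<lambda>\<omega>. (SA A \<omega>)^2)" unfolding e using uu_int i1 by (intro Bochner_Integration.integrable_sum) auto
  show "(\<integral>\<omega>. (SA A \<omega>)^2 \<partial>M) = (\<Sum>i\<in>A. \<Sum>j\<in>A. cv ((i - j) + (j - i)))" unfolding e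
    using i1 by (simp add: Bochner_Integration.integral_sum uu_int cv_dist Bochner_Integration.integrable_sum)
  show "integrable M (SA A)" unfolding SA_def using u_int i1 by (intro Bochner_Integration.integrable_sum) auto
  show "(\<integral>\<omega>. SA A \<omega> \<partial>M) = 0" unfolding SA_def using i1 by (simp add: Bochner_Integration.integral_sum u_int)
qed

text \<open>Covariances decay geometrically in the distance, so each row of the double sum is
  bounded. Arbitrary finite index sets are allowed since the leftover of a block decomposition is
  not an interval.\<close>

lemma SA_var_le: assumes "A \<subseteq> {1..}" "finite A"
  shows "(\<integral>\<omega>. (SA A \<omega>)^2 \<partial>M) \<le> Cv * card A"
proof -
  have "(\<integral>\<omega>. (SA A \<omega>)^2 \<partial>M) \<le> (\<Sum>i\<in>A. \<Sum>j\<in>A. Kc * r0 ^ ((i - j) + (j - i)))"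
    unfolding SA_square(2)[OF assms] using cv_bound by (intro sum_mono) (meson abs_ge_self order_trans)
  also have "\<dots> = (\<Sum>i\<in>A. Kc * (\<Sum>j\<in>A. r0 ^ ((i - j) + (j - i))))" by (simp add: sum_distrib_left)
  also have "\<dots> \<le> (\<Sum>i\<in>A. Cv)" unfolding Cv_def
    by (intro sum_mono mult_left_mono sum_geometric_dist_le) (use r0 Kc assms in auto)
  finally show ?thesis by (simp add: mult.commute)
qed

text \<open>Adding one observation raises the variance by \<open>cv 0\<close> plus twice the first N
  covariances, which misses \<open>vv\<close> by twice the tail of the series. The tails are
  geometric, so the errors stay summable over all steps.\<close>

lemma var_growth: "\<bar>(\<integral>\<omega>. (SA {a<..a+N} \<omega>)^2 \<partial>M) - N * vv\<bar> \<le> Cw"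
proof -
  have step: "\<bar>(\<integral>\<omega>. (SA {a<..a+Suc N} \<omega>)^2 \<partial>M) - (\<integral>\<omega>. (SA {a<..a+N} \<omega>)^2 \<partial>M) - vv\<bar> \<le> 2 * Kc / (1 - r0) * r0 ^ N" for N
  proof -
    have "{a<..a+Suc N} = insert (a + Suc N) {a<..a+N}" by auto
    then have "SA {a<..a+Suc N} \<omega> = u (X (a + Suc N) \<omega>) + SA {a<..a+N} \<omega>" for \<omega>
      by (simp add: SA_def)
    then have e: "(SA {a<..a+Suc N} \<omega>)^2 = (SA {a<..a+N} \<omega>)^2 + 2 * (\<Sum>i\<in>{a<..a+N}. u (X i \<omega>) * u (X (a + Suc N) \<omega>)) + (u (X (a + Suc N) \<omega>))^2" for \<omega>
      by (simp add: power2_sum SA_def sum_distrib_left sum_distrib_right mult_ac)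
    have ii: "integrable M (\<lambda>\<omega>. \<Sum>i\<in>{a<..a+N}. u (X i \<omega>) * u (X (a + Suc N) \<omega>))"
      by (intro Bochner_Integration.integrable_sum uu_int) auto
    have "(\<integral>\<omega>. (SA {a<..a+Suc N} \<omega>)^2 \<partial>M) = (\<integral>\<omega>. (SA {a<..a+N} \<omega>)^2 \<partial>M) + 2 * (\<integral>\<omega>. (\<Sum>i\<in>{a<..a+N}. u (X i \<omega>) * u (X (a + Suc N) \<omega>)) \<partial>M) + (\<integral>\<omega>. (u (X (a + Suc N) \<omega>))^2 \<partial>M)"
      unfolding e using ii SA_square(1)[of "{a<..a+N}"] u_int(3)[of "a + Suc N"] by (simp add: subset_eq)
    also have "(\<integral>\<omega>. (\<Sum>i\<in>{a<..a+N}. u (X i \<omega>) * u (X (a + Suc N) \<omega>)) \<partial>M) = (\<Sum>i\<in>{a<..a+N}. cv (a + Suc N - i))"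
      by (subst Bochner_Integration.integral_sum) (auto intro!: uu_int sum.cong simp: cv_dist)
    also have "\<dots> = (\<Sum>k<N. cv (k + 1))"
      by (rule sum.reindex_bij_witness[of _ "\<lambda>k. a + N - k" "\<lambda>i. a + N - i"]) (auto intro!: arg_cong[of _ _ cv])
    also have "(\<integral>\<omega>. (u (X (a + Suc N) \<omega>))^2 \<partial>M) = cv 0"
      using cv_dist[of "a + Suc N" "a + Suc N"] by (simp add: power2_eq_square)
    finally have 1: "(\<integral>\<omega>. (SA {a<..a+Suc N} \<omega>)^2 \<partial>M) - (\<integral>\<omega>. (SA {a<..a+N} \<omega>)^2 \<partial>M) - vv = - 2 * (\<Sum>k. cv (k + N + 1))"
      using suminf_split_initial_segment[OF cv_summable(1), of N] by (simp add: vv_def)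
    have sm: "summable (\<lambda>k. Kc * r0 ^ N * r0 ^ k)" using r0 by (intro summable_mult summable_geometric) auto
    have le: "norm (cv (k + N + 1)) \<le> Kc * r0 ^ N * r0 ^ k" for k
    proof -
      have "r0 ^ (k + N + 1) \<le> r0 ^ (N + k)" using r0 by (intro power_decreasing) auto
      then have "Kc * r0 ^ (k + N + 1) \<le> Kc * r0 ^ (N + k)" using Kc by (intro mult_left_mono) auto
      then show ?thesis using cv_bound[of "k + N + 1"] unfolding power_add by (simp add: mult_ac)
    qed
    have "\<bar>\<Sum>k. cv (k + N + 1)\<bar> \<le> (\<Sum>k. Kc * r0 ^ N * r0 ^ k)"
      using norm_suminf_le[OF le sm] by simp
    also have "\<dots> = Kc * r0 ^ N * (1 / (1 - r0))" using r0 by (subst suminf_mult) (auto simp: suminf_geometric)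
    finally show ?thesis unfolding 1 abs_mult by (simp add: field_simps)
  qed
  have "\<bar>(\<integral>\<omega>. (SA {a<..a+N} \<omega>)^2 \<partial>M) - N * vv\<bar> \<le> (\<Sum>k<N. 2 * Kc / (1 - r0) * r0 ^ k)"
  proof (induction N)
    case 0 then show ?case by (simp add: SA_def)
  next
    case (Suc N)
    then show ?case using step[of N] by (simp add: algebra_simps)
  qed
  also have "\<dots> = 2 * Kc / (1 - r0) * (\<Sum>k<N. r0 ^ k)" by (simp add: sum_distrib_left)
  also have "\<dots> \<le> Cw" unfolding Cw_def using sum_geometric_inj_le[OF r0, of "{..<N}" id] Kc r0 by (intro mult_left_mono) auto
  finally show ?thesis .
qed

text \<open>A negative \<open>vv\<close> would drive the variances of long blocks, which stay within
  \<open>Cw\<close> of \<open>N * vv\<close>, below zero.\<close>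

lemma vv_nonneg: "vv \<ge> 0"
proof (rule ccontr)
  assume "\<not> 0 \<le> vv"
  then obtain N :: nat where N: "N * (- vv) > Cw" using ex_less_of_nat_mult[of "- vv" Cw] by auto
  have "(\<integral>\<omega>. (SA {0<..0+N} \<omega>)^2 \<partial>M) \<ge> 0" by simp
  moreover have "Cw < - (N * vv)" using N by simp
  ultimately show False using var_growth[of 0 N] by linarith
qed

lemma SA_q: assumes "A \<subseteq> {1..}" "finite A"
  shows "integrable M (\<lambda>\<omega>. \<bar>SA A \<omega>\<bar> powr q)" "(\<integral>\<omega>. \<bar>SA A \<omega>\<bar> powr q \<partial>M) \<le> card A powr q * (card A * Dq)"
proof -
  have i1: "i \<ge> 1" if "i \<in> A" for i using assms that by auto
  have le: "\<bar>SA A \<omega>\<bar> powr q \<le> card A powr q * (\<Sum>i\<in>A. \<bar>u (X i \<omega>)\<bar> powr q)" for \<omega>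
    unfolding SA_def by (rule abs_sum_powr_le) (use assms q in auto)
  have i: "integrable M (\<lambda>\<omega>. card A powr q * (\<Sum>i\<in>A. \<bar>u (X i \<omega>)\<bar> powr q))"
    using u_q i1 by (intro integrable_mult_right Bochner_Integration.integrable_sum) auto
  show i2: "integrable M (\<lambda>\<omega>. \<bar>SA A \<omega>\<bar> powr q)"
    by (rule Bochner_Integration.integrable_bound[OF i]) (use le in \<open>auto simp: abs_of_nonneg sum_nonneg\<close>)
  have "(\<integral>\<omega>. \<bar>SA A \<omega>\<bar> powr q \<partial>M) \<le> (\<integral>\<omega>. card A powr q * (\<Sum>i\<in>A. \<bar>u (X i \<omega>)\<bar> powr q) \<partial>M)"
    by (rule integral_mono[OF i2 i le])
  also have "\<dots> = card A powr q * (card A * Dq)"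
    using u_q i1 by (simp add: Bochner_Integration.integral_sum)
  finally show "(\<integral>\<omega>. \<bar>SA A \<omega>\<bar> powr q \<partial>M) \<le> card A powr q * (card A * Dq)" .
qed

section \<open>Characteristic functions of blocks\<close>

lemma SA_char_block: assumes "A \<subseteq> {1..}" "finite A"
  shows "cmod ((\<integral>\<omega>. iexp (s * SA A \<omega>) \<partial>M) - (1 - s^2 / 2 * (\<integral>\<omega>. (SA A \<omega>)^2 \<partial>M))) \<le> \<bar>s\<bar> powr q * (card A powr q * (card A * Dq))"
proof -
  note sq = SA_square[OF assms]
  let ?Y = "\<lambda>\<omega>. s * SA A \<omega>"
  have i1: "integrable M (\<lambda>\<omega>. iexp (?Y \<omega>))" by (rule integrable_const_bound[of _ 1]) auto
  have i2: "integrable M (\<lambda>\<omega>. complex_of_real (?Y \<omega>))" using sq(3) by (intro integrable_of_real) simp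
  have i3: "integrable M (\<lambda>\<omega>. complex_of_real ((?Y \<omega>)^2 / 2))" using sq(1) by (intro integrable_of_real) (simp add: power_mult_distrib)
  have i4: "integrable M (\<lambda>\<omega>. 1 + \<i> * complex_of_real (?Y \<omega>) - complex_of_real ((?Y \<omega>)^2 / 2))"
    using i2 i3 by (intro Bochner_Integration.integrable_diff Bochner_Integration.integrable_add integrable_mult_right) auto
  have e: "(\<integral>\<omega>. 1 + \<i> * complex_of_real (?Y \<omega>) - complex_of_real ((?Y \<omega>)^2 / 2) \<partial>M) = complex_of_real (1 - s^2 / 2 * (\<integral>\<omega>. (SA A \<omega>)^2 \<partial>M))"
  proof -
    have "(\<integral>\<omega>. 1 + \<i> * complex_of_real (?Y \<omega>) - complex_of_real ((?Y \<omega>)^2 / 2) \<partial>M) = 1 + \<i> * (\<integral>\<omega>. complex_of_real (?Y \<omega>) \<partial>M) - (\<integral>\<omega>. complex_of_real ((?Y \<omega>)^2 / 2) \<partial>M)"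
      using i2 i3 prob_space by (subst Bochner_Integration.integral_diff, intro Bochner_Integration.integrable_add integrable_mult_right, simp, simp, simp) (subst Bochner_Integration.integral_add, auto)
    also have "(\<integral>\<omega>. complex_of_real (?Y \<omega>) \<partial>M) = 0" unfolding integral_complex_of_real using sq(4) by simp
    also have "(\<integral>\<omega>. complex_of_real ((?Y \<omega>)^2 / 2) \<partial>M) = complex_of_real (s^2 / 2 * (\<integral>\<omega>. (SA A \<omega>)^2 \<partial>M))"
      unfolding integral_complex_of_real by (simp add: power_mult_distrib)
    finally show ?thesis by simp
  qed
  have "cmod ((\<integral>\<omega>. iexp (?Y \<omega>) \<partial>M) - complex_of_real (1 - s^2 / 2 * (\<integral>\<omega>. (SA A \<omega>)^2 \<partial>M))) = cmod (\<integral>\<omega>. iexp (?Y \<omega>) - (1 + \<i> * complex_of_real (?Y \<omega>) - complex_of_real ((?Y \<omega>)^2 / 2)) \<partial>M)"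
    using i1 i4 e by simp
  also have "\<dots> \<le> (\<integral>\<omega>. cmod (iexp (?Y \<omega>) - (1 + \<i> * complex_of_real (?Y \<omega>) - complex_of_real ((?Y \<omega>)^2 / 2))) \<partial>M)"
    by (rule integral_norm_bound)
  also have "\<dots> \<le> (\<integral>\<omega>. \<bar>s\<bar> powr q * \<bar>SA A \<omega>\<bar> powr q \<partial>M)"
  proof (rule integral_mono)
    fix \<omega>
    show "cmod (iexp (?Y \<omega>) - (1 + \<i> * complex_of_real (?Y \<omega>) - complex_of_real ((?Y \<omega>)^2 / 2))) \<le> \<bar>s\<bar> powr q * \<bar>SA A \<omega>\<bar> powr q"
      using iexp_approx_powr[of q "?Y \<omega>"] q by (simp add: abs_mult powr_mult)
  qed (use i1 i4 SA_q[OF assms] in auto)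
  also have "\<dots> \<le> \<bar>s\<bar> powr q * (card A powr q * (card A * Dq))"
    using SA_q[OF assms] by (simp add: mult_left_mono)
  finally show ?thesis by simp
qed

text \<open>The n indices are split into k blocks of length p, each followed by a gap of length g,
  and a rest. The three error terms come from deleting gaps and rest, from treating the blocks as
  independent, and from the expansion of the characteristic function of one block.\<close>

lemma clt_bound:
  assumes pg: "p \<ge> 1" "k * (p + g) \<le> n"
  shows "cmod ((\<integral>\<omega>. iexp (s * SA {0<..n} \<omega>) \<partial>M) - exp (- (s^2 * vv * p / 2) * k))
     \<le> \<bar>s\<bar> * sqrt (Cv * (real n - real k * real p)) + k * (8 * (Cb * \<tau> ^ g))
      + k * (\<bar>s\<bar> powr q * (p powr q * (p * Dq)) + s^2 / 2 * Cw + (s^2 * vv * p / 2)^2)"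
proof -
  define A where "A b = {b * (p + g)<..b * (p + g) + p}" for b
  have cA: "card (A b) = p" "finite (A b)" "A b \<subseteq> {1..}" for b by (auto simp: A_def)
  have step: "b * (p + g) + (p + g) \<le> b' * (p + g)" if "b < b'" for b b' :: nat
    using mult_le_mono1[of "Suc b" b' "p + g"] that by simp
  have disj: "A b \<inter> A b' = {}" if "b \<noteq> b'" for b b'
    using step[of b b'] step[of b' b] that unfolding A_def by (cases "b < b'") auto
  have An: "A b \<subseteq> {0<..n}" if "b < k" for b
    using step[OF that] pg unfolding A_def by auto
  define BB where "BB = (\<Union>b<k. A b)"
  \<comment> \<open>The deleted indices: gaps and rest. Their sum enters through its L1 norm, since
    x to e^(ix) is 1-Lipschitz.\<close>
  define R where "R = {0<..n} - BB"
  have cB: "card BB = k * p" unfolding BB_def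
    by (subst card_UN_disjoint) (use cA disj in auto)
  have BBn: "BB \<subseteq> {0<..n}" unfolding BB_def using An by blast
  have fB: "finite BB" unfolding BB_def using cA by auto
  have cR: "card R = n - k * p" unfolding R_def using card_Diff_subset[OF fB BBn] cB by simp
  have kp: "k * p \<le> n" using pg by (simp add: add_mult_distrib2)
  have R1: "R \<subseteq> {1..}" "finite R" by (auto simp: R_def)
  have sp: "SA {0<..n} \<omega> = SA BB \<omega> + SA R \<omega>" for \<omega>
    unfolding SA_def R_def by (subst sum.subset_diff[OF BBn]) auto
  have sB: "SA BB \<omega> = (\<Sum>b<k. SA (A b) \<omega>)" for \<omega>
    unfolding SA_def BB_def by (rule sum.UNION_disjoint) (use cA disj in auto)
  have meas: "(\<lambda>\<omega>. iexp (s * SA B \<omega>)) \<in> borel_measurable (gs I)" if "B \<subseteq> I" for B I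
    using SA_gs[OF that] by measurable
  have ii: "integrable M (\<lambda>\<omega>. iexp (s * SA B \<omega>))" for B by (rule integrable_const_bound[of _ 1]) auto
  have 1: "cmod ((\<integral>\<omega>. iexp (s * SA {0<..n} \<omega>) \<partial>M) - (\<integral>\<omega>. iexp (s * SA BB \<omega>) \<partial>M)) \<le> \<bar>s\<bar> * sqrt (Cv * (real n - real k * real p))"
  proof -
    have "cmod ((\<integral>\<omega>. iexp (s * SA {0<..n} \<omega>) \<partial>M) - (\<integral>\<omega>. iexp (s * SA BB \<omega>) \<partial>M)) = cmod (\<integral>\<omega>. iexp (s * SA {0<..n} \<omega>) - iexp (s * SA BB \<omega>) \<partial>M)"
      using ii by simp
    also have "\<dots> \<le> (\<integral>\<omega>. cmod (iexp (s * SA {0<..n} \<omega>) - iexp (s * SA BB \<omega>)) \<partial>M)" by (rule integral_norm_bound)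
    also have "\<dots> \<le> (\<integral>\<omega>. \<bar>s\<bar> * \<bar>SA R \<omega>\<bar> \<partial>M)"
    proof (rule integral_mono)
      fix \<omega> show "cmod (iexp (s * SA {0<..n} \<omega>) - iexp (s * SA BB \<omega>)) \<le> \<bar>s\<bar> * \<bar>SA R \<omega>\<bar>"
        using cmod_iexp_diff_le[of "s * SA {0<..n} \<omega>" "s * SA BB \<omega>"] by (simp add: sp right_diff_distrib[symmetric] abs_mult)
    qed (use ii SA_square(3)[OF R1] in auto)
    also have "\<dots> = \<bar>s\<bar> * (\<integral>\<omega>. \<bar>SA R \<omega>\<bar> \<partial>M)" by simp
    also have "\<dots> \<le> \<bar>s\<bar> * sqrt (Cv * (real n - real k * real p))"
    proof (rule mult_left_mono)
      have "(\<integral>\<omega>. \<bar>SA R \<omega>\<bar> \<partial>M) \<le> sqrt (\<integral>\<omega>. (SA R \<omega>)^2 \<partial>M)"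
        by (rule expectation_abs_le_sqrt) (use SA_square(1)[OF R1] in auto)
      also have "\<dots> \<le> sqrt (Cv * card R)" using SA_var_le[OF R1] by simp
      also have "real (card R) = real n - real k * real p" unfolding cR using kp by (simp add: of_nat_diff)
      finally show "(\<integral>\<omega>. \<bar>SA R \<omega>\<bar> \<partial>M) \<le> sqrt (Cv * (real n - real k * real p))" .
    qed simp
    finally show ?thesis .
  qed
  have "(\<integral>\<omega>. iexp (s * SA BB \<omega>) \<partial>M) = (\<integral>\<omega>. (\<Prod>b<k. iexp (s * SA (A b) \<omega>)) \<partial>M)"
    unfolding sB by (simp add: sum_distrib_left exp_sum)
  moreover have "cmod ((\<integral>\<omega>. (\<Prod>b<k. iexp (s * SA (A b) \<omega>)) \<partial>M) - (\<Prod>b<k. \<integral>\<omega>. iexp (s * SA (A b) \<omega>) \<partial>M)) \<le> k * (8 * (Cb * \<tau> ^ g))"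
  proof (rule factorize_complex[where l = "\<lambda>b. b * (p + g) + 1" and r = "\<lambda>b. b * (p + g) + p"])
    fix b show "(\<lambda>\<omega>. iexp (s * SA (A b) \<omega>)) \<in> borel_measurable (gs {b * (p + g) + 1..b * (p + g) + p})"
      by (rule meas) (auto simp: A_def)
  qed (use pg in auto)
  ultimately have 2: "cmod ((\<integral>\<omega>. iexp (s * SA BB \<omega>) \<partial>M) - (\<Prod>b<k. \<integral>\<omega>. iexp (s * SA (A b) \<omega>) \<partial>M)) \<le> k * (8 * (Cb * \<tau> ^ g))"
    by simp
  let ?x = "s^2 * vv * p / 2"
  have x0: "?x \<ge> 0" using vv_nonneg by simp
  \<comment> \<open>Both products have factors of modulus at most 1, so their distance is at most
    the sum of the distances of the factors.\<close>
  have 3: "cmod ((\<Prod>b<k. \<integral>\<omega>. iexp (s * SA (A b) \<omega>) \<partial>M) - (\<Prod>b<k. complex_of_real (exp (- ?x)))) \<le> (\<Sum>b<k. \<bar>s\<bar> powr q * (p powr q * (p * Dq)) + s^2 / 2 * Cw + ?x^2)"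
  proof (rule order_trans[OF norm_prod_diff sum_mono])
    fix b
    show "cmod (\<integral>\<omega>. iexp (s * SA (A b) \<omega>) \<partial>M) \<le> 1"
      by (rule order_trans[OF integral_norm_bound]) (simp add: prob_space)
    show "cmod (complex_of_real (exp (- ?x))) \<le> 1" using x0 by simp
    have a: "cmod ((\<integral>\<omega>. iexp (s * SA (A b) \<omega>) \<partial>M) - (1 - s^2 / 2 * (\<integral>\<omega>. (SA (A b) \<omega>)^2 \<partial>M))) \<le> \<bar>s\<bar> powr q * (p powr q * (p * Dq))"
      using SA_char_block[OF cA(3,2)[of b], of s] cA by simp
    have "\<bar>s^2 / 2 * (\<integral>\<omega>. (SA (A b) \<omega>)^2 \<partial>M) - ?x\<bar> = s^2 / 2 * \<bar>(\<integral>\<omega>. (SA (A b) \<omega>)^2 \<partial>M) - p * vv\<bar>"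
    proof -
      have "s^2 / 2 * (\<integral>\<omega>. (SA (A b) \<omega>)^2 \<partial>M) - ?x = s^2 / 2 * ((\<integral>\<omega>. (SA (A b) \<omega>)^2 \<partial>M) - p * vv)"
        by (simp add: algebra_simps)
      then show ?thesis by (simp only: abs_mult) simp
    qed
    also have "\<dots> \<le> s^2 / 2 * Cw" using var_growth[of "b * (p + g)" p] unfolding A_def by (intro mult_left_mono) auto
    finally have b: "\<bar>(1 - s^2 / 2 * (\<integral>\<omega>. (SA (A b) \<omega>)^2 \<partial>M)) - exp (- ?x)\<bar> \<le> s^2 / 2 * Cw + ?x^2"
      using exp_minus_approx[OF x0] by linarith
    have "cmod ((\<integral>\<omega>. iexp (s * SA (A b) \<omega>) \<partial>M) - complex_of_real (exp (- ?x))) \<le> cmod ((\<integral>\<omega>. iexp (s * SA (A b) \<omega>) \<partial>M) - (1 - s^2 / 2 * (\<integral>\<omega>. (SA (A b) \<omega>)^2 \<partial>M))) + cmod (complex_of_real ((1 - s^2 / 2 * (\<integral>\<omega>. (SA (A b) \<omega>)^2 \<partial>M)) - exp (- ?x)))"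
      using norm_triangle_ineq[of "(\<integral>\<omega>. iexp (s * SA (A b) \<omega>) \<partial>M) - (1 - s^2 / 2 * (\<integral>\<omega>. (SA (A b) \<omega>)^2 \<partial>M))" "complex_of_real ((1 - s^2 / 2 * (\<integral>\<omega>. (SA (A b) \<omega>)^2 \<partial>M)) - exp (- ?x))"]
      by (simp add: algebra_simps)
    then show "cmod ((\<integral>\<omega>. iexp (s * SA (A b) \<omega>) \<partial>M) - complex_of_real (exp (- ?x))) \<le> \<bar>s\<bar> powr q * (p powr q * (p * Dq)) + s^2 / 2 * Cw + ?x^2"
      using a b unfolding norm_of_real by linarith
  qed
  have e: "(\<Prod>b<k. complex_of_real (exp (- ?x))) = complex_of_real (exp (- ?x * k))"
    by (simp add: exp_of_nat_mult[symmetric] mult.commute flip: of_real_power)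
  have "cmod ((\<integral>\<omega>. iexp (s * SA {0<..n} \<omega>) \<partial>M) - complex_of_real (exp (- ?x * k))) \<le>
    cmod ((\<integral>\<omega>. iexp (s * SA {0<..n} \<omega>) \<partial>M) - (\<integral>\<omega>. iexp (s * SA BB \<omega>) \<partial>M))
    + cmod ((\<integral>\<omega>. iexp (s * SA BB \<omega>) \<partial>M) - (\<Prod>b<k. \<integral>\<omega>. iexp (s * SA (A b) \<omega>) \<partial>M))
    + cmod ((\<Prod>b<k. \<integral>\<omega>. iexp (s * SA (A b) \<omega>) \<partial>M) - complex_of_real (exp (- ?x * k)))"
    using norm_triangle_ineq[of "(\<integral>\<omega>. iexp (s * SA {0<..n} \<omega>) \<partial>M) - (\<integral>\<omega>. iexp (s * SA BB \<omega>) \<partial>M)" "(\<integral>\<omega>. iexp (s * SA BB \<omega>) \<partial>M) - (\<Prod>b<k. \<integral>\<omega>. iexp (s * SA (A b) \<omega>) \<partial>M)"]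
     norm_triangle_ineq[of "((\<integral>\<omega>. iexp (s * SA {0<..n} \<omega>) \<partial>M) - (\<integral>\<omega>. iexp (s * SA BB \<omega>) \<partial>M)) + ((\<integral>\<omega>. iexp (s * SA BB \<omega>) \<partial>M) - (\<Prod>b<k. \<integral>\<omega>. iexp (s * SA (A b) \<omega>) \<partial>M))" "(\<Prod>b<k. \<integral>\<omega>. iexp (s * SA (A b) \<omega>) \<partial>M) - complex_of_real (exp (- ?x * k))"]
    by (simp add: algebra_simps)
  then show ?thesis using 1 2 3 unfolding e by simp
qed

theorem clt: "(\<lambda>n. \<integral>\<omega>. iexp (t / sqrt (real n) * SA {0<..n} \<omega>) \<partial>M) \<longlonglongrightarrow> exp (- (t^2 * vv / 2))"
proof -
  \<comment> \<open>Blocks of length L^3 and gaps of length L^2 with L about log n. Then n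
    \<tau>^(L^2) vanishes whatever \<tau> is, the gaps take a fraction of about 1/L of the indices,
    the variance error \<open>Cw\<close> per block contributes about 1/L^3, and the q-th moments of
    the blocks only add powers of log n to n^(1-q/2).\<close>
  define L where "L n = nat \<lfloor>ln (real n)\<rfloor>" for n :: nat
  define p where "p n = L n ^ 3" for n
  define g where "g n = L n ^ 2" for n
  define k where "k n = n div (p n + g n)" for n
  define s where "s n = t / sqrt (real n)" for n :: nat
  \<comment> \<open>Bound for the proportion of deleted indices: the gaps, then the rest at the end,
    which is no longer than one block with its gap.\<close>
  define E1 where "E1 n = 1 / (ln (real n) - 1) + (ln (real n) ^ 3 + ln (real n) ^ 2) / n" for n :: nat
  have E1: "E1 \<longlonglongrightarrow> 0" unfolding E1_def by real_asymp
  have big: "\<forall>\<^sub>F n in sequentially. ln (real n) > 3"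
    by real_asymp
  define Bd where "Bd n = \<bar>t\<bar> * sqrt (Cv * E1 n) + 8 * Cb * (n * exp (ln \<tau> * (ln (real n) - 1)^2))
     + (\<bar>t\<bar> powr q * Dq * (real n powr (1 - q/2) * ln (real n) ^ 12) + t^2 / 2 * Cw * (1 / (ln (real n) - 1)^3) + (t^2 * vv / 2)^2 * (ln (real n)^3 / n))" for n :: nat
  have Bd0: "Bd \<longlonglongrightarrow> \<bar>t\<bar> * sqrt (Cv * 0) + 8 * Cb * 0 + (\<bar>t\<bar> powr q * Dq * 0 + t^2 / 2 * Cw * 0 + (t^2 * vv / 2)^2 * 0)"
  proof -
    have lt: "ln \<tau> < 0" using \<tau> by simp
    have "(\<lambda>n::nat. n * exp (ln \<tau> * (ln (real n) - 1)^2)) \<longlonglongrightarrow> 0" using lt by real_asymp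
    moreover have "(\<lambda>n::nat. 1 / (ln (real n) - 1)^3) \<longlonglongrightarrow> 0" by real_asymp
    moreover have "(\<lambda>n::nat. ln (real n)^3 / n) \<longlonglongrightarrow> 0" by real_asymp
    moreover have "(\<lambda>n::nat. real n powr (1 - q/2) * ln (real n) ^ 12) \<longlonglongrightarrow> 0"
    proof -
      have "1 - q/2 < 0" using q by simp
      then show ?thesis by real_asymp
    qed
    ultimately show ?thesis unfolding Bd_def by (intro tendsto_intros E1)
  qed
  \<comment> \<open>The Gaussian exponent carries the fraction k p / n of indices inside blocks;
    \<open>E1\<close> squeezes it to 1 afterwards.\<close>
  have main: "\<forall>\<^sub>F n in sequentially. cmod ((\<integral>\<omega>. iexp (s n * SA {0<..n} \<omega>) \<partial>M) - exp (- (t^2 * vv / 2 * (k n * p n / n)))) \<le> Bd n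
     \<and> 1 - E1 n \<le> k n * p n / n \<and> k n * p n / n \<le> 1"
    using big eventually_gt_at_top[of 0]
  proof eventually_elim
    case (elim n)
    define l where "l = ln (real n)"
    have l: "l > 3" "real n > 0" using elim by (auto simp: l_def)
    have L: "l - 1 \<le> L n" "L n \<le> l" using l unfolding L_def l_def[symmetric] by linarith+
    have L1: "L n \<ge> 1" using L l by linarith
    have p1: "p n \<ge> 1" "g n \<ge> 1" using L1 by (auto simp: p_def g_def)
    have kn: "k n * (p n + g n) \<le> n" unfolding k_def by simp
    have kn': "real (k n) * p n + real (k n) * g n \<le> n"
      using kn by (metis of_nat_add of_nat_le_iff of_nat_mult add_mult_distrib2)
    have kn2: "real n - real (k n) * p n - real (k n) * g n \<le> p n + g n"
    proof -
      have "n = k n * (p n + g n) + n mod (p n + g n)" unfolding k_def by (rule div_mult_mod_eq[symmetric])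
      moreover have "n mod (p n + g n) \<le> p n + g n" using p1 by (simp add: order_less_imp_le)
      ultimately have "n \<le> k n * (p n + g n) + (p n + g n)" by linarith
      then have "real n \<le> real (k n * (p n + g n) + (p n + g n))" by (simp only: of_nat_le_iff)
      then show ?thesis by (simp add: algebra_simps)
    qed
    have pL: "real (p n) = real (L n) ^ 3" "real (g n) = real (L n)^2" by (auto simp: p_def g_def)
    have "real (k n) * g n \<ge> 0" by simp
    then have kp: "real (k n) * p n \<le> n" using kn' by linarith
    have kg: "real (k n) * g n \<le> n / (l - 1)"
    proof -
      have "real (k n) * g n * L n = real (k n) * p n" unfolding pL by (simp add: power2_eq_square power3_eq_cube)
      then have "real (k n) * g n * L n \<le> n" using kp by linarith
      moreover have "real (k n) * g n * (l - 1) \<le> real (k n) * g n * L n" using L by (intro mult_left_mono) auto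
      ultimately have "real (k n) * g n * (l - 1) \<le> n" by linarith
      then show ?thesis using l by (simp add: pos_le_divide_eq)
    qed
    have pg3: "real (p n) \<le> l ^ 3" "real (g n) \<le> l^2" unfolding pL using L by (auto intro!: power_mono)
    have pl: "(l - 1)^3 \<le> real (p n)" unfolding pL using L l by (intro power_mono) auto
    have r1: "real n - real (k n) * p n \<le> n * E1 n"
    proof -
      have "real n - real (k n) * p n \<le> n / (l - 1) + (l^3 + l^2)" using kn2 kg pg3 by linarith
      also have "\<dots> = n * E1 n" using l unfolding E1_def l_def[symmetric] by (simp add: field_simps)
      finally show ?thesis .
    qed
    have b: "cmod ((\<integral>\<omega>. iexp (s n * SA {0<..n} \<omega>) \<partial>M) - exp (- ((s n)^2 * vv * p n / 2) * k n))
     \<le> \<bar>s n\<bar> * sqrt (Cv * (real n - real (k n) * real (p n))) + k n * (8 * (Cb * \<tau> ^ g n))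
      + k n * (\<bar>s n\<bar> powr q * (p n powr q * (p n * Dq)) + (s n)^2 / 2 * Cw + ((s n)^2 * vv * p n / 2)^2)"
      by (rule clt_bound[OF p1(1) kn])
    have s2: "(s n)^2 = t^2 / n" using l by (simp add: s_def power_divide)
    have e: "- ((s n)^2 * vv * p n / 2) * k n = - (t^2 * vv / 2 * (k n * p n / n))"
      unfolding s2 by (simp add: field_simps)
    have t1: "\<bar>s n\<bar> * sqrt (Cv * (real n - real (k n) * real (p n))) \<le> \<bar>t\<bar> * sqrt (Cv * E1 n)"
    proof -
      have "\<bar>s n\<bar> * sqrt (Cv * (real n - real (k n) * real (p n))) \<le> \<bar>s n\<bar> * sqrt (n * (Cv * E1 n))"
        using r1 Cv mult_left_mono[OF r1, of Cv] by (intro mult_left_mono) (auto simp: mult_ac)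
      also have "\<dots> = \<bar>t\<bar> * sqrt (Cv * E1 n)" unfolding s_def using l by (simp add: real_sqrt_mult abs_divide)
      finally show ?thesis .
    qed
    have "real (k n) * 1 \<le> real (k n) * p n" using p1 by (intro mult_left_mono) auto
    then have kle: "real (k n) \<le> n" using kp by linarith
    have t2: "k n * (8 * (Cb * \<tau> ^ g n)) \<le> 8 * Cb * (n * exp (ln \<tau> * (l - 1)^2))"
    proof -
      have "\<tau> ^ g n = exp (ln \<tau> * (real (L n))^2)" using \<tau> by (simp add: g_def powr_realpow[symmetric] powr_def mult.commute)
      also have "\<dots> \<le> exp (ln \<tau> * (l - 1)^2)"
        using \<tau> L l power_mono[of "l - 1" "real (L n)" 2] by (simp add: mult_le_cancel_left)
      finally have "k n * (8 * (Cb * \<tau> ^ g n)) \<le> n * (8 * (Cb * exp (ln \<tau> * (l - 1)^2)))"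
        using kle Cb \<tau> by (intro mult_mono) auto
      then show ?thesis by (simp add: mult_ac)
    qed
    have t3: "k n * (\<bar>s n\<bar> powr q * (p n powr q * (p n * Dq))) \<le> \<bar>t\<bar> powr q * Dq * (real n powr (1 - q/2) * l ^ 12)"
    proof -
      have "p n powr q \<le> (l^3) powr q" using pg3 q by (intro powr_mono2) auto
      \<comment> \<open>Here q at most 3 makes the power of the logarithm independent of q: l^9 from
        the q-th power of the block length and l^3 from the number of summands give the l^12
        below.\<close>
      also have "\<dots> \<le> (l^3) powr 3" using l q by (intro powr_mono) (auto simp: one_le_power)
      also have "\<dots> = l^9" using l by (subst powr_numeral) (auto simp: power_mult[symmetric])
      finally have pq: "p n powr q \<le> l^9" .
      have sq: "\<bar>s n\<bar> powr q = \<bar>t\<bar> powr q * n powr (-q/2)"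
      proof -
        have "sqrt (real n) powr q = n powr (q/2)" using l by (simp add: powr_half_sqrt[symmetric] powr_powr)
        moreover have "n powr (-q/2) = 1 / n powr (q/2)" using powr_minus_divide[of "real n" "q/2"] by simp
        ultimately show ?thesis using l unfolding s_def abs_divide by (simp add: powr_divide)
      qed
      have "k n * (\<bar>s n\<bar> powr q * (p n powr q * (p n * Dq))) \<le> n * (\<bar>s n\<bar> powr q * (l^9 * (l^3 * Dq)))"
        using kle pq pg3 Dq l by (intro mult_mono mult_nonneg_nonneg) auto
      also have "\<dots> = \<bar>t\<bar> powr q * Dq * ((real n * n powr (-q/2)) * (l^9 * l^3))" unfolding sq by (simp add: mult_ac)
      also have "real n * n powr (-q/2) = n powr (1 - q/2)"
        using l powr_add[of "real n" 1 "-q/2"] by simp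
      also have "l^9 * l^3 = l^12" by (simp add: power_add[symmetric])
      finally show ?thesis .
    qed
    have t4: "k n * ((s n)^2 / 2 * Cw) \<le> t^2 / 2 * Cw * (1 / (l - 1)^3)"
    proof -
      have "real (k n) * (l - 1)^3 \<le> k n * p n" using pl by (simp add: mult_left_mono)
      then have "real (k n) * (l - 1)^3 \<le> n" using kp by simp
      then have "real (k n) / n \<le> 1 / (l - 1)^3" using l by (simp add: field_simps)
      then have "t^2 / 2 * Cw * (real (k n) / n) \<le> t^2 / 2 * Cw * (1 / (l - 1)^3)" using Cw by (intro mult_left_mono) auto
      then show ?thesis unfolding s2 by (simp add: field_simps)
    qed
    have t5: "k n * ((s n)^2 * vv * p n / 2)^2 \<le> (t^2 * vv / 2)^2 * (l^3 / n)"
    proof -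
      have "real (k n) * p n * p n \<le> n * l^3" using kp pg3 l by (intro mult_mono) auto
      then have "(t^2 * vv / 2)^2 * (real (k n) * p n * p n / n^2) \<le> (t^2 * vv / 2)^2 * (n * l^3 / n^2)"
        by (intro mult_left_mono divide_right_mono) auto
      then show ?thesis unfolding s2 using l by (simp add: field_simps power2_eq_square)
    qed
    have "cmod ((\<integral>\<omega>. iexp (s n * SA {0<..n} \<omega>) \<partial>M) - exp (- (t^2 * vv / 2 * (k n * p n / n)))) \<le> Bd n"
      using b[unfolded e distrib_left] t1 t2 t3 t4 t5 unfolding Bd_def l_def[symmetric] by linarith
    moreover have "1 - E1 n \<le> k n * p n / n" using r1 l by (simp add: field_simps)
    moreover have "k n * p n / n \<le> 1" using kp l by simp
    ultimately show ?case by simp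
  qed
  have kpn: "(\<lambda>n. real (k n) * p n / n) \<longlonglongrightarrow> 1"
  proof (rule tendsto_sandwich)
    show "(\<lambda>n. 1 - E1 n) \<longlonglongrightarrow> 1" using tendsto_diff[OF tendsto_const[of 1] E1] by simp
    show "\<forall>\<^sub>F n in sequentially. 1 - E1 n \<le> real (k n) * p n / n" using main by eventually_elim simp
    show "\<forall>\<^sub>F n in sequentially. real (k n) * p n / n \<le> 1" using main by eventually_elim simp
  qed simp
  have "(\<lambda>n. complex_of_real (exp (- (t^2 * vv / 2 * (k n * p n / n))))) \<longlonglongrightarrow> complex_of_real (exp (- (t^2 * vv / 2 * 1)))"
    using kpn by (intro tendsto_of_real tendsto_exp tendsto_minus tendsto_mult_left) simp
  moreover have "(\<lambda>n. (\<integral>\<omega>. iexp (s n * SA {0<..n} \<omega>) \<partial>M) - complex_of_real (exp (- (t^2 * vv / 2 * (k n * p n / n))))) \<longlonglongrightarrow> 0"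
  proof (rule Lim_null_comparison)
    show "\<forall>\<^sub>F n in sequentially. norm ((\<integral>\<omega>. iexp (s n * SA {0<..n} \<omega>) \<partial>M) - complex_of_real (exp (- (t^2 * vv / 2 * (k n * p n / n))))) \<le> Bd n"
      using main by (rule eventually_mono) (rule conjunct1)
    show "Bd \<longlonglongrightarrow> 0" using Bd0 by simp
  qed
  ultimately have "(\<lambda>n. complex_of_real (exp (- (t^2 * vv / 2 * (k n * p n / n)))) + ((\<integral>\<omega>. iexp (s n * SA {0<..n} \<omega>) \<partial>M) - complex_of_real (exp (- (t^2 * vv / 2 * (k n * p n / n)))))) \<longlonglongrightarrow> complex_of_real (exp (- (t^2 * vv / 2 * 1))) + 0"
    by (rule tendsto_add)
  then show ?thesis unfolding s_def by simp
qed

end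

section \<open>A maximal inequality\<close>

context mixing_seq begin

lemma decouple_events:
  assumes j: "j \<ge> 1" and E: "E \<in> sets (gs {1..j})" and F: "F \<in> sets (gs {j+m..})"
  shows "prob (E \<inter> F) \<le> prob E * prob F + 8 * (Cb * \<tau> ^ m)"
proof -
  have EM: "E \<in> events" "F \<in> events" using E F gs_le by auto
  have "cmod ((\<integral>\<omega>. complex_of_real (indicator E \<omega>) * complex_of_real (indicator F \<omega>) \<partial>M) - (\<integral>\<omega>. complex_of_real (indicator E \<omega>) \<partial>M) * (\<integral>\<omega>. complex_of_real (indicator F \<omega>) \<partial>M)) \<le> 8 * (Cb * \<tau> ^ m)"
    by (rule decouple_complex[OF j]) (use E F in \<open>auto simp: indicator_def\<close>)
  also have "(\<integral>\<omega>. complex_of_real (indicator E \<omega>) * complex_of_real (indicator F \<omega>) \<partial>M) = complex_of_real (\<integral>\<omega>. indicator (E \<inter> F) \<omega> \<partial>M)"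
    unfolding integral_complex_of_real[symmetric] by (intro Bochner_Integration.integral_cong) (auto simp: indicator_def)
  also have "\<dots> = prob (E \<inter> F)" using EM by simp
  finally have "cmod (complex_of_real (prob (E \<inter> F) - prob E * prob F)) \<le> 8 * (Cb * \<tau> ^ m)"
    using EM by simp
  then show ?thesis unfolding norm_of_real by linarith
qed

end

context mixing_fun begin

text \<open>Ottaviani's inequality; at the first passage time the next \<open>m\<close> summands are discarded, so that
  the remaining increment is almost independent of the past.\<close>

lemma ottaviani:
  assumes lam: "l > 0" and half: "\<And>j. prob {\<omega>\<in>space M. \<bar>SA {j<..N} \<omega>\<bar> > l} \<le> 1/2"
  shows "prob {\<omega>\<in>space M. \<exists>i\<le>N. \<bar>SA {0<..i} \<omega>\<bar> > 3 * l} \<le> 2 * (prob {\<omega>\<in>space M. \<bar>SA {0<..N} \<omega>\<bar> > l}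
     + prob {\<omega>\<in>space M. \<exists>i\<in>{1..N}. m * \<bar>u (X i \<omega>)\<bar> > l} + N * (8 * (Cb * \<tau> ^ m)))"
proof -
  \<comment> \<open>First passage over the level 3 l at time i. These events are disjoint, and
    \<open>T i\<close> depends on the observations up to i only.\<close>
  define T where "T i = {\<omega>\<in>space M. \<bar>SA {0<..i} \<omega>\<bar> > 3 * l \<and> (\<forall>k<i. \<bar>SA {0<..k} \<omega>\<bar> \<le> 3 * l)}" for i
  define A where "A = {\<omega>\<in>space M. \<exists>i\<le>N. \<bar>SA {0<..i} \<omega>\<bar> > 3 * l}"
  define D where "D = {\<omega>\<in>space M. \<bar>SA {0<..N} \<omega>\<bar> > l}"
  define BL where "BL = {\<omega>\<in>space M. \<exists>i\<in>{1..N}. m * \<bar>u (X i \<omega>)\<bar> > l}"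
  define F where "F i = {\<omega>\<in>space M. \<bar>SA {i+m<..N} \<omega>\<bar> > l}" for i
  have Tgs: "T i \<in> sets (gs {1..i})" for i
  proof -
    have [measurable]: "SA {0<..k} \<in> borel_measurable (gs {1..i})" if "k \<le> i" for k
      by (rule SA_gs) (use that in auto)
    have e: "T i = {\<omega>\<in>space (gs {1..i}). \<bar>SA {0<..i} \<omega>\<bar> > 3 * l} \<inter> (\<Inter>k\<in>{..<i}. {\<omega>\<in>space (gs {1..i}). \<bar>SA {0<..k} \<omega>\<bar> \<le> 3 * l}) \<inter> space (gs {1..i})"
      unfolding T_def by auto
    show ?thesis
    proof (cases "i = 0")
      \<comment> \<open>At time 0 the partial sum is empty, so the event is void.\<close>
      case True
      have "T i = {}" unfolding T_def True using lam by (auto simp: SA_def)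
      then show ?thesis by simp
    next
      case False
      have 1: "{\<omega>\<in>space (gs {1..i}). \<bar>SA {0<..k} \<omega>\<bar> \<le> 3 * l} \<in> sets (gs {1..i})" if "k < i" for k
      proof -
        have [measurable]: "SA {0<..k} \<in> borel_measurable (gs {1..i})" by (rule SA_gs) (use that in auto)
        show ?thesis by measurable
      qed
      have 2: "{\<omega>\<in>space (gs {1..i}). \<bar>SA {0<..i} \<omega>\<bar> > 3 * l} \<in> sets (gs {1..i})"
      proof -
        have [measurable]: "SA {0<..i} \<in> borel_measurable (gs {1..i})" by (rule SA_gs) auto
        show ?thesis by measurable
      qed
      show ?thesis unfolding e
        by (intro sets.Int sets.finite_INT 2 sets.top) (use 1 False in auto)
    qed
  qed
  have Fgs: "F i \<in> sets (gs {i+m..})" for i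
  proof -
    have [measurable]: "SA {i+m<..N} \<in> borel_measurable (gs {i+m..})" by (rule SA_gs) auto
    have "{\<omega>\<in>space (gs {i+m..}). \<bar>SA {i+m<..N} \<omega>\<bar> > l} \<in> sets (gs {i+m..})" by measurable
    then show ?thesis unfolding F_def by simp
  qed
  have ev[measurable]: "T i \<in> events" "F i \<in> events" for i using Tgs Fgs gs_le by blast+
  have evs[measurable]: "A \<in> events" "D \<in> events" "BL \<in> events" unfolding A_def D_def BL_def by measurable
  have dj: "disjoint_family_on T {1..N}"
  proof -
    have "T i \<inter> T k = {}" if "i < k" for i k using that unfolding T_def by fastforce
    then show ?thesis unfolding disjoint_family_on_def by (metis Int_commute linorder_neqE_nat)
  qed
  have AT: "A = (\<Union>i\<in>{1..N}. T i)"
  proof (intro equalityI subsetI)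
    fix \<omega> assume w: "\<omega> \<in> A"
    then have ex: "\<exists>i. i \<le> N \<and> \<bar>SA {0<..i} \<omega>\<bar> > 3 * l" unfolding A_def by auto
    define i where "i = (LEAST i. i \<le> N \<and> \<bar>SA {0<..i} \<omega>\<bar> > 3 * l)"
    have i: "i \<le> N" "\<bar>SA {0<..i} \<omega>\<bar> > 3 * l" using LeastI_ex[OF ex] unfolding i_def by auto
    have "\<bar>SA {0<..k} \<omega>\<bar> \<le> 3 * l" if "k < i" for k
      using not_less_Least[of k "\<lambda>i. i \<le> N \<and> \<bar>SA {0<..i} \<omega>\<bar> > 3 * l"] that i(1) unfolding i_def[symmetric] by auto
    moreover have "i \<noteq> 0" using i(2) lam by (intro notI) (simp add: SA_def)
    ultimately show "\<omega> \<in> (\<Union>i\<in>{1..N}. T i)" using i w unfolding T_def A_def by auto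
  next
    fix \<omega> assume "\<omega> \<in> (\<Union>i\<in>{1..N}. T i)" then show "\<omega> \<in> A" unfolding T_def A_def by auto
  qed
  have PA: "prob A = (\<Sum>i\<in>{1..N}. prob (T i))"
    unfolding AT by (rule finite_measure_finite_Union) (use dj in auto)
  \<comment> \<open>If the final sum is at most l and the discarded stretch of m summands is at most
    l, then after a passage over 3 l the remaining increment must exceed l in absolute value.
    \<open>BL\<close> controls the stretch through its single summands.\<close>
  have sub: "A \<subseteq> D \<union> (BL \<union> (\<Union>i\<in>{1..N}. T i \<inter> F i))"
  proof
    fix \<omega> assume "\<omega> \<in> A"
    then obtain i where i: "i \<in> {1..N}" "\<omega> \<in> T i" unfolding AT by blast
    have w: "\<omega> \<in> space M" using i(2) by (auto simp: T_def)
    show "\<omega> \<in> D \<union> (BL \<union> (\<Union>i\<in>{1..N}. T i \<inter> F i))"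
    proof (cases "\<omega> \<in> D \<or> \<omega> \<in> BL")
      case False
      have 1: "\<bar>SA {0<..N} \<omega>\<bar> \<le> l" using False w unfolding D_def by auto
      have 2: "m * \<bar>u (X k \<omega>)\<bar> \<le> l" if "k \<in> {1..N}" for k using False w that unfolding BL_def by force
      have 3: "\<bar>SA {0<..i} \<omega>\<bar> > 3 * l" using i unfolding T_def by auto
      define c where "c = min (i + m) N"
      have sp: "SA {0<..N} \<omega> = SA {0<..i} \<omega> + SA {i<..c} \<omega> + SA {i+m<..N} \<omega>"
      proof -
        have "{0<..N} = {0<..i} \<union> ({i<..c} \<union> {i+m<..N})" using i unfolding c_def by auto
        then show ?thesis unfolding SA_def
          by (simp only:) (subst sum.union_disjoint, auto simp: c_def sum.union_disjoint)
      qed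
      have "\<bar>SA {i<..c} \<omega>\<bar> \<le> l"
      proof (cases "m = 0")
        case True then show ?thesis using lam by (simp add: c_def SA_def)
      next
        case False
        have "\<bar>SA {i<..c} \<omega>\<bar> \<le> (\<Sum>k\<in>{i<..c}. \<bar>u (X k \<omega>)\<bar>)" unfolding SA_def by (rule sum_abs)
        also have "\<dots> \<le> (\<Sum>k\<in>{i<..c}. l / m)"
          by (intro sum_mono) (use 2 i False in \<open>auto simp: c_def field_simps\<close>)
        also have "\<dots> = real (c - i) * (l / m)" by simp
        also have "\<dots> \<le> real m * (l / m)" using lam by (intro mult_right_mono) (auto simp: c_def)
        also have "\<dots> = l" using False by simp
        finally show ?thesis .
      qed
      then have "\<bar>SA {i+m<..N} \<omega>\<bar> > l" using 1 3 sp by linarith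
      then show ?thesis using i w unfolding F_def by auto
    qed auto
  qed
  have "prob A \<le> prob (D \<union> (BL \<union> (\<Union>i\<in>{1..N}. T i \<inter> F i)))"
    by (rule finite_measure_mono[OF sub]) measurable
  also have "\<dots> \<le> prob D + (prob BL + prob (\<Union>i\<in>{1..N}. T i \<inter> F i))"
    by (rule order_trans[OF measure_Un_le add_left_mono[OF measure_Un_le]]) auto
  also have "prob (\<Union>i\<in>{1..N}. T i \<inter> F i) \<le> (\<Sum>i\<in>{1..N}. prob (T i \<inter> F i))"
    by (rule finite_measure_subadditive_finite) auto
  also have "\<dots> \<le> (\<Sum>i\<in>{1..N}. prob (T i) * (1/2) + 8 * (Cb * \<tau> ^ m))"
  proof (rule sum_mono)
    fix i assume "i \<in> {1..N}"
    then have "prob (T i \<inter> F i) \<le> prob (T i) * prob (F i) + 8 * (Cb * \<tau> ^ m)"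
      by (intro decouple_events[OF _ Tgs Fgs]) auto
    also have "prob (T i) * prob (F i) \<le> prob (T i) * (1/2)"
      using half[of "i+m"] unfolding F_def by (intro mult_left_mono) auto
    finally show "prob (T i \<inter> F i) \<le> prob (T i) * (1/2) + 8 * (Cb * \<tau> ^ m)" by simp
  qed
  \<comment> \<open>The first passage events add up to \<open>A\<close>. Half of its probability is
    moved to the left-hand side, which yields the overall factor 2.\<close>
  also have "\<dots> = prob A / 2 + N * (8 * (Cb * \<tau> ^ m))"
    unfolding PA by (simp add: sum.distrib sum_divide_distrib)
  finally have "prob A \<le> 2 * (prob D + prob BL + N * (8 * (Cb * \<tau> ^ m)))" by simp
  then show ?thesis unfolding A_def D_def BL_def .
qed

lemma SA_chebyshev: assumes "A \<subseteq> {1..}" "finite A" "l > 0"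
  shows "prob {\<omega>\<in>space M. \<bar>SA A \<omega>\<bar> > l} \<le> Cv * card A / l^2"
proof -
  have "prob {\<omega>\<in>space M. \<bar>SA A \<omega>\<bar> > l} \<le> prob {\<omega>\<in>space M. (SA A \<omega>)^2 \<ge> l^2}"
    by (rule finite_measure_mono) (use assms in \<open>auto simp: abs_le_square_iff[symmetric]\<close>)
  also have "\<dots> \<le> (\<integral>\<omega>. (SA A \<omega>)^2 \<partial>M) / l^2"
    by (rule integral_Markov_inequality_measure[OF SA_square(1)]) (use assms in auto)
  also have "\<dots> \<le> Cv * card A / l^2" using SA_var_le[OF assms(1,2)] assms by (intro divide_right_mono) auto
  finally show ?thesis .
qed

lemma u_tail: assumes "i \<ge> 1" "l > 0"
  shows "prob {\<omega>\<in>space M. \<bar>u (X i \<omega>)\<bar> > l} \<le> Dq / l powr q"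
proof -
  have "prob {\<omega>\<in>space M. \<bar>u (X i \<omega>)\<bar> > l} \<le> prob {\<omega>\<in>space M. \<bar>u (X i \<omega>)\<bar> powr q \<ge> l powr q}"
    by (rule finite_measure_mono) (use assms q in \<open>auto intro!: powr_mono2\<close>)
  also have "\<dots> \<le> (\<integral>\<omega>. \<bar>u (X i \<omega>)\<bar> powr q \<partial>M) / l powr q"
    by (rule integral_Markov_inequality_measure[OF u_q(1)]) (use assms in auto)
  finally show ?thesis using u_q(2)[OF assms(1)] by simp
qed

text \<open>An interval of 2n/K indices is twice a cell of a grid with K cells. The lower bound on K
  lets Chebyshev's inequality supply the 1/2 that \<open>ottaviani\<close> requires. The probability
  on the right is kept, since it is estimated later through the Gaussian limit.\<close>

lemma maximal_asymptotic:
  assumes eps: "\<epsilon> > 0" and K: "K \<ge> 1" "real K \<ge> 4 * Cv / \<epsilon>^2"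
  shows "\<exists>e. e \<longlonglongrightarrow> 0 \<and> (\<forall>\<^sub>F n in sequentially.
     prob {\<omega>\<in>space M. \<exists>i\<le>2 * n div K. \<bar>SA {0<..i} \<omega>\<bar> > 3 * (\<epsilon> * sqrt (real n))}
       \<le> 2 * prob {\<omega>\<in>space M. \<bar>SA {0<..2 * n div K} \<omega>\<bar> > \<epsilon> * sqrt (real n)} + e n)"
proof -
  \<comment> \<open>Large enough that n \<tau>^m vanishes, small enough that n m^q n^(-q/2), the
    cost of the discarded summands, vanishes as well.\<close>
  define m where "m n = nat \<lceil>ln (real n)\<rceil> ^ 2" for n :: nat
  define e where "e n = 2 * (Dq * \<epsilon> powr (-q) * (2 * (real n powr (1 - q/2) * (ln (real n) + 1)^6)) + 16 * Cb * (n * exp (ln \<tau> * ln (real n)^2)))" for n :: nat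
  have e0: "e \<longlonglongrightarrow> 2 * (Dq * \<epsilon> powr (-q) * (2 * 0) + 16 * Cb * 0)"
  proof -
    have "ln \<tau> < 0" using \<tau> by simp
    then have "(\<lambda>n::nat. n * exp (ln \<tau> * ln (real n)^2)) \<longlonglongrightarrow> 0" by real_asymp
    moreover have "(\<lambda>n::nat. real n powr (1 - q/2) * (ln (real n) + 1)^6) \<longlonglongrightarrow> 0"
    proof -
      have "1 - q/2 < 0" using q by simp
      then show ?thesis by real_asymp
    qed
    ultimately show ?thesis unfolding e_def by (intro tendsto_intros)
  qed
  have big: "\<forall>\<^sub>F n in sequentially. ln (real n) > 1" by real_asymp
  have "\<forall>\<^sub>F n in sequentially.
     prob {\<omega>\<in>space M. \<exists>i\<le>2 * n div K. \<bar>SA {0<..i} \<omega>\<bar> > 3 * (\<epsilon> * sqrt (real n))}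
       \<le> 2 * prob {\<omega>\<in>space M. \<bar>SA {0<..2 * n div K} \<omega>\<bar> > \<epsilon> * sqrt (real n)} + e n"
    using big eventually_gt_at_top[of 0]
  proof eventually_elim
    case (elim n)
    define N where "N = 2 * n div K"
    define l where "l = \<epsilon> * sqrt (real n)"
    define y where "y = ln (real n)"
    have y: "y > 1" using elim by (simp add: y_def)
    have l: "l > 0" using eps elim by (simp add: l_def)
    have l2: "l^2 = \<epsilon>^2 * n" by (simp add: l_def power_mult_distrib)
    have NK: "real N \<le> 2 * n / K" unfolding N_def using of_nat_div_le_of_nat[of "2 * n" K, where ?'a=real] by simp
    have N2: "real N \<le> 2 * n"
    proof -
      have "N \<le> 2 * n" unfolding N_def by (rule div_le_dividend)
      then show ?thesis by linarith
    qed
    have cr: "y \<le> real (nat \<lceil>y\<rceil>)" "real (nat \<lceil>y\<rceil>) \<le> y + 1" using y by linarith+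
    have mm: "y^2 \<le> m n" "m n \<le> (y+1)^2" "m n \<ge> 1"
    proof -
      show "y^2 \<le> m n" "real (m n) \<le> (y+1)^2" unfolding m_def y_def[symmetric] using cr y by (auto intro!: power_mono)
      have "nat \<lceil>y\<rceil> \<ge> 1" using y by linarith
      then show "m n \<ge> 1" unfolding m_def y_def[symmetric] by simp
    qed
    have half: "prob {\<omega>\<in>space M. \<bar>SA {j<..N} \<omega>\<bar> > l} \<le> 1/2" for j
    proof -
      have "prob {\<omega>\<in>space M. \<bar>SA {j<..N} \<omega>\<bar> > l} \<le> Cv * card {j<..N} / l^2"
        by (rule SA_chebyshev) (use l in auto)
      also have "\<dots> \<le> Cv * (2 * n / K) / l^2"
      proof (intro divide_right_mono mult_left_mono)
        have "real (card {j<..N}) \<le> N" by simp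
        then show "real (card {j<..N}) \<le> 2 * n / K" using NK by linarith
      qed (use Cv in auto)
      also have "\<dots> = 2 * Cv / (K * \<epsilon>^2)" unfolding l2 using elim by (simp add: field_simps)
      also have "\<dots> \<le> 1/2" using K eps by (simp add: field_simps)
      finally show ?thesis .
    qed
    have ot: "prob {\<omega>\<in>space M. \<exists>i\<le>N. \<bar>SA {0<..i} \<omega>\<bar> > 3 * l} \<le> 2 * (prob {\<omega>\<in>space M. \<bar>SA {0<..N} \<omega>\<bar> > l}
     + prob {\<omega>\<in>space M. \<exists>i\<in>{1..N}. m n * \<bar>u (X i \<omega>)\<bar> > l} + N * (8 * (Cb * \<tau> ^ m n)))"
      by (rule ottaviani[OF l half])
    have t1: "N * (8 * (Cb * \<tau> ^ m n)) \<le> 16 * Cb * (n * exp (ln \<tau> * y^2))"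
    proof -
      have "\<tau> ^ m n = exp (ln \<tau> * m n)" using \<tau> by (simp add: powr_realpow[symmetric] powr_def mult.commute)
      also have "\<dots> \<le> exp (ln \<tau> * y^2)" using \<tau> mm by (simp add: mult_le_cancel_left)
      finally have "N * (8 * (Cb * \<tau> ^ m n)) \<le> (2 * n) * (8 * (Cb * exp (ln \<tau> * y^2)))"
        using N2 Cb \<tau> by (intro mult_mono) auto
      then show ?thesis by (simp add: mult_ac)
    qed
    have t2: "prob {\<omega>\<in>space M. \<exists>i\<in>{1..N}. m n * \<bar>u (X i \<omega>)\<bar> > l} \<le> Dq * \<epsilon> powr (-q) * (2 * (real n powr (1 - q/2) * (y + 1)^6))"
    proof -
      have lm: "l / m n > 0" using l mm by simp
      have "{\<omega>\<in>space M. \<exists>i\<in>{1..N}. m n * \<bar>u (X i \<omega>)\<bar> > l} = (\<Union>i\<in>{1..N}. {\<omega>\<in>space M. \<bar>u (X i \<omega>)\<bar> > l / m n})"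
        using mm by (auto simp: field_simps)
      then have "prob {\<omega>\<in>space M. \<exists>i\<in>{1..N}. m n * \<bar>u (X i \<omega>)\<bar> > l} \<le> (\<Sum>i\<in>{1..N}. prob {\<omega>\<in>space M. \<bar>u (X i \<omega>)\<bar> > l / m n})"
        by (simp only:) (rule finite_measure_subadditive_finite, auto)
      also have "\<dots> \<le> (\<Sum>i\<in>{1..N}. Dq / (l / m n) powr q)"
        by (intro sum_mono u_tail lm) auto
      also have "\<dots> = N * (Dq / (l / m n) powr q)" by simp
      also have "\<dots> \<le> (2 * n) * (Dq / (l / m n) powr q)" using N2 Dq by (intro mult_right_mono) auto
      also have "Dq / (l / m n) powr q = Dq * (m n powr q * (\<epsilon> powr (-q) * n powr (-q/2)))"
      proof -
        have "(l / m n) powr q = \<epsilon> powr q * n powr (q/2) / m n powr q"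
          using eps elim unfolding l_def by (simp add: powr_divide powr_mult powr_half_sqrt[symmetric] powr_powr)
        moreover have "n powr (-q/2) = 1 / n powr (q/2)" using powr_minus_divide[of "real n" "q/2"] by simp
        moreover have "\<epsilon> powr (-q) = 1 / \<epsilon> powr q" by (rule powr_minus_divide)
        ultimately show ?thesis by simp
      qed
      also have "(2 * n) * (Dq * (m n powr q * (\<epsilon> powr (-q) * n powr (-q/2)))) \<le> (2 * n) * (Dq * ((y+1)^6 * (\<epsilon> powr (-q) * n powr (-q/2))))"
      proof (intro mult_left_mono mult_right_mono)
        have "m n powr q \<le> ((y+1)^2) powr q" using mm q by (intro powr_mono2) auto
        also have "\<dots> \<le> ((y+1)^2) powr 3" using y q by (intro powr_mono) (auto simp: one_le_power)
        also have "\<dots> = (y+1)^6" using y by (subst powr_numeral) (auto simp: power_mult[symmetric])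
        finally show "m n powr q \<le> (y+1)^6" .
      qed (use Dq in auto)
      also have "\<dots> = Dq * \<epsilon> powr (-q) * (2 * ((real n * n powr (-q/2)) * (y + 1)^6))" by (simp add: mult_ac)
      also have "real n * n powr (-q/2) = n powr (1 - q/2)"
        using elim powr_add[of "real n" 1 "-q/2"] by simp
      finally show ?thesis .
    qed
    show ?case using ot t1 t2 unfolding N_def l_def e_def y_def distrib_left by linarith
  qed
  then show ?thesis using e0 by (intro exI[of _ e]) simp
qed

end

section \<open>The degenerate part\<close>

subsection \<open>A two-parameter Rademacher--Menshov inequality\<close>

lemma sum_dyadic_pair: "(\<Sum>j<2 * (n::nat). f j) = (\<Sum>j<n. f (2 * j) + f (2 * j + 1) :: real)"
  by (induction n) (auto simp: algebra_simps)

definition blk :: "nat \<Rightarrow> nat \<Rightarrow> nat set" where "blk s c = {c * 2^s..<Suc c * 2^s}"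

lemma card_blk[simp]: "card (blk s c) = 2^s" by (simp add: blk_def)

lemma finite_blk[simp]: "finite (blk s c)" by (simp add: blk_def)

text \<open>Adding neighbouring entries of a sequence moves every dyadic block one level up; this
  drives the induction in \<open>dyadic_chaining\<close>.\<close>

lemma sum_blk_Suc: "(\<Sum>j\<in>blk s c. f (2 * j) + f (2 * j + 1)) = (\<Sum>j\<in>blk (Suc s) c. (f j :: real))"
proof -
  have e: "(\<Sum>j\<in>{a..<b}. f (2 * j) + f (2 * j + 1)) = (\<Sum>j\<in>{2 * a..<2 * b}. f j)" if "a \<le> b" for a b :: nat
  proof -
    have "(\<Sum>j\<in>{a..<b}. f (2 * j) + f (2 * j + 1)) = (\<Sum>j<b. f (2 * j) + f (2 * j + 1)) - (\<Sum>j<a. f (2 * j) + f (2 * j + 1))"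
      using that sum_diff_nat_ivl[of 0 a b "\<lambda>j. f (2 * j) + f (2 * j + 1)"] by (simp add: atLeast0LessThan)
    also have "\<dots> = (\<Sum>j\<in>{2 * a..<2 * b}. f j)"
      using that sum_diff_nat_ivl[of 0 "2 * a" "2 * b" f] by (simp add: atLeast0LessThan sum_dyadic_pair)
    finally show ?thesis .
  qed
  show ?thesis unfolding blk_def using e[of "c * 2^s" "Suc c * 2^s"] by (simp add: mult_ac)
qed

text \<open>The Euclidean norm of the vector of all block sums of level s below 2^r; it dominates
  each single one of them.\<close>

definition lvl :: "nat \<Rightarrow> (nat \<Rightarrow> real) \<Rightarrow> nat \<Rightarrow> real" where
  "lvl r f s = sqrt (\<Sum>c<2^(r-s). (\<Sum>j\<in>blk s c. f j)^2)"

text \<open>The binary digits of b write the initial segment as a disjoint union of dyadic blocks,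
  at most one per level. The induction reads off the lowest digit: for odd b the last entry stands
  alone, and the rest is paired.\<close>

lemma dyadic_chaining: "b \<le> 2^r \<Longrightarrow> \<bar>\<Sum>j<b. f j\<bar> \<le> (\<Sum>s\<le>r. lvl r f s)"
proof (induction r arbitrary: b f)
  case 0
  then have "b = 0 \<or> b = 1" by auto
  then show ?case by (auto simp: lvl_def blk_def)
next
  case (Suc r)
  let ?f = "\<lambda>j. f (2 * j) + f (2 * j + 1)"
  have IH: "\<bar>\<Sum>j<b div 2. ?f j\<bar> \<le> (\<Sum>s\<le>r. lvl r ?f s)" using Suc by simp
  have l: "lvl r ?f s = lvl (Suc r) f (Suc s)" for s unfolding lvl_def sum_blk_Suc by simp
  have odd: "\<bar>(\<Sum>j<b. f j) - (\<Sum>j<b div 2. ?f j)\<bar> \<le> lvl (Suc r) f 0"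
  proof (cases "even b")
    case True
    then have "(\<Sum>j<b. f j) = (\<Sum>j<b div 2. ?f j)" using sum_dyadic_pair[of f "b div 2"] by simp
    then show ?thesis by (simp add: lvl_def sum_nonneg)
  next
    case False
    then have b: "b = Suc (2 * (b div 2))" by presburger
    have "(\<Sum>j<b. f j) = (\<Sum>j<b div 2. ?f j) + f (b - 1)"
      using sum_dyadic_pair[of f "b div 2"] by (subst b) (metis b diff_Suc_1 sum.lessThan_Suc)
    then have "\<bar>(\<Sum>j<b. f j) - (\<Sum>j<b div 2. ?f j)\<bar> = sqrt ((f (b - 1))^2)" by simp
    also have "\<dots> \<le> lvl (Suc r) f 0" unfolding lvl_def
    proof (rule real_sqrt_le_mono)
      have "b - 1 \<in> {..<2^(Suc r)}" using Suc.prems b by auto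
      then have "(\<Sum>j\<in>blk 0 (b-1). f j)^2 \<le> (\<Sum>c<2^(Suc r). (\<Sum>j\<in>blk 0 c. f j)^2)" by (intro member_le_sum) auto
      then show "(f (b - 1))^2 \<le> (\<Sum>c<2^(Suc r - 0). (\<Sum>j\<in>blk 0 c. f j)^2)" by (simp add: blk_def)
    qed
    finally show ?thesis .
  qed
  have "(\<Sum>s\<le>Suc r. lvl (Suc r) f s) = lvl (Suc r) f 0 + (\<Sum>s\<le>r. lvl r ?f s)"
    unfolding l by (rule sum.atMost_Suc_shift)
  then show ?case using IH odd by linarith
qed

text \<open>Cauchy--Schwarz over the r + 1 levels. The right-hand side is free of b, so it also
  bounds the maximum over b, at the price of logarithmic factors.\<close>

lemma rademacher_menshov:
  assumes "b \<le> 2^r"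
  shows "(\<Sum>j<b. f j)^2 \<le> (real r + 1) * (\<Sum>s\<le>r. \<Sum>c<2^(r-s). (\<Sum>j\<in>blk s c. f j)^2)"
proof -
  have "(\<Sum>j<b. f j)^2 \<le> (\<Sum>s\<le>r. lvl r f s)^2"
    using dyadic_chaining[OF assms, of f] by (intro power2_le_iff_abs_le[THEN iffD2]) (auto simp: lvl_def intro!: sum_nonneg)
  also have "\<dots> \<le> (\<Sum>s\<le>r. (lvl r f s)^2) * (\<Sum>s\<le>r. 1^2)"
    using Cauchy_Schwarz_ineq_sum[of "lvl r f" "\<lambda>_. 1" "{..r}"] by simp
  also have "\<dots> = (real r + 1) * (\<Sum>s\<le>r. \<Sum>c<2^(r-s). (\<Sum>j\<in>blk s c. f j)^2)"
    by (simp add: lvl_def sum_nonneg mult.commute)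
  finally show ?thesis .
qed

text \<open>The one-parameter bound is applied in j, and then in i inside each squared block sum
  after exchanging the two summations.\<close>

lemma rademacher_menshov2:
  assumes a: "a \<le> 2^r" and b: "b \<le> 2^r"
  shows "(\<Sum>j<b. \<Sum>i<a. f i j)^2 \<le> (real r + 1)^2 *
     (\<Sum>s\<le>r. \<Sum>c<2^(r-s). \<Sum>s'\<le>r. \<Sum>c'<2^(r-s'). (\<Sum>i\<in>blk s' c'. \<Sum>j\<in>blk s c. f i j)^2)"
proof -
  have "(\<Sum>j<b. \<Sum>i<a. f i j)^2 \<le> (real r + 1) * (\<Sum>s\<le>r. \<Sum>c<2^(r-s). (\<Sum>j\<in>blk s c. \<Sum>i<a. f i j)^2)"
    by (rule rademacher_menshov[OF b])
  also have "\<dots> \<le> (real r + 1) * (\<Sum>s\<le>r. \<Sum>c<2^(r-s). (real r + 1) * (\<Sum>s'\<le>r. \<Sum>c'<2^(r-s'). (\<Sum>i\<in>blk s' c'. \<Sum>j\<in>blk s c. f i j)^2))"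
  proof (intro mult_left_mono sum_mono)
    fix s c
    have "(\<Sum>j\<in>blk s c. \<Sum>i<a. f i j) = (\<Sum>i<a. \<Sum>j\<in>blk s c. f i j)" by (rule sum.swap)
    then show "(\<Sum>j\<in>blk s c. \<Sum>i<a. f i j)^2 \<le> (real r + 1) * (\<Sum>s'\<le>r. \<Sum>c'<2^(r-s'). (\<Sum>i\<in>blk s' c'. \<Sum>j\<in>blk s c. f i j)^2)"
      using rademacher_menshov[OF a, of "\<lambda>i. \<Sum>j\<in>blk s c. f i j"] by simp
  qed simp
  also have "\<dots> = (real r + 1)^2 * (\<Sum>s\<le>r. \<Sum>c<2^(r-s). \<Sum>s'\<le>r. \<Sum>c'<2^(r-s'). (\<Sum>i\<in>blk s' c'. \<Sum>j\<in>blk s c. f i j)^2)"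
    by (simp add: sum_distrib_left[symmetric] power2_eq_square)
  finally show ?thesis .
qed

subsection \<open>Counting clustered quadruples\<close>

definition close :: "nat \<Rightarrow> nat \<Rightarrow> nat \<Rightarrow> bool" where "close m i j \<longleftrightarrow> i < j + m \<and> j < i + m"

lemma card_close: "finite I \<Longrightarrow> real (card {j\<in>I. close m i j}) \<le> 2 * real m"
proof -
  assume "finite I"
  have "{j\<in>I. close m i j} \<subseteq> {i - m..<i + m}" by (auto simp: close_def)
  then have "card {j\<in>I. close m i j} \<le> card {i - m..<i + m}" by (intro card_mono) auto
  then show ?thesis by simp
qed

lemma sum_close: "finite I \<Longrightarrow> (\<Sum>j\<in>I. of_bool (close m i j) :: real) \<le> 2 * real m"
  using card_close[of I m i] by (simp add: Int_def)

lemma sum_close': "finite I \<Longrightarrow> (\<Sum>j\<in>I. of_bool (close m j i) :: real) \<le> 2 * real m"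
  using sum_close[of I m i] by (simp add: close_def conj_commute)

text \<open>In the first pattern i' and j' range over at most 2m values each. The second is the
  square of the number of close pairs, of which one factor is bounded by rows and the other by
  columns, so that |I| |J| appears instead of |I|^2.\<close>

lemma count_near:
  assumes I: "finite I" and J: "finite J"
  shows "(\<Sum>i\<in>I. \<Sum>j\<in>J. \<Sum>i'\<in>I. \<Sum>j'\<in>J. (of_bool (close m i i') * of_bool (close m j j') + of_bool (close m i j) * of_bool (close m i' j') :: real))
     \<le> 8 * real m^2 * card I * card J"
proof -
  have 1: "(\<Sum>i\<in>I. \<Sum>j\<in>J. \<Sum>i'\<in>I. \<Sum>j'\<in>J. of_bool (close m i i') * of_bool (close m j j') :: real) \<le> 4 * real m^2 * card I * card J"
  proof -
    have "(\<Sum>i\<in>I. \<Sum>j\<in>J. \<Sum>i'\<in>I. \<Sum>j'\<in>J. of_bool (close m i i') * of_bool (close m j j') :: real)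
       = (\<Sum>i\<in>I. \<Sum>j\<in>J. (\<Sum>i'\<in>I. of_bool (close m i i')) * (\<Sum>j'\<in>J. of_bool (close m j j')))"
      by (simp only: sum_product)
    also have "\<dots> \<le> (\<Sum>i\<in>I. \<Sum>j\<in>J. (2 * real m) * (2 * real m))"
      by (intro sum_mono mult_mono sum_close I J) (auto intro: sum_nonneg)
    finally show ?thesis by (simp add: power2_eq_square mult_ac)
  qed
  have "(\<Sum>i\<in>I. \<Sum>j\<in>J. of_bool (close m i j) :: real) \<le> (\<Sum>i\<in>I. 2 * real m)"
    by (intro sum_mono sum_close J)
  then have a: "(\<Sum>i\<in>I. \<Sum>j\<in>J. of_bool (close m i j) :: real) \<le> 2 * real m * card I" by (simp add: mult_ac)
  have "(\<Sum>i\<in>I. \<Sum>j\<in>J. of_bool (close m i j) :: real) \<le> (\<Sum>j\<in>J. 2 * real m)"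
    by (subst sum.swap) (intro sum_mono sum_close' I)
  then have b: "(\<Sum>i\<in>I. \<Sum>j\<in>J. of_bool (close m i j) :: real) \<le> 2 * real m * card J" by (simp add: mult_ac)
  have "(\<Sum>i\<in>I. \<Sum>j\<in>J. \<Sum>i'\<in>I. \<Sum>j'\<in>J. of_bool (close m i j) * of_bool (close m i' j') :: real)
       = (\<Sum>i\<in>I. \<Sum>j\<in>J. of_bool (close m i j)) * (\<Sum>i\<in>I. \<Sum>j\<in>J. of_bool (close m i j))"
    by (simp only: sum_distrib_left sum_distrib_right) (intro sum.cong refl mult.commute)
  also have "\<dots> \<le> (2 * real m * card I) * (2 * real m * card J)"
    by (intro mult_mono a b) (auto intro!: sum_nonneg)
  also have "\<dots> = 4 * real m^2 * card I * card J" by (simp add: power2_eq_square mult_ac)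
  finally show ?thesis using 1 by (simp add: sum.distrib)
qed

subsection \<open>Moments\<close>

text \<open>Moments are stated as nonnegative integrals so that the bounds include integrability.
  They are required under the joint laws of all pairs and under the product law, since decoupling
  compares the two.\<close>

locale degenerate_kernel = mixing_seq +
  fixes g :: "real \<Rightarrow> real \<Rightarrow> real" and q D :: real
  assumes g[measurable]: "case_prod g \<in> borel_measurable (borel \<Otimes>\<^sub>M borel)" and q: "q > 2"
    and deg1: "\<And>y. (\<integral>x. g x y \<partial>distr M borel (X 1)) = 0"
    and deg2: "\<And>x. (\<integral>y. g x y \<partial>distr M borel (X 1)) = 0"
    and gq: "\<And>i j. i \<ge> 1 \<Longrightarrow> j \<ge> 1 \<Longrightarrow> (\<integral>\<^sup>+\<omega>. ennreal (\<bar>g (X i \<omega>) (X j \<omega>)\<bar> powr q) \<partial>M) \<le> ennreal D"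
    and gq2: "(\<integral>\<^sup>+x. \<integral>\<^sup>+y. ennreal (\<bar>g x y\<bar> powr q) \<partial>distr M borel (X 1) \<partial>distr M borel (X 1)) \<le> ennreal D"
    and D: "D \<ge> 0"
begin

lemma g_comp[measurable (raw)]:
  "f \<in> borel_measurable N \<Longrightarrow> f' \<in> borel_measurable N \<Longrightarrow> (\<lambda>x. g (f x) (f' x)) \<in> borel_measurable N"
  using measurable_compose[OF measurable_Pair g, of f N f'] by simp

lemma integrable_of_nn_le:
  fixes f :: "'b \<Rightarrow> real"
  assumes "f \<in> borel_measurable N" "\<And>x. f x \<ge> 0" "(\<integral>\<^sup>+x. ennreal (f x) \<partial>N) \<le> ennreal c" "c \<ge> 0"
  shows "integrable N f" "(\<integral>x. f x \<partial>N) \<le> c"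
proof -
  show i: "integrable N f"
    by (rule integrableI_nonneg) (use assms le_less_trans[OF assms(3)] in auto)
  have "ennreal (\<integral>x. f x \<partial>N) = (\<integral>\<^sup>+x. ennreal (f x) \<partial>N)"
    by (rule nn_integral_eq_integral[symmetric]) (use i assms in auto)
  then have "ennreal (\<integral>x. f x \<partial>N) \<le> ennreal c" using assms(3) by simp
  then show "(\<integral>x. f x \<partial>N) \<le> c" using assms(4) ennreal_le_iff by blast
qed

lemma gX_q: assumes "i \<ge> 1" "j \<ge> 1"
  shows "integrable M (\<lambda>\<omega>. \<bar>g (X i \<omega>) (X j \<omega>)\<bar> powr q)" "(\<integral>\<omega>. \<bar>g (X i \<omega>) (X j \<omega>)\<bar> powr q \<partial>M) \<le> D"
  using integrable_of_nn_le[OF _ _ gq[OF assms] D] by auto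

lemma gX_square: assumes "i \<ge> 1" "j \<ge> 1"
  shows "integrable M (\<lambda>\<omega>. (g (X i \<omega>) (X j \<omega>))^2)" "(\<integral>\<omega>. (g (X i \<omega>) (X j \<omega>))^2 \<partial>M) \<le> 1 + D"
proof -
  show i: "integrable M (\<lambda>\<omega>. (g (X i \<omega>) (X j \<omega>))^2)"
    by (rule integrable_square_of_powr[OF _ gX_q(1)[OF assms]]) (use q in auto)
  have "(\<integral>\<omega>. (g (X i \<omega>) (X j \<omega>))^2 \<partial>M) \<le> (\<integral>\<omega>. 1 + \<bar>g (X i \<omega>) (X j \<omega>)\<bar> powr q \<partial>M)"
    by (rule integral_mono) (use i gX_q(1)[OF assms] powr_two_le q in auto)
  then show "(\<integral>\<omega>. (g (X i \<omega>) (X j \<omega>))^2 \<partial>M) \<le> 1 + D"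
    using gX_q[OF assms] prob_space by simp
qed

definition "W i j i' j' = (\<integral>\<omega>. g (X i \<omega>) (X j \<omega>) * g (X i' \<omega>) (X j' \<omega>) \<partial>M)"

lemma gg_int: assumes "i \<ge> 1" "j \<ge> 1" "i' \<ge> 1" "j' \<ge> 1"
  shows "integrable M (\<lambda>\<omega>. g (X i \<omega>) (X j \<omega>) * g (X i' \<omega>) (X j' \<omega>))"
  by (rule integrable_mult_of_squares) (use gX_square assms in auto)

lemma W_le: assumes "i \<ge> 1" "j \<ge> 1" "i' \<ge> 1" "j' \<ge> 1" shows "\<bar>W i j i' j'\<bar> \<le> 2 + 2 * D"
proof -
  have "\<bar>W i j i' j'\<bar> \<le> (\<integral>\<omega>. \<bar>g (X i \<omega>) (X j \<omega>) * g (X i' \<omega>) (X j' \<omega>)\<bar> \<partial>M)"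
    unfolding W_def by (rule integral_abs_bound)
  also have "\<dots> \<le> (\<integral>\<omega>. (g (X i \<omega>) (X j \<omega>))^2 + (g (X i' \<omega>) (X j' \<omega>))^2 \<partial>M)"
    by (rule integral_mono) (use gg_int gX_square assms abs_mult_le_squares in auto)
  also have "\<dots> \<le> 2 + 2 * D" using gX_square[OF assms(1,2)] gX_square[OF assms(3,4)] by simp
  finally show ?thesis .
qed

lemma W_swap: "W i j i' j' = W i' j' i j" unfolding W_def by (simp add: mult.commute)

definition "Kg = 4 * Cb + 4 * D"
definition "rg = rho (q / 2)"

lemma rg: "0 < rg" "rg < 1" using rho[of "q/2"] q by (auto simp: rg_def)

lemma le_half: "\<bar>x * y\<bar> powr (q/2) \<le> \<bar>x\<bar> powr q + \<bar>y\<bar> powr q" for x y :: real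
  using powr_mult_le[of "q/2" x y] q by simp

text \<open>If the smallest index is isolated, its variable can be replaced by an independent copy at cost \<open>rg ^ m\<close>,
  after which the expectation vanishes by degeneracy.\<close>

lemma W_left:
  assumes i: "1 \<le> i" "i + m \<le> j" "i + m \<le> i'" "i + m \<le> j'"
  shows "\<bar>W i j i' j'\<bar> \<le> Kg * rg ^ m"
proof -
  define V where "V \<omega> = (X j \<omega>, X i' \<omega>, X j' \<omega>)" for \<omega>
  define f where "f z = g (fst z) (fst (snd z)) * g (fst (snd (snd z))) (snd (snd (snd z)))" for z :: "real \<times> real \<times> real \<times> real"
  let ?B = "borel \<Otimes>\<^sub>M borel \<Otimes>\<^sub>M borel :: (real \<times> real \<times> real) measure"
  have U: "X i \<in> borel_measurable (gs {1..i})" by (rule X_gs) (use i in auto)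
  have V: "V \<in> measurable (gs {i+m..}) ?B" unfolding V_def
    by (intro measurable_Pair X_gs) (use i in auto)
  have f[measurable]: "f \<in> borel_measurable (borel \<Otimes>\<^sub>M ?B)" unfolding f_def by measurable
  note UM[measurable] = measurable_gsD[OF U] and VM[measurable] = measurable_gsD[OF V]
  interpret p: pair_prob_space "distr M borel (X i)" "distr M ?B V" by (rule decouple_spaces(4)[OF UM VM])
  let ?nu = "distr M borel (X i) \<Otimes>\<^sub>M distr M ?B V"
  have i1: "distr M borel (X i) = distr M borel (X 1)" by (rule stat_one) (use i in auto)
  have j1: "distr M borel (X j) = distr M borel (X 1)" by (rule stat_one) (use i in auto)
  \<comment> \<open>After decoupling, the variables with indices i and j are independent with the
    law of \<open>X 1\<close>, whence the product moment \<open>gq2\<close>; the second factor lives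
    on \<open>V\<close> alone and keeps its joint law.\<close>
  have n1: "(\<integral>\<^sup>+z. ennreal (\<bar>g (fst z) (fst (snd z))\<bar> powr q) \<partial>?nu) \<le> ennreal D"
  proof -
    have "(\<integral>\<^sup>+z. ennreal (\<bar>g (fst z) (fst (snd z))\<bar> powr q) \<partial>?nu) = (\<integral>\<^sup>+x. \<integral>\<^sup>+v. ennreal (\<bar>g x (fst v)\<bar> powr q) \<partial>distr M ?B V \<partial>distr M borel (X i))"
      by (subst p.M2.nn_integral_fst[symmetric]) (auto intro!: nn_integral_cong)
    also have "\<dots> = (\<integral>\<^sup>+x. \<integral>\<^sup>+y. ennreal (\<bar>g x y\<bar> powr q) \<partial>distr M borel (X j) \<partial>distr M borel (X i))"
      by (intro nn_integral_cong) (simp add: nn_integral_distr V_def)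
    finally show ?thesis unfolding i1 j1 using gq2 by simp
  qed
  have n2: "(\<integral>\<^sup>+z. ennreal (\<bar>g (fst (snd (snd z))) (snd (snd (snd z)))\<bar> powr q) \<partial>?nu) \<le> ennreal D"
  proof -
    have "(\<integral>\<^sup>+z. ennreal (\<bar>g (fst (snd (snd z))) (snd (snd (snd z)))\<bar> powr q) \<partial>?nu) = (\<integral>\<^sup>+x. \<integral>\<^sup>+v. ennreal (\<bar>g (fst (snd v)) (snd (snd v))\<bar> powr q) \<partial>distr M ?B V \<partial>distr M borel (X i))"
      by (subst p.M2.nn_integral_fst[symmetric]) (auto intro!: nn_integral_cong)
    also have "\<dots> = (\<integral>\<^sup>+\<omega>. ennreal (\<bar>g (X i' \<omega>) (X j' \<omega>)\<bar> powr q) \<partial>M)"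
      by (simp add: nn_integral_distr V_def p.M1.emeasure_space_1[simplified])
    finally show ?thesis using gq[of i' j'] i by simp
  qed
  note a1 = integrable_of_nn_le[OF _ _ n1 D] and a2 = integrable_of_nn_le[OF _ _ n2 D]
  have b1: "integrable ?nu (\<lambda>z. \<bar>g (fst z) (fst (snd z))\<bar> powr q)" "(\<integral>z. \<bar>g (fst z) (fst (snd z))\<bar> powr q \<partial>?nu) \<le> D"
    by (rule a1; simp)+
  have b2: "integrable ?nu (\<lambda>z. \<bar>g (fst (snd (snd z))) (snd (snd (snd z)))\<bar> powr q)" "(\<integral>z. \<bar>g (fst (snd (snd z))) (snd (snd (snd z)))\<bar> powr q \<partial>?nu) \<le> D"
    by (rule a2; simp)+
  have i3: "integrable ?nu (\<lambda>z. \<bar>f z\<bar> powr (q/2))"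
    by (rule Bochner_Integration.integrable_bound[OF Bochner_Integration.integrable_add[OF b1(1) b2(1)]]) (auto simp: f_def intro!: le_half)
  have e3: "(\<integral>z. \<bar>f z\<bar> powr (q/2) \<partial>?nu) \<le> 2 * D"
  proof -
    have "(\<integral>z. \<bar>f z\<bar> powr (q/2) \<partial>?nu) \<le> (\<integral>z. \<bar>g (fst z) (fst (snd z))\<bar> powr q + \<bar>g (fst (snd (snd z))) (snd (snd (snd z)))\<bar> powr q \<partial>?nu)"
      by (rule integral_mono[OF i3 Bochner_Integration.integrable_add[OF b1(1) b2(1)]]) (simp add: f_def le_half)
    then show ?thesis using b1 b2 by simp
  qed
  have c1: "integrable M (\<lambda>\<omega>. \<bar>g (X i \<omega>) (X j \<omega>)\<bar> powr q)" "(\<integral>\<omega>. \<bar>g (X i \<omega>) (X j \<omega>)\<bar> powr q \<partial>M) \<le> D"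
    and c2: "integrable M (\<lambda>\<omega>. \<bar>g (X i' \<omega>) (X j' \<omega>)\<bar> powr q)" "(\<integral>\<omega>. \<bar>g (X i' \<omega>) (X j' \<omega>)\<bar> powr q \<partial>M) \<le> D"
    using gX_q[of i j] gX_q[of i' j'] i by auto
  have i4: "integrable M (\<lambda>\<omega>. \<bar>f (X i \<omega>, V \<omega>)\<bar> powr (q/2))"
    by (rule Bochner_Integration.integrable_bound[OF Bochner_Integration.integrable_add[OF c1(1) c2(1)]]) (auto simp: f_def V_def intro!: le_half)
  have e4: "(\<integral>\<omega>. \<bar>f (X i \<omega>, V \<omega>)\<bar> powr (q/2) \<partial>M) \<le> 2 * D"
  proof -
    have "(\<integral>\<omega>. \<bar>f (X i \<omega>, V \<omega>)\<bar> powr (q/2) \<partial>M) \<le> (\<integral>\<omega>. \<bar>g (X i \<omega>) (X j \<omega>)\<bar> powr q + \<bar>g (X i' \<omega>) (X j' \<omega>)\<bar> powr q \<partial>M)"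
      by (rule integral_mono[OF i4 Bochner_Integration.integrable_add[OF c1(1) c2(1)]]) (simp add: f_def V_def le_half)
    then show ?thesis using c1 c2 by simp
  qed
  have d: "\<bar>(\<integral>\<omega>. f (X i \<omega>, V \<omega>) \<partial>M) - (\<integral>z. f z \<partial>?nu)\<bar> \<le> (4 * Cb + 2 * (2 * D)) * rho (q/2) ^ m"
    by (rule decouple_Lp[OF i(1) U V f]) (use q i3 e3 i4 e4 in auto)
  have fi: "integrable ?nu f" by (rule Bochner_Integration.integrable_bound[of _ "\<lambda>z. 1 + \<bar>f z\<bar> powr (q/2)"])
     (use i3 powr_one_abs_le[of "q/2"] q in auto)
  \<comment> \<open>The isolated variable is integrated out first: it occurs in one factor only,
    whose integral is zero for every value of the other variables.\<close>
  have "(\<integral>z. f z \<partial>?nu) = (\<integral>v. \<integral>x. f (x, v) \<partial>distr M borel (X i) \<partial>distr M ?B V)"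
    using p.integral_snd[of "\<lambda>x v. f (x, v)"] fi by simp
  also have "\<dots> = 0" unfolding i1 f_def by (simp add: deg1[unfolded One_nat_def])
  finally show ?thesis using d by (simp add: W_def Kg_def rg_def f_def V_def)
qed

text \<open>Mirror image of \<open>W_left\<close> for an isolated largest index: everything else is
  now the past, and degeneracy in the second argument is used.\<close>

lemma W_right:
  assumes i: "1 \<le> i" "1 \<le> i'" "1 \<le> j'" "i + m \<le> j" "i' + m \<le> j" "j' + m \<le> j"
  shows "\<bar>W i j i' j'\<bar> \<le> Kg * rg ^ m"
proof -
  define U where "U \<omega> = (X i \<omega>, X i' \<omega>, X j' \<omega>)" for \<omega>
  define f where "f z = g (fst (fst z)) (snd z) * g (fst (snd (fst z))) (snd (snd (fst z)))" for z :: "(real \<times> real \<times> real) \<times> real"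
  let ?B = "borel \<Otimes>\<^sub>M borel \<Otimes>\<^sub>M borel :: (real \<times> real \<times> real) measure"
  define k where "k = j - m"
  have k: "k \<ge> 1" "i \<le> k" "i' \<le> k" "j' \<le> k" "k + m = j" using i by (auto simp: k_def)
  have V: "X j \<in> borel_measurable (gs {k+m..})" by (rule X_gs) (use k in auto)
  have U: "U \<in> measurable (gs {1..k}) ?B" unfolding U_def
    by (intro measurable_Pair X_gs) (use i k in auto)
  have f[measurable]: "f \<in> borel_measurable (?B \<Otimes>\<^sub>M borel)" unfolding f_def by measurable
  note UM[measurable] = measurable_gsD[OF U] and VM[measurable] = measurable_gsD[OF V]
  interpret p: pair_prob_space "distr M ?B U" "distr M borel (X j)" by (rule decouple_spaces(4)[OF UM VM])
  let ?nu = "distr M ?B U \<Otimes>\<^sub>M distr M borel (X j)"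
  have i1: "distr M borel (X i) = distr M borel (X 1)" by (rule stat_one) (use i in auto)
  have j1: "distr M borel (X j) = distr M borel (X 1)" by (rule stat_one) (use i in auto)
  have n1: "(\<integral>\<^sup>+z. ennreal (\<bar>g (fst (fst z)) (snd z)\<bar> powr q) \<partial>?nu) \<le> ennreal D"
  proof -
    have "(\<integral>\<^sup>+z. ennreal (\<bar>g (fst (fst z)) (snd z)\<bar> powr q) \<partial>?nu) = (\<integral>\<^sup>+v. \<integral>\<^sup>+y. ennreal (\<bar>g (fst v) y\<bar> powr q) \<partial>distr M borel (X j) \<partial>distr M ?B U)"
      by (subst p.M2.nn_integral_fst[symmetric]) (auto intro!: nn_integral_cong)
    also have "\<dots> = (\<integral>\<^sup>+x. \<integral>\<^sup>+y. ennreal (\<bar>g x y\<bar> powr q) \<partial>distr M borel (X j) \<partial>distr M borel (X i))"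
    proof -
      have [measurable]: "(\<lambda>x. \<integral>\<^sup>+y. ennreal (\<bar>g x y\<bar> powr q) \<partial>distr M borel (X j)) \<in> borel_measurable borel"
        by (rule p.M2.borel_measurable_nn_integral) simp
      show ?thesis by (subst (1 3) nn_integral_distr) (auto simp: U_def)
    qed
    finally show ?thesis unfolding i1 j1 using gq2 by simp
  qed
  have n2: "(\<integral>\<^sup>+z. ennreal (\<bar>g (fst (snd (fst z))) (snd (snd (fst z)))\<bar> powr q) \<partial>?nu) \<le> ennreal D"
  proof -
    have "(\<integral>\<^sup>+z. ennreal (\<bar>g (fst (snd (fst z))) (snd (snd (fst z)))\<bar> powr q) \<partial>?nu) = (\<integral>\<^sup>+v. \<integral>\<^sup>+y. ennreal (\<bar>g (fst (snd v)) (snd (snd v))\<bar> powr q) \<partial>distr M borel (X j) \<partial>distr M ?B U)"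
      by (subst p.M2.nn_integral_fst[symmetric]) (auto intro!: nn_integral_cong)
    also have "\<dots> = (\<integral>\<^sup>+v. ennreal (\<bar>g (fst (snd v)) (snd (snd v))\<bar> powr q) \<partial>distr M ?B U)"
      by (simp add: p.M2.emeasure_space_1[simplified])
    also have "\<dots> = (\<integral>\<^sup>+\<omega>. ennreal (\<bar>g (X i' \<omega>) (X j' \<omega>)\<bar> powr q) \<partial>M)"
      by (simp add: nn_integral_distr U_def)
    finally show ?thesis using gq[of i' j'] i by simp
  qed
  note a1 = integrable_of_nn_le[OF _ _ n1 D] and a2 = integrable_of_nn_le[OF _ _ n2 D]
  have b1: "integrable ?nu (\<lambda>z. \<bar>g (fst (fst z)) (snd z)\<bar> powr q)" "(\<integral>z. \<bar>g (fst (fst z)) (snd z)\<bar> powr q \<partial>?nu) \<le> D"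
    by (rule a1; simp)+
  have b2: "integrable ?nu (\<lambda>z. \<bar>g (fst (snd (fst z))) (snd (snd (fst z)))\<bar> powr q)" "(\<integral>z. \<bar>g (fst (snd (fst z))) (snd (snd (fst z)))\<bar> powr q \<partial>?nu) \<le> D"
    by (rule a2; simp)+
  have i3: "integrable ?nu (\<lambda>z. \<bar>f z\<bar> powr (q/2))"
    by (rule Bochner_Integration.integrable_bound[OF Bochner_Integration.integrable_add[OF b1(1) b2(1)]]) (auto simp: f_def intro!: le_half)
  have e3: "(\<integral>z. \<bar>f z\<bar> powr (q/2) \<partial>?nu) \<le> 2 * D"
  proof -
    have "(\<integral>z. \<bar>f z\<bar> powr (q/2) \<partial>?nu) \<le> (\<integral>z. \<bar>g (fst (fst z)) (snd z)\<bar> powr q + \<bar>g (fst (snd (fst z))) (snd (snd (fst z)))\<bar> powr q \<partial>?nu)"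
      by (rule integral_mono[OF i3 Bochner_Integration.integrable_add[OF b1(1) b2(1)]]) (simp add: f_def le_half)
    then show ?thesis using b1 b2 by simp
  qed
  have c1: "integrable M (\<lambda>\<omega>. \<bar>g (X i \<omega>) (X j \<omega>)\<bar> powr q)" "(\<integral>\<omega>. \<bar>g (X i \<omega>) (X j \<omega>)\<bar> powr q \<partial>M) \<le> D"
    and c2: "integrable M (\<lambda>\<omega>. \<bar>g (X i' \<omega>) (X j' \<omega>)\<bar> powr q)" "(\<integral>\<omega>. \<bar>g (X i' \<omega>) (X j' \<omega>)\<bar> powr q \<partial>M) \<le> D"
    using gX_q[of i j] gX_q[of i' j'] i by auto
  have i4: "integrable M (\<lambda>\<omega>. \<bar>f (U \<omega>, X j \<omega>)\<bar> powr (q/2))"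
    by (rule Bochner_Integration.integrable_bound[OF Bochner_Integration.integrable_add[OF c1(1) c2(1)]]) (auto simp: f_def U_def intro!: le_half)
  have e4: "(\<integral>\<omega>. \<bar>f (U \<omega>, X j \<omega>)\<bar> powr (q/2) \<partial>M) \<le> 2 * D"
  proof -
    have "(\<integral>\<omega>. \<bar>f (U \<omega>, X j \<omega>)\<bar> powr (q/2) \<partial>M) \<le> (\<integral>\<omega>. \<bar>g (X i \<omega>) (X j \<omega>)\<bar> powr q + \<bar>g (X i' \<omega>) (X j' \<omega>)\<bar> powr q \<partial>M)"
      by (rule integral_mono[OF i4 Bochner_Integration.integrable_add[OF c1(1) c2(1)]]) (simp add: f_def U_def le_half)
    then show ?thesis using c1 c2 by simp
  qed
  have d: "\<bar>(\<integral>\<omega>. f (U \<omega>, X j \<omega>) \<partial>M) - (\<integral>z. f z \<partial>?nu)\<bar> \<le> (4 * Cb + 2 * (2 * D)) * rho (q/2) ^ m"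
    by (rule decouple_Lp[OF k(1) U V f]) (use q i3 e3 i4 e4 in auto)
  have fi: "integrable ?nu f" by (rule Bochner_Integration.integrable_bound[of _ "\<lambda>z. 1 + \<bar>f z\<bar> powr (q/2)"])
     (use i3 powr_one_abs_le[of "q/2"] q in auto)
  have "(\<integral>z. f z \<partial>?nu) = (\<integral>v. \<integral>y. f (v, y) \<partial>distr M borel (X j) \<partial>distr M ?B U)"
    using p.integral_fst[of "\<lambda>v y. f (v, y)"] fi by simp
  also have "\<dots> = 0" unfolding j1 f_def by (simp add: deg2[unfolded One_nat_def])
  finally show ?thesis using d by (simp add: W_def Kg_def rg_def f_def U_def)
qed

text \<open>Because i < j and i' < j', the smallest of the four indices is i or i' and the largest
  is j or j'. If neither the smallest nor the largest were separated from the others by m, the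
  quadruple would fall into one of the two excluded patterns.\<close>

lemma W_far:
  assumes "1 \<le> i" "i < j" "1 \<le> i'" "i' < j'"
    and "\<not> (close m i i' \<and> close m j j')" "\<not> (close m i j \<and> close m i' j')"
  shows "\<bar>W i j i' j'\<bar> \<le> Kg * rg ^ m"
proof -
  have "(i + m \<le> j \<and> i + m \<le> i' \<and> i + m \<le> j') \<or> (i' + m \<le> j \<and> i' + m \<le> i \<and> i' + m \<le> j')
     \<or> (i + m \<le> j \<and> i' + m \<le> j \<and> j' + m \<le> j) \<or> (i + m \<le> j' \<and> i' + m \<le> j' \<and> j + m \<le> j')"
    using assms unfolding close_def by linarith
  then consider "i + m \<le> j \<and> i + m \<le> i' \<and> i + m \<le> j'" | "i' + m \<le> j \<and> i' + m \<le> i \<and> i' + m \<le> j'"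
     | "i + m \<le> j \<and> i' + m \<le> j \<and> j' + m \<le> j" | "i + m \<le> j' \<and> i' + m \<le> j' \<and> j + m \<le> j'" by blast
  then show ?thesis
  proof cases
    case 1 then show ?thesis using W_left[of i m j i' j'] assms by auto
  next
    case 2 then show ?thesis using W_left[of i' m j' i j] assms by (auto simp: W_swap[of i j])
  next
    case 3 then show ?thesis using W_right[of i i' j' m j] assms by auto
  next
    case 4 then show ?thesis using W_right[of i' i j m j'] assms by (auto simp: W_swap[of i j])
  qed
qed

text \<open>Indices are shifted to start at 0, as the dyadic blocks do, and pairs on or below the
  diagonal are set to zero, so that \<open>W_far\<close> covers all remaining pairs.\<close>

definition yg :: "nat \<Rightarrow> nat \<Rightarrow> 'a \<Rightarrow> real" where
  "yg i j \<omega> = (if i < j then g (X (Suc i) \<omega>) (X (Suc j) \<omega>) else 0)"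

lemma yg_meas[measurable]: "yg i j \<in> borel_measurable M" unfolding yg_def by measurable

text \<open>The square is a sum over quadruples: far ones contribute at most
  \<open>Kg * rg ^ m\<close> each, clustered ones a bounded amount, and \<open>count_near\<close>
  counts the latter.\<close>

lemma block_square:
  assumes I: "finite I" and J: "finite J"
  shows "integrable M (\<lambda>\<omega>. (\<Sum>i\<in>I. \<Sum>j\<in>J. yg i j \<omega>)^2)"
    "(\<integral>\<omega>. (\<Sum>i\<in>I. \<Sum>j\<in>J. yg i j \<omega>)^2 \<partial>M) \<le> Kg * rg ^ m * (real (card I) * card J)^2 + (2 + 2 * D) * (8 * real m^2 * card I * card J)"
proof -
  have e: "(\<Sum>i\<in>I. \<Sum>j\<in>J. yg i j \<omega>)^2 = (\<Sum>i\<in>I. \<Sum>j\<in>J. \<Sum>i'\<in>I. \<Sum>j'\<in>J. yg i j \<omega> * yg i' j' \<omega>)" for \<omega>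
    unfolding power2_eq_square by (simp only: sum_distrib_left sum_distrib_right) (intro sum.cong refl mult.commute)
  have ii: "integrable M (\<lambda>\<omega>. yg i j \<omega> * yg i' j' \<omega>)" for i j i' j'
    unfolding yg_def using gg_int[of "Suc i" "Suc j" "Suc i'" "Suc j'"] by (cases "i < j"; cases "i' < j'"; simp)
  show "integrable M (\<lambda>\<omega>. (\<Sum>i\<in>I. \<Sum>j\<in>J. yg i j \<omega>)^2)" unfolding e by (intro Bochner_Integration.integrable_sum ii)
  have Kg: "Kg \<ge> 0" using Cb D by (simp add: Kg_def)
  have b: "(\<integral>\<omega>. yg i j \<omega> * yg i' j' \<omega> \<partial>M) \<le> Kg * rg ^ m + (2 + 2 * D) * (of_bool (close m i i') * of_bool (close m j j') + of_bool (close m i j) * of_bool (close m i' j'))"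
    (is "_ \<le> ?r") for i j i' j'
  proof (cases "i < j \<and> i' < j'")
    case False
    then have "(\<integral>\<omega>. yg i j \<omega> * yg i' j' \<omega> \<partial>M) = 0" by (auto simp: yg_def)
    also have "0 \<le> ?r" using Kg rg D by (intro add_nonneg_nonneg mult_nonneg_nonneg) auto
    finally show ?thesis .
  next
    case True
    then have w: "(\<integral>\<omega>. yg i j \<omega> * yg i' j' \<omega> \<partial>M) = W (Suc i) (Suc j) (Suc i') (Suc j')" by (auto simp: yg_def W_def)
    show ?thesis
    proof (cases "(close m i i' \<and> close m j j') \<or> (close m i j \<and> close m i' j')")
      case near: True
      have "W (Suc i) (Suc j) (Suc i') (Suc j') \<le> 2 + 2 * D" using W_le[of "Suc i" "Suc j" "Suc i'" "Suc j'"] by auto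
      also have "\<dots> = 0 + (2 + 2 * D) * 1" by simp
      also have "\<dots> \<le> ?r"
        using near Kg rg D by (intro add_mono mult_left_mono mult_nonneg_nonneg) auto
      finally show ?thesis using w by simp
    next
      case False
      then have "W (Suc i) (Suc j) (Suc i') (Suc j') \<le> Kg * rg ^ m"
        using W_far[of "Suc i" "Suc j" "Suc i'" "Suc j'" m] True by (auto simp: close_def)
      also have "\<dots> \<le> ?r" using D by simp
      finally show ?thesis using w by simp
    qed
  qed
  have "(\<integral>\<omega>. (\<Sum>i\<in>I. \<Sum>j\<in>J. yg i j \<omega>)^2 \<partial>M) = (\<Sum>i\<in>I. \<Sum>j\<in>J. \<Sum>i'\<in>I. \<Sum>j'\<in>J. (\<integral>\<omega>. yg i j \<omega> * yg i' j' \<omega> \<partial>M))"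
    unfolding e by (simp add: Bochner_Integration.integral_sum Bochner_Integration.integrable_sum ii)
  also have "\<dots> \<le> (\<Sum>i\<in>I. \<Sum>j\<in>J. \<Sum>i'\<in>I. \<Sum>j'\<in>J. Kg * rg ^ m + (2 + 2 * D) * (of_bool (close m i i') * of_bool (close m j j') + of_bool (close m i j) * of_bool (close m i' j')))"
    by (intro sum_mono b)
  also have "\<dots> = Kg * rg ^ m * (real (card I) * card J)^2 + (2 + 2 * D) * (\<Sum>i\<in>I. \<Sum>j\<in>J. \<Sum>i'\<in>I. \<Sum>j'\<in>J. (of_bool (close m i i') * of_bool (close m j j') + of_bool (close m i j) * of_bool (close m i' j')))"
    by (simp only: sum.distrib[of "\<lambda>_. Kg * rg ^ m"] sum.distrib sum_distrib_left[symmetric])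
       (simp add: power2_eq_square mult_ac)
  also have "\<dots> \<le> Kg * rg ^ m * (real (card I) * card J)^2 + (2 + 2 * D) * (8 * real m^2 * card I * card J)"
    using count_near[OF I J, of m] D by (intro add_left_mono mult_left_mono) auto
  finally show "(\<integral>\<omega>. (\<Sum>i\<in>I. \<Sum>j\<in>J. yg i j \<omega>)^2 \<partial>M) \<le> Kg * rg ^ m * (real (card I) * card J)^2 + (2 + 2 * D) * (8 * real m^2 * card I * card J)" .
qed

text \<open>The right-hand side of \<open>rademacher_menshov2\<close>: one integrable variable that
  dominates the squares of all corner sums at once.\<close>

definition Qg :: "nat \<Rightarrow> 'a \<Rightarrow> real" where
  "Qg r \<omega> = (real r + 1)^2 *
     (\<Sum>s\<le>r. \<Sum>c<2^(r-s). \<Sum>s'\<le>r. \<Sum>c'<2^(r-s'). (\<Sum>i\<in>blk s' c'. \<Sum>j\<in>blk s c. yg i j \<omega>)^2)"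

lemma Qg_bound: "a \<le> 2^r \<Longrightarrow> b \<le> 2^r \<Longrightarrow> (\<Sum>j<b. \<Sum>i<a. yg i j \<omega>)^2 \<le> Qg r \<omega>"
  unfolding Qg_def by (rule rademacher_menshov2)

text \<open>The condition on m makes the far part of each block at most a constant times its area.
  The blocks of a fixed pair of levels tile a square of area 4^r, and the (r + 1)^2 pairs of levels
  multiply the factor (r + 1)^2 of the chaining.\<close>

lemma Qg_expect:
  assumes m: "rg ^ m * 4 ^ r \<le> 1"
  shows "integrable M (Qg r)" "(\<integral>\<omega>. Qg r \<omega> \<partial>M) \<le> (real r + 1)^4 * 4^r * (Kg + (2 + 2 * D) * 8 * real m^2)"
proof -
  show "integrable M (Qg r)" unfolding Qg_def
    by (intro integrable_mult_right Bochner_Integration.integrable_sum block_square) auto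
  have Kg: "Kg \<ge> 0" using Cb D by (simp add: Kg_def)
  let ?C = "Kg + (2 + 2 * D) * 8 * real m^2"
  have C: "?C \<ge> 0" using Kg D by simp
  have b: "(\<integral>\<omega>. (\<Sum>i\<in>blk s' c'. \<Sum>j\<in>blk s c. yg i j \<omega>)^2 \<partial>M) \<le> 2^s * 2^s' * ?C" if "s \<le> r" "s' \<le> r" for s s' c c'
  proof -
    have "(\<integral>\<omega>. (\<Sum>i\<in>blk s' c'. \<Sum>j\<in>blk s c. yg i j \<omega>)^2 \<partial>M) \<le> Kg * rg ^ m * (2^s' * 2^s)^2 + (2 + 2 * D) * (8 * real m^2 * 2^s' * 2^s)"
      using block_square(2)[of "blk s' c'" "blk s c" m] by simp
    also have "Kg * rg ^ m * (2^s' * 2^s)^2 = Kg * (rg ^ m * (2^s' * 2^s)) * (2^s * 2^s')" by (simp add: power2_eq_square)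
    also have "\<dots> \<le> Kg * 1 * (2^s * 2^s')"
    proof (intro mult_right_mono mult_left_mono Kg)
      have "(2::real)^s' * 2^s \<le> 2^r * 2^r" using that by (intro mult_mono power_increasing) auto
      also have "\<dots> = 4^r" by (simp add: power_mult_distrib[symmetric])
      finally have "rg ^ m * (2^s' * 2^s) \<le> rg ^ m * 4^r" using rg by (intro mult_left_mono) auto
      then show "rg ^ m * (2^s' * 2^s) \<le> 1" using m by linarith
    qed auto
    finally show ?thesis by (simp add: algebra_simps)
  qed
  have "(\<integral>\<omega>. Qg r \<omega> \<partial>M) = (real r + 1)^2 * (\<Sum>s\<le>r. \<Sum>c<2^(r-s). \<Sum>s'\<le>r. \<Sum>c'<2^(r-s'). (\<integral>\<omega>. (\<Sum>i\<in>blk s' c'. \<Sum>j\<in>blk s c. yg i j \<omega>)^2 \<partial>M))"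
    unfolding Qg_def by (simp add: Bochner_Integration.integral_sum Bochner_Integration.integrable_sum block_square)
  also have "\<dots> \<le> (real r + 1)^2 * (\<Sum>s\<le>r. \<Sum>c<(2::nat)^(r-s). \<Sum>s'\<le>r. \<Sum>c'<(2::nat)^(r-s'). 2^s * 2^s' * ?C)"
    by (intro mult_left_mono sum_mono b) auto
  also have "(\<Sum>s\<le>r. \<Sum>c<(2::nat)^(r-s). \<Sum>s'\<le>r. \<Sum>c'<(2::nat)^(r-s'). 2^s * 2^s' * ?C) = (\<Sum>s\<le>r. \<Sum>s'\<le>r. 4^r * ?C)"
  proof (rule sum.cong[OF refl])
    fix s assume s: "s \<in> {..r}"
    have "(\<Sum>c<(2::nat)^(r-s). \<Sum>s'\<le>r. \<Sum>c'<(2::nat)^(r-s'). 2^s * 2^s' * ?C) = (\<Sum>s'\<le>r. (2::real)^(r-s) * (2^(r-s') * (2^s * 2^s' * ?C)))"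
      by (simp add: sum_distrib_left)
    also have "\<dots> = (\<Sum>s'\<le>r. 4^r * ?C)"
    proof (rule sum.cong[OF refl])
      fix s' assume s': "s' \<in> {..r}"
      have "(2::real)^(r-s) * 2^s = 2^r" "(2::real)^(r-s') * 2^s' = 2^r" using s s' by (auto simp: power_add[symmetric])
      then have "((2::real)^(r-s) * 2^s) * (2^(r-s') * 2^s') = 4^r" by (simp add: power_mult_distrib[symmetric])
      then show "(2::real)^(r-s) * (2^(r-s') * (2^s * 2^s' * ?C)) = 4^r * ?C" by (simp add: mult_ac)
    qed
    finally show "(\<Sum>c<(2::nat)^(r-s). \<Sum>s'\<le>r. \<Sum>c'<(2::nat)^(r-s'). 2^s * 2^s' * ?C) = (\<Sum>s'\<le>r. 4^r * ?C)" .
  qed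
  also have "\<dots> = (real r + 1)^2 * (4^r * ?C)" by (simp add: power2_eq_square algebra_simps)
  finally show "(\<integral>\<omega>. Qg r \<omega> \<partial>M) \<le> (real r + 1)^4 * 4^r * ?C" by (simp add: power2_eq_square power4_eq_xxxx mult_ac)
qed

text \<open>Any logarithmic gap \<open>m\<close> with a large enough constant makes the far pairs negligible.\<close>

lemma degenerate_negligible:
  "\<exists>Q :: nat \<Rightarrow> 'a \<Rightarrow> real. (\<forall>n. integrable M (Q n)) \<and> (\<forall>n a b \<omega>. a \<le> n \<longrightarrow> b \<le> n \<longrightarrow> (\<Sum>j<b. \<Sum>i<a. yg i j \<omega>)^2 \<le> Q n \<omega>)
     \<and> (\<lambda>n. (\<integral>\<omega>. Q n \<omega> \<partial>M) / real n ^ 3) \<longlonglongrightarrow> 0"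
proof -
  \<comment> \<open>With the gap \<open>c * r\<close> the area 4^r of the square is beaten by
    \<open>rg ^ (c * r)\<close>.\<close>
  obtain c :: nat where c: "rg ^ c < 1/4" using real_arch_pow_inv[of "1/4" rg] rg by auto
  \<comment> \<open>The level of a dyadic square that contains all indices up to n; 4^r is at most 4
    n^2, so the expectation is of order n^2 times a power of log n, against n^3.\<close>
  define r where "r n = nat \<lceil>log 2 (real n)\<rceil>" for n :: nat
  have Kg: "Kg \<ge> 0" using Cb D by (simp add: Kg_def)
  have m: "rg ^ (c * r n) * 4 ^ r n \<le> 1" for n
  proof -
    have "rg ^ (c * r n) * 4 ^ r n = (rg ^ c * 4) ^ r n" by (simp add: power_mult power_mult_distrib)
    also have "\<dots> \<le> 1" using c rg by (intro power_le_one) auto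
    finally show ?thesis .
  qed
  have n2: "n \<le> 2 ^ r n" for n
  proof (cases "n = 0")
    case False
    then have "real n = 2 powr (log 2 n)" by simp
    also have "\<dots> \<le> 2 powr (real (r n))" unfolding r_def by (intro powr_mono) linarith+
    also have "\<dots> = 2 ^ r n" by (simp add: powr_realpow)
    finally show ?thesis by (metis of_nat_le_iff of_nat_numeral of_nat_power)
  qed simp
  define B where "B n = 4 * (log 2 (real n) + 2)^4 * (Kg + (2 + 2 * D) * 8 * (real c)^2 * (log 2 (real n) + 1)^2) / n" for n :: nat
  have ub: "(\<integral>\<omega>. Qg (r n) \<omega> \<partial>M) / real n ^ 3 \<le> B n" if n: "n \<ge> 1" for n
  proof -
    have lg: "log 2 n \<ge> 0" using n by simp
    have rn: "real (r n) \<le> log 2 n + 1" unfolding r_def using lg by linarith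
    have r2: "(2::real) ^ r n \<le> 2 * real n"
    proof -
      have "(2::real) ^ r n = 2 powr r n" by (simp add: powr_realpow)
      also have "\<dots> \<le> 2 powr (log 2 n + 1)" using rn by (intro powr_mono) auto
      also have "\<dots> = 2 * real n" using n by (simp add: powr_add)
      finally show ?thesis .
    qed
    have r4: "(4::real) ^ r n \<le> 4 * n^2"
    proof -
      have "(4::real) ^ r n = (2 ^ r n)^2" by (simp add: power_mult[symmetric] mult.commute[of "r n"] power_mult)
      also have "\<dots> \<le> (2 * real n)^2" using r2 by (intro power_mono) auto
      finally show ?thesis by (simp add: power_mult_distrib)
    qed
    have "(\<integral>\<omega>. Qg (r n) \<omega> \<partial>M) \<le> (real (r n) + 1)^4 * 4^(r n) * (Kg + (2 + 2 * D) * 8 * real (c * r n)^2)"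
      by (rule Qg_expect(2)[OF m])
    also have "\<dots> \<le> (log 2 n + 2)^4 * (4 * n^2) * (Kg + (2 + 2 * D) * 8 * ((real c)^2 * (log 2 n + 1)^2))"
    proof (intro mult_mono r4)
      show "(real (r n) + 1)^4 \<le> (log 2 n + 2)^4" using rn by (intro power_mono) auto
      have "real (c * r n)^2 \<le> (real c)^2 * (log 2 n + 1)^2"
        unfolding of_nat_mult power_mult_distrib using rn by (intro mult_left_mono power_mono) auto
      then show "Kg + (2 + 2 * D) * 8 * real (c * r n)^2 \<le> Kg + (2 + 2 * D) * 8 * ((real c)^2 * (log 2 n + 1)^2)"
        using D by (intro add_left_mono mult_left_mono) auto
    qed (use Kg D in \<open>auto intro!: add_nonneg_nonneg mult_nonneg_nonneg\<close>)
    also have "\<dots> = B n * n ^ 3" unfolding B_def using n by (simp add: field_simps power2_eq_square power3_eq_cube)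
    finally show ?thesis using n by (simp add: pos_divide_le_eq)
  qed
  have B0: "B \<longlonglongrightarrow> 0"
  proof -
    have 1: "(\<lambda>n::nat. (log 2 (real n) + 2)^4 / n) \<longlonglongrightarrow> 0" by real_asymp
    have 2: "(\<lambda>n::nat. (log 2 (real n) + 2)^4 * (log 2 (real n) + 1)^2 / n) \<longlonglongrightarrow> 0" by real_asymp
    have "(\<lambda>n. 4 * Kg * ((log 2 (real n) + 2)^4 / n) + 4 * (2 + 2 * D) * 8 * (real c)^2 * ((log 2 (real n) + 2)^4 * (log 2 (real n) + 1)^2 / n)) \<longlonglongrightarrow> 4 * Kg * 0 + 4 * (2 + 2 * D) * 8 * (real c)^2 * 0"
      by (intro tendsto_intros 1 2)
    moreover have "B = (\<lambda>n. 4 * Kg * ((log 2 (real n) + 2)^4 / n) + 4 * (2 + 2 * D) * 8 * (real c)^2 * ((log 2 (real n) + 2)^4 * (log 2 (real n) + 1)^2 / n))"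
      unfolding B_def by (rule ext, simp only: distrib_left add_divide_distrib) (simp add: mult_ac)
    ultimately show ?thesis by simp
  qed
  have "(\<lambda>n. (\<integral>\<omega>. Qg (r n) \<omega> \<partial>M) / real n ^ 3) \<longlonglongrightarrow> 0"
  proof (rule tendsto_sandwich[OF _ _ tendsto_const B0])
    have "(\<integral>\<omega>. Qg (r n) \<omega> \<partial>M) \<ge> 0" for n
      by (rule Bochner_Integration.integral_nonneg) (auto simp: Qg_def intro!: mult_nonneg_nonneg sum_nonneg)
    then show "\<forall>\<^sub>F n in sequentially. 0 \<le> (\<integral>\<omega>. Qg (r n) \<omega> \<partial>M) / real n ^ 3" by simp
    show "\<forall>\<^sub>F n in sequentially. (\<integral>\<omega>. Qg (r n) \<omega> \<partial>M) / real n ^ 3 \<le> B n"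
      using eventually_ge_at_top[of 1] by eventually_elim (rule ub)
  qed
  then show ?thesis
    using Qg_expect(1)[OF m] Qg_bound n2 by (intro exI[of _ "\<lambda>n. Qg (r n)"]) (meson order_trans)
qed

end

section \<open>Convergence of finite-dimensional distributions\<close>

context mixing_fun begin

lemma SA_shift_expect:
  fixes f :: "real \<Rightarrow> 'b::{banach, second_countable_topology}"
  assumes [measurable]: "f \<in> borel_measurable borel"
  shows "(\<integral>\<omega>. f (SA {a<..a+N} \<omega>) \<partial>M) = (\<integral>\<omega>. f (SA {0<..N} \<omega>) \<partial>M)"
proof -
  have z: "{0<..N} = {1..N}" by auto
  have "distr M borel (SA {a<..a+N}) = distr M borel (SA {0<..N})"
    unfolding SA_def z by (rule stat_sum) simp
  then show ?thesis using integral_distr[of "SA {a<..a+N}" M borel f] integral_distr[of "SA {0<..N}" M borel f] by simp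
qed

text \<open>The sums may start anywhere, by stationarity. Normalising by n instead of the length
  \<open>N n\<close> changes the argument by a factor that converges, and the L1 norm of the
  normalised sum is bounded.\<close>

lemma clt_scaled:
  assumes N: "(\<lambda>n. real (N n) / real n) \<longlonglongrightarrow> \<kappa>" and \<kappa>: "\<kappa> > 0"
  shows "(\<lambda>n. \<integral>\<omega>. iexp (SA {a n<..a n + N n} \<omega> / sqrt (real n)) \<partial>M) \<longlonglongrightarrow> exp (- (\<kappa> * vv / 2))"
proof -
  define t where "t = sqrt \<kappa>"
  have ev: "\<forall>\<^sub>F n in sequentially. real (N n) / real n > \<kappa> / 2" using order_tendstoD(1)[OF N, of "\<kappa> / 2"] \<kappa> by simp
  have Nt: "filterlim N at_top sequentially"
  proof -
    have "filterlim (\<lambda>n::nat. \<kappa> / 2 * real n) at_top sequentially"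
      by (rule filterlim_tendsto_pos_mult_at_top[OF tendsto_const]) (use \<kappa> filterlim_real_sequentially in auto)
    moreover have "\<forall>\<^sub>F n in sequentially. \<kappa> / 2 * real n \<le> real (N n)"
      using ev eventually_gt_at_top[of 0] by eventually_elim (simp add: field_simps)
    ultimately have "filterlim (\<lambda>n. real (N n)) at_top sequentially" by (rule filterlim_at_top_mono)
    then have "\<forall>\<^sub>F n in sequentially. real Z \<le> real (N n)" for Z unfolding filterlim_at_top by blast
    then show ?thesis unfolding filterlim_at_top of_nat_le_iff by blast
  qed
  have 1: "(\<lambda>n. \<integral>\<omega>. iexp (t / sqrt (real (N n)) * SA {0<..N n} \<omega>) \<partial>M) \<longlonglongrightarrow> exp (- (t^2 * vv / 2))"
    by (rule filterlim_compose[OF clt Nt])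
  have 2: "(\<lambda>n. (\<integral>\<omega>. iexp (SA {0<..N n} \<omega> / sqrt (real n)) \<partial>M) - (\<integral>\<omega>. iexp (t / sqrt (real (N n)) * SA {0<..N n} \<omega>) \<partial>M)) \<longlonglongrightarrow> 0"
  proof (rule Lim_null_comparison)
    have "(\<lambda>n. sqrt Cv * \<bar>sqrt (real (N n) / real n) - t\<bar>) \<longlonglongrightarrow> sqrt Cv * \<bar>sqrt \<kappa> - t\<bar>"
      by (intro tendsto_intros N)
    then show "(\<lambda>n. sqrt Cv * \<bar>sqrt (real (N n) / real n) - t\<bar>) \<longlonglongrightarrow> 0" by (simp add: t_def)
    show "\<forall>\<^sub>F n in sequentially. norm ((\<integral>\<omega>. iexp (SA {0<..N n} \<omega> / sqrt (real n)) \<partial>M) - (\<integral>\<omega>. iexp (t / sqrt (real (N n)) * SA {0<..N n} \<omega>) \<partial>M)) \<le> sqrt Cv * \<bar>sqrt (real (N n) / real n) - t\<bar>"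
      using ev eventually_gt_at_top[of 0]
    proof eventually_elim
      case (elim n)
      have Np: "real (N n) > 0" using elim \<kappa> by (cases "N n = 0") auto
      have sq: "{0<..N n} \<subseteq> {1..}" "finite {0<..N n}" by auto
      have ii: "integrable M (\<lambda>\<omega>. iexp (c * SA B \<omega>))" "integrable M (\<lambda>\<omega>. iexp (SA B \<omega> / c))" for B c
        by (rule integrable_const_bound[of _ 1]; simp)+
      have "norm ((\<integral>\<omega>. iexp (SA {0<..N n} \<omega> / sqrt (real n)) \<partial>M) - (\<integral>\<omega>. iexp (t / sqrt (real (N n)) * SA {0<..N n} \<omega>) \<partial>M))
         = cmod (\<integral>\<omega>. iexp (SA {0<..N n} \<omega> / sqrt (real n)) - iexp (t / sqrt (real (N n)) * SA {0<..N n} \<omega>) \<partial>M)"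
        by (subst Bochner_Integration.integral_diff[OF ii(2) ii(1)]) simp
      also have "\<dots> \<le> (\<integral>\<omega>. cmod (iexp (SA {0<..N n} \<omega> / sqrt (real n)) - iexp (t / sqrt (real (N n)) * SA {0<..N n} \<omega>)) \<partial>M)"
        by (rule integral_norm_bound)
      also have "\<dots> \<le> (\<integral>\<omega>. \<bar>1 / sqrt n - t / sqrt (N n)\<bar> * \<bar>SA {0<..N n} \<omega>\<bar> \<partial>M)"
      proof (rule integral_mono)
        show "integrable M (\<lambda>\<omega>. cmod (iexp (SA {0<..N n} \<omega> / sqrt (real n)) - iexp (t / sqrt (real (N n)) * SA {0<..N n} \<omega>)))"
          by (intro integrable_norm Bochner_Integration.integrable_diff ii)
        fix \<omega>
        have "SA {0<..N n} \<omega> / sqrt (real n) - t / sqrt (real (N n)) * SA {0<..N n} \<omega> = (1 / sqrt n - t / sqrt (N n)) * SA {0<..N n} \<omega>"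
          by (simp add: left_diff_distrib)
        then show "cmod (iexp (SA {0<..N n} \<omega> / sqrt (real n)) - iexp (t / sqrt (real (N n)) * SA {0<..N n} \<omega>)) \<le> \<bar>1 / sqrt n - t / sqrt (N n)\<bar> * \<bar>SA {0<..N n} \<omega>\<bar>"
          using cmod_iexp_diff_le[of "SA {0<..N n} \<omega> / sqrt (real n)" "t / sqrt (real (N n)) * SA {0<..N n} \<omega>"] by (simp only: abs_mult)
      qed (use SA_square(3)[OF sq] in auto)
      also have "\<dots> = \<bar>1 / sqrt n - t / sqrt (N n)\<bar> * (\<integral>\<omega>. \<bar>SA {0<..N n} \<omega>\<bar> \<partial>M)" by simp
      also have "\<dots> \<le> \<bar>1 / sqrt n - t / sqrt (N n)\<bar> * sqrt (Cv * N n)"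
      proof (rule mult_left_mono)
        have "(\<integral>\<omega>. \<bar>SA {0<..N n} \<omega>\<bar> \<partial>M) \<le> sqrt (\<integral>\<omega>. (SA {0<..N n} \<omega>)^2 \<partial>M)"
          by (rule expectation_abs_le_sqrt) (use SA_square(1)[OF sq] in auto)
        also have "\<dots> \<le> sqrt (Cv * N n)" using SA_var_le[OF sq] by simp
        finally show "(\<integral>\<omega>. \<bar>SA {0<..N n} \<omega>\<bar> \<partial>M) \<le> sqrt (Cv * N n)" .
      qed simp
      also have "\<dots> = sqrt Cv * (sqrt (N n) * \<bar>1 / sqrt n - t / sqrt (N n)\<bar>)" by (simp add: real_sqrt_mult)
      also have "sqrt (N n) * \<bar>1 / sqrt n - t / sqrt (N n)\<bar> = \<bar>sqrt (N n) * (1 / sqrt n - t / sqrt (N n))\<bar>" by (simp add: abs_mult)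
      also have "sqrt (N n) * (1 / sqrt n - t / sqrt (N n)) = sqrt (real (N n) / real n) - t"
        using Np by (simp add: right_diff_distrib real_sqrt_divide)
      finally show ?case .
    qed
  qed
  have "(\<lambda>n. ((\<integral>\<omega>. iexp (SA {0<..N n} \<omega> / sqrt (real n)) \<partial>M) - (\<integral>\<omega>. iexp (t / sqrt (real (N n)) * SA {0<..N n} \<omega>) \<partial>M)) + (\<integral>\<omega>. iexp (t / sqrt (real (N n)) * SA {0<..N n} \<omega>) \<partial>M)) \<longlonglongrightarrow> 0 + complex_of_real (exp (- (t^2 * vv / 2)))"
    by (rule tendsto_add[OF 2 1])
  then have 3: "(\<lambda>n. (\<integral>\<omega>. iexp (SA {0<..N n} \<omega> / sqrt (real n)) \<partial>M)) \<longlonglongrightarrow> exp (- (\<kappa> * vv / 2))"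
    using \<kappa> by (simp add: t_def)
  have "(\<integral>\<omega>. iexp (SA {a n<..a n + N n} \<omega> / sqrt (real n)) \<partial>M) = (\<integral>\<omega>. iexp (SA {0<..N n} \<omega> / sqrt (real n)) \<partial>M)" for n
    by (rule SA_shift_expect[of "\<lambda>x. iexp (x / sqrt (real n))"]) simp
  then show ?thesis using 3 by simp
qed

lemma SA_abs_le: assumes "A \<subseteq> {1..}" "finite A" shows "(\<integral>\<omega>. \<bar>SA A \<omega>\<bar> \<partial>M) \<le> sqrt (Cv * card A)"
proof -
  have "(\<integral>\<omega>. \<bar>SA A \<omega>\<bar> \<partial>M) \<le> sqrt (\<integral>\<omega>. (SA A \<omega>)^2 \<partial>M)"
    by (rule expectation_abs_le_sqrt) (use SA_square(1)[OF assms] in auto)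
  also have "\<dots> \<le> sqrt (Cv * card A)" using SA_var_le[OF assms] by simp
  finally show ?thesis .
qed

end

lemma floor_div_limit:
  assumes "K \<ge> 1"
  shows "(\<lambda>n. real (n * i div K) / real n) \<longlonglongrightarrow> real i / real K"
proof (rule LIM_zero_cancel, rule Lim_null_comparison)
  show "(\<lambda>n. 1 / real n) \<longlonglongrightarrow> 0" by real_asymp
  show "\<forall>\<^sub>F n in sequentially. norm (real (n * i div K) / real n - real i / real K) \<le> 1 / real n"
    using eventually_gt_at_top[of 0]
  proof eventually_elim
    case (elim n)
    have "n * i = K * (n * i div K) + n * i mod K" by simp
    then have "real (n * i) = real (K * (n * i div K) + n * i mod K)" by presburger
    then have e: "real n * real i = real K * real (n * i div K) + real (n * i mod K)" by (simp only: of_nat_mult of_nat_add)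
    have m: "real (n * i mod K) \<le> real K" using assms by (simp add: order_less_imp_le)
    have "real (n * i div K) - real n * (real i / real K) = - real (n * i mod K) / K"
      using e assms by (simp add: field_simps)
    then have "\<bar>real (n * i div K) - real n * (real i / real K)\<bar> \<le> 1" using m assms by (simp add: abs_divide)
    moreover have "real (n * i div K) / real n - real i / real K = (real (n * i div K) - real n * (real i / real K)) / n"
      using elim by (simp add: field_simps)
    ultimately show ?case using elim by (simp add: abs_divide divide_right_mono)
  qed
qed

section \<open>Joint limits of two functions of the observations\<close>

locale mixing_pair = mixing_seq +
  fixes hh :: "nat \<Rightarrow> real \<Rightarrow> real" and q :: real
  assumes hh: "\<And>p. p \<in> {1,2} \<Longrightarrow> mixing_fun M X \<tau> Cb (hh p) q"
begin

text \<open>A one-sided long-run covariance: \<open>sg p r\<close> and \<open>sg r p\<close> may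
  differ. Only its quadratic form matters, and there both orders are added.\<close>

definition "sg p r = (\<integral>\<omega>. hh p (X 1 \<omega>) * hh r (X 1 \<omega>) \<partial>M) + 2 * (\<Sum>k. \<integral>\<omega>. hh p (X 1 \<omega>) * hh r (X (k + 2) \<omega>) \<partial>M)"

lemma hh_facts:
  assumes "p \<in> {1,2}"
  shows "hh p \<in> borel_measurable borel" "integrable M (\<lambda>\<omega>. \<bar>hh p (X 1 \<omega>)\<bar> powr q)" "(\<integral>\<omega>. hh p (X 1 \<omega>) \<partial>M) = 0"
  using hh[OF assms] unfolding mixing_fun_def mixing_fun_axioms_def by auto

lemma q: "2 < q" "q \<le> 3"
  using hh[of 1] unfolding mixing_fun_def mixing_fun_axioms_def by auto

lemma hh_q: assumes "p \<in> {1,2}" "i \<ge> 1"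
  shows "integrable M (\<lambda>\<omega>. \<bar>hh p (X i \<omega>)\<bar> powr q)"
  by (rule mixing_fun.u_q(1)[OF hh[OF assms(1)] assms(2)])

lemma hhX_meas: assumes "p \<in> {1,2}" shows "(\<lambda>\<omega>. hh p (X i \<omega>)) \<in> borel_measurable M"
  using measurable_compose[OF X_rv hh_facts(1)[OF assms]] by simp

lemma hh_int2: assumes "p \<in> {1,2}" "r \<in> {1,2}" "i \<ge> 1" "j \<ge> 1"
  shows "integrable M (\<lambda>\<omega>. hh p (X i \<omega>) * hh r (X j \<omega>))"
  by (rule integrable_mult_of_squares[OF hhX_meas hhX_meas]) (use assms mixing_fun.u_int(3)[OF hh] in auto)

lemma cross_bound:
  assumes "p \<in> {1,2}" "r \<in> {1,2}"
  shows "\<exists>C. \<forall>k. \<bar>\<integral>\<omega>. hh p (X 1 \<omega>) * hh r (X (1 + k) \<omega>) \<partial>M\<bar> \<le> C * rho (q/2) ^ k"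
proof -
  let ?D = "(\<integral>\<omega>. \<bar>hh p (X 1 \<omega>)\<bar> powr q \<partial>M) + (\<integral>\<omega>. \<bar>hh r (X 1 \<omega>)\<bar> powr q \<partial>M)"
  have "\<bar>\<integral>\<omega>. hh p (X 1 \<omega>) * hh r (X (1 + k) \<omega>) \<partial>M\<bar> \<le> (4 * Cb + 4 * ?D) * rho (q/2) ^ k" for k
  proof -
    have "\<bar>(\<integral>\<omega>. hh p (X 1 \<omega>) * hh r (X (1 + k) \<omega>) \<partial>M) - (\<integral>\<omega>. hh p (X 1 \<omega>) \<partial>M) * (\<integral>\<omega>. hh r (X (1 + k) \<omega>) \<partial>M)\<bar> \<le> (4 * Cb + 4 * ?D) * rho (q/2) ^ k"
    proof (rule cov_decay)
      show "(\<lambda>\<omega>. hh p (X 1 \<omega>)) \<in> borel_measurable (gs {1..1})" "(\<lambda>\<omega>. hh r (X (1 + k) \<omega>)) \<in> borel_measurable (gs {1 + k..})"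
        by (auto intro!: measurable_compose[OF X_gs hh_facts(1)[OF assms(1)]] measurable_compose[OF X_gs hh_facts(1)[OF assms(2)]])
      have "(\<integral>\<omega>. \<bar>hh r (X (1 + k) \<omega>)\<bar> powr q \<partial>M) = (\<integral>\<omega>. \<bar>hh r (X 1 \<omega>)\<bar> powr q \<partial>M)"
        using mixing_fun.u_q(2)[OF hh[OF assms(2)], of "1 + k"] mixing_fun.u_q(2)[OF hh[OF assms(2)], of 1] by simp
      then show "(\<integral>\<omega>. \<bar>hh r (X (1 + k) \<omega>)\<bar> powr q \<partial>M) \<le> ?D" by simp
    qed (use q hh_q assms in auto)
    then show ?thesis using hh_facts(3)[OF assms(1)] by simp
  qed
  then show ?thesis by blast
qed

lemma cross_summable:
  assumes "p \<in> {1,2}" "r \<in> {1,2}"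
  shows "summable (\<lambda>k. \<integral>\<omega>. hh p (X 1 \<omega>) * hh r (X (k + 2) \<omega>) \<partial>M)"
proof -
  obtain C where C: "\<And>k. \<bar>\<integral>\<omega>. hh p (X 1 \<omega>) * hh r (X (1 + k) \<omega>) \<partial>M\<bar> \<le> C * rho (q/2) ^ k"
    using cross_bound[OF assms] by blast
  have r: "0 < rho (q/2)" "rho (q/2) < 1" using rho[of "q/2"] q by auto
  have "summable (\<lambda>k. \<integral>\<omega>. hh p (X 1 \<omega>) * hh r (X (1 + k) \<omega>) \<partial>M)"
    by (rule summable_comparison_test'[of "\<lambda>k. C * rho (q/2) ^ k" 0]) (use C r in \<open>auto intro!: summable_mult summable_geometric\<close>)
  from summable_ignore_initial_segment[OF this, of 1] show ?thesis by (simp add: add.commute)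
qed

text \<open>The Cramer--Wold device: vectors of partial sums are reduced to a single function, whose
  long-run variance is the quadratic form of \<open>sg\<close>.\<close>

lemma comb_mixing_fun:
  assumes qq: "\<And>j. j < d \<Longrightarrow> qq j \<in> {1,2::nat}"
  shows "mixing_fun M X \<tau> Cb (\<lambda>x. \<Sum>j<d. b j * hh (qq j) x) q"
    and "mixing_fun.vv M X (\<lambda>x. \<Sum>j<d. b j * hh (qq j) x) = (\<Sum>j<d. \<Sum>l<(d::nat). b j * b l * sg (qq j) (qq l))"
proof -
  let ?u = "\<lambda>x. \<Sum>j<d. b j * hh (qq j) x"
  show mf: "mixing_fun M X \<tau> Cb ?u q"
  proof (unfold_locales)
    show um: "?u \<in> borel_measurable borel" using hh_facts(1) qq by (intro borel_measurable_sum borel_measurable_times) auto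
    show "2 < q" "q \<le> 3" using q by auto
    have i: "integrable M (\<lambda>\<omega>. real (card {..<d}) powr q * (\<Sum>j<d. \<bar>b j\<bar> powr q * \<bar>hh (qq j) (X 1 \<omega>)\<bar> powr q))"
      using hh_facts(2) qq by (intro integrable_mult_right Bochner_Integration.integrable_sum) auto
    show "integrable M (\<lambda>\<omega>. \<bar>?u (X 1 \<omega>)\<bar> powr q)"
    proof (rule Bochner_Integration.integrable_bound[OF i])
      show "(\<lambda>\<omega>. \<bar>?u (X 1 \<omega>)\<bar> powr q) \<in> borel_measurable M" using measurable_compose[OF X_rv um] by simp
      show "AE \<omega> in M. norm (\<bar>?u (X 1 \<omega>)\<bar> powr q) \<le> norm (real (card {..<d}) powr q * (\<Sum>j<d. \<bar>b j\<bar> powr q * \<bar>hh (qq j) (X 1 \<omega>)\<bar> powr q))"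
      proof (rule AE_I2)
        fix \<omega>
        have "\<bar>?u (X 1 \<omega>)\<bar> powr q \<le> real (card {..<d}) powr q * (\<Sum>j<d. \<bar>b j * hh (qq j) (X 1 \<omega>)\<bar> powr q)"
          by (rule abs_sum_powr_le) (use q in auto)
        also have "(\<Sum>j<d. \<bar>b j * hh (qq j) (X 1 \<omega>)\<bar> powr q) = (\<Sum>j<d. \<bar>b j\<bar> powr q * \<bar>hh (qq j) (X 1 \<omega>)\<bar> powr q)"
          by (simp add: abs_mult powr_mult)
        finally show "norm (\<bar>?u (X 1 \<omega>)\<bar> powr q) \<le> norm (real (card {..<d}) powr q * (\<Sum>j<d. \<bar>b j\<bar> powr q * \<bar>hh (qq j) (X 1 \<omega>)\<bar> powr q))"
          by (simp add: abs_of_nonneg sum_nonneg)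
      qed
    qed
    show "(\<integral>\<omega>. ?u (X 1 \<omega>) \<partial>M) = 0"
      using hh_facts(3) qq mixing_fun.u_int(1)[OF hh] by (subst Bochner_Integration.integral_sum) auto
  qed
  have e: "(\<integral>\<omega>. ?u (X 1 \<omega>) * ?u (X (1 + k) \<omega>) \<partial>M) = (\<Sum>j<d. \<Sum>l<d. b j * b l * (\<integral>\<omega>. hh (qq j) (X 1 \<omega>) * hh (qq l) (X (1 + k) \<omega>) \<partial>M))" for k
  proof -
    have "?u (X 1 \<omega>) * ?u (X (1 + k) \<omega>) = (\<Sum>j<d. \<Sum>l<d. b j * b l * (hh (qq j) (X 1 \<omega>) * hh (qq l) (X (1 + k) \<omega>)))" for \<omega>
      by (simp add: sum_product mult_ac)
    then have "(\<integral>\<omega>. ?u (X 1 \<omega>) * ?u (X (1 + k) \<omega>) \<partial>M) = (\<integral>\<omega>. (\<Sum>j<d. \<Sum>l<d. b j * b l * (hh (qq j) (X 1 \<omega>) * hh (qq l) (X (1 + k) \<omega>))) \<partial>M)" by simp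
    also have "\<dots> = (\<Sum>j<d. (\<integral>\<omega>. (\<Sum>l<d. b j * b l * (hh (qq j) (X 1 \<omega>) * hh (qq l) (X (1 + k) \<omega>))) \<partial>M))"
      by (rule Bochner_Integration.integral_sum) (intro Bochner_Integration.integrable_sum integrable_mult_right hh_int2 qq; simp)
    also have "\<dots> = (\<Sum>j<d. \<Sum>l<d. (\<integral>\<omega>. b j * b l * (hh (qq j) (X 1 \<omega>) * hh (qq l) (X (1 + k) \<omega>)) \<partial>M))"
      by (intro sum.cong refl Bochner_Integration.integral_sum) (intro integrable_mult_right hh_int2 qq; simp)
    finally show ?thesis by simp
  qed
  have "mixing_fun.vv M X ?u = (\<Sum>j<d. \<Sum>l<d. b j * b l * (\<integral>\<omega>. hh (qq j) (X 1 \<omega>) * hh (qq l) (X (1 + 0) \<omega>) \<partial>M))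
     + 2 * (\<Sum>k. \<Sum>j<d. \<Sum>l<d. b j * b l * (\<integral>\<omega>. hh (qq j) (X 1 \<omega>) * hh (qq l) (X (k + 2) \<omega>) \<partial>M))"
    unfolding mixing_fun.vv_def[OF mf] mixing_fun.cv_def[OF mf] e by (simp add: add.commute)
  also have "(\<Sum>k. \<Sum>j<d. \<Sum>l<d. b j * b l * (\<integral>\<omega>. hh (qq j) (X 1 \<omega>) * hh (qq l) (X (k + 2) \<omega>) \<partial>M)) = (\<Sum>j<d. \<Sum>l<d. b j * b l * (\<Sum>k. \<integral>\<omega>. hh (qq j) (X 1 \<omega>) * hh (qq l) (X (k + 2) \<omega>) \<partial>M))"
  proof -
    have "(\<lambda>k. \<Sum>j<d. \<Sum>l<d. b j * b l * (\<integral>\<omega>. hh (qq j) (X 1 \<omega>) * hh (qq l) (X (k + 2) \<omega>) \<partial>M)) sums (\<Sum>j<d. \<Sum>l<d. b j * b l * (\<Sum>k. \<integral>\<omega>. hh (qq j) (X 1 \<omega>) * hh (qq l) (X (k + 2) \<omega>) \<partial>M))"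
      by (intro sums_sum sums_mult summable_sums cross_summable) (use qq in auto)
    then show ?thesis by (rule sums_unique[symmetric])
  qed
  finally show "mixing_fun.vv M X ?u = (\<Sum>j<d. \<Sum>l<d. b j * b l * sg (qq j) (qq l))"
    unfolding sg_def by (simp add: distrib_left sum.distrib sum_distrib_left mult_ac)
qed

definition wn :: "nat \<Rightarrow> nat \<Rightarrow> real \<Rightarrow> 'a \<Rightarrow> real" where
  "wn n p t \<omega> = (\<Sum>i\<in>{0<..nat \<lfloor>real n * t\<rfloor>}. hh p (X i \<omega>)) / sqrt (real n)"

text \<open>Cut into K cells of equal length, a combination of partial sums is a sum over the cells,
  with one function per cell; the cells are asymptotically independent once their ends are removed.
  The number of cells common to two partial sums produces the minimum in \<open>V\<close>, and
  \<open>V\<close> is nonnegative as an average of long-run variances.\<close>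

lemma fdd_char:
  fixes a :: "nat \<Rightarrow> real" and K d :: nat
  assumes K: "K \<ge> 1" and qq: "\<And>j. j < d \<Longrightarrow> qq j \<in> {1,2::nat}" and mm: "\<And>j. j < d \<Longrightarrow> mm j \<le> K"
  defines "V \<equiv> (\<Sum>j<d. \<Sum>l<(d::nat). a j * a l * min (real (mm j) / K) (real (mm l) / K) * sg (qq j) (qq l))"
  shows "V \<ge> 0" and "(\<lambda>n. \<integral>\<omega>. iexp (\<Sum>j<d. a j * wn n (qq j) (real (mm j) / K) \<omega>) \<partial>M) \<longlonglongrightarrow> exp (- V / 2)"
proof -
  \<comment> \<open>The j-th partial sum stops after \<open>mm j\<close> cells, so it contributes to
    cell i exactly when i < mm j.\<close>
  define b where "b i j = (if i < mm j then a j else 0)" for i j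
  define u where "u i x = (\<Sum>j<d. b i j * hh (qq j) x)" for i x
  have mf: "mixing_fun M X \<tau> Cb (u i) q" for i unfolding u_def by (rule comb_mixing_fun(1)) (use qq in auto)
  have vv: "mixing_fun.vv M X (u i) = (\<Sum>j<d. \<Sum>l<d. b i j * b i l * sg (qq j) (qq l))" for i
    unfolding u_def by (rule comb_mixing_fun(2)) (use qq in auto)
  have V: "(\<Sum>i<K. mixing_fun.vv M X (u i)) / K = V"
  proof -
    have "(\<Sum>i<K. mixing_fun.vv M X (u i)) = (\<Sum>j<d. \<Sum>l<d. \<Sum>i<K. b i j * b i l * sg (qq j) (qq l))"
      unfolding vv by (subst sum.swap, rule sum.cong[OF refl], rule sum.swap)
    also have "\<dots> = (\<Sum>j<d. \<Sum>l<d. a j * a l * real (min (mm j) (mm l)) * sg (qq j) (qq l))"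
    proof (intro sum.cong refl)
      fix j l assume jl: "j \<in> {..<d}" "l \<in> {..<d}"
      have "(\<Sum>i<K. b i j * b i l * sg (qq j) (qq l)) = (\<Sum>i\<in>{..<K} \<inter> {i. i < min (mm j) (mm l)}. a j * a l * sg (qq j) (qq l))"
        by (subst sum.inter_restrict) (auto simp: b_def intro!: sum.cong)
      also have "{..<K} \<inter> {i. i < min (mm j) (mm l)} = {..<min (mm j) (mm l)}" using mm jl by fastforce
      finally show "(\<Sum>i<K. b i j * b i l * sg (qq j) (qq l)) = a j * a l * real (min (mm j) (mm l)) * sg (qq j) (qq l)" by simp
    qed
    finally have "(\<Sum>i<K. mixing_fun.vv M X (u i)) / K = (\<Sum>j<d. \<Sum>l<d. a j * a l * real (min (mm j) (mm l)) * sg (qq j) (qq l)) / K" by simp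
    also have "\<dots> = V" unfolding V_def sum_divide_distrib
    proof (intro sum.cong refl)
      fix j l
      have "min (real (mm j) / K) (real (mm l) / K) = real (min (mm j) (mm l)) / K"
        using K by (auto simp: min_def divide_right_mono field_simps)
      then show "a j * a l * real (min (mm j) (mm l)) * sg (qq j) (qq l) / K = a j * a l * min (real (mm j) / K) (real (mm l) / K) * sg (qq j) (qq l)" by simp
    qed
    finally show ?thesis .
  qed
  show "V \<ge> 0" unfolding V[symmetric] by (intro divide_nonneg_nonneg sum_nonneg) (use mixing_fun.vv_nonneg[OF mf] in auto)
  define c where "c n i = n * i div K" for n i :: nat
  define G where "G n = nat \<lceil>ln (real n)\<rceil> ^ 2" for n :: nat
  define S where "S i A \<omega> = (\<Sum>k\<in>A. u i (X k \<omega>))" for i A \<omega>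
  have S_eq: "S i A = mixing_fun.SA X (u i) A" for i A
    unfolding S_def mixing_fun.SA_def[OF mf] by (rule ext) simp
  have cm: "c n i \<le> c n (Suc i)" for n i unfolding c_def by (intro div_le_mono) simp
  have floor_c: "nat \<lfloor>real n * (real m / K)\<rfloor> = c n m" for n m
    using floor_divide_of_nat_eq[of "n * m" K, where ?'a=real] unfolding c_def by simp
  have part: "(\<Sum>k\<in>{0<..c n m}. f k) = (\<Sum>i<m. \<Sum>k\<in>{c n i<..c n (Suc i)}. f k)" for n m and f :: "nat \<Rightarrow> real"
  proof (induction m)
    case 0 then show ?case by (simp add: c_def)
  next
    case (Suc m)
    have "{0<..c n (Suc m)} = {0<..c n m} \<union> {c n m<..c n (Suc m)}" using cm[of n m] by auto
    then show ?case using Suc by (simp add: sum.union_disjoint)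
  qed
  have rep: "(\<Sum>j<d. a j * wn n (qq j) (real (mm j) / K) \<omega>) = (\<Sum>i<K. S i {c n i<..c n (Suc i)} \<omega> / sqrt n)" for n \<omega>
  proof -
    have "(\<Sum>j<d. a j * wn n (qq j) (real (mm j) / K) \<omega>) = (\<Sum>j<d. \<Sum>i<mm j. a j * (\<Sum>k\<in>{c n i<..c n (Suc i)}. hh (qq j) (X k \<omega>)) / sqrt n)"
      unfolding wn_def floor_c part by (simp add: sum_distrib_left sum_divide_distrib)
    also have "\<dots> = (\<Sum>j<d. \<Sum>i<K. b i j * (\<Sum>k\<in>{c n i<..c n (Suc i)}. hh (qq j) (X k \<omega>)) / sqrt n)"
    proof (rule sum.cong[OF refl])
      fix j assume j: "j \<in> {..<d}"
      have "{..<K} \<inter> {i. i < mm j} = {..<mm j}" using mm[of j] j by auto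
      have "(\<Sum>i<mm j. f i) = (\<Sum>i<K. if i < mm j then f i else 0)" for f :: "nat \<Rightarrow> real"
        using sum.inter_restrict[of "{..<K}" f "{i. i < mm j}"] \<open>{..<K} \<inter> {i. i < mm j} = {..<mm j}\<close> by simp
      then show "(\<Sum>i<mm j. a j * (\<Sum>k\<in>{c n i<..c n (Suc i)}. hh (qq j) (X k \<omega>)) / sqrt n) = (\<Sum>i<K. b i j * (\<Sum>k\<in>{c n i<..c n (Suc i)}. hh (qq j) (X k \<omega>)) / sqrt n)"
        by (simp only:) (rule sum.cong, simp_all add: b_def)
    qed
    also have "\<dots> = (\<Sum>i<K. \<Sum>j<d. b i j * (\<Sum>k\<in>{c n i<..c n (Suc i)}. hh (qq j) (X k \<omega>)) / sqrt n)" by (rule sum.swap)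
    also have "\<dots> = (\<Sum>i<K. S i {c n i<..c n (Suc i)} \<omega> / sqrt n)"
    proof (intro sum.cong refl)
      fix i
      have "S i {c n i<..c n (Suc i)} \<omega> = (\<Sum>j<d. b i j * (\<Sum>k\<in>{c n i<..c n (Suc i)}. hh (qq j) (X k \<omega>)))"
        unfolding S_def u_def by (subst sum.swap) (simp add: sum_distrib_left)
      then show "(\<Sum>j<d. b i j * (\<Sum>k\<in>{c n i<..c n (Suc i)}. hh (qq j) (X k \<omega>)) / sqrt n) = S i {c n i<..c n (Suc i)} \<omega> / sqrt n"
        by (simp add: sum_divide_distrib)
    qed
    finally show ?thesis .
  qed
  \<comment> \<open>Each cell is shortened at its right end by a gap of about (log n)^2
    indices.\<close>
  define R where "R n i = c n (Suc i) - G n" for n i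
  have Sm[measurable]: "S i A \<in> borel_measurable M" for i A unfolding S_eq by (rule mixing_fun.SA_meas[OF mf])
  have Gn: "(\<lambda>n. real (G n) / n) \<longlonglongrightarrow> 0"
  proof (rule tendsto_sandwich[OF _ _ tendsto_const])
    show "(\<lambda>n. (ln (real n) + 1)^2 / n) \<longlonglongrightarrow> 0" by real_asymp
    show "\<forall>\<^sub>F n in sequentially. real (G n) / n \<le> (ln (real n) + 1)^2 / n"
      using eventually_ge_at_top[of 1]
    proof eventually_elim
      case (elim n)
      then have "ln (real n) \<ge> 0" by simp
      then have "real (nat \<lceil>ln (real n)\<rceil>) \<le> ln (real n) + 1" by linarith
      then show ?case unfolding G_def by (auto intro!: divide_right_mono power_mono)
    qed
  qed auto
  have climit: "(\<lambda>n. real (c n (Suc i)) / n - real (c n i) / n) \<longlonglongrightarrow> 1 / K" for i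
    using tendsto_diff[OF floor_div_limit[OF K, of "Suc i"] floor_div_limit[OF K, of i]] unfolding c_def by (simp add: diff_divide_distrib[symmetric])
  have bigev: "\<forall>\<^sub>F n in sequentially. c n i + G n + 1 \<le> c n (Suc i)" for i
  proof -
    have "(\<lambda>n. (real (c n (Suc i)) / n - real (c n i) / n) - real (G n) / n - 1 / n) \<longlonglongrightarrow> 1 / K - 0 - 0"
      by (intro tendsto_diff climit Gn) real_asymp
    then have "\<forall>\<^sub>F n in sequentially. (real (c n (Suc i)) / n - real (c n i) / n) - real (G n) / n - 1 / n > 0"
      by (rule order_tendstoD(1)) (use K in simp)
    then show ?thesis using eventually_gt_at_top[of 0]
    proof eventually_elim
      case (elim n)
      then have "(real (c n (Suc i)) - real (c n i) - real (G n) - 1) / n > 0" by (simp add: diff_divide_distrib)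
      then have "real (c n (Suc i)) - real (c n i) - real (G n) - 1 > 0" using elim by (simp add: zero_less_divide_iff)
      then show ?case by linarith
    qed
  qed
  have big: "\<forall>\<^sub>F n in sequentially. \<forall>i<K. c n i + G n + 1 \<le> c n (Suc i)"
  proof -
    have "\<forall>\<^sub>F n in sequentially. \<forall>i\<in>{..<K}. c n i + G n + 1 \<le> c n (Suc i)"
      by (rule eventually_ball_finite) (use bigev in auto)
    then show ?thesis by (rule eventually_mono) auto
  qed
  let ?E = "\<lambda>n. \<integral>\<omega>. iexp (\<Sum>i<K. S i {c n i<..c n (Suc i)} \<omega> / sqrt n) \<partial>M"
  let ?E' = "\<lambda>n. \<integral>\<omega>. iexp (\<Sum>i<K. S i {c n i<..R n i} \<omega> / sqrt n) \<partial>M"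
  let ?P = "\<lambda>n. \<Prod>i<K. \<integral>\<omega>. iexp (S i {c n i<..R n i} \<omega> / sqrt n) \<partial>M"
  have ii: "integrable M (\<lambda>\<omega>. iexp (f \<omega>))" if "f \<in> borel_measurable M" for f :: "'a \<Rightarrow> real"
    by (rule integrable_const_bound[of _ 1]) (use that in auto)
  \<comment> \<open>The deleted sums have variance of order \<open>G n\<close>, which is negligible
    after division by n.\<close>
  have A: "(\<lambda>n. ?E n - ?E' n) \<longlonglongrightarrow> 0"
  proof (rule Lim_null_comparison)
    define Cv where "Cv i = mixing_fun.Cv M X \<tau> Cb (u i) q" for i
    have "(\<lambda>n. \<Sum>i<K. sqrt (Cv i * (real (G n) / n))) \<longlonglongrightarrow> (\<Sum>i<K. sqrt (Cv i * 0))"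
      by (intro tendsto_intros Gn)
    then show "(\<lambda>n. \<Sum>i<K. sqrt (Cv i * (real (G n) / n))) \<longlonglongrightarrow> 0" by simp
    show "\<forall>\<^sub>F n in sequentially. norm (?E n - ?E' n) \<le> (\<Sum>i<K. sqrt (Cv i * (real (G n) / n)))"
      using big eventually_gt_at_top[of 0]
    proof eventually_elim
      case (elim n)
      have sp: "S i {c n i<..c n (Suc i)} \<omega> - S i {c n i<..R n i} \<omega> = S i {R n i<..c n (Suc i)} \<omega>" if "i < K" for i \<omega>
      proof -
        have "{c n i<..c n (Suc i)} = {c n i<..R n i} \<union> {R n i<..c n (Suc i)}" using elim(1) that unfolding R_def by force
        moreover have "{c n i<..R n i} \<inter> {R n i<..c n (Suc i)} = {}" by auto
        ultimately show ?thesis unfolding S_def by (simp add: sum.union_disjoint)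
      qed
      have sq: "{R n i<..c n (Suc i)} \<subseteq> {1..}" "finite {R n i<..c n (Suc i)}" for i by auto
      have I1: "integrable M (\<lambda>\<omega>. iexp (\<Sum>i<K. S i {c n i<..c n (Suc i)} \<omega> / sqrt n))" by (rule ii) measurable
      have I2: "integrable M (\<lambda>\<omega>. iexp (\<Sum>i<K. S i {c n i<..R n i} \<omega> / sqrt n))" by (rule ii) measurable
      have Si: "integrable M (S i {R n i<..c n (Suc i)})" for i unfolding S_eq by (rule mixing_fun.SA_square(3)[OF mf sq])
      have "norm (?E n - ?E' n) = cmod (\<integral>\<omega>. iexp (\<Sum>i<K. S i {c n i<..c n (Suc i)} \<omega> / sqrt n) - iexp (\<Sum>i<K. S i {c n i<..R n i} \<omega> / sqrt n) \<partial>M)"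
        by (simp only: Bochner_Integration.integral_diff[OF I1 I2])
      also have "\<dots> \<le> (\<integral>\<omega>. cmod (iexp (\<Sum>i<K. S i {c n i<..c n (Suc i)} \<omega> / sqrt n) - iexp (\<Sum>i<K. S i {c n i<..R n i} \<omega> / sqrt n)) \<partial>M)"
        by (rule integral_norm_bound)
      also have "\<dots> \<le> (\<integral>\<omega>. (\<Sum>i<K. \<bar>S i {R n i<..c n (Suc i)} \<omega>\<bar> / sqrt n) \<partial>M)"
      proof (rule integral_mono)
        show "integrable M (\<lambda>\<omega>. cmod (iexp (\<Sum>i<K. S i {c n i<..c n (Suc i)} \<omega> / sqrt n) - iexp (\<Sum>i<K. S i {c n i<..R n i} \<omega> / sqrt n)))"
          by (intro integrable_norm Bochner_Integration.integrable_diff I1 I2)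
        show "integrable M (\<lambda>\<omega>. (\<Sum>i<K. \<bar>S i {R n i<..c n (Suc i)} \<omega>\<bar> / sqrt n))"
          by (intro Bochner_Integration.integrable_sum integrable_divide_zero integrable_abs Si impI)
        fix \<omega>
        have "cmod (iexp (\<Sum>i<K. S i {c n i<..c n (Suc i)} \<omega> / sqrt n) - iexp (\<Sum>i<K. S i {c n i<..R n i} \<omega> / sqrt n))
           \<le> \<bar>(\<Sum>i<K. S i {c n i<..c n (Suc i)} \<omega> / sqrt n) - (\<Sum>i<K. S i {c n i<..R n i} \<omega> / sqrt n)\<bar>" by (rule cmod_iexp_diff_le)
        also have "\<dots> = \<bar>\<Sum>i<K. S i {R n i<..c n (Suc i)} \<omega> / sqrt n\<bar>"
          unfolding sum_subtractf[symmetric] diff_divide_distrib[symmetric] using sp by simp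
        also have "\<dots> \<le> (\<Sum>i<K. \<bar>S i {R n i<..c n (Suc i)} \<omega>\<bar> / sqrt n)"
          by (rule order_trans[OF sum_abs]) (simp add: abs_divide)
        finally show "cmod (iexp (\<Sum>i<K. S i {c n i<..c n (Suc i)} \<omega> / sqrt n) - iexp (\<Sum>i<K. S i {c n i<..R n i} \<omega> / sqrt n)) \<le> (\<Sum>i<K. \<bar>S i {R n i<..c n (Suc i)} \<omega>\<bar> / sqrt n)" .
      qed
      also have "\<dots> = (\<Sum>i<K. (\<integral>\<omega>. \<bar>S i {R n i<..c n (Suc i)} \<omega>\<bar> \<partial>M) / sqrt n)"
        by (subst Bochner_Integration.integral_sum) (auto intro!: integrable_divide_zero integrable_abs Si)
      also have "\<dots> \<le> (\<Sum>i<K. sqrt (Cv i * (real (G n) / n)))"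
      proof (rule sum_mono)
        fix i assume "i \<in> {..<K}"
        have "(\<integral>\<omega>. \<bar>S i {R n i<..c n (Suc i)} \<omega>\<bar> \<partial>M) \<le> sqrt (Cv i * card {R n i<..c n (Suc i)})"
          unfolding S_eq Cv_def by (rule mixing_fun.SA_abs_le[OF mf sq])
        also have "\<dots> \<le> sqrt (Cv i * G n)"
          using mixing_fun.Cv[OF mf, of i] unfolding Cv_def R_def by (intro real_sqrt_le_mono mult_left_mono) auto
        finally have "(\<integral>\<omega>. \<bar>S i {R n i<..c n (Suc i)} \<omega>\<bar> \<partial>M) / sqrt n \<le> sqrt (Cv i * G n) / sqrt n" by (intro divide_right_mono) auto
        then show "(\<integral>\<omega>. \<bar>S i {R n i<..c n (Suc i)} \<omega>\<bar> \<partial>M) / sqrt n \<le> sqrt (Cv i * (real (G n) / n))"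
          by (simp add: real_sqrt_divide[symmetric])
      qed
      finally show ?case .
    qed
  qed
  have B: "(\<lambda>n. ?E' n - ?P n) \<longlonglongrightarrow> 0"
  proof (rule Lim_null_comparison)
    show "(\<lambda>n. real K * (8 * (Cb * exp (ln \<tau> * ln (real n)^2)))) \<longlonglongrightarrow> 0"
    proof -
      have "ln \<tau> < 0" using \<tau> by simp
      then have "(\<lambda>n::nat. exp (ln \<tau> * ln (real n)^2)) \<longlonglongrightarrow> 0" by real_asymp
      then have "(\<lambda>n::nat. real K * (8 * (Cb * exp (ln \<tau> * ln (real n)^2)))) \<longlonglongrightarrow> real K * (8 * (Cb * 0))" by (intro tendsto_intros)
      then show ?thesis by simp
    qed
    show "\<forall>\<^sub>F n in sequentially. norm (?E' n - ?P n) \<le> real K * (8 * (Cb * exp (ln \<tau> * ln (real n)^2)))"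
      using big eventually_ge_at_top[of 1]
    proof eventually_elim
      case (elim n)
      have e: "?E' n = (\<integral>\<omega>. (\<Prod>i<K. iexp (S i {c n i<..R n i} \<omega> / sqrt n)) \<partial>M)"
        by (simp add: sum_distrib_left exp_sum)
      have "cmod ((\<integral>\<omega>. (\<Prod>i<K. iexp (S i {c n i<..R n i} \<omega> / sqrt n)) \<partial>M) - ?P n) \<le> real K * (8 * (Cb * \<tau> ^ G n))"
      proof (rule factorize_complex[where l = "\<lambda>i. c n i + 1" and r = "\<lambda>i. R n i"])
        fix i assume "i < K"
        have [measurable]: "S i {c n i<..R n i} \<in> borel_measurable (gs {c n i + 1..R n i})"
          unfolding S_eq by (rule mixing_fun.SA_gs[OF mf]) auto
        show "(\<lambda>\<omega>. iexp (S i {c n i<..R n i} \<omega> / sqrt n)) \<in> borel_measurable (gs {c n i + 1..R n i})" by measurable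
        show "1 \<le> R n i" using elim(1) \<open>i < K\<close> unfolding R_def by fastforce
      next
        fix i assume i: "Suc i < K"
        have 1: "c n i + G n + 1 \<le> c n (Suc i)" "c n (Suc i) + G n + 1 \<le> c n (Suc (Suc i))" using elim(1) i by auto
        show "R n i + G n \<le> c n (Suc i) + 1" "R n i \<le> R n (Suc i)" using 1 unfolding R_def by linarith+
      qed auto
      also have "\<dots> \<le> real K * (8 * (Cb * exp (ln \<tau> * ln (real n)^2)))"
      proof -
        have "ln (real n) \<le> real (nat \<lceil>ln (real n)\<rceil>)" by linarith
        then have "ln (real n)^2 \<le> real (G n)" unfolding G_def using elim(2) by (auto intro!: power_mono)
        moreover have "\<tau> ^ G n = exp (ln \<tau> * G n)" using \<tau> by (simp add: powr_realpow[symmetric] powr_def mult.commute)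
        ultimately have "\<tau> ^ G n \<le> exp (ln \<tau> * ln (real n)^2)" using \<tau> by (simp add: mult_le_cancel_left)
        then show ?thesis using Cb by (intro mult_left_mono) auto
      qed
      finally show ?case unfolding e .
    qed
  qed
  \<comment> \<open>Each shortened cell has a length asymptotic to n / K, so
    \<open>clt_scaled\<close> applies to it.\<close>
  have C: "?P \<longlonglongrightarrow> (\<Prod>i<K. complex_of_real (exp (- (1 / K * mixing_fun.vv M X (u i) / 2))))"
  proof (rule tendsto_prod)
    fix i assume i: "i \<in> {..<K}"
    define N where "N n = R n i - c n i" for n
    have Nl: "(\<lambda>n. real (N n) / n) \<longlonglongrightarrow> 1 / K"
    proof (rule Lim_transform_eventually)
      show "(\<lambda>n. (real (c n (Suc i)) / n - real (c n i) / n) - real (G n) / n) \<longlonglongrightarrow> 1 / K"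
        using tendsto_diff[OF climit Gn] by simp
      show "\<forall>\<^sub>F n in sequentially. (real (c n (Suc i)) / n - real (c n i) / n) - real (G n) / n = real (N n) / n"
        using bigev[of i]
      proof eventually_elim
        case (elim n)
        then have "real (N n) = real (c n (Suc i)) - real (c n i) - real (G n)" unfolding N_def R_def by linarith
        then show ?case by (simp add: diff_divide_distrib)
      qed
    qed
    have "(\<lambda>n. \<integral>\<omega>. iexp (mixing_fun.SA X (u i) {c n i<..c n i + N n} \<omega> / sqrt n) \<partial>M) \<longlonglongrightarrow> complex_of_real (exp (- (1 / K * mixing_fun.vv M X (u i) / 2)))"
      by (rule mixing_fun.clt_scaled[OF mf Nl]) (use K in auto)
    then show "(\<lambda>n. \<integral>\<omega>. iexp (S i {c n i<..R n i} \<omega> / sqrt n) \<partial>M) \<longlonglongrightarrow> complex_of_real (exp (- (1 / K * mixing_fun.vv M X (u i) / 2)))"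
    proof (rule Lim_transform_eventually)
      show "\<forall>\<^sub>F n in sequentially. (\<integral>\<omega>. iexp (mixing_fun.SA X (u i) {c n i<..c n i + N n} \<omega> / sqrt n) \<partial>M) = (\<integral>\<omega>. iexp (S i {c n i<..R n i} \<omega> / sqrt n) \<partial>M)"
        using bigev[of i]
      proof eventually_elim
        case (elim n)
        then have "c n i + N n = R n i" unfolding N_def R_def by linarith
        then show ?case unfolding S_eq by simp
      qed
    qed
  qed
  have "(\<Prod>i<K. complex_of_real (exp (- (1 / K * mixing_fun.vv M X (u i) / 2)))) = complex_of_real (exp (\<Sum>i<K. - (1 / K * mixing_fun.vv M X (u i) / 2)))"
    by (simp add: exp_sum)
  also have "(\<Sum>i<K. - (1 / K * mixing_fun.vv M X (u i) / 2)) = - V / 2"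
    unfolding V[symmetric] by (simp add: sum_negf sum_divide_distrib[symmetric])
  finally have "(\<lambda>n. (?E n - ?E' n) + (?E' n - ?P n) + ?P n) \<longlonglongrightarrow> 0 + 0 + complex_of_real (exp (- V / 2))"
    using tendsto_add[OF tendsto_add[OF A B] C] by simp
  then show "(\<lambda>n. \<integral>\<omega>. iexp (\<Sum>j<d. a j * wn n (qq j) (real (mm j) / K) \<omega>) \<partial>M) \<longlonglongrightarrow> exp (- V / 2)"
    unfolding rep by simp
qed

end

text \<open>Evaluated at 1 only, because the coefficients of a linear combination are already part
  of its variance.\<close>

lemma char_centered_gauss: assumes "v \<ge> 0" shows "(\<integral>x. iexp x \<partial>centered_gauss v) = exp (- v / 2)"
proof (cases "v = 0")
  case True
  have "(\<integral>x. iexp x \<partial>return borel (0::real)) = iexp 0" by (subst integral_return) auto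
  then show ?thesis using True by (simp add: centered_gauss_def)
next
  case False
  then have v: "v > 0" using assms by simp
  let ?s = "sqrt v"
  have s: "?s > 0" using v by simp
  have nd: "normal_density 0 ?s (?s * y) * ?s = std_normal_density y" for y
  proof -
    have "sqrt (2 * pi * v) = sqrt (2 * pi) * ?s" by (simp add: real_sqrt_mult)
    then show ?thesis using v unfolding normal_density_def
      by (simp add: power_mult_distrib field_simps)
  qed
  have "(\<integral>x. iexp x \<partial>centered_gauss v) = (\<integral>x. normal_density 0 ?s x *\<^sub>R iexp x \<partial>lborel)"
    using v unfolding centered_gauss_def by (simp add: integral_density)
  also have "\<dots> = \<bar>?s\<bar> *\<^sub>R (\<integral>x. normal_density 0 ?s (0 + ?s * x) *\<^sub>R iexp (0 + ?s * x) \<partial>lborel)"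
    by (rule lborel_integral_real_affine) (use s in auto)
  also have "\<dots> = (\<integral>x. ?s *\<^sub>R (normal_density 0 ?s (?s * x) *\<^sub>R iexp (?s * x)) \<partial>lborel)"
    unfolding integral_scaleR_right using s by simp
  also have "\<dots> = (\<integral>x. std_normal_density x *\<^sub>R iexp (?s * x) \<partial>lborel)"
    by (intro Bochner_Integration.integral_cong refl) (simp only: nd[symmetric] scaleR_scaleR mult.commute)
  also have "\<dots> = char std_normal_distribution ?s"
    unfolding char_def by (subst integral_density) auto
  also have "\<dots> = exp (- v / 2)" using v by (simp add: char_std_normal_distribution)
  finally show ?thesis .
qed

section \<open>From characteristic functions to bounded Lipschitz functions\<close>

text \<open>Real trigonometric polynomials in d variables; the phase \<open>b\<close> makes sines
  available while everything stays real.\<close>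

inductive_set TR :: "nat \<Rightarrow> ((nat \<Rightarrow> real) \<Rightarrow> real) set" for d where
  cos: "(\<lambda>x. cos ((\<Sum>j<d. a j * x j) + b)) \<in> TR d"
| add: "f \<in> TR d \<Longrightarrow> g \<in> TR d \<Longrightarrow> (\<lambda>x. f x + g x) \<in> TR d"
| scale: "f \<in> TR d \<Longrightarrow> (\<lambda>x. c * f x) \<in> TR d"

lemma TR_const: "(\<lambda>_. c) \<in> TR d"
  using TR.scale[OF TR.cos[of "\<lambda>_. 0" d 0], of c] by simp

lemma TR_sin: assumes "j < d" shows "(\<lambda>x. sin (c * x j)) \<in> TR d"
proof -
  let ?a = "\<lambda>i. if i = j then c else 0"
  have 1: "(\<Sum>i<d. ?a i * x i) = c * x j" for x :: "nat \<Rightarrow> real"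
  proof -
    have "(\<Sum>i<d. ?a i * x i) = (\<Sum>i<d. if i = j then c * x j else 0)" by (rule sum.cong) auto
    then show ?thesis using assms by simp
  qed
  have 2: "cos (y + (- (pi/2))) = sin y" for y :: real using cos_add[of y "- (pi/2)"] by simp
  show ?thesis using TR.cos[of ?a d "- (pi/2)"] unfolding 1 2 .
qed

text \<open>The product formula for two cosines, extended bilinearly by an induction over each
  factor.\<close>

lemma TR_mult: "f \<in> TR d \<Longrightarrow> g \<in> TR d \<Longrightarrow> (\<lambda>x. f x * g x) \<in> TR d"
proof (induction rule: TR.induct)
  case (cos a b)
  from cos show ?case
  proof (induction rule: TR.induct)
    case (cos a' b')
    have "cos ((\<Sum>j<d. a j * x j) + b) * cos ((\<Sum>j<d. a' j * x j) + b') =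
       (1/2) * cos ((\<Sum>j<d. (a j - a' j) * x j) + (b - b')) + (1/2) * cos ((\<Sum>j<d. (a j + a' j) * x j) + (b + b'))" for x
      unfolding cos_times_cos by (simp add: algebra_simps sum_subtractf sum.distrib)
    then show ?case
      using TR.add[OF TR.scale[OF TR.cos[of "\<lambda>j. a j - a' j" d "b - b'"], of "1/2"] TR.scale[OF TR.cos[of "\<lambda>j. a j + a' j" d "b + b'"], of "1/2"]]
      by simp
  next
    case (add f g)
    then show ?case using TR.add[OF add.IH] by (simp add: distrib_left)
  next
    case (scale f c)
    then show ?case using TR.scale[OF scale.IH, of c] by (simp add: mult_ac)
  qed
next
  case (add f h)
  then show ?case using TR.add[of "\<lambda>x. f x * g x" d "\<lambda>x. h x * g x"] by (simp add: distrib_right)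
next
  case (scale f c)
  then show ?case using TR.scale[of "\<lambda>x. f x * g x" d c] by (simp add: mult_ac)
qed

text \<open>Points are functions on all naturals. Freezing the coordinates from d on at 0 makes the
  d-dimensional cube a compact set of the product topology, by Tychonoff's theorem.\<close>

lemma compact_box: "compact {s :: nat \<Rightarrow> real. \<forall>j. s j \<in> (if j < d then {-1..1} else {0})}"
proof -
  have "compactin (product_topology (\<lambda>_. euclideanreal) UNIV) (PiE UNIV (\<lambda>j::nat. if j < d then {-1..1} else {0::real}))"
    unfolding compactin_PiE by (auto simp: compactin_euclidean_iff)
  moreover have "PiE UNIV (\<lambda>j::nat. if j < d then {-1..1} else {0::real}) = {s. \<forall>j. s j \<in> (if j < d then {-1..1} else {0})}"
    by (auto simp: PiE_def Pi_def)
  ultimately show ?thesis by (simp add: euclidean_product_topology)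
qed

lemma continuous_lipschitz_coords:
  fixes \<phi> :: "(nat \<Rightarrow> real) \<Rightarrow> real"
  assumes lip: "\<And>x y. \<bar>\<phi> x - \<phi> y\<bar> \<le> L * (\<Sum>j<d. \<bar>x j - y j\<bar>)" and cont: "\<And>j. j < d \<Longrightarrow> continuous_on S (\<lambda>s. T s j)"
  shows "continuous_on S (\<lambda>s. \<phi> (T s))"
  unfolding continuous_on_def
proof
  fix s assume s: "s \<in> S"
  show "((\<lambda>s. \<phi> (T s)) \<longlongrightarrow> \<phi> (T s)) (at s within S)"
  proof (rule LIM_zero_cancel, rule Lim_null_comparison)
    show "\<forall>\<^sub>F x in at s within S. norm (\<phi> (T x) - \<phi> (T s)) \<le> L * (\<Sum>j<d. \<bar>T x j - T s j\<bar>)"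
      using lip by (intro always_eventually allI) simp
    have "((\<lambda>x. L * (\<Sum>j<d. \<bar>T x j - T s j\<bar>)) \<longlongrightarrow> L * (\<Sum>j<d. \<bar>T s j - T s j\<bar>)) (at s within S)"
      by (intro tendsto_intros) (use cont s in \<open>auto simp: continuous_on_def\<close>)
    then show "((\<lambda>x. L * (\<Sum>j<d. \<bar>T x j - T s j\<bar>)) \<longlongrightarrow> 0) (at s within S)" by simp
  qed
qed

text \<open>The bounded function is composed with a triangular wave, i.e. with \<open>arcsin \<circ> sin\<close>, which is the identity on
  a large box; the periodic function so obtained is a continuous function of sines, to which Stone--Weierstrass applies.\<close>

lemma trig_approx:
  fixes \<phi> :: "(nat \<Rightarrow> real) \<Rightarrow> real"
  assumes lip: "\<And>x y. \<bar>\<phi> x - \<phi> y\<bar> \<le> L * (\<Sum>j<d. \<bar>x j - y j\<bar>)" and bd: "\<And>x. \<bar>\<phi> x\<bar> \<le> B"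
    and e: "e > 0" and R: "R > 0"
  shows "\<exists>\<psi>\<in>TR d. (\<forall>x. \<bar>\<psi> x\<bar> \<le> B + e) \<and> (\<forall>x. (\<forall>j<d. \<bar>x j\<bar> \<le> R) \<longrightarrow> \<bar>\<phi> x - \<psi> x\<bar> \<le> e)"
proof -
  define S where "S = {s :: nat \<Rightarrow> real. \<forall>j. s j \<in> (if j < d then {-1..1} else {0})}"
  \<comment> \<open>Scaled so that [-R, R] is mapped onto [-pi/2, pi/2], where arcsin inverts the
    sine.\<close>
  define c where "c = pi / (2 * R)"
  define sm where "sm x = (\<lambda>j. if j < d then sin (c * x j) else 0)" for x :: "nat \<Rightarrow> real"
  \<comment> \<open>Continuous functions on the cube that become trigonometric polynomials when
    sines are inserted. The first d coordinates belong to this ring and separate the points of the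
    cube.\<close>
  define RR where "RR = {F. continuous_on S F \<and> (\<lambda>x. F (sm x)) \<in> TR d}"
  have smS: "sm x \<in> S" for x unfolding sm_def S_def by auto
  interpret function_ring_on RR S
  proof
    show "compact S" unfolding S_def by (rule compact_box)
    show "f \<in> RR \<Longrightarrow> continuous_on S f" for f unfolding RR_def by simp
    show "(\<lambda>x. f x + g x) \<in> RR" if "f \<in> RR" "g \<in> RR" for f g
      using that unfolding RR_def by (auto intro!: continuous_on_add TR.add)
    show "(\<lambda>x. f x * g x) \<in> RR" if "f \<in> RR" "g \<in> RR" for f g
      using that unfolding RR_def by (auto intro!: continuous_on_mult TR_mult)
    show "(\<lambda>_. k) \<in> RR" for k unfolding RR_def by (auto intro!: TR_const)
    fix x y assume xy: "x \<in> S" "y \<in> S" "x \<noteq> y"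
    then obtain j where j: "x j \<noteq> y j" by auto
    have jd: "j < d"
    proof (rule ccontr)
      assume n: "\<not> j < d"
      have "x j \<in> (if j < d then {-1..1} else {0})" "y j \<in> (if j < d then {-1..1} else {0})" using xy(1,2) unfolding S_def by blast+
      then show False using n j by simp
    qed
    have "continuous_on S (\<lambda>s. s j)" by (rule continuous_on_subset[OF continuous_on_product_coordinates subset_UNIV])
    moreover have "(\<lambda>x. sm x j) \<in> TR d" using TR_sin[OF jd, of c] jd by (simp add: sm_def)
    ultimately have "(\<lambda>s. s j) \<in> RR" unfolding RR_def by simp
    then show "\<exists>f\<in>RR. f x \<noteq> f y" using j by (intro bexI[of _ "\<lambda>s. s j"]) auto
  qed
  define T where "T s = (\<lambda>j. arcsin (s j) / c)" for s :: "nat \<Rightarrow> real"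
  have "continuous_on S (\<lambda>s. \<phi> (T s))"
  proof (rule continuous_lipschitz_coords[OF lip])
    fix j assume jd: "j < d"
    have sub: "(\<lambda>s. s j) ` S \<subseteq> {-1..1}"
    proof
      fix y assume "y \<in> (\<lambda>s. s j) ` S"
      then obtain s where s: "s \<in> S" "y = s j" by blast
      have "s j \<in> (if j < d then {-1..1} else {0})" using s(1) unfolding S_def by blast
      then show "y \<in> {-1..1}" using jd s(2) by simp
    qed
    have "continuous_on S (\<lambda>s. arcsin (s j))"
      by (rule continuous_on_compose2[OF continuous_on_arcsin' _ sub])
         (rule continuous_on_subset[OF continuous_on_product_coordinates subset_UNIV])
    then show "continuous_on S (\<lambda>s. T s j)" unfolding T_def
      using R by (intro continuous_on_divide continuous_on_const) (auto simp: c_def)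
  qed
  from Stone_Weierstrass_basic[OF this e] obtain g where g: "g \<in> RR" "\<forall>x\<in>S. \<bar>\<phi> (T x) - g x\<bar> < e" by blast
  show ?thesis
  proof (intro bexI[of _ "\<lambda>x. g (sm x)"] conjI allI impI)
    show "(\<lambda>x. g (sm x)) \<in> TR d" using g unfolding RR_def by simp
    fix x
    have 1: "\<bar>\<phi> (T (sm x)) - g (sm x)\<bar> < e" using g smS by blast
    show "\<bar>g (sm x)\<bar> \<le> B + e" using 1 bd[of "T (sm x)"] by linarith
    assume x: "\<forall>j<d. \<bar>x j\<bar> \<le> R"
    have "T (sm x) j = x j" if "j < d" for j
    proof -
      have cp: "c > 0" using R by (simp add: c_def)
      have "c * \<bar>x j\<bar> \<le> c * R" using x that cp by (intro mult_left_mono) auto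
      also have "\<dots> = pi / 2" using R by (simp add: c_def)
      finally have "\<bar>c * x j\<bar> \<le> pi / 2" using cp by (simp add: abs_mult)
      then have "arcsin (sin (c * x j)) = c * x j" by (intro arcsin_sin) auto
      then show ?thesis using that cp by (simp add: T_def sm_def)
    qed
    then have "\<bar>\<phi> x - \<phi> (T (sm x))\<bar> \<le> 0" using lip[of x "T (sm x)"] by simp
    then show "\<bar>\<phi> x - g (sm x)\<bar> \<le> e" using 1 by linarith
  qed
qed

lemma TR_meas_bounded:
  assumes "f \<in> TR d" and X: "\<And>j. j < d \<Longrightarrow> (\<lambda>\<omega>. Z \<omega> j) \<in> borel_measurable M"
  shows "(\<lambda>\<omega>. f (Z \<omega>)) \<in> borel_measurable M" "\<exists>B. \<forall>x. \<bar>f x\<bar> \<le> B"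
proof -
  have "(\<lambda>\<omega>. f (Z \<omega>)) \<in> borel_measurable M \<and> (\<exists>B. \<forall>x. \<bar>f x\<bar> \<le> B)" using assms(1)
  proof (induction rule: TR.induct)
    case (cos a b)
    have "(\<lambda>\<omega>. cos ((\<Sum>j<d. a j * Z \<omega> j) + b)) \<in> borel_measurable M"
      using X by (intro borel_measurable_continuous_on[OF continuous_on_cos] borel_measurable_add borel_measurable_sum borel_measurable_times continuous_on_id) auto
    then show ?case by (auto intro!: exI[of _ 1])
  next
    case (add f g)
    then obtain B B' where b: "\<forall>x. \<bar>f x\<bar> \<le> B" "\<forall>x. \<bar>g x\<bar> \<le> B'" by blast
    have "\<bar>f x + g x\<bar> \<le> B + B'" for x using spec[OF b(1), of x] spec[OF b(2), of x] by linarith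
    then show ?case using add by auto
  next
    case (scale f c)
    then obtain B where b: "\<forall>x. \<bar>f x\<bar> \<le> B" by blast
    have "\<bar>c * f x\<bar> \<le> \<bar>c\<bar> * B" for x using b by (simp add: abs_mult mult_left_mono)
    then show ?case using scale by auto
  qed
  then show "(\<lambda>\<omega>. f (Z \<omega>)) \<in> borel_measurable M" "\<exists>B. \<forall>x. \<bar>f x\<bar> \<le> B" by auto
qed

text \<open>A cosine with a phase is the real part of a rotated character; sums and multiples follow
  by linearity.\<close>

lemma TR_converge:
  fixes S :: "nat \<Rightarrow> 'a \<Rightarrow> nat \<Rightarrow> real" and G :: "'b \<Rightarrow> nat \<Rightarrow> real"
  assumes M: "prob_space M" and N: "prob_space N"
    and Sm: "\<And>n j. j < d \<Longrightarrow> (\<lambda>\<omega>. S n \<omega> j) \<in> borel_measurable M" and Gm: "\<And>j. j < d \<Longrightarrow> (\<lambda>\<omega>. G \<omega> j) \<in> borel_measurable N"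
    and ch: "\<And>a. (\<lambda>n. \<integral>\<omega>. iexp (\<Sum>j<d. a j * S n \<omega> j) \<partial>M) \<longlonglongrightarrow> (\<integral>\<omega>. iexp (\<Sum>j<d. a j * G \<omega> j) \<partial>N)"
    and f: "f \<in> TR d"
  shows "(\<lambda>n. \<integral>\<omega>. f (S n \<omega>) \<partial>M) \<longlonglongrightarrow> (\<integral>\<omega>. f (G \<omega>) \<partial>N)"
  using f
proof (induction rule: TR.induct)
  case (cos a b)
  interpret M: prob_space M by fact
  interpret N: prob_space N by fact
  have [measurable]: "(\<lambda>\<omega>. \<Sum>j<d. a j * S n \<omega> j) \<in> borel_measurable M" for n using Sm by (intro borel_measurable_sum borel_measurable_times) auto
  have [measurable]: "(\<lambda>\<omega>. \<Sum>j<d. a j * G \<omega> j) \<in> borel_measurable N" using Gm by (intro borel_measurable_sum borel_measurable_times) auto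
  have Re: "cos (y + b) = Re (iexp b * iexp y)" for y
    by (simp add: Re_exp exp_add[symmetric] add.commute distrib_left[symmetric] flip: of_real_add)
  have 1: "(\<integral>\<omega>. cos ((\<Sum>j<d. a j * S n \<omega> j) + b) \<partial>M) = Re (iexp b * (\<integral>\<omega>. iexp (\<Sum>j<d. a j * S n \<omega> j) \<partial>M))" for n
  proof -
    have i: "integrable M (\<lambda>\<omega>. iexp (\<Sum>j<d. a j * S n \<omega> j))" by (rule M.integrable_const_bound[of _ 1], simp, measurable)
    show ?thesis unfolding Re integral_Re[OF integrable_mult_right[OF i]] integral_mult_right_zero ..
  qed
  have 2: "(\<integral>\<omega>. cos ((\<Sum>j<d. a j * G \<omega> j) + b) \<partial>N) = Re (iexp b * (\<integral>\<omega>. iexp (\<Sum>j<d. a j * G \<omega> j) \<partial>N))"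
  proof -
    have i: "integrable N (\<lambda>\<omega>. iexp (\<Sum>j<d. a j * G \<omega> j))" by (rule N.integrable_const_bound[of _ 1], simp, measurable)
    show ?thesis unfolding Re integral_Re[OF integrable_mult_right[OF i]] integral_mult_right_zero ..
  qed
  show ?case unfolding 1 2 by (intro tendsto_Re tendsto_mult tendsto_const ch)
next
  case (add f g)
  interpret M: prob_space M by fact
  interpret N: prob_space N by fact
  obtain B B' where b: "\<forall>x. \<bar>f x\<bar> \<le> B" "\<forall>x. \<bar>g x\<bar> \<le> B'"
    using TR_meas_bounded(2)[where Z = G and M = N, OF add.hyps(1)] TR_meas_bounded(2)[where Z = G and M = N, OF add.hyps(2)] Gm by blast
  have m: "(\<lambda>\<omega>. f (S n \<omega>)) \<in> borel_measurable M" "(\<lambda>\<omega>. g (S n \<omega>)) \<in> borel_measurable M" for n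
    by (rule TR_meas_bounded(1)[OF add.hyps(1)], rule Sm, assumption) (rule TR_meas_bounded(1)[OF add.hyps(2)], rule Sm, assumption)
  have m': "(\<lambda>\<omega>. f (G \<omega>)) \<in> borel_measurable N" "(\<lambda>\<omega>. g (G \<omega>)) \<in> borel_measurable N"
    by (rule TR_meas_bounded(1)[OF add.hyps(1)], rule Gm, assumption) (rule TR_meas_bounded(1)[OF add.hyps(2)], rule Gm, assumption)
  have i1: "integrable M (\<lambda>\<omega>. f (S n \<omega>))" "integrable M (\<lambda>\<omega>. g (S n \<omega>))" for n
    by (rule M.integrable_const_bound[of _ B], use b m in simp_all) (rule M.integrable_const_bound[of _ B'], use b m in simp_all)
  have i2: "integrable N (\<lambda>\<omega>. f (G \<omega>))" "integrable N (\<lambda>\<omega>. g (G \<omega>))"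
    by (rule N.integrable_const_bound[of _ B], use b m' in simp_all) (rule N.integrable_const_bound[of _ B'], use b m' in simp_all)
  show ?case using tendsto_add[OF add.IH] i1 i2 by simp
next
  case (scale f c)
  then show ?case by (auto intro!: tendsto_intros)
qed

text \<open>Only d coordinates are known to be measurable. The others are replaced by 0, which
  \<phi> does not notice, and continuity in the product topology does the rest.\<close>

lemma lipschitz_comp_measurable:
  fixes \<phi> :: "(nat \<Rightarrow> real) \<Rightarrow> real"
  assumes lip: "\<And>x y. \<bar>\<phi> x - \<phi> y\<bar> \<le> L * (\<Sum>j<d. \<bar>x j - y j\<bar>)"
    and m: "\<And>j. j < d \<Longrightarrow> (\<lambda>\<omega>. Z \<omega> j) \<in> borel_measurable M"
  shows "(\<lambda>\<omega>. \<phi> (Z \<omega>)) \<in> borel_measurable M"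
proof -
  define Z' where "Z' \<omega> = (\<lambda>j. if j < d then Z \<omega> j else 0)" for \<omega>
  have "Z' \<in> borel_measurable M"
  proof (rule measurable_coordinatewise_then_product)
    fix j show "(\<lambda>\<omega>. Z' \<omega> j) \<in> borel_measurable M" by (cases "j < d") (use m in \<open>auto simp: Z'_def\<close>)
  qed
  moreover have "continuous_on UNIV \<phi>"
    by (rule continuous_lipschitz_coords[where T = "\<lambda>s. s", OF lip]) (rule continuous_on_product_coordinates)
  ultimately have "(\<lambda>\<omega>. \<phi> (Z' \<omega>)) \<in> borel_measurable M" by (rule borel_measurable_continuous_on[rotated])
  moreover have "\<phi> (Z' \<omega>) = \<phi> (Z \<omega>)" for \<omega> using lip[of "Z' \<omega>" "Z \<omega>"] by (simp add: Z'_def)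
  ultimately show ?thesis by simp
qed

text \<open>Inside the box the error is e; outside, both functions are bounded, which costs at most
  \<open>2 * B + 1\<close> beyond e, times the probability of leaving the box.\<close>

lemma expectation_approx_on_box:
  fixes \<phi> :: "(nat \<Rightarrow> real) \<Rightarrow> real"
  assumes Q: "prob_space Q" and Zm: "\<And>j. j < d \<Longrightarrow> (\<lambda>\<omega>. Z \<omega> j) \<in> borel_measurable Q"
    and A: "A = {\<omega>\<in>space Q. \<exists>j<d. \<bar>Z \<omega> j\<bar> > k}" "A \<in> sets Q"
    and lip: "\<And>x y. \<bar>\<phi> x - \<phi> y\<bar> \<le> L * (\<Sum>j<d. \<bar>x j - y j\<bar>)" and bd: "\<And>x. \<bar>\<phi> x\<bar> \<le> B" and e: "e \<le> 1"
    and \<psi>: "\<psi> \<in> TR d" "\<And>x. \<bar>\<psi> x\<bar> \<le> B + e" "\<And>x. (\<forall>j<d. \<bar>x j\<bar> \<le> k) \<Longrightarrow> \<bar>\<phi> x - \<psi> x\<bar> \<le> e"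
  shows "\<bar>(\<integral>\<omega>. \<phi> (Z \<omega>) \<partial>Q) - (\<integral>\<omega>. \<psi> (Z \<omega>) \<partial>Q)\<bar> \<le> e + (2 * B + 1) * measure Q A"
proof -
    interpret Q: prob_space Q by fact
    have Ai: "integrable Q (\<lambda>\<omega>. indicator A \<omega> :: real)" using A(2) by (simp add: Q.emeasure_eq_measure)
    have m1: "(\<lambda>\<omega>. \<phi> (Z \<omega>)) \<in> borel_measurable Q" by (rule lipschitz_comp_measurable[OF lip]) (rule Zm)
    have m2: "(\<lambda>\<omega>. \<psi> (Z \<omega>)) \<in> borel_measurable Q" by (rule TR_meas_bounded(1)[OF \<psi>(1)]) (rule Zm)
    have i1: "integrable Q (\<lambda>\<omega>. \<phi> (Z \<omega>))" by (rule Q.integrable_const_bound[of _ B]) (simp add: bd, rule m1)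
    have i2: "integrable Q (\<lambda>\<omega>. \<psi> (Z \<omega>))" by (rule Q.integrable_const_bound[of _ "B + e"]) (simp add: \<psi>(2), rule m2)
    have "\<bar>(\<integral>\<omega>. \<phi> (Z \<omega>) \<partial>Q) - (\<integral>\<omega>. \<psi> (Z \<omega>) \<partial>Q)\<bar> \<le> (\<integral>\<omega>. \<bar>\<phi> (Z \<omega>) - \<psi> (Z \<omega>)\<bar> \<partial>Q)"
      using integral_abs_bound[of Q "\<lambda>\<omega>. \<phi> (Z \<omega>) - \<psi> (Z \<omega>)"] i1 i2 by simp
    also have "\<dots> \<le> (\<integral>\<omega>. e + (2 * B + 1) * indicator A \<omega> \<partial>Q)"
    proof (rule integral_mono)
      fix \<omega> assume w: "\<omega> \<in> space Q"
      show "\<bar>\<phi> (Z \<omega>) - \<psi> (Z \<omega>)\<bar> \<le> e + (2 * B + 1) * indicator A \<omega>"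
      proof (cases "\<omega> \<in> A")
        case True
        then have "indicator A \<omega> = (1::real)" by simp
        moreover have "\<bar>\<phi> (Z \<omega>) - \<psi> (Z \<omega>)\<bar> \<le> e + (2 * B + 1) * 1" using bd[of "Z \<omega>"] \<psi>(2)[of "Z \<omega>"] unfolding mult_1_right by linarith
        ultimately show ?thesis by (simp only:)
      next
        case False
        then have "indicator A \<omega> = (0::real)" by simp
        have "\<not> (\<exists>j<d. \<bar>Z \<omega> j\<bar> > k)" using False w unfolding A(1) by blast
        then have "\<forall>j<d. \<bar>Z \<omega> j\<bar> \<le> k" by (meson not_less)
        from \<psi>(3)[OF this] show ?thesis unfolding \<open>indicator A \<omega> = (0::real)\<close> by simp
      qed
    qed (use i1 i2 Ai in auto)
    also have "\<dots> = e + (2 * B + 1) * measure Q A"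
      using Ai A(2) by (simp add: Q.prob_space)
    finally show ?thesis .
qed

lemma exceed_sets:
  fixes Z :: "'c \<Rightarrow> nat \<Rightarrow> real"
  assumes m: "\<And>j. j < d \<Longrightarrow> (\<lambda>\<omega>. Z \<omega> j) \<in> borel_measurable Q"
  shows "{\<omega>\<in>space Q. \<exists>j<d. \<bar>Z \<omega> j\<bar> > R} \<in> sets Q"
proof -
  have e: "{\<omega>\<in>space Q. \<exists>j<d. \<bar>Z \<omega> j\<bar> > R} = (\<Union>j\<in>{..<d}. {\<omega>\<in>space Q. \<bar>Z \<omega> j\<bar> > R})" by blast
  show ?thesis unfolding e
  proof (rule sets.finite_UN)
    fix j assume "j \<in> {..<d}"
    then have [measurable]: "(\<lambda>\<omega>. Z \<omega> j) \<in> borel_measurable Q" using m by simp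
    show "{\<omega>\<in>space Q. \<bar>Z \<omega> j\<bar> > R} \<in> sets Q" by measurable
  qed simp
qed

text \<open>Tightness confines both vectors to one large box up to a small probability, and on this
  box a trigonometric polynomial replaces \<phi>.\<close>

theorem lipschitz_converge:
  fixes S :: "nat \<Rightarrow> 'a \<Rightarrow> nat \<Rightarrow> real" and G :: "'b \<Rightarrow> nat \<Rightarrow> real"
  assumes M: "prob_space M" and N: "prob_space N"
    and Sm: "\<And>n j. j < d \<Longrightarrow> (\<lambda>\<omega>. S n \<omega> j) \<in> borel_measurable M" and Gm: "\<And>j. j < d \<Longrightarrow> (\<lambda>\<omega>. G \<omega> j) \<in> borel_measurable N"
    and ch: "\<And>a. (\<lambda>n. \<integral>\<omega>. iexp (\<Sum>j<d. a j * S n \<omega> j) \<partial>M) \<longlonglongrightarrow> (\<integral>\<omega>. iexp (\<Sum>j<d. a j * G \<omega> j) \<partial>N)"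
    and tight: "\<And>e. e > 0 \<Longrightarrow> \<exists>R0. \<forall>R\<ge>R0. \<forall>n. measure M {\<omega>\<in>space M. \<exists>j<d. \<bar>S n \<omega> j\<bar> > R} \<le> e"
    and lip: "\<And>x y. \<bar>\<phi> x - \<phi> y\<bar> \<le> L * (\<Sum>j<d. \<bar>x j - y j\<bar>)" and bd: "\<And>x. \<bar>\<phi> x\<bar> \<le> B"
  shows "(\<lambda>n. \<integral>\<omega>. \<phi> (S n \<omega>) \<partial>M) \<longlonglongrightarrow> (\<integral>\<omega>. \<phi> (G \<omega>) \<partial>N)"
proof (rule LIMSEQ_I)
  interpret M: prob_space M by fact
  interpret N: prob_space N by fact
  fix \<epsilon> :: real assume eps: "0 < \<epsilon>"
  have B0: "B \<ge> 0" using bd[of undefined] by linarith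
  \<comment> \<open>The errors below add up to (4 B + 5) e, which is at most 8 (B + 2) e.\<close>
  define e where "e = min 1 (\<epsilon> / (8 * (B + 2)))"
  have "e \<le> \<epsilon> / (8 * (B + 2))" by (simp add: e_def)
  then have "e * (8 * (B + 2)) \<le> \<epsilon>" using B0 by (subst (asm) pos_le_divide_eq) auto
  then have e: "e > 0" "e \<le> 1" "e * (8 * (B + 2)) \<le> \<epsilon>" using eps B0 by (auto simp: e_def)
  obtain R0 where R0: "\<And>R n. R \<ge> R0 \<Longrightarrow> measure M {\<omega>\<in>space M. \<exists>j<d. \<bar>S n \<omega> j\<bar> > R} \<le> e" using tight[OF e(1)] by blast
  have GN: "{\<omega>\<in>space N. \<exists>j<d. \<bar>G \<omega> j\<bar> > R} \<in> sets N" for R by (rule exceed_sets) (rule Gm)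
  have SM: "{\<omega>\<in>space M. \<exists>j<d. \<bar>S n \<omega> j\<bar> > R} \<in> sets M" for n R by (rule exceed_sets) (rule Sm)
  \<comment> \<open>The limit vector is tight by itself: the sets where some coordinate exceeds k
    decrease to the empty set.\<close>
  have "(\<lambda>k::nat. measure N {\<omega>\<in>space N. \<exists>j<d. \<bar>G \<omega> j\<bar> > real k}) \<longlonglongrightarrow> measure N (\<Inter>k::nat. {\<omega>\<in>space N. \<exists>j<d. \<bar>G \<omega> j\<bar> > real k})"
  proof (rule N.finite_Lim_measure_decseq)
    show "decseq (\<lambda>k::nat. {\<omega>\<in>space N. \<exists>j<d. \<bar>G \<omega> j\<bar> > real k})"
      unfolding decseq_def
    proof (intro allI impI subsetI)
      fix a b :: nat and \<omega> assume ab: "a \<le> b" and w: "\<omega> \<in> {\<omega>\<in>space N. \<exists>j<d. \<bar>G \<omega> j\<bar> > real b}"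
      then obtain j where j: "j < d" "\<bar>G \<omega> j\<bar> > real b" by blast
      then have "\<bar>G \<omega> j\<bar> > real a" using ab by linarith
      then show "\<omega> \<in> {\<omega>\<in>space N. \<exists>j<d. \<bar>G \<omega> j\<bar> > real a}" using w j by blast
    qed
    show "range (\<lambda>k::nat. {\<omega>\<in>space N. \<exists>j<d. \<bar>G \<omega> j\<bar> > real k}) \<subseteq> sets N"
      by (rule image_subsetI) (rule GN)
  qed
  also have "(\<Inter>k::nat. {\<omega>\<in>space N. \<exists>j<d. \<bar>G \<omega> j\<bar> > real k}) = {}"
  proof (rule ccontr)
    assume "(\<Inter>k::nat. {\<omega>\<in>space N. \<exists>j<d. \<bar>G \<omega> j\<bar> > real k}) \<noteq> {}"
    then obtain \<omega> where ww: "\<omega> \<in> (\<Inter>k::nat. {\<omega>\<in>space N. \<exists>j<d. \<bar>G \<omega> j\<bar> > real k})" by blast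
    have w: "\<exists>j<d. \<bar>G \<omega> j\<bar> > real k" for k :: nat using INT_D[OF ww, of k] by simp
    obtain k :: nat where k: "(\<Sum>j<d. \<bar>G \<omega> j\<bar>) \<le> real k" using real_arch_simple by blast
    obtain j where j: "j < d" "\<bar>G \<omega> j\<bar> > real k" using w by blast
    have "\<bar>G \<omega> j\<bar> \<le> (\<Sum>j<d. \<bar>G \<omega> j\<bar>)" by (rule member_le_sum) (use j in auto)
    then show False using j k by linarith
  qed
  finally have "\<forall>\<^sub>F k::nat in sequentially. measure N {\<omega>\<in>space N. \<exists>j<d. \<bar>G \<omega> j\<bar> > real k} < e"
    by (rule order_tendstoD(2)) (use e in simp)
  then have "\<forall>\<^sub>F k::nat in sequentially. measure N {\<omega>\<in>space N. \<exists>j<d. \<bar>G \<omega> j\<bar> > real k} < e \<and> real k \<ge> R0 \<and> real k > 0"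
    using eventually_ge_at_top[of "nat \<lceil>R0\<rceil>"] eventually_gt_at_top[of 0]
  proof eventually_elim
    case (elim k)
    have "R0 \<le> real k" using elim(2) by linarith
    then show ?case using elim by simp
  qed
  then obtain k :: nat where k: "measure N {\<omega>\<in>space N. \<exists>j<d. \<bar>G \<omega> j\<bar> > real k} < e" "real k \<ge> R0" "real k > 0"
    by (auto dest: eventually_happens)
  obtain \<psi> where \<psi>: "\<psi> \<in> TR d" "\<And>x. \<bar>\<psi> x\<bar> \<le> B + e" "\<And>x. (\<forall>j<d. \<bar>x j\<bar> \<le> real k) \<Longrightarrow> \<bar>\<phi> x - \<psi> x\<bar> \<le> e"
    using trig_approx[OF lip bd e(1) k(3)] by blast
  obtain n0 where n0: "\<And>n. n \<ge> n0 \<Longrightarrow> \<bar>(\<integral>\<omega>. \<psi> (S n \<omega>) \<partial>M) - (\<integral>\<omega>. \<psi> (G \<omega>) \<partial>N)\<bar> < e"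
    using LIMSEQ_D[OF TR_converge[where S = S and G = G and d = d, OF M N Sm Gm ch \<psi>(1)] e(1)] by auto
  show "\<exists>no. \<forall>n\<ge>no. norm ((\<integral>\<omega>. \<phi> (S n \<omega>) \<partial>M) - (\<integral>\<omega>. \<phi> (G \<omega>) \<partial>N)) < \<epsilon>"
  proof (intro exI[of _ n0] allI impI)
    fix n assume n: "n \<ge> n0"
    have "\<bar>(\<integral>\<omega>. \<phi> (S n \<omega>) \<partial>M) - (\<integral>\<omega>. \<psi> (S n \<omega>) \<partial>M)\<bar> \<le> e + (2 * B + 1) * measure M {\<omega>\<in>space M. \<exists>j<d. \<bar>S n \<omega> j\<bar> > real k}"
      by (rule expectation_approx_on_box[where Z = "S n" and Q = M and d = d and k = "real k" and L = L and e = e, OF M _ refl _ lip bd e(2) \<psi>], rule Sm, assumption, rule SM)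
    also have "\<dots> \<le> e + (2 * B + 1) * e" using R0[OF k(2), of n] B0 by (intro add_left_mono mult_left_mono) auto
    finally have 1: "\<bar>(\<integral>\<omega>. \<phi> (S n \<omega>) \<partial>M) - (\<integral>\<omega>. \<psi> (S n \<omega>) \<partial>M)\<bar> \<le> e + (2 * B + 1) * e" .
    have "\<bar>(\<integral>\<omega>. \<phi> (G \<omega>) \<partial>N) - (\<integral>\<omega>. \<psi> (G \<omega>) \<partial>N)\<bar> \<le> e + (2 * B + 1) * measure N {\<omega>\<in>space N. \<exists>j<d. \<bar>G \<omega> j\<bar> > real k}"
      by (rule expectation_approx_on_box[where Z = G and Q = N and d = d and k = "real k" and L = L and e = e, OF N _ refl _ lip bd e(2) \<psi>], rule Gm, assumption, rule GN)
    also have "\<dots> \<le> e + (2 * B + 1) * e" using k(1) B0 by (intro add_left_mono mult_left_mono) auto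
    finally have 2: "\<bar>(\<integral>\<omega>. \<phi> (G \<omega>) \<partial>N) - (\<integral>\<omega>. \<psi> (G \<omega>) \<partial>N)\<bar> \<le> e + (2 * B + 1) * e" .
    have "\<bar>(\<integral>\<omega>. \<phi> (S n \<omega>) \<partial>M) - (\<integral>\<omega>. \<phi> (G \<omega>) \<partial>N)\<bar> < 2 * (e + (2 * B + 1) * e) + e"
    proof -
      have "\<bar>a - b\<bar> < 2 * z + e" if "\<bar>a - a'\<bar> \<le> z" "\<bar>b - b'\<bar> \<le> z" "\<bar>a' - b'\<bar> < e" for a b a' b' z :: real
        using that by linarith
      from this[OF 1 2 n0[OF n]] show ?thesis .
    qed
    also have "\<dots> \<le> e * (8 * (B + 2))" using e B0 by (simp add: algebra_simps)
    finally show "norm ((\<integral>\<omega>. \<phi> (S n \<omega>) \<partial>M) - (\<integral>\<omega>. \<phi> (G \<omega>) \<partial>N)) < \<epsilon>" using e(3) by simp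
  qed
qed

section \<open>A criterion for convergence in distribution in the supremum norm\<close>

lemma sup_dist_bdd:
  assumes "bounded_on T x" "bounded_on T y"
  shows "bdd_above ((\<lambda>t. \<bar>x t - y t\<bar>) ` T)"
proof -
  obtain a b where ab: "\<And>t. t \<in> T \<Longrightarrow> \<bar>x t\<bar> \<le> a" "\<And>t. t \<in> T \<Longrightarrow> \<bar>y t\<bar> \<le> b"
    using assms unfolding bounded_on_def bdd_above_def by auto
  show ?thesis by (rule bdd_aboveI2[of _ _ "a + b"]) (use ab in \<open>force intro: order_trans[OF abs_triangle_ineq4 add_mono]\<close>)
qed

lemma sup_dist_upper:
  assumes "bounded_on T x" "bounded_on T y" "t \<in> T"
  shows "\<bar>x t - y t\<bar> \<le> sup_dist T x y"
  unfolding sup_dist_def by (rule cSUP_upper[OF assms(3) sup_dist_bdd[OF assms(1,2)]])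

lemma sup_dist_least:
  assumes "T \<noteq> {}" "\<And>t. t \<in> T \<Longrightarrow> \<bar>x t - y t\<bar> \<le> c" shows "sup_dist T x y \<le> c"
  unfolding sup_dist_def by (rule cSUP_least[OF assms])

lemma sup_dist_nonneg: assumes "T \<noteq> {}" "bounded_on T x" "bounded_on T y" shows "0 \<le> sup_dist T x y"
proof -
  obtain t where "t \<in> T" using assms(1) by blast
  from sup_dist_upper[OF assms(2,3) this] show ?thesis by linarith
qed

lemma sup_dist_self: "T \<noteq> {} \<Longrightarrow> sup_dist T x x = 0"
  unfolding sup_dist_def by simp

lemma sup_dist_commute: "sup_dist T x y = sup_dist T y x"
  unfolding sup_dist_def by (simp add: abs_minus_commute)

lemma sup_dist_triangle:
  assumes "T \<noteq> {}" "bounded_on T x" "bounded_on T y" "bounded_on T z"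
  shows "sup_dist T x z \<le> sup_dist T x y + sup_dist T y z"
proof (rule sup_dist_least[OF assms(1)])
  fix t assume t: "t \<in> T"
  show "\<bar>x t - z t\<bar> \<le> sup_dist T x y + sup_dist T y z"
    using sup_dist_upper[OF assms(2,3) t] sup_dist_upper[OF assms(3,4) t] by linarith
qed

text \<open>The sup-convolution of f with L times the distance, i.e. the least L-Lipschitz majorant
  of f on bounded functions. The value 0 elsewhere is a default, since \<open>sup_dist\<close> is
  then a supremum of a possibly unbounded set. Minorants come from applying the construction to
  -f.\<close>

definition lipreg :: "(nat \<Rightarrow> real) set \<Rightarrow> (((nat \<Rightarrow> real) \<Rightarrow> real) \<Rightarrow> real) \<Rightarrow> real \<Rightarrow> ((nat \<Rightarrow> real) \<Rightarrow> real) \<Rightarrow> real" where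
  "lipreg T f L x = (if bounded_on T x then SUP y\<in>{y. bounded_on T y}. f y - L * sup_dist T x y else 0)"

definition lip_functional :: "(nat \<Rightarrow> real) set \<Rightarrow> (((nat \<Rightarrow> real) \<Rightarrow> real) \<Rightarrow> real) \<Rightarrow> real \<Rightarrow> real \<Rightarrow> bool" where
  "lip_functional T f L B \<longleftrightarrow> 0 \<le> L \<and> (\<forall>x. \<bar>f x\<bar> \<le> B) \<and> (\<forall>x y. bounded_on T x \<longrightarrow> bounded_on T y \<longrightarrow> \<bar>f x - f y\<bar> \<le> L * sup_dist T x y)"

lemma lipreg_bdd:
  assumes T: "T \<noteq> {}" and B: "\<And>x. \<bar>f x\<bar> \<le> B" and L: "0 \<le> L" and x: "bounded_on T x"
  shows "bdd_above ((\<lambda>y. f y - L * sup_dist T x y) ` {y. bounded_on T y})"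
proof (rule bdd_aboveI2[of _ _ B])
  fix y assume "y \<in> {y. bounded_on T y}"
  then have "0 \<le> L * sup_dist T x y" using sup_dist_nonneg[OF T x] L by simp
  then show "f y - L * sup_dist T x y \<le> B" using B[of y] by linarith
qed

lemma lipreg_ge:
  assumes T: "T \<noteq> {}" and B: "\<And>x. \<bar>f x\<bar> \<le> B" and L: "0 \<le> L" and x: "bounded_on T x"
  shows "f x \<le> lipreg T f L x"
proof -
  have "f x - L * sup_dist T x x \<le> (SUP y\<in>{y. bounded_on T y}. f y - L * sup_dist T x y)"
    by (rule cSUP_upper[OF _ lipreg_bdd[OF T B L x]]) (use x in simp)
  then show ?thesis using x by (simp add: lipreg_def sup_dist_self[OF T])
qed

lemma lipreg_lip:
  assumes T: "T \<noteq> {}" and B: "\<And>x. \<bar>f x\<bar> \<le> B" and L: "0 \<le> L"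
  shows "lip_functional T (lipreg T f L) L B"
  unfolding lip_functional_def
proof (intro conjI allI impI L)
  have B0: "0 \<le> B" using B[of undefined] by linarith
  have one: "lipreg T f L x \<le> lipreg T f L y + L * sup_dist T x y" if x: "bounded_on T x" and y: "bounded_on T y" for x y
  proof -
    have "(SUP z\<in>{y. bounded_on T y}. f z - L * sup_dist T x z) \<le> lipreg T f L y + L * sup_dist T x y"
    proof (rule cSUP_least)
      show "{y. bounded_on T y} \<noteq> {}" using x by blast
      fix z assume z: "z \<in> {y. bounded_on T y}"
      have "f z - L * sup_dist T y z \<le> lipreg T f L y"
        using cSUP_upper[OF z lipreg_bdd[OF T B L y]] y by (simp add: lipreg_def)
      moreover have "L * sup_dist T y z \<le> L * (sup_dist T x y + sup_dist T x z)"
        using sup_dist_triangle[OF T y x, of z] z L by (intro mult_left_mono) (auto simp: sup_dist_commute[of T y x])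
      ultimately show "f z - L * sup_dist T x z \<le> lipreg T f L y + L * sup_dist T x y" by (simp add: distrib_left)
    qed
    then show ?thesis using x by (simp add: lipreg_def)
  qed
  fix x
  show "\<bar>lipreg T f L x\<bar> \<le> B"
  proof (cases "bounded_on T x")
    case True
    have "lipreg T f L x \<le> B" unfolding lipreg_def using True
    proof (simp, intro cSUP_least)
      fix y assume "y \<in> {y. bounded_on T y}"
      then have "0 \<le> L * sup_dist T x y" using sup_dist_nonneg[OF T True] L by simp
      then show "f y - L * sup_dist T x y \<le> B" using B[of y] by linarith
    qed auto
    moreover have "- B \<le> lipreg T f L x" using lipreg_ge[where f = f, OF T B L True] B[of x] by linarith
    ultimately show ?thesis by linarith
  qed (simp add: lipreg_def B0)
  fix y assume x: "bounded_on T x" and y: "bounded_on T y"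
  show "\<bar>lipreg T f L x - lipreg T f L y\<bar> \<le> L * sup_dist T x y"
    using one[OF x y] one[OF y x] by (simp add: sup_dist_commute[of T y x])
qed

text \<open>Within \<delta> of x continuity bounds f; a point further away loses at least n
  \<delta>, which outweighs the possible gain 2 B once n is large.\<close>

lemma lipreg_tendsto:
  assumes T: "T \<noteq> {}" and B: "\<And>x. \<bar>f x\<bar> \<le> B" and x: "bounded_on T x"
    and c: "\<And>\<epsilon>. \<epsilon> > 0 \<Longrightarrow> \<exists>\<delta>>0. \<forall>y. bounded_on T y \<longrightarrow> sup_dist T x y < \<delta> \<longrightarrow> \<bar>f x - f y\<bar> < \<epsilon>"
  shows "(\<lambda>n. lipreg T f (real n) x) \<longlonglongrightarrow> f x"
proof (rule LIMSEQ_I)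
  fix r :: real assume r: "0 < r"
  then obtain \<delta> where d: "\<delta> > 0" "\<And>y. bounded_on T y \<Longrightarrow> sup_dist T x y < \<delta> \<Longrightarrow> \<bar>f x - f y\<bar> < r / 2"
    using c[of "r/2"] by auto
  obtain N :: nat where N: "2 * B / \<delta> \<le> real N" using real_arch_simple by blast
  show "\<exists>no. \<forall>n\<ge>no. norm (lipreg T f (real n) x - f x) < r"
  proof (intro exI[of _ N] allI impI)
    fix n assume "N \<le> n"
    then have "2 * B / \<delta> \<le> real n" using N by linarith
    then have n: "2 * B \<le> real n * \<delta>" using d by (simp add: pos_divide_le_eq)
    have "(SUP y\<in>{y. bounded_on T y}. f y - real n * sup_dist T x y) \<le> f x + r / 2"
    proof (rule cSUP_least)
      show "{y. bounded_on T y} \<noteq> {}" using x by blast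
      fix y assume y: "y \<in> {y. bounded_on T y}"
      show "f y - real n * sup_dist T x y \<le> f x + r / 2"
      proof (cases "sup_dist T x y < \<delta>")
        case True
        have "0 \<le> real n * sup_dist T x y" using sup_dist_nonneg[OF T x] y by simp
        then show ?thesis using d(2)[OF _ True] y by (simp add: abs_if split: if_splits)
      next
        case False
        then have "real n * \<delta> \<le> real n * sup_dist T x y" by (intro mult_left_mono) auto
        then show ?thesis using n B[of x] B[of y] r by linarith
      qed
    qed
    then have "lipreg T f (real n) x \<le> f x + r / 2" using x by (simp add: lipreg_def)
    moreover have "f x \<le> lipreg T f (real n) x" by (rule lipreg_ge[where f = f, OF T B _ x]) simp
    ultimately show "norm (lipreg T f (real n) x - f x) < r" using r by simp
  qed
qed

text \<open>\<open>As n K\<close> and \<open>A K\<close> stand for the discretisations of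
  \<open>Zs n\<close> and \<open>Z\<close> on a grid with K cells. The closeness in
  \<open>As_lim\<close> is required off a measurable set \<open>E\<close>, because measurability of
  the supremum distance itself is not assumed; n goes to infinity before K.\<close>

locale sup_approx =
  fixes T :: "(nat \<Rightarrow> real) set" and M :: "'a measure" and N :: "'b measure"
    and Zs :: "nat \<Rightarrow> 'a \<Rightarrow> (nat \<Rightarrow> real) \<Rightarrow> real" and Z :: "'b \<Rightarrow> (nat \<Rightarrow> real) \<Rightarrow> real"
    and As :: "nat \<Rightarrow> nat \<Rightarrow> 'a \<Rightarrow> (nat \<Rightarrow> real) \<Rightarrow> real" and A :: "nat \<Rightarrow> 'b \<Rightarrow> (nat \<Rightarrow> real) \<Rightarrow> real"
  assumes M: "prob_space M" and N: "prob_space N" and T: "T \<noteq> {}"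
    and Zs_bdd: "\<And>n \<omega>. \<omega> \<in> space M \<Longrightarrow> bounded_on T (Zs n \<omega>)" and Z_bdd: "\<And>\<omega>. \<omega> \<in> space N \<Longrightarrow> bounded_on T (Z \<omega>)"
    and As_bdd: "\<And>n K \<omega>. \<omega> \<in> space M \<Longrightarrow> bounded_on T (As n K \<omega>)" and A_bdd: "\<And>K \<omega>. \<omega> \<in> space N \<Longrightarrow> bounded_on T (A K \<omega>)"
    and As_meas: "\<And>f L B n K. lip_functional T f L B \<Longrightarrow> K \<ge> 1 \<Longrightarrow> (\<lambda>\<omega>. f (As n K \<omega>)) \<in> borel_measurable M"
    and A_meas: "\<And>f L B K. lip_functional T f L B \<Longrightarrow> K \<ge> 1 \<Longrightarrow> (\<lambda>\<omega>. f (A K \<omega>)) \<in> borel_measurable N"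
    and conv: "\<And>f L B K. lip_functional T f L B \<Longrightarrow> K \<ge> 1 \<Longrightarrow> (\<lambda>n. \<integral>\<omega>. f (As n K \<omega>) \<partial>M) \<longlonglongrightarrow> (\<integral>\<omega>. f (A K \<omega>) \<partial>N)"
    and A_lim: "\<And>\<omega>. \<omega> \<in> space N \<Longrightarrow> (\<lambda>K. sup_dist T (Z \<omega>) (A K \<omega>)) \<longlonglongrightarrow> 0"
    and As_lim: "\<And>\<epsilon> \<eta>. \<epsilon> > 0 \<Longrightarrow> \<eta> > 0 \<Longrightarrow> \<forall>\<^sub>F K in sequentially. \<forall>\<^sub>F n in sequentially. \<exists>E\<in>sets M. measure M E \<le> \<eta> \<and>
       (\<forall>\<omega>\<in>space M - E. sup_dist T (Zs n \<omega>) (As n K \<omega>) \<le> \<epsilon>)"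
begin

sublocale M: prob_space M by (rule M)
sublocale N: prob_space N by (rule N)

text \<open>Measurability of f(Z) is not assumed but results from the pointwise convergence of the
  discretisations. The index is shifted to \<open>Suc K\<close> since measurability is only given
  for positive K.\<close>

lemma lip_Z:
  assumes f: "lip_functional T f L B"
  shows "(\<lambda>\<omega>. f (Z \<omega>)) \<in> borel_measurable N" "(\<lambda>K. \<integral>\<omega>. f (A K \<omega>) \<partial>N) \<longlonglongrightarrow> (\<integral>\<omega>. f (Z \<omega>) \<partial>N)"
proof -
  have L: "0 \<le> L" and B: "\<And>x. \<bar>f x\<bar> \<le> B" and lip: "\<And>x y. bounded_on T x \<Longrightarrow> bounded_on T y \<Longrightarrow> \<bar>f x - f y\<bar> \<le> L * sup_dist T x y"
    using f unfolding lip_functional_def by auto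
  have pt: "(\<lambda>K. f (A (Suc K) \<omega>)) \<longlonglongrightarrow> f (Z \<omega>)" if w: "\<omega> \<in> space N" for \<omega>
  proof (rule LIM_zero_cancel, rule Lim_null_comparison)
    show "(\<lambda>K. L * sup_dist T (Z \<omega>) (A (Suc K) \<omega>)) \<longlonglongrightarrow> 0"
      using tendsto_mult[OF tendsto_const[of L] LIMSEQ_Suc[OF A_lim[OF w]]] by simp
    show "\<forall>\<^sub>F K in sequentially. norm (f (A (Suc K) \<omega>) - f (Z \<omega>)) \<le> L * sup_dist T (Z \<omega>) (A (Suc K) \<omega>)"
    proof (rule always_eventually, rule allI)
      fix K show "norm (f (A (Suc K) \<omega>) - f (Z \<omega>)) \<le> L * sup_dist T (Z \<omega>) (A (Suc K) \<omega>)"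
        using lip[OF Z_bdd[OF w] A_bdd[OF w, of "Suc K"]] by (simp add: abs_minus_commute)
    qed
  qed
  have m: "(\<lambda>\<omega>. f (A (Suc K) \<omega>)) \<in> borel_measurable N" for K by (rule A_meas[OF f]) simp
  show fZ: "(\<lambda>\<omega>. f (Z \<omega>)) \<in> borel_measurable N" by (rule borel_measurable_LIMSEQ_metric[OF m pt])
  have "(\<lambda>K. \<integral>\<omega>. f (A (Suc K) \<omega>) \<partial>N) \<longlonglongrightarrow> (\<integral>\<omega>. f (Z \<omega>) \<partial>N)"
  proof (rule integral_dominated_convergence[where w = "\<lambda>_. B"])
    show "AE \<omega> in N. (\<lambda>K. f (A (Suc K) \<omega>)) \<longlonglongrightarrow> f (Z \<omega>)" by (rule AE_I2[OF pt])
    show "AE \<omega> in N. norm (f (A (Suc K) \<omega>)) \<le> B" for K by (rule AE_I2) (simp add: B)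
  qed (rule fZ, rule m, simp)
  then show "(\<lambda>K. \<integral>\<omega>. f (A K \<omega>) \<partial>N) \<longlonglongrightarrow> (\<integral>\<omega>. f (Z \<omega>) \<partial>N)" by (rule LIMSEQ_imp_Suc)
qed

text \<open>The same argument one step further, now with the Lipschitz regularisations in the place
  of the discretisations.\<close>

lemma bc_Z:
  assumes B: "\<And>x. \<bar>f x\<bar> \<le> B"
    and c: "\<And>x \<epsilon>. bounded_on T x \<Longrightarrow> \<epsilon> > 0 \<Longrightarrow> \<exists>\<delta>>0. \<forall>y. bounded_on T y \<longrightarrow> sup_dist T x y < \<delta> \<longrightarrow> \<bar>f x - f y\<bar> < \<epsilon>"
  shows "(\<lambda>\<omega>. f (Z \<omega>)) \<in> borel_measurable N" "(\<lambda>l. \<integral>\<omega>. lipreg T f (real l) (Z \<omega>) \<partial>N) \<longlonglongrightarrow> (\<integral>\<omega>. f (Z \<omega>) \<partial>N)"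
proof -
  have lr: "lip_functional T (lipreg T f (real l)) (real l) B" for l by (rule lipreg_lip[where f = f, OF T B]) simp
  have m: "(\<lambda>\<omega>. lipreg T f (real l) (Z \<omega>)) \<in> borel_measurable N" for l by (rule lip_Z(1)[OF lr])
  have pt: "(\<lambda>l. lipreg T f (real l) (Z \<omega>)) \<longlonglongrightarrow> f (Z \<omega>)" if w: "\<omega> \<in> space N" for \<omega>
    by (rule lipreg_tendsto[where f = f, OF T B Z_bdd[OF w] c[OF Z_bdd[OF w]]])
  show fZ: "(\<lambda>\<omega>. f (Z \<omega>)) \<in> borel_measurable N" by (rule borel_measurable_LIMSEQ_metric[OF m pt])
  show "(\<lambda>l. \<integral>\<omega>. lipreg T f (real l) (Z \<omega>) \<partial>N) \<longlonglongrightarrow> (\<integral>\<omega>. f (Z \<omega>) \<partial>N)"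
  proof (rule integral_dominated_convergence[where w = "\<lambda>_. B"])
    show "AE \<omega> in N. (\<lambda>l. lipreg T f (real l) (Z \<omega>)) \<longlonglongrightarrow> f (Z \<omega>)" by (rule AE_I2[OF pt])
    show "AE \<omega> in N. norm (lipreg T f (real l) (Z \<omega>)) \<le> B" for l
      using lr unfolding lip_functional_def by (intro AE_I2) simp
  qed (rule fZ, rule m, simp)
qed

text \<open>Outer expectations are bounded by exhibiting one integrable majorant \<open>V\<close>:
  the regularised functional at the discretised process, plus the price of the discretisation, plus
  a bound on the exceptional set. Each of the five replacements costs at most \<epsilon>/5.\<close>

lemma upper:
  fixes f :: "((nat \<Rightarrow> real) \<Rightarrow> real) \<Rightarrow> real"
  assumes B: "\<And>x. \<bar>f x\<bar> \<le> B"
    and c: "\<And>x \<epsilon>. bounded_on T x \<Longrightarrow> \<epsilon> > 0 \<Longrightarrow> \<exists>\<delta>>0. \<forall>y. bounded_on T y \<longrightarrow> sup_dist T x y < \<delta> \<longrightarrow> \<bar>f x - f y\<bar> < \<epsilon>"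
    and e: "\<epsilon> > 0"
  shows "\<forall>\<^sub>F n in sequentially. \<exists>V. integrable M V \<and> (\<forall>\<omega>\<in>space M. f (Zs n \<omega>) \<le> V \<omega>) \<and> (\<integral>\<omega>. V \<omega> \<partial>M) \<le> (\<integral>\<omega>. f (Z \<omega>) \<partial>N) + \<epsilon>"
proof -
  have B0: "0 \<le> B" using B[of undefined] by linarith
  have "\<forall>\<^sub>F l in sequentially. (\<integral>\<omega>. lipreg T f (real l) (Z \<omega>) \<partial>N) < (\<integral>\<omega>. f (Z \<omega>) \<partial>N) + \<epsilon> / 5"
    by (rule order_tendstoD(2)[OF bc_Z(2)[where f = f, OF B c]]) (use e in auto)
  then obtain l where l: "(\<integral>\<omega>. lipreg T f (real l) (Z \<omega>) \<partial>N) < (\<integral>\<omega>. f (Z \<omega>) \<partial>N) + \<epsilon> / 5"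
    by (auto dest: eventually_happens)
  let ?g = "lipreg T f (real l)"
  have lr: "lip_functional T ?g (real l) B" by (rule lipreg_lip[where f = f, OF T B]) simp
  have gB: "\<bar>?g x\<bar> \<le> B" for x using lr unfolding lip_functional_def by blast
  have glip: "\<bar>?g x - ?g y\<bar> \<le> real l * sup_dist T x y" if "bounded_on T x" "bounded_on T y" for x y
    using lr that unfolding lip_functional_def by blast
  \<comment> \<open>Chosen so that l \<epsilon>' and 2 B \<eta> are each at most \<epsilon>/5;
    adding 1 guards against l = 0 and B = 0.\<close>
  define \<epsilon>' where "\<epsilon>' = \<epsilon> / (5 * (real l + 1))"
  define \<eta> where "\<eta> = \<epsilon> / (10 * (B + 1))"
  have e': "\<epsilon>' > 0" "\<eta> > 0" using e B0 by (auto simp: \<epsilon>'_def \<eta>_def)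
  have le': "real l * \<epsilon>' \<le> \<epsilon> / 5"
  proof -
    have "real l * \<epsilon>' \<le> (real l + 1) * \<epsilon>'" using e' by (intro mult_right_mono) auto
    also have "\<dots> = \<epsilon> / 5"
    proof -
      have "z * (\<epsilon> / (5 * z)) = \<epsilon> / 5" if "z > 0" for z :: real using that by (simp add: field_simps)
      from this[of "real l + 1"] show ?thesis unfolding \<epsilon>'_def by simp
    qed
    finally show ?thesis .
  qed
  have Be: "2 * B * \<eta> \<le> \<epsilon> / 5"
  proof -
    have "2 * B * \<eta> \<le> 2 * (B + 1) * \<eta>" using e' by (intro mult_right_mono) auto
    also have "\<dots> = \<epsilon> / 5" using B0 by (simp add: \<eta>_def field_simps)
    finally show ?thesis .
  qed
  have "\<forall>\<^sub>F K in sequentially. (\<integral>\<omega>. ?g (A K \<omega>) \<partial>N) < (\<integral>\<omega>. ?g (Z \<omega>) \<partial>N) + \<epsilon> / 5"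
    by (rule order_tendstoD(2)[OF lip_Z(2)[OF lr]]) (use e in auto)
  then have "\<forall>\<^sub>F K in sequentially. (\<integral>\<omega>. ?g (A K \<omega>) \<partial>N) < (\<integral>\<omega>. ?g (Z \<omega>) \<partial>N) + \<epsilon> / 5 \<and> K \<ge> 1 \<and>
     (\<forall>\<^sub>F n in sequentially. \<exists>E\<in>sets M. measure M E \<le> \<eta> \<and> (\<forall>\<omega>\<in>space M - E. sup_dist T (Zs n \<omega>) (As n K \<omega>) \<le> \<epsilon>'))"
    using As_lim[OF e'] eventually_ge_at_top[of 1] by eventually_elim blast
  then obtain K where K: "(\<integral>\<omega>. ?g (A K \<omega>) \<partial>N) < (\<integral>\<omega>. ?g (Z \<omega>) \<partial>N) + \<epsilon> / 5" "K \<ge> 1"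
     "\<forall>\<^sub>F n in sequentially. \<exists>E\<in>sets M. measure M E \<le> \<eta> \<and> (\<forall>\<omega>\<in>space M - E. sup_dist T (Zs n \<omega>) (As n K \<omega>) \<le> \<epsilon>')"
    by (auto dest: eventually_happens)
  have "\<forall>\<^sub>F n in sequentially. (\<integral>\<omega>. ?g (As n K \<omega>) \<partial>M) < (\<integral>\<omega>. ?g (A K \<omega>) \<partial>N) + \<epsilon> / 5"
    by (rule order_tendstoD(2)[OF conv[OF lr K(2)]]) (use e in auto)
  then show ?thesis using K(3)
  proof eventually_elim
    case (elim n)
    then obtain E where E: "E \<in> sets M" "measure M E \<le> \<eta>" "\<And>\<omega>. \<omega> \<in> space M - E \<Longrightarrow> sup_dist T (Zs n \<omega>) (As n K \<omega>) \<le> \<epsilon>'" by blast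
    define V where "V \<omega> = ?g (As n K \<omega>) + real l * \<epsilon>' + 2 * B * indicator E \<omega>" for \<omega>
    have i1: "integrable M (\<lambda>\<omega>. ?g (As n K \<omega>))"
      by (rule M.integrable_const_bound[of _ B]) (simp add: gB, rule As_meas[OF lr K(2)])
    have i2: "integrable M (\<lambda>\<omega>. indicator E \<omega> :: real)" using E(1) by (simp add: M.emeasure_eq_measure)
    have iV: "integrable M V" unfolding V_def using i1 i2 by auto
    have dom: "f (Zs n \<omega>) \<le> V \<omega>" if w: "\<omega> \<in> space M" for \<omega>
    proof (cases "\<omega> \<in> E")
      case True
      have "0 \<le> real l * \<epsilon>'" using e' by simp
      then show ?thesis using B[of "Zs n \<omega>"] gB[of "As n K \<omega>"] True unfolding V_def by simp
    next
      case False
      have "f (Zs n \<omega>) \<le> ?g (Zs n \<omega>)" by (rule lipreg_ge[where f = f, OF T B _ Zs_bdd[OF w]]) simp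
      also have "\<dots> \<le> ?g (As n K \<omega>) + real l * sup_dist T (Zs n \<omega>) (As n K \<omega>)"
        using glip[OF Zs_bdd[OF w] As_bdd[OF w], of n n K] by linarith
      also have "real l * sup_dist T (Zs n \<omega>) (As n K \<omega>) \<le> real l * \<epsilon>'" using E(3) w False by (intro mult_left_mono) auto
      finally show ?thesis using False unfolding V_def by simp
    qed
    have "(\<integral>\<omega>. V \<omega> \<partial>M) = (\<integral>\<omega>. ?g (As n K \<omega>) \<partial>M) + real l * \<epsilon>' + 2 * B * measure M E"
      unfolding V_def using i1 i2 E(1) by (simp add: M.prob_space)
    also have "2 * B * measure M E \<le> 2 * B * \<eta>" using E(2) B0 by (intro mult_left_mono) auto
    finally have "(\<integral>\<omega>. V \<omega> \<partial>M) \<le> (\<integral>\<omega>. f (Z \<omega>) \<partial>N) + \<epsilon>"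
      using l K(1) elim(1) le' Be by linarith
    then show ?case using iV dom by blast
  qed
qed

theorem conv_dist_approx: "conv_dist T M Zs N Z"
  unfolding conv_dist_def
proof (intro allI impI)
  fix f assume "bc_functional T f"
  then obtain B where B: "\<And>x. \<bar>f x\<bar> \<le> B"
    and c: "\<And>x \<epsilon>. bounded_on T x \<Longrightarrow> \<epsilon> > 0 \<Longrightarrow> \<exists>\<delta>>0. \<forall>y. bounded_on T y \<longrightarrow> sup_dist T x y < \<delta> \<longrightarrow> \<bar>f x - f y\<bar> < \<epsilon>"
    unfolding bc_functional_def by blast
  have fZ: "integrable N (\<lambda>\<omega>. f (Z \<omega>))"
    by (rule N.integrable_const_bound[of _ B]) (simp add: B, rule bc_Z(1)[where f = f, OF B c])
  \<comment> \<open>f(Z) is integrable, so the infimum over its majorants is attained at f(Z)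
    itself.\<close>
  have oN: "outer_exp N (\<lambda>\<omega>. f (Z \<omega>)) = (\<integral>\<omega>. f (Z \<omega>) \<partial>N)"
    unfolding outer_exp_def
  proof (rule cInf_eq_minimum)
    show "(\<integral>\<omega>. f (Z \<omega>) \<partial>N) \<in> {integral\<^sup>L N U |U. integrable N U \<and> (\<forall>\<omega>\<in>space N. f (Z \<omega>) \<le> U \<omega>)}" using fZ by blast
    fix y assume "y \<in> {integral\<^sup>L N U |U. integrable N U \<and> (\<forall>\<omega>\<in>space N. f (Z \<omega>) \<le> U \<omega>)}"
    then obtain U where U: "y = integral\<^sup>L N U" "integrable N U" "\<forall>\<omega>\<in>space N. f (Z \<omega>) \<le> U \<omega>" by blast
    show "(\<integral>\<omega>. f (Z \<omega>) \<partial>N) \<le> y" unfolding U(1) by (rule integral_mono[OF fZ U(2)]) (use U(3) in blast)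
  qed
  show "(\<lambda>n. outer_exp M (\<lambda>\<omega>. f (Zs n \<omega>))) \<longlonglongrightarrow> outer_exp N (\<lambda>\<omega>. f (Z \<omega>))"
    unfolding oN
  proof (rule LIMSEQ_I)
    fix r :: real assume r: "0 < r"
    then have r2: "r / 2 > 0" by simp
    have up: "\<forall>\<^sub>F n in sequentially. \<exists>V. integrable M V \<and> (\<forall>\<omega>\<in>space M. f (Zs n \<omega>) \<le> V \<omega>) \<and> (\<integral>\<omega>. V \<omega> \<partial>M) \<le> (\<integral>\<omega>. f (Z \<omega>) \<partial>N) + r / 2"
      by (rule upper[where f = f, OF B c r2])
    have "\<forall>\<^sub>F n in sequentially. \<exists>V. integrable M V \<and> (\<forall>\<omega>\<in>space M. - f (Zs n \<omega>) \<le> V \<omega>) \<and> (\<integral>\<omega>. V \<omega> \<partial>M) \<le> (\<integral>\<omega>. - f (Z \<omega>) \<partial>N) + r / 2"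
    proof (rule upper[where f = "\<lambda>x. - f x" and B = B, OF _ _ r2])
      show "\<bar>- f x\<bar> \<le> B" for x using B[of x] by simp
      show "\<exists>\<delta>>0. \<forall>y. bounded_on T y \<longrightarrow> sup_dist T x y < \<delta> \<longrightarrow> \<bar>- f x - - f y\<bar> < \<epsilon>" if "bounded_on T x" "\<epsilon> > 0" for x \<epsilon>
        using c[OF that] by (simp add: abs_minus_commute)
    qed
    with up have "\<forall>\<^sub>F n in sequentially. norm (outer_exp M (\<lambda>\<omega>. f (Zs n \<omega>)) - (\<integral>\<omega>. f (Z \<omega>) \<partial>N)) < r"
    proof eventually_elim
      case (elim n)
      from elim(1) obtain V where V: "integrable M V" "\<And>\<omega>. \<omega> \<in> space M \<Longrightarrow> f (Zs n \<omega>) \<le> V \<omega>" "(\<integral>\<omega>. V \<omega> \<partial>M) \<le> (\<integral>\<omega>. f (Z \<omega>) \<partial>N) + r / 2" by blast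
      from elim(2) obtain V' where V': "integrable M V'" "\<And>\<omega>. \<omega> \<in> space M \<Longrightarrow> - f (Zs n \<omega>) \<le> V' \<omega>" "(\<integral>\<omega>. V' \<omega> \<partial>M) \<le> (\<integral>\<omega>. - f (Z \<omega>) \<partial>N) + r / 2" by blast
      let ?S = "{integral\<^sup>L M U |U. integrable M U \<and> (\<forall>\<omega>\<in>space M. f (Zs n \<omega>) \<le> U \<omega>)}"
      \<comment> \<open>The lower bound is the upper bound for -f: a majorant \<open>V'\<close> of
        -f forces every majorant \<open>U\<close> of f to satisfy U + V' at least 0.\<close>
      have lb: "(\<integral>\<omega>. f (Z \<omega>) \<partial>N) - r / 2 \<le> y" if "y \<in> ?S" for y
      proof -
        from that obtain U where U: "y = integral\<^sup>L M U" "integrable M U" "\<And>\<omega>. \<omega> \<in> space M \<Longrightarrow> f (Zs n \<omega>) \<le> U \<omega>" by blast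
        have "0 \<le> (\<integral>\<omega>. U \<omega> + V' \<omega> \<partial>M)"
        proof (rule Bochner_Integration.integral_nonneg_AE, rule AE_I2)
          fix \<omega> assume "\<omega> \<in> space M"
          then show "0 \<le> U \<omega> + V' \<omega>" using U(3)[of \<omega>] V'(2)[of \<omega>] by linarith
        qed
        then have "0 \<le> integral\<^sup>L M U + integral\<^sup>L M V'" using U(2) V'(1) by simp
        then show ?thesis using V'(3) U(1) by simp
      qed
      have mem: "integral\<^sup>L M V \<in> ?S" using V by blast
      have "outer_exp M (\<lambda>\<omega>. f (Zs n \<omega>)) \<le> integral\<^sup>L M V"
        unfolding outer_exp_def by (rule cInf_lower[OF mem]) (rule bdd_belowI[OF lb])
      moreover have "(\<integral>\<omega>. f (Z \<omega>) \<partial>N) - r / 2 \<le> outer_exp M (\<lambda>\<omega>. f (Zs n \<omega>))"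
        unfolding outer_exp_def by (rule cInf_greatest[OF _ lb]) (use mem in blast)+
      ultimately show ?case using V(3) r by (simp add: abs_if)
    qed
    then show "\<exists>no. \<forall>n\<ge>no. norm (outer_exp M (\<lambda>\<omega>. f (Zs n \<omega>)) - (\<integral>\<omega>. f (Z \<omega>) \<partial>N)) < r"
      by (simp add: eventually_sequentially)
  qed
qed

end

subsection \<open>The limit functional\<close>

lemma Theta_ext:
  assumes k: "k \<ge> 1" and t: "t \<in> Theta k"
  shows "l \<le> Suc k \<Longrightarrow> 0 \<le> text_ext k t l" "l \<le> Suc k \<Longrightarrow> text_ext k t l \<le> 1"
    "l \<le> k \<Longrightarrow> text_ext k t l \<le> text_ext k t (Suc l)"
proof -
  have c: "\<And>l. l \<in> {1..k} \<Longrightarrow> 0 \<le> t l \<and> t l \<le> 1" using t unfolding Theta_def cube_def by blast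
  show "l \<le> Suc k \<Longrightarrow> 0 \<le> text_ext k t l" "l \<le> Suc k \<Longrightarrow> text_ext k t l \<le> 1"
    using c[of l] unfolding text_ext_def by auto
  show "l \<le> k \<Longrightarrow> text_ext k t l \<le> text_ext k t (Suc l)"
  proof -
    assume l: "l \<le> k"
    consider "l = 0" | "l = k" "l \<noteq> 0" | "l \<in> {1..<k}" using l by force
    then show ?thesis
    proof cases
      case 1 then show ?thesis using c[of 1] k by (auto simp: text_ext_def)
    next
      case 2 then show ?thesis using c[of k] k by (auto simp: text_ext_def)
    next
      case 3
      then have "t l < t (Suc l)" using t unfolding Theta_def by blast
      then show ?thesis using 3 by (auto simp: text_ext_def)
    qed
  qed
qed

text \<open>The limit functional is Lipschitz in the supremum norm of the two paths: every increment
  changes by at most 2 D, with a weight in [0, 1], and there are 2 k increments. The paths may live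
  on different sample spaces, so that random paths can be compared with deterministic ones.\<close>

lemma Zlim_bound:
  assumes k: "k \<ge> 1" and w: "\<And>p t. p \<in> {1,2} \<Longrightarrow> 0 \<le> t \<Longrightarrow> t \<le> 1 \<Longrightarrow> \<bar>w p t \<omega> - w' p t \<omega>'\<bar> \<le> D" and D: "0 \<le> D"
  shows "\<bar>Zlim k w \<omega> t - Zlim k w' \<omega>' t\<bar> \<le> 4 * real k * D"
proof (cases "t \<in> Theta k")
  case False then show ?thesis using D by (simp add: Zlim_def)
next
  case True
  let ?x = "text_ext k t"
  have "\<bar>Zlim k w \<omega> t - Zlim k w' \<omega>' t\<bar> \<le> (\<Sum>l\<in>{1..k}. 4 * D)"
    unfolding Zlim_def if_P[OF True] sum_subtractf[symmetric]
  proof (rule order_trans[OF sum_abs sum_mono])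
    fix l assume l: "l \<in> {1..k}"
    have x: "0 \<le> ?x m" "?x m \<le> 1" if "m \<in> {l - 1, l, Suc l}" for m
      using Theta_ext[OF k True, of m] that l by auto
    have d1: "0 \<le> ?x (Suc l) - ?x l" "?x (Suc l) - ?x l \<le> 1" using Theta_ext(3)[OF k True, of l] x[of l] x[of "Suc l"] l by auto
    have d2: "0 \<le> ?x l - ?x (l - 1)" "?x l - ?x (l - 1) \<le> 1" using Theta_ext(3)[OF k True, of "l - 1"] x[of l] x[of "l - 1"] l by auto
    have w1: "\<bar>w 1 (?x m) \<omega> - w' 1 (?x m) \<omega>'\<bar> \<le> D" "\<bar>w 2 (?x m) \<omega> - w' 2 (?x m) \<omega>'\<bar> \<le> D" if "m \<in> {l - 1, l, Suc l}" for m
      using w[of 1 "?x m"] w[of 2 "?x m"] x[OF that] by auto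
    have a: "\<bar>(w 1 (?x l) \<omega> - w 1 (?x (l-1)) \<omega>) - (w' 1 (?x l) \<omega>' - w' 1 (?x (l-1)) \<omega>')\<bar> \<le> 2 * D"
      using w1(1)[of l] w1(1)[of "l - 1"] by auto
    have b: "\<bar>(w 2 (?x (Suc l)) \<omega> - w 2 (?x l) \<omega>) - (w' 2 (?x (Suc l)) \<omega>' - w' 2 (?x l) \<omega>')\<bar> \<le> 2 * D"
      using w1(2)[of l] w1(2)[of "Suc l"] by auto
    have a': "\<bar>(?x (Suc l) - ?x l) * ((w 1 (?x l) \<omega> - w 1 (?x (l-1)) \<omega>) - (w' 1 (?x l) \<omega>' - w' 1 (?x (l-1)) \<omega>'))\<bar> \<le> 1 * (2 * D)"
      unfolding abs_mult using d1 a D by (intro mult_mono) auto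
    have b': "\<bar>(?x l - ?x (l - 1)) * ((w 2 (?x (Suc l)) \<omega> - w 2 (?x l) \<omega>) - (w' 2 (?x (Suc l)) \<omega>' - w' 2 (?x l) \<omega>'))\<bar> \<le> 1 * (2 * D)"
      unfolding abs_mult using d2 b D by (intro mult_mono) auto
    have e: "(?x (Suc l) - ?x l) * (w 1 (?x l) \<omega> - w 1 (?x (l-1)) \<omega>) + (?x l - ?x (l-1)) * (w 2 (?x (Suc l)) \<omega> - w 2 (?x l) \<omega>)
       - ((?x (Suc l) - ?x l) * (w' 1 (?x l) \<omega>' - w' 1 (?x (l-1)) \<omega>') + (?x l - ?x (l-1)) * (w' 2 (?x (Suc l)) \<omega>' - w' 2 (?x l) \<omega>'))
      = (?x (Suc l) - ?x l) * ((w 1 (?x l) \<omega> - w 1 (?x (l-1)) \<omega>) - (w' 1 (?x l) \<omega>' - w' 1 (?x (l-1)) \<omega>'))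
      + (?x l - ?x (l - 1)) * ((w 2 (?x (Suc l)) \<omega> - w 2 (?x l) \<omega>) - (w' 2 (?x (Suc l)) \<omega>' - w' 2 (?x l) \<omega>'))"
      by (simp only: right_diff_distrib)
    show "\<bar>(?x (Suc l) - ?x l) * (w 1 (?x l) \<omega> - w 1 (?x (l-1)) \<omega>) + (?x l - ?x (l-1)) * (w 2 (?x (Suc l)) \<omega> - w 2 (?x l) \<omega>)
       - ((?x (Suc l) - ?x l) * (w' 1 (?x l) \<omega>' - w' 1 (?x (l-1)) \<omega>') + (?x l - ?x (l-1)) * (w' 2 (?x (Suc l)) \<omega>' - w' 2 (?x l) \<omega>'))\<bar> \<le> 4 * D"
      unfolding e using a' b' by linarith
  qed
  then show ?thesis by simp
qed

lemma Zlim_bounded_on: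
  assumes k: "k \<ge> 1" and w: "\<And>p t. p \<in> {1,2} \<Longrightarrow> 0 \<le> t \<Longrightarrow> t \<le> 1 \<Longrightarrow> \<bar>w p t \<omega>\<bar> \<le> D"
  shows "bounded_on T (Zlim k w \<omega>)"
proof -
  have D: "0 \<le> D" using w[of 1 0] by force
  have z: "Zlim k (\<lambda>_ _ _. 0) () t = 0" for t by (simp add: Zlim_def)
  have "\<bar>Zlim k w \<omega> t\<bar> \<le> 4 * real k * D" for t
    using Zlim_bound[where w = w and \<omega> = \<omega> and w' = "\<lambda>_ _ _. 0" and \<omega>' = "()", OF k _ D] w unfolding z by simp
  then show ?thesis unfolding bounded_on_def by (intro bdd_aboveI2)
qed

lemma cube_nonempty: "cube k \<noteq> {}"
proof -
  have "(\<lambda>_. 0) \<in> cube k" by (simp add: cube_def)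
  then show ?thesis by blast
qed

text \<open>Markov's inequality for the fourth moment. The square of v is the point: with v of order
  1/K, the sum over K cells is still of order 1/K.\<close>

lemma centered_gauss_tail:
  assumes v: "v \<ge> 0" and l: "l > 0"
  shows "measure (centered_gauss v) {x. \<bar>x\<bar> > l} \<le> 3 * v^2 / l^4"
proof (cases "v = 0")
  case True
  have "measure (return borel (0::real)) {x. \<bar>x\<bar> > l} = 0" using l by (simp add: measure_return)
  then show ?thesis using True by (simp add: centered_gauss_def)
next
  case False
  then have v: "v > 0" using assms by simp
  then have s: "sqrt v > 0" by simp
  interpret prob_space "density lborel (normal_density 0 (sqrt v))" by (rule prob_space_normal_density[OF s])
  have m: "has_bochner_integral lborel (\<lambda>x. normal_density 0 (sqrt v) x * (x - 0) ^ (2 * 2)) (fact (2 * 2) / ((2 / (sqrt v)^2) ^ 2 * fact 2))"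
    by (rule normal_moment_even[OF s])
  have i: "integrable (density lborel (normal_density 0 (sqrt v))) (\<lambda>x. x ^ 4)"
    using m by (subst integrable_density) (auto simp: has_bochner_integral_iff)
  have e: "(\<integral>x. x ^ 4 \<partial>density lborel (normal_density 0 (sqrt v))) = 3 * v^2"
    using has_bochner_integral_integral_eq[OF m] v by (subst integral_density) (auto simp: fact_numeral field_simps power2_eq_square)
  have "measure (centered_gauss v) {x. \<bar>x\<bar> > l} \<le> prob {x \<in> space (density lborel (normal_density 0 (sqrt v))). x ^ 4 \<ge> l ^ 4}"
    using v unfolding centered_gauss_def
  proof (simp, intro finite_measure_mono subsetI)
    fix x assume "x \<in> {x. l < \<bar>x\<bar>}"
    then have "l ^ 4 \<le> \<bar>x\<bar> ^ 4" using l by (intro power_mono) auto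
    then show "x \<in> {x. l ^ 4 \<le> x ^ 4}" by (simp add: power_even_abs)
  qed measurable
  also have "\<dots> \<le> (\<integral>x. x ^ 4 \<partial>density lborel (normal_density 0 (sqrt v))) / l ^ 4"
    by (rule integral_Markov_inequality_measure[OF i, of "{}"]) (use l in auto)
  finally show ?thesis using e by simp
qed

section \<open>Convergence of the partial sum functional\<close>

context mixing_fun begin

text \<open>The event is written as a function \<open>F\<close> of the vector of N consecutive
  observations, to which stationarity applies.\<close>

lemma SA_shift_max:
  "prob {\<omega>\<in>space M. \<exists>i\<le>N. \<bar>SA {a<..a+i} \<omega>\<bar> > l} = prob {\<omega>\<in>space M. \<exists>i\<le>N. \<bar>SA {0<..i} \<omega>\<bar> > l}"
proof -
  define F :: "(nat \<Rightarrow> real) \<Rightarrow> real" where "F x = (if \<exists>i\<le>N. \<bar>\<Sum>k\<in>{1..i}. u (x k)\<bar> > l then 1 else 0)" for x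
  have F: "F \<in> borel_measurable (PiM {1..N} (\<lambda>_. borel))"
  proof -
    have s: "(\<lambda>x. \<Sum>k\<in>{1..i}. u (x k)) \<in> borel_measurable (PiM {1..N} (\<lambda>_. borel))" if "i \<le> N" for i
      by (intro borel_measurable_sum measurable_compose[OF _ u] measurable_component_singleton) (use that in auto)
    have p: "Measurable.pred (PiM {1..N} (\<lambda>_. borel)) (\<lambda>x. \<bar>\<Sum>k\<in>{1..i}. u (x k)\<bar> > l)" if "i \<le> N" for i
      using s[OF that] by measurable
    have "Measurable.pred (PiM {1..N} (\<lambda>_. borel)) (\<lambda>x. \<exists>i\<in>{..N}. \<bar>\<Sum>k\<in>{1..i}. u (x k)\<bar> > l)"
      by (rule pred_intros_countable_bounded(4)) (use p in auto)
    then show ?thesis unfolding F_def Bex_def atMost_iff by (intro measurable_If) auto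
  qed
  have sh: "(\<Sum>k\<in>{1..i}. u (X (k + b) \<omega>)) = SA {b<..b+i} \<omega>" for i b \<omega>
    unfolding SA_def by (rule sum.reindex_bij_witness[of _ "\<lambda>i. i - b" "\<lambda>i. i + b"]) auto
  have sh0: "(\<Sum>k\<in>{1..i}. u (X k \<omega>)) = SA {0<..i} \<omega>" for i \<omega> using sh[of 0 \<omega> i] by simp
  have F1: "F (\<lambda>i\<in>{1..N}. X (i + a) \<omega>) = indicator {\<omega>\<in>space M. \<exists>i\<le>N. \<bar>SA {a<..a+i} \<omega>\<bar> > l} \<omega>" if "\<omega> \<in> space M" for \<omega>
  proof -
    have "(\<Sum>k\<in>{1..i}. u ((\<lambda>i\<in>{1..N}. X (i + a) \<omega>) k)) = SA {a<..a+i} \<omega>" if "i \<le> N" for i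
      unfolding sh[symmetric] by (rule sum.cong) (use that in auto)
    then have "(\<exists>i\<le>N. \<bar>\<Sum>k\<in>{1..i}. u ((\<lambda>i\<in>{1..N}. X (i + a) \<omega>) k)\<bar> > l) = (\<exists>i\<le>N. \<bar>SA {a<..a+i} \<omega>\<bar> > l)" by metis
    then show ?thesis unfolding F_def using that by (simp add: indicator_def)
  qed
  have F2: "F (\<lambda>i\<in>{1..N}. X i \<omega>) = indicator {\<omega>\<in>space M. \<exists>i\<le>N. \<bar>SA {0<..i} \<omega>\<bar> > l} \<omega>" if "\<omega> \<in> space M" for \<omega>
  proof -
    have "(\<Sum>k\<in>{1..i}. u ((\<lambda>i\<in>{1..N}. X i \<omega>) k)) = SA {0<..i} \<omega>" if "i \<le> N" for i
      unfolding sh0[symmetric] by (rule sum.cong) (use that in auto)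
    then have "(\<exists>i\<le>N. \<bar>\<Sum>k\<in>{1..i}. u ((\<lambda>i\<in>{1..N}. X i \<omega>) k)\<bar> > l) = (\<exists>i\<le>N. \<bar>SA {0<..i} \<omega>\<bar> > l)" by metis
    then show ?thesis unfolding F_def using that by (simp add: indicator_def)
  qed
  have XM: "(\<lambda>\<omega>. \<lambda>i\<in>{1..N}. X (i + s) \<omega>) \<in> measurable M (PiM {1..N} (\<lambda>_. borel))" for s by measurable
  have d: "distr M borel (\<lambda>\<omega>. F (\<lambda>i\<in>{1..N}. X (i + a) \<omega>)) = distr M borel (\<lambda>\<omega>. F (\<lambda>i\<in>{1..N}. X i \<omega>))"
    by (rule stat_distr[OF _ _ F]) auto
  have m1: "(\<lambda>\<omega>. F (\<lambda>i\<in>{1..N}. X (i + s) \<omega>)) \<in> borel_measurable M" for s by (rule measurable_compose[OF XM F])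
  have "(\<integral>\<omega>. F (\<lambda>i\<in>{1..N}. X (i + a) \<omega>) \<partial>M) = (\<integral>\<omega>. F (\<lambda>i\<in>{1..N}. X i \<omega>) \<partial>M)"
    using arg_cong[OF d, of "\<lambda>m. integral\<^sup>L m (\<lambda>x. x)"] integral_distr[OF m1[of a], of "\<lambda>x. x"] integral_distr[OF m1[of 0], of "\<lambda>x. x"] by simp
  also have "(\<integral>\<omega>. F (\<lambda>i\<in>{1..N}. X (i + a) \<omega>) \<partial>M) = prob {\<omega>\<in>space M. \<exists>i\<le>N. \<bar>SA {a<..a+i} \<omega>\<bar> > l}"
    using Bochner_Integration.integral_cong[OF refl F1, of M] by (simp add: Int_absorb1 subsetI cong: conj_cong)
  also have "(\<integral>\<omega>. F (\<lambda>i\<in>{1..N}. X i \<omega>) \<partial>M) = prob {\<omega>\<in>space M. \<exists>i\<le>N. \<bar>SA {0<..i} \<omega>\<bar> > l}"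
    using Bochner_Integration.integral_cong[OF refl F2, of M] by (simp add: Int_absorb1 subsetI cong: conj_cong)
  finally show ?thesis .
qed

end

locale pair_limit = mixing_pair M X \<tau> Cb hh q for M :: "'a measure" and X \<tau> Cb hh q +
  fixes N :: "'b measure" and W :: "nat \<Rightarrow> real \<Rightarrow> 'b \<Rightarrow> real"
  assumes N: "prob_space N"
    and W_meas: "\<And>p t. p \<in> {1,2} \<Longrightarrow> t \<in> {0..1} \<Longrightarrow> W p t \<in> borel_measurable N"
    and W_cont: "\<And>p \<omega>. p \<in> {1,2} \<Longrightarrow> \<omega> \<in> space N \<Longrightarrow> continuous_on {0..1} (\<lambda>t. W p t \<omega>)"
    and W_law: "\<And>(n::nat) a q s. (\<forall>j<n. q j \<in> {1,2} \<and> s j \<in> {0..1}) \<Longrightarrow>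
        distr N borel (\<lambda>\<omega>. \<Sum>j<n. a j * W (q j) (s j) \<omega>)
        = centered_gauss (\<Sum>j<n. \<Sum>m<n. a j * a m * min (s j) (s m) * sg (q j) (q m))"
begin

sublocale N: prob_space N by (rule N)

text \<open>The characteristic function on the right equals exp(-V/2) with the same \<open>V\<close>
  as in \<open>fdd_char\<close>.\<close>

lemma fdd_conv:
  fixes a :: "nat \<Rightarrow> real"
  assumes K: "K \<ge> 1" and qq: "\<And>j. j < d \<Longrightarrow> qq j \<in> {1,2::nat}" and mm: "\<And>j. j < d \<Longrightarrow> mm j \<le> (K::nat)"
  shows "(\<lambda>n. \<integral>\<omega>. iexp (\<Sum>j<d. a j * wn n (qq j) (real (mm j) / K) \<omega>) \<partial>M) \<longlonglongrightarrow> (\<integral>\<omega>. iexp (\<Sum>j<d. a j * W (qq j) (real (mm j) / K) \<omega>) \<partial>N)"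
proof -
  have s: "real (mm j) / K \<in> {0..1}" if "j < d" for j using mm[OF that] K by simp
  let ?V = "\<Sum>j<d. \<Sum>l<d. a j * a l * min (real (mm j) / K) (real (mm l) / K) * sg (qq j) (qq l)"
  let ?S = "\<lambda>\<omega>. \<Sum>j<d. a j * W (qq j) (real (mm j) / K) \<omega>"
  have m: "?S \<in> borel_measurable N"
    by (intro borel_measurable_sum borel_measurable_times borel_measurable_const W_meas) (use qq s in auto)
  have "distr N borel ?S = centered_gauss ?V" by (rule W_law[where n = d and a = a and q = qq and s = "\<lambda>j. real (mm j) / K"]) (use qq s in blast)
  then have "(\<integral>x. iexp x \<partial>distr N borel ?S) = exp (- ?V / 2)"
    using char_centered_gauss[OF fdd_char(1)[where a = a, OF K qq mm]] by simp
  moreover have "(\<integral>x. iexp x \<partial>distr N borel ?S) = (\<integral>\<omega>. iexp (?S \<omega>) \<partial>N)" by (rule integral_distr[OF m]) measurable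
  ultimately show ?thesis using fdd_char(2)[where a = a, OF K qq mm] by simp
qed

lemma wn_SA: "wn n p t \<omega> = mixing_fun.SA X (hh p) {0<..nat \<lfloor>real n * t\<rfloor>} \<omega> / sqrt (real n)" if "p \<in> {1,2}"
  unfolding wn_def mixing_fun.SA_def[OF hh[OF that]] ..

lemma wn_meas: "p \<in> {1,2} \<Longrightarrow> wn n p t \<in> borel_measurable M"
  unfolding wn_def by (intro borel_measurable_divide borel_measurable_sum hhX_meas borel_measurable_const)

lemma floor_grid: "nat \<lfloor>real n * (real m / real K)\<rfloor> = n * m div K"
  using floor_divide_of_nat_eq[of "n * m" K, where ?'a=real] by simp

section \<open>Tails and oscillation of the partial sum processes\<close>

lemma wn_tail:
  assumes p: "p \<in> {1,2}" and m: "m \<le> K" "K \<ge> 1" and R: "R > 0"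
  shows "prob {\<omega>\<in>space M. \<bar>wn n p (real m / real K) \<omega>\<bar> > R} \<le> mixing_fun.Cv M X \<tau> Cb (hh p) q / R^2"
proof (cases "n = 0")
  case True
  have "mixing_fun.Cv M X \<tau> Cb (hh p) q > 0" by (rule mixing_fun.Cv[OF hh[OF p]])
  then show ?thesis using True R by (simp add: wn_def)
next
  case False
  let ?C = "mixing_fun.Cv M X \<tau> Cb (hh p) q" and ?A = "{0<..n * m div K}"
  have C: "?C > 0" by (rule mixing_fun.Cv[OF hh[OF p]])
  have n: "real n > 0" using False by simp
  have "{\<omega>\<in>space M. \<bar>wn n p (real m / real K) \<omega>\<bar> > R} = {\<omega>\<in>space M. \<bar>mixing_fun.SA X (hh p) ?A \<omega>\<bar> > R * sqrt n}"
    unfolding wn_SA[OF p] floor_grid using n by (auto simp: abs_divide pos_less_divide_eq)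
  then have "prob {\<omega>\<in>space M. \<bar>wn n p (real m / real K) \<omega>\<bar> > R} \<le> ?C * card ?A / (R * sqrt n)^2"
    using mixing_fun.SA_chebyshev[OF hh[OF p], of ?A "R * sqrt n"] R n by (simp add: subset_eq)
  also have "\<dots> \<le> ?C * n / (R * sqrt n)^2"
  proof (intro divide_right_mono mult_left_mono)
    have "n * m div K \<le> n * K div K" using m by (intro div_le_mono mult_le_mono2)
    then show "real (card ?A) \<le> real n" using m by simp
  qed (use C in auto)
  also have "\<dots> = ?C / R^2" using n by (simp add: power_mult_distrib)
  finally show ?thesis .
qed

lemma fdd_lip:
  fixes \<phi> :: "(nat \<Rightarrow> real) \<Rightarrow> real"
  assumes K: "K \<ge> 1" and qq: "\<And>j. j < d \<Longrightarrow> qq j \<in> {1,2::nat}" and mm: "\<And>j. j < d \<Longrightarrow> mm j \<le> (K::nat)"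
    and lip: "\<And>x y. \<bar>\<phi> x - \<phi> y\<bar> \<le> L * (\<Sum>j<d. \<bar>x j - y j\<bar>)" and bd: "\<And>x. \<bar>\<phi> x\<bar> \<le> (B::real)"
  shows "(\<lambda>n. \<integral>\<omega>. \<phi> (\<lambda>j. wn n (qq j) (real (mm j) / K) \<omega>) \<partial>M) \<longlonglongrightarrow> (\<integral>\<omega>. \<phi> (\<lambda>j. W (qq j) (real (mm j) / K) \<omega>) \<partial>N)"
proof (rule lipschitz_converge[where S = "\<lambda>n \<omega> j. wn n (qq j) (real (mm j) / K) \<omega>" and G = "\<lambda>\<omega> j. W (qq j) (real (mm j) / K) \<omega>" and d = d, OF prob_space_axioms N])
  show "(\<lambda>\<omega>. wn n (qq j) (real (mm j) / K) \<omega>) \<in> borel_measurable M" if "j < d" for n j by (rule wn_meas[OF qq[OF that]])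
  show "(\<lambda>\<omega>. W (qq j) (real (mm j) / K) \<omega>) \<in> borel_measurable N" if "j < d" for j
    by (rule W_meas[OF qq[OF that]]) (use mm[OF that] K in simp)
  show "(\<lambda>n. \<integral>\<omega>. iexp (\<Sum>j<d. a j * wn n (qq j) (real (mm j) / K) \<omega>) \<partial>M) \<longlonglongrightarrow> (\<integral>\<omega>. iexp (\<Sum>j<d. a j * W (qq j) (real (mm j) / K) \<omega>) \<partial>N)" for a
    by (rule fdd_conv[OF K qq mm])
  show "\<exists>R0. \<forall>R\<ge>R0. \<forall>n. prob {\<omega>\<in>space M. \<exists>j<d. \<bar>wn n (qq j) (real (mm j) / K) \<omega>\<bar> > R} \<le> e" if e: "e > 0" for e
  proof -
    define C where "C = (\<Sum>j<d. mixing_fun.Cv M X \<tau> Cb (hh (qq j)) q)"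
    have C0: "C \<ge> 0" unfolding C_def by (intro sum_nonneg less_imp_le mixing_fun.Cv hh qq) simp
    define R0 where "R0 = sqrt (C / e) + 1"
    have R0: "R0 > 0" unfolding R0_def using C0 e by (intro add_nonneg_pos) auto
    have "prob {\<omega>\<in>space M. \<exists>j<d. \<bar>wn n (qq j) (real (mm j) / K) \<omega>\<bar> > R} \<le> e" if R: "R \<ge> R0" for R n
    proof -
      have "{\<omega>\<in>space M. \<exists>j<d. \<bar>wn n (qq j) (real (mm j) / K) \<omega>\<bar> > R} = (\<Union>j\<in>{..<d}. {\<omega>\<in>space M. \<bar>wn n (qq j) (real (mm j) / K) \<omega>\<bar> > R})" by blast
      then have "prob {\<omega>\<in>space M. \<exists>j<d. \<bar>wn n (qq j) (real (mm j) / K) \<omega>\<bar> > R} = prob (\<Union>j\<in>{..<d}. {\<omega>\<in>space M. \<bar>wn n (qq j) (real (mm j) / K) \<omega>\<bar> > R})" by (rule arg_cong)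
      also have "\<dots> \<le> (\<Sum>j<d. prob {\<omega>\<in>space M. \<bar>wn n (qq j) (real (mm j) / K) \<omega>\<bar> > R})"
      proof (rule finite_measure_subadditive_finite)
        show "(\<lambda>j. {\<omega>\<in>space M. \<bar>wn n (qq j) (real (mm j) / K) \<omega>\<bar> > R}) ` {..<d} \<subseteq> events"
        proof (rule image_subsetI)
          fix j assume "j \<in> {..<d}"
          then have [measurable]: "wn n (qq j) (real (mm j) / K) \<in> borel_measurable M" using wn_meas qq by blast
          show "{\<omega>\<in>space M. \<bar>wn n (qq j) (real (mm j) / K) \<omega>\<bar> > R} \<in> events" by measurable
        qed
      qed simp
      also have "\<dots> \<le> (\<Sum>j<d. mixing_fun.Cv M X \<tau> Cb (hh (qq j)) q / R^2)"
        by (intro sum_mono wn_tail) (use qq mm K R R0 in auto)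
      also have "\<dots> = C / R^2" by (simp add: C_def sum_divide_distrib)
      also have "\<dots> \<le> e"
      proof -
        have "C / e = (sqrt (C / e))^2" using C0 e by simp
        also have "\<dots> \<le> R^2" using R C0 e unfolding R0_def by (intro power_mono) auto
        finally have "C \<le> R^2 * e" using e by (simp add: pos_divide_le_eq)
        then show ?thesis using R R0 by (simp add: pos_divide_le_eq mult.commute)
      qed
      finally show ?thesis .
    qed
    then show ?thesis by blast
  qed
qed (rule lip, rule bd)

text \<open>An indicator is not Lipschitz, so the threshold is smeared: \<phi> is 0 up to e/2 and 1
  from e on. In the limit the tail of the partial sum at e is thus bounded by the Gaussian tail at
  e/2.\<close>

lemma tail_limit:
  assumes p: "p \<in> {1,2}" and K: "K \<ge> 2" and e: "e > 0"
  shows "\<exists>s. s \<longlonglongrightarrow> 0 \<and> (\<forall>n. prob {\<omega>\<in>space M. \<bar>wn n p (2 / real K) \<omega>\<bar> > e} \<le> 3 * (2 * sg p p / real K)^2 / (e/2)^4 + s n)"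
proof -
  define \<phi> :: "(nat \<Rightarrow> real) \<Rightarrow> real" where "\<phi> x = min 1 (max 0 (2 * \<bar>x 0\<bar> / e - 1))" for x
  have bd: "\<bar>\<phi> x\<bar> \<le> 1" for x unfolding \<phi>_def by auto
  have lip: "\<bar>\<phi> x - \<phi> y\<bar> \<le> 2 / e * (\<Sum>j<1. \<bar>x j - y j\<bar>)" for x y
  proof -
    have clip: "\<bar>min 1 (max 0 a) - min 1 (max 0 b)\<bar> \<le> \<bar>a - b\<bar>" for a b :: real unfolding min_def max_def by (simp split: if_split)
    have "\<bar>\<phi> x - \<phi> y\<bar> \<le> \<bar>(2 * \<bar>x 0\<bar> / e - 1) - (2 * \<bar>y 0\<bar> / e - 1)\<bar>"
      unfolding \<phi>_def by (rule clip)
    also have "(2 * \<bar>x 0\<bar> / e - 1) - (2 * \<bar>y 0\<bar> / e - 1) = 2 * \<bar>x 0\<bar> / e - 2 * \<bar>y 0\<bar> / e" by linarith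
    also have "2 * \<bar>x 0\<bar> / e - 2 * \<bar>y 0\<bar> / e = 2 / e * (\<bar>x 0\<bar> - \<bar>y 0\<bar>)" using e by (simp add: field_simps)
    also have "\<bar>2 / e * (\<bar>x 0\<bar> - \<bar>y 0\<bar>)\<bar> = 2 / e * \<bar>\<bar>x 0\<bar> - \<bar>y 0\<bar>\<bar>" using e by (simp only: abs_mult) simp
    also have "\<dots> \<le> 2 / e * \<bar>x 0 - y 0\<bar>" using e by (intro mult_left_mono) auto
    finally show ?thesis by (simp only: lessThan_Suc lessThan_0 One_nat_def sum.insert sum.empty) simp
  qed
  have c: "(\<lambda>n. \<integral>\<omega>. \<phi> (\<lambda>j. wn n p (real 2 / real K) \<omega>) \<partial>M) \<longlonglongrightarrow> (\<integral>\<omega>. \<phi> (\<lambda>j. W p (real 2 / real K) \<omega>) \<partial>N)"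
    by (rule fdd_lip[where qq = "\<lambda>_. p" and mm = "\<lambda>_. 2" and K = K and d = 1 and \<phi> = \<phi>, OF _ _ _ lip bd]) (use p K in auto)
  let ?v = "2 / real K * sg p p"
  have tK: "2 / real K \<in> {0..1}" using K by simp
  have Wm[measurable]: "W p (2 / real K) \<in> borel_measurable N" by (rule W_meas[OF p tK])
  have v0: "?v \<ge> 0" using fdd_char(1)[where K = K and d = 1 and qq = "\<lambda>_. p" and mm = "\<lambda>_. 2" and a = "\<lambda>_. 1"] p K by simp
  have law: "distr N borel (W p (2 / real K)) = centered_gauss ?v"
    using W_law[where n = 1 and q = "\<lambda>_. p" and s = "\<lambda>_. 2 / real K" and a = "\<lambda>_. 1"] p tK by simp
  have "(\<integral>\<omega>. \<phi> (\<lambda>j. W p (2 / real K) \<omega>) \<partial>N) \<le> (\<integral>\<omega>. indicator {\<omega>\<in>space N. \<bar>W p (2 / real K) \<omega>\<bar> > e / 2} \<omega> \<partial>N)"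
  proof (rule integral_mono)
    have "(\<lambda>\<omega>. \<phi> (\<lambda>j. W p (2 / real K) \<omega>)) \<in> borel_measurable N" unfolding \<phi>_def by measurable
    then show "integrable N (\<lambda>\<omega>. \<phi> (\<lambda>j. W p (2 / real K) \<omega>))" by (intro N.integrable_const_bound[of _ 1]) (simp_all add: bd)
    have "{\<omega>\<in>space N. \<bar>W p (2 / real K) \<omega>\<bar> > e / 2} \<in> sets N" by measurable
    then show "integrable N (\<lambda>\<omega>. indicator {\<omega>\<in>space N. \<bar>W p (2 / real K) \<omega>\<bar> > e / 2} \<omega> :: real)" by (simp add: N.emeasure_eq_measure)
    fix \<omega> assume w: "\<omega> \<in> space N"
    show "\<phi> (\<lambda>j. W p (2 / real K) \<omega>) \<le> indicator {\<omega>\<in>space N. \<bar>W p (2 / real K) \<omega>\<bar> > e / 2} \<omega>"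
    proof (cases "\<bar>W p (2 / real K) \<omega>\<bar> > e / 2")
      case True then show ?thesis using w by (simp add: \<phi>_def)
    next
      case False
      then have "2 * \<bar>W p (2 / real K) \<omega>\<bar> / e \<le> 1" using e by (simp add: field_simps)
      then show ?thesis by (simp add: \<phi>_def)
    qed
  qed
  also have "\<dots> = N.prob {\<omega>\<in>space N. \<bar>W p (2 / real K) \<omega>\<bar> > e / 2}" by simp
  also have "\<dots> = measure (distr N borel (W p (2 / real K))) {x. \<bar>x\<bar> > e / 2}"
    by (subst measure_distr) (auto intro!: arg_cong[of _ _ N.prob])
  also have "\<dots> \<le> 3 * ?v^2 / (e/2)^4" unfolding law by (rule centered_gauss_tail[OF v0]) (use e in simp)
  finally have le: "(\<integral>\<omega>. \<phi> (\<lambda>j. W p (2 / real K) \<omega>) \<partial>N) \<le> 3 * (2 * sg p p / real K)^2 / (e/2)^4" by simp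
  define s where "s n = (\<integral>\<omega>. \<phi> (\<lambda>j. wn n p (2 / real K) \<omega>) \<partial>M) - (\<integral>\<omega>. \<phi> (\<lambda>j. W p (2 / real K) \<omega>) \<partial>N)" for n
  have s0: "s \<longlonglongrightarrow> 0" unfolding s_def using tendsto_diff[OF c tendsto_const[of "\<integral>\<omega>. \<phi> (\<lambda>j. W p (2 / real K) \<omega>) \<partial>N"]] by simp
  have "prob {\<omega>\<in>space M. \<bar>wn n p (2 / real K) \<omega>\<bar> > e} \<le> 3 * (2 * sg p p / real K)^2 / (e/2)^4 + s n" for n
  proof -
    have wm[measurable]: "wn n p (2 / real K) \<in> borel_measurable M" by (rule wn_meas[OF p])
    have "prob {\<omega>\<in>space M. \<bar>wn n p (2 / real K) \<omega>\<bar> > e} = (\<integral>\<omega>. indicator {\<omega>\<in>space M. \<bar>wn n p (2 / real K) \<omega>\<bar> > e} \<omega> \<partial>M)" by simp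
    also have "\<dots> \<le> (\<integral>\<omega>. \<phi> (\<lambda>j. wn n p (2 / real K) \<omega>) \<partial>M)"
    proof (rule integral_mono)
      have "(\<lambda>\<omega>. \<phi> (\<lambda>j. wn n p (2 / real K) \<omega>)) \<in> borel_measurable M" unfolding \<phi>_def by measurable
      then show "integrable M (\<lambda>\<omega>. \<phi> (\<lambda>j. wn n p (2 / real K) \<omega>))" by (intro integrable_const_bound[of _ 1]) (simp_all add: bd)
      have "{\<omega>\<in>space M. \<bar>wn n p (2 / real K) \<omega>\<bar> > e} \<in> events" by measurable
      then show "integrable M (\<lambda>\<omega>. indicator {\<omega>\<in>space M. \<bar>wn n p (2 / real K) \<omega>\<bar> > e} \<omega> :: real)" by (simp add: emeasure_eq_measure)
      fix \<omega> assume w: "\<omega> \<in> space M"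
      show "indicator {\<omega>\<in>space M. \<bar>wn n p (2 / real K) \<omega>\<bar> > e} \<omega> \<le> \<phi> (\<lambda>j. wn n p (2 / real K) \<omega>)"
      proof (cases "\<bar>wn n p (2 / real K) \<omega>\<bar> > e")
        case True
        then have "2 * \<bar>wn n p (2 / real K) \<omega>\<bar> / e \<ge> 2" using e by (simp add: field_simps)
        then show ?thesis using True w by (simp add: \<phi>_def)
      qed (simp add: \<phi>_def)
    qed
    finally show ?thesis using le unfolding s_def by linarith
  qed
  then show ?thesis using s0 by blast
qed

text \<open>Some stretch of at most 2n/K indices that begins at a grid point has a large sum. The
  stretch is twice as long as a cell so that the rounding of the cell boundaries stays inside
  it.\<close>

definition osc :: "nat \<Rightarrow> nat \<Rightarrow> nat \<Rightarrow> real \<Rightarrow> 'a set" where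
  "osc p n K e = {\<omega>\<in>space M. \<exists>j<K. \<exists>i\<le>2 * n div K. \<bar>mixing_fun.SA X (hh p) {n * j div K<..n * j div K + i} \<omega>\<bar> > e * sqrt (real n)}"

text \<open>By stationarity all K cells share one bound. The Gaussian tail contributes D/K^2 per
  cell, hence D/K in total, and the remaining terms vanish as n grows for fixed K.\<close>

lemma osc_small:
  assumes p: "p \<in> {1,2}" and e: "e > 0" and \<eta>: "\<eta> > 0"
  shows "\<forall>\<^sub>F K in sequentially. \<forall>\<^sub>F n in sequentially. osc p n K e \<in> events \<and> prob (osc p n K e) \<le> \<eta>"
proof -
  interpret u: mixing_fun M X \<tau> Cb "hh p" q by (rule hh[OF p])
  define c where "c = e / 3"
  have c: "c > 0" using e by (simp add: c_def)
  define D where "D = 2 * (3 * (2 * sg p p)^2 / (c/2)^4)"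
  have D0: "D \<ge> 0" using c by (simp add: D_def)
  have "\<forall>\<^sub>F K in sequentially. K \<ge> 2 \<and> real K \<ge> 4 * u.Cv / c^2 \<and> D / real K \<le> \<eta> / 2"
  proof -
    have "\<forall>\<^sub>F K in sequentially. real K \<ge> 4 * u.Cv / c^2"
      using filterlim_real_sequentially by (auto simp: filterlim_at_top)
    moreover have "\<forall>\<^sub>F K in sequentially. real K \<ge> 2 * D / \<eta>"
      using filterlim_real_sequentially by (auto simp: filterlim_at_top)
    ultimately show ?thesis using eventually_ge_at_top[of 2]
    proof eventually_elim
      case (elim K)
      have "D / real K \<le> \<eta> / 2" using elim(2,3) \<eta> by (simp add: field_simps)
      then show ?case using elim by blast
    qed
  qed
  then show ?thesis
  proof eventually_elim
    case (elim K)
    then have K: "K \<ge> 2" "K \<ge> 1" and K2: "real K \<ge> 4 * u.Cv / c^2" and K3: "D / real K \<le> \<eta> / 2" by auto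
    obtain s where s: "s \<longlonglongrightarrow> 0" "\<And>n. prob {\<omega>\<in>space M. \<bar>wn n p (2 / real K) \<omega>\<bar> > c} \<le> 3 * (2 * sg p p / real K)^2 / (c/2)^4 + s n"
      using tail_limit[OF p K(1) c] by blast
    obtain r where r: "r \<longlonglongrightarrow> 0" "\<forall>\<^sub>F n in sequentially.
      prob {\<omega>\<in>space M. \<exists>i\<le>2 * n div K. \<bar>u.SA {0<..i} \<omega>\<bar> > 3 * (c * sqrt (real n))}
       \<le> 2 * prob {\<omega>\<in>space M. \<bar>u.SA {0<..2 * n div K} \<omega>\<bar> > c * sqrt (real n)} + r n"
      using u.maximal_asymptotic[OF c K(2) K2] by blast
    have "(\<lambda>n. real K * (2 * s n + r n)) \<longlonglongrightarrow> real K * (2 * 0 + 0)" by (intro tendsto_intros s r)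
    then have sm: "\<forall>\<^sub>F n in sequentially. real K * (2 * s n + r n) < \<eta> / 2"
      by (rule order_tendstoD(2)) (use \<eta> in simp)
    show ?case using r(2) sm eventually_gt_at_top[of 0]
    proof eventually_elim
      case (elim n)
      have n: "real n > 0" using elim by simp
      let ?N = "2 * n div K"
      let ?J = "\<lambda>a. {\<omega>\<in>space M. \<exists>i\<le>?N. \<bar>u.SA {a<..a+i} \<omega>\<bar> > e * sqrt (real n)}"
      have J[measurable]: "?J a \<in> events" for a by measurable
      have oe: "osc p n K e = (\<Union>j\<in>{..<K}. ?J (n * j div K))" unfolding osc_def by blast
      have "prob (osc p n K e) \<le> (\<Sum>j<K. prob (?J (n * j div K)))"
        unfolding oe by (rule finite_measure_subadditive_finite) auto
      also have "\<dots> = (\<Sum>j<K. prob {\<omega>\<in>space M. \<exists>i\<le>?N. \<bar>u.SA {0<..i} \<omega>\<bar> > e * sqrt (real n)})"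
        by (simp only: u.SA_shift_max)
      also have "\<dots> = real K * prob {\<omega>\<in>space M. \<exists>i\<le>?N. \<bar>u.SA {0<..i} \<omega>\<bar> > 3 * (c * sqrt (real n))}"
        by (simp add: c_def)
      also have "\<dots> \<le> real K * (2 * prob {\<omega>\<in>space M. \<bar>u.SA {0<..?N} \<omega>\<bar> > c * sqrt (real n)} + r n)"
        by (intro mult_left_mono elim(1)) simp
      also have "{\<omega>\<in>space M. \<bar>u.SA {0<..?N} \<omega>\<bar> > c * sqrt (real n)} = {\<omega>\<in>space M. \<bar>wn n p (2 / real K) \<omega>\<bar> > c}"
      proof -
        have "nat \<lfloor>real n * (2 / real K)\<rfloor> = ?N" using floor_grid[of n 2 K] by (simp add: mult.commute)
        then show ?thesis unfolding wn_SA[OF p] using n by (auto simp: abs_divide pos_less_divide_eq)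
      qed
      also have "real K * (2 * prob {\<omega>\<in>space M. \<bar>wn n p (2 / real K) \<omega>\<bar> > c} + r n) \<le> real K * (2 * (3 * (2 * sg p p / real K)^2 / (c/2)^4 + s n) + r n)"
        by (intro mult_left_mono add_right_mono s(2)) auto
      also have "\<dots> = D / real K + real K * (2 * s n + r n)"
        unfolding D_def using K by (simp add: field_simps power2_eq_square)
      also have "\<dots> \<le> \<eta>" using K3 elim(2) by linarith
      finally have "prob (osc p n K e) \<le> \<eta>" .
      moreover have "osc p n K e \<in> events" unfolding oe by (rule sets.finite_UN) auto
      ultimately show ?case by blast
    qed
  qed
qed

lemma osc_bound:
  assumes p: "p \<in> {1,2}" and K: "K \<ge> 1" "n \<ge> 2 * K" and e: "e > 0" and w: "\<omega> \<in> space M" "\<omega> \<notin> osc p n K e" and t: "0 \<le> t" "t \<le> 1"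
  shows "\<bar>wn n p t \<omega> - wn n p (real (nat \<lfloor>real K * t\<rfloor>) / real K) \<omega>\<bar> \<le> e"
proof -
  define j where "j = nat \<lfloor>real K * t\<rfloor>"
  have "0 \<le> real K * t" using t by simp
  then have j1: "real j \<le> real K * t" "real K * t < real j + 1" unfolding j_def by linarith+
  have n: "real n > 0" using K by simp
  have jK: "j \<le> K"
  proof -
    have "real K * t \<le> real K" using t by (simp add: mult_left_le)
    then show ?thesis using j1 by linarith
  qed
  define a where "a = n * j div K"
  define b where "b = nat \<lfloor>real n * t\<rfloor>"
  have fa: "nat \<lfloor>real n * (real j / real K)\<rfloor> = a" unfolding a_def by (rule floor_grid)
  have "real n * (real j / real K) \<le> real n * t" using j1 K by (intro mult_left_mono) (auto simp: field_simps)
  then have ab: "a \<le> b" unfolding fa[symmetric] b_def by (intro nat_mono floor_mono)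
  show ?thesis
  proof (cases "j = K")
    \<comment> \<open>The last grid point is reached only at t = 1, where both values
      coincide.\<close>
    case True
    then have "t = 1" using j1(1) t K by simp
    then show ?thesis using True K e unfolding j_def[symmetric] by simp
  next
    case False
    then have jlt: "j < K" using jK by simp
    \<comment> \<open>The stretch has at most n/K + 1 indices; as n/K is at least 2, this is at most
      2n/K - 1, hence at most \<open>2 * n div K\<close>.\<close>
    have ba: "b - a \<le> 2 * n div K"
    proof -
      have Kp: "real K > 0" using K by simp
      have "real n * t \<le> real n * ((real j + 1) / real K)" using j1 Kp by (intro mult_left_mono) (auto simp: field_simps)
      then have b1: "real b \<le> real n * (real j / real K) + real n / real K"
        unfolding b_def using t by (simp add: add_divide_distrib distrib_left) linarith
      have a1: "real n * (real j / real K) - 1 \<le> real a" unfolding fa[symmetric] by linarith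
      have nK: "real n / real K \<ge> 2" using K Kp by (simp add: pos_le_divide_eq)
      have "real (2 * n div K) = real (nat \<lfloor>real n * (real 2 / real K)\<rfloor>)" using floor_grid[of n 2 K] by (simp add: mult.commute)
      moreover have "real (nat \<lfloor>real n * (real 2 / real K)\<rfloor>) \<ge> real n * (real 2 / real K) - 1" by linarith
      moreover have "real n * (real 2 / real K) = 2 * (real n / real K)" by simp
      ultimately have "real (2 * n div K) \<ge> 2 * (real n / real K) - 1" by linarith
      then have "real b - real a \<le> real (2 * n div K)" using a1 b1 nK by linarith
      then show ?thesis using ab by linarith
    qed
    have "\<bar>mixing_fun.SA X (hh p) {a<..a + (b - a)} \<omega>\<bar> \<le> e * sqrt n"
    proof -
      have "\<not> (\<exists>j<K. \<exists>i\<le>2 * n div K. \<bar>mixing_fun.SA X (hh p) {n * j div K<..n * j div K + i} \<omega>\<bar> > e * sqrt (real n))"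
        using w unfolding osc_def by blast
      then have "\<not> \<bar>mixing_fun.SA X (hh p) {a<..a + (b - a)} \<omega>\<bar> > e * sqrt (real n)"
        using jlt ba unfolding a_def by blast
      then show ?thesis by simp
    qed
    moreover have "a + (b - a) = b" using ab by simp
    moreover have "mixing_fun.SA X (hh p) {0<..b} \<omega> - mixing_fun.SA X (hh p) {0<..a} \<omega> = mixing_fun.SA X (hh p) {a<..b} \<omega>"
    proof -
      have "{0<..b} = {0<..a} \<union> {a<..b}" using ab by auto
      moreover have "{0<..a} \<inter> {a<..b} = {}" by auto
      ultimately show ?thesis unfolding mixing_fun.SA_def[OF hh[OF p]] by (simp add: sum.union_disjoint)
    qed
    ultimately have "\<bar>mixing_fun.SA X (hh p) {0<..b} \<omega> - mixing_fun.SA X (hh p) {0<..a} \<omega>\<bar> \<le> e * sqrt n" by simp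
    then have "\<bar>(mixing_fun.SA X (hh p) {0<..b} \<omega> - mixing_fun.SA X (hh p) {0<..a} \<omega>) / sqrt n\<bar> \<le> e"
      using n by (simp add: abs_divide pos_divide_le_eq)
    then show ?thesis unfolding wn_SA[OF p] j_def[symmetric] fa b_def[symmetric] by (simp add: diff_divide_distrib)
  qed
qed

text \<open>Two step paths on the grid, read off one vector: coordinates 0 to K are the grid values
  of the first path, the next K + 1 those of the second; \<open>qqv\<close> and \<open>mmv\<close>
  decode a coordinate. The sample space is trivial because the randomness sits in x.\<close>

definition stepv :: "nat \<Rightarrow> (nat \<Rightarrow> real) \<Rightarrow> nat \<Rightarrow> real \<Rightarrow> unit \<Rightarrow> real" where
  "stepv K x p t _ = x ((p - 1) * (K + 1) + nat \<lfloor>real K * t\<rfloor>)"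

definition qqv :: "nat \<Rightarrow> nat \<Rightarrow> nat" where "qqv K j = (if j < K + 1 then 1 else 2)"
definition mmv :: "nat \<Rightarrow> nat \<Rightarrow> nat" where "mmv K j = (if j < K + 1 then j else j - (K + 1))"

lemma grid_idx:
  fixes K :: nat
  assumes "p \<in> {1,2::nat}" "0 \<le> t" "t \<le> 1"
  defines "j \<equiv> (p - 1) * (K + 1) + nat \<lfloor>real K * t\<rfloor>"
  shows "j < 2 * (K + 1)" "qqv K j = p" "mmv K j = nat \<lfloor>real K * t\<rfloor>"
proof -
  have "real K * t \<le> real K" using assms by (simp add: mult_left_le)
  then have "nat \<lfloor>real K * t\<rfloor> \<le> K" by linarith
  then show "j < 2 * (K + 1)" "qqv K j = p" "mmv K j = nat \<lfloor>real K * t\<rfloor>"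
    using assms(1) unfolding j_def qqv_def mmv_def by auto
qed

text \<open>Turns a functional of processes into a Lipschitz function of \<open>2 * (K + 1)\<close>
  real variables, the form to which \<open>fdd_lip\<close> applies.\<close>

lemma step_lip:
  assumes k: "k \<ge> 1" and f: "lip_functional (cube k) f L B"
  shows "\<bar>f (Zlim k (stepv K x) ()) - f (Zlim k (stepv K y) ())\<bar> \<le> (L * (4 * real k)) * (\<Sum>j<2 * (K + 1). \<bar>x j - y j\<bar>)"
proof -
  have L: "0 \<le> L" and lip: "\<And>x y. bounded_on (cube k) x \<Longrightarrow> bounded_on (cube k) y \<Longrightarrow> \<bar>f x - f y\<bar> \<le> L * sup_dist (cube k) x y"
    using f unfolding lip_functional_def by auto
  have b: "bounded_on (cube k) (Zlim k (stepv K x) ())" for x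
  proof (rule Zlim_bounded_on[OF k])
    fix p :: nat and t :: real assume pt: "p \<in> {1,2}" "0 \<le> t" "t \<le> 1"
    show "\<bar>stepv K x p t ()\<bar> \<le> (\<Sum>j<2 * (K + 1). \<bar>x j\<bar>)" unfolding stepv_def
      by (rule member_le_sum[where f = "\<lambda>j. \<bar>x j\<bar>"]) (use grid_idx(1)[OF pt, of K] in auto)
  qed
  have "sup_dist (cube k) (Zlim k (stepv K x) ()) (Zlim k (stepv K y) ()) \<le> 4 * real k * (\<Sum>j<2 * (K + 1). \<bar>x j - y j\<bar>)"
  proof (rule sup_dist_least[OF cube_nonempty], rule Zlim_bound[OF k])
    fix p :: nat and t :: real assume pt: "p \<in> {1,2}" "0 \<le> t" "t \<le> 1"
    show "\<bar>stepv K x p t () - stepv K y p t ()\<bar> \<le> (\<Sum>j<2 * (K + 1). \<bar>x j - y j\<bar>)" unfolding stepv_def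
      by (rule member_le_sum[where f = "\<lambda>j. \<bar>x j - y j\<bar>"]) (use grid_idx(1)[OF pt, of K] in auto)
  qed (auto intro: sum_nonneg)
  then have "L * sup_dist (cube k) (Zlim k (stepv K x) ()) (Zlim k (stepv K y) ()) \<le> L * (4 * real k * (\<Sum>j<2 * (K + 1). \<bar>x j - y j\<bar>))"
    using L by (rule mult_left_mono)
  then show ?thesis using lip[OF b b, of x y] by (simp add: mult_ac)
qed

text \<open>The two sides use paths that are known to agree only for p in {1, 2} and times in
  [0, 1], so the equality is drawn from \<open>Zlim_bound\<close> with distance 0.\<close>

lemma Zlim_step:
  assumes k: "k \<ge> 1"
  shows "Zlim k (\<lambda>p t \<omega>. w p (real (nat \<lfloor>real K * t\<rfloor>) / real K) \<omega>) \<omega> = Zlim k (stepv K (\<lambda>j. w (qqv K j) (real (mmv K j) / real K) \<omega>)) ()"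
proof
  fix t
  have "\<bar>Zlim k (\<lambda>p t \<omega>. w p (real (nat \<lfloor>real K * t\<rfloor>) / real K) \<omega>) \<omega> t - Zlim k (stepv K (\<lambda>j. w (qqv K j) (real (mmv K j) / real K) \<omega>)) () t\<bar> \<le> 4 * real k * 0"
  proof (rule Zlim_bound[OF k])
    fix p :: nat and t :: real assume pt: "p \<in> {1,2}" "0 \<le> t" "t \<le> 1"
    show "\<bar>w p (real (nat \<lfloor>real K * t\<rfloor>) / real K) \<omega> - stepv K (\<lambda>j. w (qqv K j) (real (mmv K j) / real K) \<omega>) p t ()\<bar> \<le> 0"
      unfolding stepv_def grid_idx(2,3)[OF pt] by simp
  qed simp
  then show "Zlim k (\<lambda>p t \<omega>. w p (real (nat \<lfloor>real K * t\<rfloor>) / real K) \<omega>) \<omega> t = Zlim k (stepv K (\<lambda>j. w (qqv K j) (real (mmv K j) / real K) \<omega>)) () t" by simp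
qed

text \<open>Keeps the kernel out of the limit theorem: the process enters only through its distance
  \<open>Er\<close> from the functional of the partial sums. The discretisation is controlled by
  uniform continuity of the paths of \<open>W\<close> on one side and by the oscillation events on
  the other.\<close>

theorem conv_main:
  fixes Zs :: "nat \<Rightarrow> 'a \<Rightarrow> (nat \<Rightarrow> real) \<Rightarrow> real" and Er :: "nat \<Rightarrow> 'a \<Rightarrow> real"
  assumes k: "k \<ge> 1" and Zb: "\<And>n \<omega>. bounded_on (cube k) (Zs n \<omega>)"
    and Er_meas: "\<And>n. Er n \<in> borel_measurable M"
    and Er: "\<And>n \<omega> t. n \<ge> 1 \<Longrightarrow> t \<in> cube k \<Longrightarrow> \<bar>Zs n \<omega> t - Zlim k (wn n) \<omega> t\<bar> \<le> Er n \<omega>"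
    and Er0: "\<And>\<epsilon>. \<epsilon> > 0 \<Longrightarrow> (\<lambda>n. prob {\<omega>\<in>space M. Er n \<omega> > \<epsilon>}) \<longlonglongrightarrow> 0"
  shows "conv_dist (cube k) M Zs N (Zlim k W)"
proof -
  define As where "As n K \<omega> = Zlim k (\<lambda>p t \<omega>. wn n p (real (nat \<lfloor>real K * t\<rfloor>) / real K) \<omega>) \<omega>" for n K \<omega>
  define A where "A K \<omega> = Zlim k (\<lambda>p t \<omega>. W p (real (nat \<lfloor>real K * t\<rfloor>) / real K) \<omega>) \<omega>" for K \<omega>
  note AsE = As_def[unfolded Zlim_step[OF k]] and AE = A_def[unfolded Zlim_step[OF k]]
  have sb: "bounded_on (cube k) (Zlim k (stepv K x) ())" for K x
  proof (rule Zlim_bounded_on[OF k])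
    fix p :: nat and t :: real assume pt: "p \<in> {1,2}" "0 \<le> t" "t \<le> 1"
    show "\<bar>stepv K x p t ()\<bar> \<le> (\<Sum>j<2 * (K + 1). \<bar>x j\<bar>)" unfolding stepv_def
      by (rule member_le_sum[where f = "\<lambda>j. \<bar>x j\<bar>"]) (use grid_idx(1)[OF pt, of K] in auto)
  qed
  have Asb: "bounded_on (cube k) (As n K \<omega>)" for n K \<omega> unfolding AsE by (rule sb)
  have Ab: "bounded_on (cube k) (A K \<omega>)" for K \<omega> unfolding AE by (rule sb)
  have qq: "qqv K j \<in> {1,2}" for K j by (simp add: qqv_def)
  have mm: "mmv K j \<le> K" if "j < 2 * (K + 1)" for K j using that by (auto simp: mmv_def)
  have Wb: "bounded_on (cube k) (Zlim k W \<omega>)" if w: "\<omega> \<in> space N" for \<omega>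
  proof -
    have Wbd: "\<exists>D. \<forall>t\<in>{0..1}. \<bar>W p t \<omega>\<bar> \<le> D" if "p \<in> {1,2}" for p
    proof -
      have "bounded ((\<lambda>t. W p t \<omega>) ` {0..1})"
        by (rule compact_imp_bounded[OF compact_continuous_image[OF W_cont[OF that w]]]) simp
      then show ?thesis unfolding bounded_iff by auto
    qed
    obtain D1 where D1: "\<forall>t\<in>{0..1}. \<bar>W 1 t \<omega>\<bar> \<le> D1" using Wbd[of 1] by blast
    obtain D2 where D2: "\<forall>t\<in>{0..1}. \<bar>W 2 t \<omega>\<bar> \<le> D2" using Wbd[of 2] by blast
    have D: "\<bar>W 1 t \<omega>\<bar> \<le> D1" "\<bar>W 2 t \<omega>\<bar> \<le> D2" if "t \<in> {0..1}" for t using D1 D2 that by blast+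
    show ?thesis
    proof (rule Zlim_bounded_on[OF k, of W \<omega> "max D1 D2"])
      fix p :: nat and t :: real assume "p \<in> {1,2}" "0 \<le> t" "t \<le> 1"
      then show "\<bar>W p t \<omega>\<bar> \<le> max D1 D2" using D(1)[of t] D(2)[of t] by (auto simp: le_max_iff_disj)
    qed
  qed
  interpret sa: sup_approx "cube k" M N Zs "Zlim k W" As A
  proof
    show "cube k \<noteq> {}" by (rule cube_nonempty)
    show "bounded_on (cube k) (Zs n \<omega>)" for n \<omega> by (rule Zb)
    show "bounded_on (cube k) (Zlim k W \<omega>)" if "\<omega> \<in> space N" for \<omega> by (rule Wb[OF that])
    show "bounded_on (cube k) (As n K \<omega>)" for n K \<omega> by (rule Asb)
    show "bounded_on (cube k) (A K \<omega>)" for K \<omega> by (rule Ab)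
    fix f L B and K :: nat assume f: "lip_functional (cube k) f L B" and K: "1 \<le> K"
    have fB: "\<bar>f x\<bar> \<le> B" for x using f unfolding lip_functional_def by blast
    note lip = step_lip[OF k f, of K]
    show "(\<lambda>\<omega>. f (As n K \<omega>)) \<in> borel_measurable M" for n unfolding AsE
      by (rule lipschitz_comp_measurable[where \<phi> = "\<lambda>x. f (Zlim k (stepv K x) ())", OF lip]) (rule wn_meas[OF qq])
    show "(\<lambda>\<omega>. f (A K \<omega>)) \<in> borel_measurable N" unfolding AE
    proof (rule lipschitz_comp_measurable[where \<phi> = "\<lambda>x. f (Zlim k (stepv K x) ())", OF lip])
      fix j assume "j < 2 * (K + 1)"
      then show "(\<lambda>\<omega>. W (qqv K j) (real (mmv K j) / real K) \<omega>) \<in> borel_measurable N"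
        using mm[of j K] K by (intro W_meas[OF qq]) simp
    qed
    show "(\<lambda>n. \<integral>\<omega>. f (As n K \<omega>) \<partial>M) \<longlonglongrightarrow> (\<integral>\<omega>. f (A K \<omega>) \<partial>N)" unfolding AsE AE
      by (rule fdd_lip[where \<phi> = "\<lambda>x. f (Zlim k (stepv K x) ())" and d = "2 * (K + 1)", OF K qq mm lip fB])
  next
    fix \<omega> assume w: "\<omega> \<in> space N"
    show "(\<lambda>K. sup_dist (cube k) (Zlim k W \<omega>) (A K \<omega>)) \<longlonglongrightarrow> 0"
    proof (rule LIMSEQ_I)
      fix r :: real assume r: "0 < r"
      define e where "e = r / (8 * real k)"
      have e: "e > 0" "4 * real k * e < r" using r k by (auto simp: e_def)
      have "\<exists>d>0. \<forall>x\<in>{0..1}. \<forall>x'\<in>{0..1}. dist x' x < d \<longrightarrow> dist (W p x' \<omega>) (W p x \<omega>) < e" if "p \<in> {1,2}" for p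
        using compact_uniformly_continuous[OF W_cont[OF that w]] e unfolding uniformly_continuous_on_def by auto
      note uc = this
      obtain d1 where d1: "d1 > 0" "\<forall>x\<in>{0..1}. \<forall>x'\<in>{0..1}. dist x' x < d1 \<longrightarrow> dist (W 1 x' \<omega>) (W 1 x \<omega>) < e" using uc[of 1] by blast
      obtain d2 where d2: "d2 > 0" "\<forall>x\<in>{0..1}. \<forall>x'\<in>{0..1}. dist x' x < d2 \<longrightarrow> dist (W 2 x' \<omega>) (W 2 x \<omega>) < e" using uc[of 2] by blast
      have d: "d1 > 0" "d2 > 0"
         "\<And>x x'. x \<in> {0..1} \<Longrightarrow> x' \<in> {0..1} \<Longrightarrow> dist x' x < d1 \<Longrightarrow> dist (W 1 x' \<omega>) (W 1 x \<omega>) < e"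
         "\<And>x x'. x \<in> {0..1} \<Longrightarrow> x' \<in> {0..1} \<Longrightarrow> dist x' x < d2 \<Longrightarrow> dist (W 2 x' \<omega>) (W 2 x \<omega>) < e" using d1 d2 by blast+
      obtain K0 :: nat where K0: "1 / min d1 d2 < real K0" using reals_Archimedean2 by blast
      show "\<exists>no. \<forall>K\<ge>no. norm (sup_dist (cube k) (Zlim k W \<omega>) (A K \<omega>) - 0) < r"
      proof (intro exI[of _ K0] allI impI)
        fix K assume "K \<ge> K0"
        then have K1: "1 / min d1 d2 < real K" using K0 by linarith
        have Kp: "real K > 0" using K1 d by (intro less_trans[OF _ K1]) simp
        have inv: "1 / real K < m" if "0 < m" "1 / m < real K" for m using that Kp by (simp add: field_simps)
        have K2: "1 / real K < min d1 d2" by (rule inv[OF _ K1]) (use d(1,2) in simp)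
        have "sup_dist (cube k) (Zlim k W \<omega>) (A K \<omega>) \<le> 4 * real k * e"
          unfolding A_def
        proof (rule sup_dist_least[OF cube_nonempty], rule Zlim_bound[OF k])
          fix p :: nat and t :: real assume pt: "p \<in> {1,2}" "0 \<le> t" "t \<le> 1"
          let ?s = "real (nat \<lfloor>real K * t\<rfloor>) / real K"
          have "0 \<le> real K * t" using pt by simp
          then have f: "real (nat \<lfloor>real K * t\<rfloor>) \<le> real K * t" "real K * t \<le> real (nat \<lfloor>real K * t\<rfloor>) + 1" by linarith+
          have s1: "?s \<le> t" "t \<le> ?s + 1 / real K" using f Kp by (auto simp: field_simps)
          have s: "?s \<in> {0..1}" "t \<in> {0..1}" using s1 pt by auto
          have "dist t ?s < min d1 d2" unfolding dist_real_def using s1 K2 by linarith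
          then have "dist (W p t \<omega>) (W p ?s \<omega>) < e" using d(3)[OF s] d(4)[OF s] pt(1) by auto
          then show "\<bar>W p t \<omega> - W p ?s \<omega>\<bar> \<le> e" unfolding dist_real_def by simp
        qed (use e in simp)
        moreover have "0 \<le> sup_dist (cube k) (Zlim k W \<omega>) (A K \<omega>)" by (rule sup_dist_nonneg[OF cube_nonempty Wb[OF w] Ab])
        ultimately show "norm (sup_dist (cube k) (Zlim k W \<omega>) (A K \<omega>) - 0) < r" using e by simp
      qed
    qed
  next
    fix \<epsilon> \<eta> :: real assume e: "0 < \<epsilon>" and \<eta>: "0 < \<eta>"
    \<comment> \<open>At this oscillation level the discretisation costs at most \<epsilon>/2 by
      \<open>Zlim_bound\<close>, which leaves \<epsilon>/2 for \<open>Er\<close>; the probability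
      \<eta> is shared by \<open>Er\<close> and the two paths.\<close>
    define c where "c = \<epsilon> / (8 * real k)"
    have c: "c > 0" "4 * real k * c = \<epsilon> / 2" using e k by (auto simp: c_def)
    have \<eta>3: "\<eta> / 3 > 0" and e2: "\<epsilon> / 2 > 0" using \<eta> e by auto
    have "\<forall>\<^sub>F K in sequentially. K \<ge> 1 \<and> (\<forall>\<^sub>F n in sequentially. osc 1 n K c \<in> events \<and> prob (osc 1 n K c) \<le> \<eta> / 3)
       \<and> (\<forall>\<^sub>F n in sequentially. osc 2 n K c \<in> events \<and> prob (osc 2 n K c) \<le> \<eta> / 3)"
      using eventually_ge_at_top[of 1] osc_small[of 1, OF _ c(1) \<eta>3] osc_small[of 2, OF _ c(1) \<eta>3] by (simp add: eventually_conj_iff)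
    then show "\<forall>\<^sub>F K in sequentially. \<forall>\<^sub>F n in sequentially. \<exists>E\<in>events. prob E \<le> \<eta> \<and>
       (\<forall>\<omega>\<in>space M - E. sup_dist (cube k) (Zs n \<omega>) (As n K \<omega>) \<le> \<epsilon>)"
    proof eventually_elim
      case (elim K)
      have Ers: "\<forall>\<^sub>F n in sequentially. prob {\<omega>\<in>space M. Er n \<omega> > \<epsilon> / 2} < \<eta> / 3"
        by (rule order_tendstoD(2)[OF Er0[OF e2] \<eta>3])
      from elim have K: "1 \<le> K" and o1: "\<forall>\<^sub>F n in sequentially. osc 1 n K c \<in> events \<and> prob (osc 1 n K c) \<le> \<eta> / 3"
        and o2: "\<forall>\<^sub>F n in sequentially. osc 2 n K c \<in> events \<and> prob (osc 2 n K c) \<le> \<eta> / 3" by blast+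
      show ?case using Ers o1 o2 eventually_ge_at_top[of "2 * K"]
      proof eventually_elim
        case (elim n)
        define F where "F = {\<omega>\<in>space M. Er n \<omega> > \<epsilon> / 2}"
        have F: "F \<in> events" unfolding F_def using Er_meas[of n] by measurable
        define E where "E = osc 1 n K c \<union> (osc 2 n K c \<union> F)"
        have ev: "E \<in> events" unfolding E_def using elim F by blast
        have "prob E \<le> prob (osc 1 n K c) + (prob (osc 2 n K c) + prob F)"
          unfolding E_def using elim F by (intro order_trans[OF measure_Un_le add_left_mono[OF measure_Un_le]]) auto
        also have "\<dots> \<le> \<eta>" using elim unfolding F_def by linarith
        finally have pE: "prob E \<le> \<eta>" .
        have "sup_dist (cube k) (Zs n \<omega>) (As n K \<omega>) \<le> \<epsilon>" if w: "\<omega> \<in> space M - E" for \<omega>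
        proof (rule sup_dist_least[OF cube_nonempty])
          fix t assume t: "t \<in> cube k"
          have n1: "n \<ge> 1" using elim(4) K by linarith
          have "\<bar>Zs n \<omega> t - Zlim k (wn n) \<omega> t\<bar> \<le> Er n \<omega>" by (rule Er[OF n1 t])
          also have "\<dots> \<le> \<epsilon> / 2" using w unfolding E_def F_def by auto
          finally have 1: "\<bar>Zs n \<omega> t - Zlim k (wn n) \<omega> t\<bar> \<le> \<epsilon> / 2" .
          have "\<bar>Zlim k (wn n) \<omega> t - As n K \<omega> t\<bar> \<le> 4 * real k * c" unfolding As_def
          proof (rule Zlim_bound[OF k])
            fix p :: nat and t :: real assume pt: "p \<in> {1,2}" "0 \<le> t" "t \<le> 1"
            have "\<omega> \<notin> osc p n K c" using w pt(1) unfolding E_def by auto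
            then show "\<bar>wn n p t \<omega> - wn n p (real (nat \<lfloor>real K * t\<rfloor>) / real K) \<omega>\<bar> \<le> c"
              using w pt by (intro osc_bound[OF pt(1) K elim(4) c(1)]) auto
          qed (use c in simp)
          then show "\<bar>Zs n \<omega> t - As n K \<omega> t\<bar> \<le> \<epsilon>" using 1 c(2) by linarith
        qed
        then show ?case using ev pE by blast
      qed
    qed
  qed
  show ?thesis by (rule sa.conv_dist_approx)
qed

end

section \<open>The kernel decomposition\<close>

lemma gen_sigma_space: "space M \<in> gen_sigma M X I"
  unfolding gen_sigma_def by (rule sigma_sets_top)

lemma gen_sigma_sub: "(\<And>i. X i \<in> borel_measurable M) \<Longrightarrow> gen_sigma M X I \<subseteq> sets M"
  unfolding gen_sigma_def by (rule sets.sigma_sets_subset) (auto simp: measurable_sets)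

lemma mixing_seq_of_geom_abs_regular:
  assumes P: "prob_space M" and X: "\<And>i. X i \<in> borel_measurable M" and st: "stationary_seq M X" and reg: "geom_abs_regular M X"
  shows "\<exists>\<tau> Cb. mixing_seq M X \<tau> Cb"
proof -
  interpret prob_space M by fact
  obtain \<tau> C and N :: nat where t: "0 < \<tau>" "\<tau> < 1" and N: "\<And>m. m \<ge> N \<Longrightarrow> \<bar>beta_mix M X m\<bar> \<le> C * \<tau> ^ m"
    using reg unfolding geom_abs_regular_def by blast
  \<comment> \<open>For gaps m < N only the trivial bound 1 is available, and there (1/\<tau>)^N
    times \<tau>^m is at least 1.\<close>
  define Cb where "Cb = \<bar>C\<bar> + (1 / \<tau>) ^ N"
  let ?b = "\<lambda>j m. beta_coef M (gen_sigma M X {1..j}) (gen_sigma M X {j+m..})"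
  have b1: "?b j m \<le> 1" for j m
    by (rule beta_coef_upper(2)[of M "gen_sigma M X {1..j}" "gen_sigma M X {j+m..}" 1 "\<lambda>_. space M" "\<lambda>_. space M", OF P gen_sigma_sub gen_sigma_sub])
       (auto simp: X gen_sigma_space disjoint_family_on_def)
  have bm: "?b j m \<le> beta_mix M X m" if "j \<ge> 1" for j m
    unfolding beta_mix_def
  proof (rule cSup_upper)
    show "?b j m \<in> {beta_coef M (gen_sigma M X {1..j}) (gen_sigma M X {j + m..}) |j. 1 \<le> j}" using that by blast
    show "bdd_above {beta_coef M (gen_sigma M X {1..j}) (gen_sigma M X {j + m..}) |j. 1 \<le> j}"
      by (rule bdd_aboveI[of _ 1]) (use b1 in blast)
  qed
  have "?b j m \<le> Cb * \<tau> ^ m" if j: "j \<ge> 1" for j m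
  proof (cases "m \<ge> N")
    case True
    have "?b j m \<le> C * \<tau> ^ m" using bm[OF j, of m] N[OF True] by linarith
    also have "\<dots> \<le> Cb * \<tau> ^ m" unfolding Cb_def using t by (intro mult_right_mono) (auto intro: order_trans[OF abs_ge_self])
    finally show ?thesis .
  next
    case False
    have "1 = (1 / \<tau>) ^ N * \<tau> ^ N" using t by (simp add: power_mult_distrib[symmetric])
    also have "\<dots> \<le> (1 / \<tau>) ^ N * \<tau> ^ m" using t False by (intro mult_left_mono power_decreasing) auto
    also have "\<dots> \<le> Cb * \<tau> ^ m" unfolding Cb_def using t by (intro mult_right_mono) auto
    finally show ?thesis using b1[of j m] by linarith
  qed
  moreover have "Cb > 0" unfolding Cb_def using t by (intro add_nonneg_pos) auto
  ultimately have "mixing_seq M X \<tau> Cb" using X st t by unfold_locales auto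
  then show ?thesis by blast
qed

section \<open>Moments of the projections and of the degenerate remainder\<close>

lemma add_powr_le: assumes "0 \<le> a" "0 \<le> b" "0 < q" shows "(a + b) powr q \<le> 2 powr q * (a powr q + b powr (q::real))"
proof -
  have "(a + b) powr q \<le> (2 * max a b) powr q" using assms by (intro powr_mono2) auto
  also have "\<dots> = 2 powr q * max a b powr q" using assms by (simp add: powr_mult)
  also have "max a b powr q \<le> a powr q + b powr q" by (simp add: max_def)
  finally show ?thesis by simp
qed

text \<open>Jensen's inequality for x^q, convex on the open half-line, hence the shift of |f| by 1.
  The form with nonnegative integrals also covers an infinite right-hand side, so it can be applied
  to every section of a kernel.\<close>

lemma (in prob_space) powr_expectation_le:
  fixes f :: "'a \<Rightarrow> real"
  assumes f[measurable]: "f \<in> borel_measurable M" and q: "q \<ge> 1"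
  shows "ennreal (\<bar>\<integral>x. f x \<partial>M\<bar> powr q) \<le> ennreal (2 powr q) * ((\<integral>\<^sup>+x. ennreal (\<bar>f x\<bar> powr q) \<partial>M) + 1)"
proof (cases "(\<integral>\<^sup>+x. ennreal (\<bar>f x\<bar> powr q) \<partial>M) = \<infinity>")
  case True
  then show ?thesis by (simp add: ennreal_mult_top)
next
  case False
  have iq: "integrable M (\<lambda>x. \<bar>f x\<bar> powr q)"
    by (rule integrableI_nonneg) (use False in \<open>auto simp: less_top[symmetric]\<close>)
  have "integrable M f"
    by (rule Bochner_Integration.integrable_bound[of _ "\<lambda>x. 1 + \<bar>f x\<bar> powr q"]) (use iq powr_one_abs_le[OF q] in auto)
  then have i1: "integrable M (\<lambda>x. \<bar>f x\<bar> + 1)" by simp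
  have le: "(\<bar>f x\<bar> + 1) powr q \<le> 2 powr q * (\<bar>f x\<bar> powr q + 1)" for x using add_powr_le[of "\<bar>f x\<bar>" 1 q] q by simp
  have i3: "integrable M (\<lambda>x. 2 powr q * (\<bar>f x\<bar> powr q + 1))" using iq by simp
  have i2: "integrable M (\<lambda>x. (\<bar>f x\<bar> + 1) powr q)"
    by (rule Bochner_Integration.integrable_bound[OF i3]) (use le in auto)
  have "\<bar>\<integral>x. f x \<partial>M\<bar> powr q \<le> (expectation (\<lambda>x. \<bar>f x\<bar> + 1)) powr q"
  proof (rule powr_mono2)
    have "\<bar>\<integral>x. f x \<partial>M\<bar> \<le> (\<integral>x. \<bar>f x\<bar> \<partial>M)" by (rule integral_abs_bound)
    also have "\<dots> \<le> expectation (\<lambda>x. \<bar>f x\<bar> + 1)" by (rule integral_mono) (use \<open>integrable M f\<close> in auto)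
    finally show "\<bar>\<integral>x. f x \<partial>M\<bar> \<le> expectation (\<lambda>x. \<bar>f x\<bar> + 1)" .
  qed (use q in auto)
  also have "\<dots> \<le> expectation (\<lambda>x. (\<bar>f x\<bar> + 1) powr q)"
    by (rule jensens_inequality[of "\<lambda>x. \<bar>f x\<bar> + 1" "{0<..}" 0 0, OF i1 _ _ i2 powr_convex[OF q]]) (auto intro!: add_nonneg_pos)
  also have "\<dots> \<le> expectation (\<lambda>x. 2 powr q * (\<bar>f x\<bar> powr q + 1))" by (rule integral_mono[OF i2 i3 le])
  also have "\<dots> = 2 powr q * (expectation (\<lambda>x. \<bar>f x\<bar> powr q) + 1)" using iq by (simp add: prob_space)
  finally have "ennreal (\<bar>\<integral>x. f x \<partial>M\<bar> powr q) \<le> ennreal (2 powr q * (expectation (\<lambda>x. \<bar>f x\<bar> powr q) + 1))" by (rule ennreal_leI)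
  also have "\<dots> = ennreal (2 powr q) * (ennreal (expectation (\<lambda>x. \<bar>f x\<bar> powr q)) + 1)"
    by (simp add: ennreal_mult ennreal_plus)
  also have "ennreal (expectation (\<lambda>x. \<bar>f x\<bar> powr q)) = (\<integral>\<^sup>+x. ennreal (\<bar>f x\<bar> powr q) \<partial>M)"
    by (rule nn_integral_eq_integral[symmetric, OF iq]) simp
  finally show ?thesis .
qed

locale ustat_kernel = mixing_seq M X \<tau> Cb for M :: "'a measure" and X \<tau> Cb +
  fixes h :: "real \<Rightarrow> real \<Rightarrow> real" and q D :: real
  assumes h[measurable]: "case_prod h \<in> borel_measurable (borel \<Otimes>\<^sub>M borel)" and q: "2 < q" "q \<le> 3" and D: "D \<ge> 0"
    and hq: "\<And>i j. i \<ge> 1 \<Longrightarrow> j \<ge> 1 \<Longrightarrow> (\<integral>\<^sup>+\<omega>. ennreal (\<bar>h (X i \<omega>) (X j \<omega>)\<bar> powr q) \<partial>M) \<le> ennreal D"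
    and hq2: "(\<integral>\<^sup>+x. \<integral>\<^sup>+y. ennreal (\<bar>h x y\<bar> powr q) \<partial>distr M borel (X 1) \<partial>distr M borel (X 1)) \<le> ennreal D"
begin

definition "mu = distr M borel (X 1)"
definition "th = theta_h h mu mu"
text \<open>Hoeffding's degenerate remainder: as \<open>hF\<close> is already centred,
  \<open>th\<close> is subtracted once more, and both partial integrals become zero.\<close>

definition "gk x y = h x y - th - hF h mu 1 x - hF h mu 2 y"

lemma h_comp[measurable (raw)]:
  "f \<in> borel_measurable N \<Longrightarrow> f' \<in> borel_measurable N \<Longrightarrow> (\<lambda>x. h (f x) (f' x)) \<in> borel_measurable N"
  using measurable_compose[OF measurable_Pair h, of f N f'] by simp

lemma sets_mu[measurable_cong, simp]: "sets mu = sets borel" by (simp add: mu_def)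

lemma space_mu[simp]: "space mu = UNIV" by (simp add: mu_def)

sublocale mu: prob_space mu unfolding mu_def by (rule prob_space_distr) simp

sublocale mm: pair_prob_space mu mu by unfold_locales

lemma prob_mu[simp]: "measure mu UNIV = 1" using mu.prob_space by simp

lemma hq2': "(\<integral>\<^sup>+x. \<integral>\<^sup>+y. ennreal (\<bar>h x y\<bar> powr q) \<partial>mu \<partial>mu) \<le> ennreal D" using hq2 by (simp add: mu_def)

lemma h_int: "integrable (mu \<Otimes>\<^sub>M mu) (case_prod h)"
proof -
  have [measurable]: "case_prod h \<in> borel_measurable (mu \<Otimes>\<^sub>M mu)" using h by simp
  have "(\<integral>\<^sup>+z. ennreal (\<bar>case_prod h z\<bar> powr q) \<partial>(mu \<Otimes>\<^sub>M mu)) \<le> ennreal D"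
    using hq2' by (subst mu.nn_integral_fst[symmetric]) auto
  then have "integrable (mu \<Otimes>\<^sub>M mu) (\<lambda>z. \<bar>case_prod h z\<bar> powr q)"
    by (intro integrableI_nonneg) (auto intro: le_less_trans)
  then show ?thesis
    by (intro Bochner_Integration.integrable_bound[of _ "\<lambda>z. 1 + \<bar>case_prod h z\<bar> powr q" "case_prod h"])
       (use powr_one_abs_le[of q] q in auto)
qed

lemma H_meas[measurable]: "(\<lambda>x. \<integral>y. h x y \<partial>mu) \<in> borel_measurable borel" "(\<lambda>y. \<integral>x. h x y \<partial>mu) \<in> borel_measurable borel"
proof -
  have m: "case_prod h \<in> borel_measurable (borel \<Otimes>\<^sub>M mu)" "case_prod (\<lambda>y x. h x y) \<in> borel_measurable (borel \<Otimes>\<^sub>M mu)" by measurable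
  show "(\<lambda>x. \<integral>y. h x y \<partial>mu) \<in> borel_measurable borel" by (rule mu.borel_measurable_lebesgue_integral[OF m(1)])
  show "(\<lambda>y. \<integral>x. h x y \<partial>mu) \<in> borel_measurable borel" by (rule mu.borel_measurable_lebesgue_integral[OF m(2)])
qed

lemma hF_meas[measurable]: "hF h mu p \<in> borel_measurable borel"
  unfolding hF_def[abs_def] by (cases "p = 1") (simp_all, measurable)

lemma H_int: "integrable mu (\<lambda>x. \<integral>y. h x y \<partial>mu)" "integrable mu (\<lambda>y. \<integral>x. h x y \<partial>mu)"
  "(\<integral>x. \<integral>y. h x y \<partial>mu \<partial>mu) = th" "(\<integral>y. \<integral>x. h x y \<partial>mu \<partial>mu) = th"
proof -
  show "integrable mu (\<lambda>x. \<integral>y. h x y \<partial>mu)" by (rule mm.integrable_fst[OF h_int])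
  show "integrable mu (\<lambda>y. \<integral>x. h x y \<partial>mu)" by (rule mm.integrable_snd[OF h_int])
  show "(\<integral>y. \<integral>x. h x y \<partial>mu \<partial>mu) = th" by (simp add: th_def theta_h_def)
  then show "(\<integral>x. \<integral>y. h x y \<partial>mu \<partial>mu) = th"
    using mm.integral_fst[OF h_int] mm.integral_snd[OF h_int] by simp
qed

lemma hF_12: "hF h mu 1 x = (\<integral>y. h x y \<partial>mu) - th" "hF h mu 2 y = (\<integral>x. h x y \<partial>mu) - th"
  by (simp_all add: hF_def th_def)

lemma hF_int: assumes "p \<in> {1,2}" shows "integrable mu (hF h mu p)" "(\<integral>x. hF h mu p x \<partial>mu) = 0"
proof -
  have "integrable mu (\<lambda>x. hF h mu p x) \<and> (\<integral>x. hF h mu p x \<partial>mu) = 0"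
    using assms H_int by (auto simp: hF_12[unfolded One_nat_def] mu.prob_space)
  then show "integrable mu (hF h mu p)" "(\<integral>x. hF h mu p x \<partial>mu) = 0" by auto
qed

text \<open>Integrating out one variable preserves q-th moments: Jensen's inequality is used on each
  section and then integrated over the other variable.\<close>

lemma hF_mom: assumes p: "p \<in> {1,2}"
  shows "\<exists>m\<ge>0. (\<integral>\<^sup>+x. ennreal (\<bar>hF h mu p x\<bar> powr q) \<partial>mu) \<le> ennreal m"
proof -
  \<comment> \<open>Exchanging the arguments treats both projections at once.\<close>
  define F where "F = (if p = 1 then h else (\<lambda>y x. h x y))"
  have Fm[measurable]: "case_prod F \<in> borel_measurable (borel \<Otimes>\<^sub>M borel)" unfolding F_def by (cases "p = 1") (simp_all, measurable)
  have Fs[measurable]: "F z \<in> borel_measurable borel" for z using measurable_compose[OF measurable_Pair1' Fm, of z] by simp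
  have Fe: "hF h mu p z = (\<integral>y. F z y \<partial>mu) - th" for z using p hF_12 by (auto simp: F_def)
  have Fn: "(\<integral>\<^sup>+z. \<integral>\<^sup>+y. ennreal (\<bar>F z y\<bar> powr q) \<partial>mu \<partial>mu) \<le> ennreal D"
  proof (cases "p = 1")
    case True then show ?thesis using hq2' by (simp add: F_def)
  next
    case False
    have "(\<integral>\<^sup>+z. \<integral>\<^sup>+y. ennreal (\<bar>h y z\<bar> powr q) \<partial>mu \<partial>mu) = (\<integral>\<^sup>+z. \<integral>\<^sup>+y. ennreal (\<bar>h z y\<bar> powr q) \<partial>mu \<partial>mu)"
      using mm.Fubini'[of "\<lambda>x y. ennreal (\<bar>h x y\<bar> powr q)"] by simp
    then show ?thesis using False hq2' by (simp add: F_def)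
  qed
  have le1: "ennreal (\<bar>hF h mu p z\<bar> powr q) \<le> ennreal (2 powr q) * (ennreal (2 powr q) * ((\<integral>\<^sup>+y. ennreal (\<bar>F z y\<bar> powr q) \<partial>mu) + 1) + ennreal (\<bar>th\<bar> powr q))" for z
  proof -
    have "\<bar>hF h mu p z\<bar> powr q \<le> (\<bar>\<integral>y. F z y \<partial>mu\<bar> + \<bar>th\<bar>) powr q" unfolding Fe using q by (intro powr_mono2) auto
    also have "\<dots> \<le> 2 powr q * (\<bar>\<integral>y. F z y \<partial>mu\<bar> powr q + \<bar>th\<bar> powr q)" by (rule add_powr_le) (use q in auto)
    finally have "ennreal (\<bar>hF h mu p z\<bar> powr q) \<le> ennreal (2 powr q) * (ennreal (\<bar>\<integral>y. F z y \<partial>mu\<bar> powr q) + ennreal (\<bar>th\<bar> powr q))"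
      by (simp add: ennreal_mult[symmetric] ennreal_plus[symmetric] ennreal_leI del: ennreal_plus)
    also have "\<dots> \<le> ennreal (2 powr q) * (ennreal (2 powr q) * ((\<integral>\<^sup>+y. ennreal (\<bar>F z y\<bar> powr q) \<partial>mu) + 1) + ennreal (\<bar>th\<bar> powr q))"
      by (intro mult_left_mono add_right_mono mu.powr_expectation_le) (use q in auto)
    finally show ?thesis .
  qed
  have [measurable]: "(\<lambda>z. \<integral>\<^sup>+y. ennreal (\<bar>F z y\<bar> powr q) \<partial>mu) \<in> borel_measurable mu"
  proof -
    have "(\<lambda>(z,y). ennreal (\<bar>F z y\<bar> powr q)) \<in> borel_measurable (mu \<Otimes>\<^sub>M mu)"
    proof -
      have [measurable]: "case_prod F \<in> borel_measurable (mu \<Otimes>\<^sub>M mu)" using Fm by simp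
      have "(\<lambda>z. ennreal (\<bar>case_prod F z\<bar> powr q)) \<in> borel_measurable (mu \<Otimes>\<^sub>M mu)" by measurable
      then show ?thesis by (simp add: case_prod_unfold)
    qed
    then show ?thesis by (rule mu.borel_measurable_nn_integral)
  qed
  have "(\<integral>\<^sup>+z. ennreal (\<bar>hF h mu p z\<bar> powr q) \<partial>mu) \<le> (\<integral>\<^sup>+z. ennreal (2 powr q) * (ennreal (2 powr q) * ((\<integral>\<^sup>+y. ennreal (\<bar>F z y\<bar> powr q) \<partial>mu) + 1) + ennreal (\<bar>th\<bar> powr q)) \<partial>mu)"
    by (rule nn_integral_mono) (rule le1)
  also have "\<dots> = ennreal (2 powr q) * (ennreal (2 powr q) * ((\<integral>\<^sup>+z. \<integral>\<^sup>+y. ennreal (\<bar>F z y\<bar> powr q) \<partial>mu \<partial>mu) + 1) + ennreal (\<bar>th\<bar> powr q))"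
    by (simp add: nn_integral_cmult nn_integral_add mu.emeasure_space_1[simplified])
  also have "\<dots> \<le> ennreal (2 powr q) * (ennreal (2 powr q) * (ennreal D + 1) + ennreal (\<bar>th\<bar> powr q))"
    by (intro mult_left_mono add_right_mono Fn) auto
  also have "\<dots> = ennreal (2 powr q * (2 powr q * (D + 1) + \<bar>th\<bar> powr q))"
    using D by (simp add: ennreal_mult ennreal_plus)
  finally show ?thesis using D by (intro exI[of _ "2 powr q * (2 powr q * (D + 1) + \<bar>th\<bar> powr q)"]) (auto intro!: mult_nonneg_nonneg add_nonneg_nonneg)
qed

lemma X_law: assumes "i \<ge> 1" shows "distr M borel (X i) = mu" unfolding mu_def by (rule stat_one[OF assms])

lemma hF_mixing: assumes p: "p \<in> {1,2}" shows "mixing_fun M X \<tau> Cb (hF h mu p) q"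
proof
  show "hF h mu p \<in> borel_measurable borel" by (rule hF_meas)
  show "2 < q" "q \<le> 3" by (rule q)+
  obtain m where m: "m \<ge> 0" "(\<integral>\<^sup>+x. ennreal (\<bar>hF h mu p x\<bar> powr q) \<partial>mu) \<le> ennreal m" using hF_mom[OF p] by blast
  have "integrable mu (\<lambda>x. \<bar>hF h mu p x\<bar> powr q)"
    by (rule integrableI_nonneg) (use m(2) in \<open>auto intro: le_less_trans\<close>)
  then show "integrable M (\<lambda>\<omega>. \<bar>hF h mu p (X 1 \<omega>)\<bar> powr q)" unfolding mu_def[symmetric]
    using integrable_distr_eq[of "X 1" M borel "\<lambda>x. \<bar>hF h mu p x\<bar> powr q"] by (simp add: mu_def[unfolded One_nat_def, symmetric])
  show "(\<integral>\<omega>. hF h mu p (X 1 \<omega>) \<partial>M) = 0"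
    using integral_distr[of "X 1" M borel "hF h mu p"] hF_int(2)[OF p] by (simp add: mu_def[unfolded One_nat_def, symmetric])
qed

sublocale mp: mixing_pair M X \<tau> Cb "hF h mu" q
  by (intro mixing_pair.intro mixing_pair_axioms.intro mixing_seq_axioms hF_mixing)

lemma gk_meas: "case_prod gk \<in> borel_measurable (borel \<Otimes>\<^sub>M borel)"
  unfolding gk_def[abs_def] by measurable

lemma gk_pow: "ennreal (\<bar>gk x y\<bar> powr q) \<le> ennreal (4 powr q) * (ennreal (\<bar>h x y\<bar> powr q) + (ennreal (\<bar>th\<bar> powr q) + (ennreal (\<bar>hF h mu 1 x\<bar> powr q) + ennreal (\<bar>hF h mu 2 y\<bar> powr q))))"
proof -
  define z where "z i = (if i = 0 then h x y else if i = 1 then - th else if i = 2 then - hF h mu 1 x else - hF h mu 2 y)" for i :: nat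
  have s: "(\<Sum>i<4. f i) = f 0 + f 1 + f 2 + f (3::nat)" for f :: "nat \<Rightarrow> real" by (simp add: eval_nat_numeral)
  have "\<bar>\<Sum>i<4. z i\<bar> powr q \<le> real (card {..<4::nat}) powr q * (\<Sum>i<4. \<bar>z i\<bar> powr q)"
    by (rule abs_sum_powr_le) (use q in auto)
  then have "\<bar>gk x y\<bar> powr q \<le> 4 powr q * (\<bar>h x y\<bar> powr q + (\<bar>th\<bar> powr q + (\<bar>hF h mu 1 x\<bar> powr q + \<bar>hF h mu 2 y\<bar> powr q)))"
    unfolding s by (simp add: z_def gk_def add.assoc)
  then show ?thesis by (simp add: ennreal_mult[symmetric] ennreal_plus[symmetric] ennreal_leI del: ennreal_plus)
qed

lemma degenerate: "\<exists>D'. degenerate_kernel M X \<tau> Cb gk q D'"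
proof -
  obtain m1 where m1: "m1 \<ge> 0" "(\<integral>\<^sup>+x. ennreal (\<bar>hF h mu 1 x\<bar> powr q) \<partial>mu) \<le> ennreal m1" using hF_mom[of 1] by auto
  obtain m2 where m2: "m2 \<ge> 0" "(\<integral>\<^sup>+x. ennreal (\<bar>hF h mu 2 x\<bar> powr q) \<partial>mu) \<le> ennreal m2" using hF_mom[of 2] by auto
  define D' where "D' = 4 powr q * (D + (\<bar>th\<bar> powr q + (m1 + m2)))"
  have D'0: "D' \<ge> 0" unfolding D'_def using D m1 m2 by auto
  have D'e: "ennreal (4 powr q) * (ennreal D + (ennreal (\<bar>th\<bar> powr q) + (ennreal m1 + ennreal m2))) = ennreal D'"
    unfolding D'_def using D m1 m2 by (simp add: ennreal_mult ennreal_plus)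
  have "degenerate_kernel M X \<tau> Cb gk q D'"
  proof
    show "case_prod gk \<in> borel_measurable (borel \<Otimes>\<^sub>M borel)" by (rule gk_meas)
    show "2 < q" by (rule q)
    show "0 \<le> D'" by (rule D'0)
    show "(\<integral>x. gk x y \<partial>distr M borel (X 1)) = 0" for y unfolding mu_def[symmetric]
    proof (cases "integrable mu (\<lambda>x. h x y)")
      case True
      then have "(\<integral>x. gk x y \<partial>mu) = (\<integral>x. h x y \<partial>mu) - th - (\<integral>x. hF h mu 1 x \<partial>mu) - hF h mu 2 y"
        unfolding gk_def using hF_int(1)[of 1] by (simp add: mu.prob_space)
      then show "(\<integral>x. gk x y \<partial>mu) = 0" using hF_int(2)[of 1] by (simp add: hF_12)
    next
      case False
      \<comment> \<open>Degeneracy is claimed for every y. Where the section of \<open>h\<close> is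
        not integrable, neither is that of \<open>gk\<close>, and its integral is 0 by
        convention.\<close>
      have "\<not> integrable mu (\<lambda>x. gk x y)"
      proof
        assume i: "integrable mu (\<lambda>x. gk x y)"
        have "integrable mu (\<lambda>x. gk x y + th + hF h mu 1 x + hF h mu 2 y)" using i hF_int(1)[of 1] by simp
        then show False using False by (simp add: gk_def)
      qed
      then show "(\<integral>x. gk x y \<partial>mu) = 0" by (rule not_integrable_integral_eq)
    qed
    show "(\<integral>y. gk x y \<partial>distr M borel (X 1)) = 0" for x unfolding mu_def[symmetric]
    proof (cases "integrable mu (\<lambda>y. h x y)")
      case True
      then have "(\<integral>y. gk x y \<partial>mu) = (\<integral>y. h x y \<partial>mu) - th - hF h mu 1 x - (\<integral>y. hF h mu 2 y \<partial>mu)"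
        unfolding gk_def using hF_int(1)[of 2] by (simp add: mu.prob_space)
      then show "(\<integral>y. gk x y \<partial>mu) = 0" using hF_int(2)[of 2] hF_12(1)[of x] by simp
    next
      case False
      have "\<not> integrable mu (\<lambda>y. gk x y)"
      proof
        assume i: "integrable mu (\<lambda>y. gk x y)"
        have "integrable mu (\<lambda>y. gk x y + th + hF h mu 1 x + hF h mu 2 y)" using i hF_int(1)[of 2] by simp
        then show False using False by (simp add: gk_def)
      qed
      then show "(\<integral>y. gk x y \<partial>mu) = 0" by (rule not_integrable_integral_eq)
    qed
    show "(\<integral>\<^sup>+\<omega>. ennreal (\<bar>gk (X i \<omega>) (X j \<omega>)\<bar> powr q) \<partial>M) \<le> ennreal D'" if ij: "i \<ge> 1" "j \<ge> 1" for i j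
    proof -
      have e1: "(\<integral>\<^sup>+\<omega>. ennreal (\<bar>hF h mu 1 (X i \<omega>)\<bar> powr q) \<partial>M) \<le> ennreal m1"
        using m1(2) nn_integral_distr[of "X i" M borel "\<lambda>x. ennreal (\<bar>hF h mu 1 x\<bar> powr q)"] unfolding X_law[OF ij(1)] by simp
      have e2: "(\<integral>\<^sup>+\<omega>. ennreal (\<bar>hF h mu 2 (X j \<omega>)\<bar> powr q) \<partial>M) \<le> ennreal m2"
        using m2(2) nn_integral_distr[of "X j" M borel "\<lambda>x. ennreal (\<bar>hF h mu 2 x\<bar> powr q)"] unfolding X_law[OF ij(2)] by simp
      have "(\<integral>\<^sup>+\<omega>. ennreal (\<bar>gk (X i \<omega>) (X j \<omega>)\<bar> powr q) \<partial>M) \<le> (\<integral>\<^sup>+\<omega>. ennreal (4 powr q) * (ennreal (\<bar>h (X i \<omega>) (X j \<omega>)\<bar> powr q) + (ennreal (\<bar>th\<bar> powr q) + (ennreal (\<bar>hF h mu 1 (X i \<omega>)\<bar> powr q) + ennreal (\<bar>hF h mu 2 (X j \<omega>)\<bar> powr q)))) \<partial>M)"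
        by (rule nn_integral_mono) (rule gk_pow)
      also have "\<dots> = ennreal (4 powr q) * ((\<integral>\<^sup>+\<omega>. ennreal (\<bar>h (X i \<omega>) (X j \<omega>)\<bar> powr q) \<partial>M) + (ennreal (\<bar>th\<bar> powr q) + ((\<integral>\<^sup>+\<omega>. ennreal (\<bar>hF h mu 1 (X i \<omega>)\<bar> powr q) \<partial>M) + (\<integral>\<^sup>+\<omega>. ennreal (\<bar>hF h mu 2 (X j \<omega>)\<bar> powr q) \<partial>M))))"
        by (simp add: nn_integral_cmult nn_integral_add emeasure_space_1)
      also have "\<dots> \<le> ennreal (4 powr q) * (ennreal D + (ennreal (\<bar>th\<bar> powr q) + (ennreal m1 + ennreal m2)))"
        by (intro mult_left_mono add_mono hq ij e1 e2) auto
      finally show ?thesis unfolding D'e .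
    qed
    show "(\<integral>\<^sup>+x. \<integral>\<^sup>+y. ennreal (\<bar>gk x y\<bar> powr q) \<partial>distr M borel (X 1) \<partial>distr M borel (X 1)) \<le> ennreal D'"
      unfolding mu_def[symmetric]
    proof -
      have [measurable]: "(\<lambda>x. \<integral>\<^sup>+y. ennreal (\<bar>h x y\<bar> powr q) \<partial>mu) \<in> borel_measurable mu"
        by (rule mu.borel_measurable_nn_integral) measurable
      have "(\<integral>\<^sup>+x. \<integral>\<^sup>+y. ennreal (\<bar>gk x y\<bar> powr q) \<partial>mu \<partial>mu) \<le> (\<integral>\<^sup>+x. \<integral>\<^sup>+y. ennreal (4 powr q) * (ennreal (\<bar>h x y\<bar> powr q) + (ennreal (\<bar>th\<bar> powr q) + (ennreal (\<bar>hF h mu 1 x\<bar> powr q) + ennreal (\<bar>hF h mu 2 y\<bar> powr q)))) \<partial>mu \<partial>mu)"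
        by (intro nn_integral_mono gk_pow)
      also have "\<dots> = (\<integral>\<^sup>+x. ennreal (4 powr q) * ((\<integral>\<^sup>+y. ennreal (\<bar>h x y\<bar> powr q) \<partial>mu) + (ennreal (\<bar>th\<bar> powr q) + (ennreal (\<bar>hF h mu 1 x\<bar> powr q) + (\<integral>\<^sup>+y. ennreal (\<bar>hF h mu 2 y\<bar> powr q) \<partial>mu)))) \<partial>mu)"
        by (simp add: nn_integral_cmult nn_integral_add mu.emeasure_space_1[simplified])
      also have "\<dots> = ennreal (4 powr q) * ((\<integral>\<^sup>+x. \<integral>\<^sup>+y. ennreal (\<bar>h x y\<bar> powr q) \<partial>mu \<partial>mu) + (ennreal (\<bar>th\<bar> powr q) + ((\<integral>\<^sup>+x. ennreal (\<bar>hF h mu 1 x\<bar> powr q) \<partial>mu) + (\<integral>\<^sup>+y. ennreal (\<bar>hF h mu 2 y\<bar> powr q) \<partial>mu))))"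
        by (simp add: nn_integral_cmult nn_integral_add mu.emeasure_space_1[simplified])
      also have "\<dots> \<le> ennreal (4 powr q) * (ennreal D + (ennreal (\<bar>th\<bar> powr q) + (ennreal m1 + ennreal m2)))"
        by (intro mult_left_mono add_mono hq2' m1(2) m2(2)) auto
      finally show "(\<integral>\<^sup>+x. \<integral>\<^sup>+y. ennreal (\<bar>gk x y\<bar> powr q) \<partial>mu \<partial>mu) \<le> ennreal D'" unfolding D'e .
    qed
  qed
  then show ?thesis by blast
qed

lemma hFX: assumes "p \<in> {1,2}" "i \<ge> 1" shows "integrable M (\<lambda>\<omega>. hF h mu p (X i \<omega>))" "(\<integral>\<omega>. hF h mu p (X i \<omega>) \<partial>M) = 0"
  using mixing_fun.u_int(1,2)[OF hF_mixing[OF assms(1)] assms(2)] by auto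

text \<open>The projections are centred, so the covariances are expectations of products.\<close>

lemma lrv_sg: assumes "p \<in> {1,2}" "r \<in> {1,2}" shows "lrv M X h p r = mp.sg p r"
  unfolding lrv_def mp.sg_def Let_def mu_def[symmetric] covar_def using hFX(2)[OF assms(1), of 1] by simp

lemma lrv_finite: assumes "p \<in> {1,2}" "r \<in> {1,2}" shows "lrv_finite M X h p r"
  unfolding lrv_finite_def Let_def mu_def[symmetric]
proof (intro conjI allI impI)
  show "integrable M (\<lambda>\<omega>. hF h mu p (X 1 \<omega>))" by (rule hFX(1)[OF assms(1)]) simp
  show "integrable M (\<lambda>\<omega>. hF h mu r (X i \<omega>))" if "1 \<le> i" for i by (rule hFX(1)[OF assms(2) that])
  show "integrable M (\<lambda>\<omega>. hF h mu p (X 1 \<omega>) * hF h mu r (X i \<omega>))" if "1 \<le> i" for i by (rule mp.hh_int2[OF assms]) (use that in auto)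
  show "summable (\<lambda>i. covar M (\<lambda>\<omega>. hF h mu p (X 1 \<omega>)) (\<lambda>\<omega>. hF h mu r (X (i + 2) \<omega>)))"
    unfolding covar_def using mp.cross_summable[OF assms] hFX(2)[OF assms(1), of 1] by simp
qed

end

section \<open>Block sums over the partition of the index range\<close>

lemma sum_block: "(b::nat) \<le> c \<Longrightarrow> (\<Sum>i\<in>{b+1..c}. f i) = (\<Sum>i\<in>{1..c}. f i) - (\<Sum>i\<in>{1..b}. f i :: real)"
  using sum.ub_add_nat[of 1 b f "c - b"] by simp

lemma abs_sum_block_le: "(c::nat) \<le> n \<Longrightarrow> \<bar>\<Sum>i\<in>{b+1..c}. f i\<bar> \<le> (\<Sum>i\<in>{1..n}. \<bar>f i :: real\<bar>)"
  by (rule order_trans[OF sum_abs sum_mono2]) auto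

definition rect_sum :: "(nat \<Rightarrow> nat \<Rightarrow> real) \<Rightarrow> nat \<Rightarrow> nat \<Rightarrow> real" where
  "rect_sum G a e = (\<Sum>j\<in>{1..e}. \<Sum>i\<in>{1..a}. if i < j then G i j else 0)"

text \<open>A block \<open>(b,c] \<times> (c,d]\<close> lies above the diagonal, so its sum is an alternating sum of four truncated corner sums.\<close>

lemma block_identity:
  fixes u v :: "nat \<Rightarrow> real"
  assumes bc: "b \<le> c" and cd: "c \<le> d"
  shows "(\<Sum>i\<in>{b+1..c}. \<Sum>j\<in>{c+1..d}. u i + v j + G i j)
    = (real d - real c) * (\<Sum>i\<in>{b+1..c}. u i) + (real c - real b) * (\<Sum>j\<in>{c+1..d}. v j)
      + (rect_sum G c d - rect_sum G b d - rect_sum G c c + rect_sum G b c)"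
proof -
  define y where "y i j = (if i < j then G i j else 0)" for i j
  have r: "rect_sum G a e = (\<Sum>j\<in>{1..e}. \<Sum>i\<in>{1..a}. y i j)" for a e by (simp add: rect_sum_def y_def)
  have "(\<Sum>i\<in>{b+1..c}. \<Sum>j\<in>{c+1..d}. G i j) = (\<Sum>i\<in>{b+1..c}. \<Sum>j\<in>{c+1..d}. y i j)"
    by (intro sum.cong refl) (auto simp: y_def)
  also have "\<dots> = (\<Sum>j\<in>{c+1..d}. \<Sum>i\<in>{b+1..c}. y i j)" by (rule sum.swap)
  also have "\<dots> = (\<Sum>j\<in>{1..d}. \<Sum>i\<in>{b+1..c}. y i j) - (\<Sum>j\<in>{1..c}. \<Sum>i\<in>{b+1..c}. y i j)" by (rule sum_block[OF cd])
  also have "\<dots> = rect_sum G c d - rect_sum G b d - rect_sum G c c + rect_sum G b c"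
    unfolding r sum_block[OF bc] sum_subtractf by simp
  finally have g: "(\<Sum>i\<in>{b+1..c}. \<Sum>j\<in>{c+1..d}. G i j) = rect_sum G c d - rect_sum G b d - rect_sum G c c + rect_sum G b c" .
  have "(\<Sum>i\<in>{b+1..c}. \<Sum>j\<in>{c+1..d}. u i) = (real d - real c) * (\<Sum>i\<in>{b+1..c}. u i)"
    using cd by (simp add: sum_distrib_left of_nat_diff)
  moreover have "(\<Sum>i\<in>{b+1..c}. \<Sum>j\<in>{c+1..d}. v j) = (real c - real b) * (\<Sum>j\<in>{c+1..d}. v j)"
    using bc by (simp add: of_nat_diff)
  ultimately show ?thesis using g by (simp add: sum.distrib)
qed

text \<open>Three discrepancies are collected. The convention \<open>id0 0 = 1\<close> drops the row
  i = 1; the weights y need not be integers, which costs at most 1 per weight; and each block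
  contributes four corner sums of the remainder. For the first two, sums of n absolute values are
  affordable.\<close>

lemma block_approx:
  fixes u v :: "nat \<Rightarrow> real" and a :: "nat \<Rightarrow> nat" and x :: "nat \<Rightarrow> real"
  assumes k: "k \<ge> 1" and H: "\<And>i j. H i j = u i + v j + G i j"
    and mono: "\<And>l. l \<le> k \<Longrightarrow> a l \<le> a (Suc l)" and an: "\<And>l. l \<le> Suc k \<Longrightarrow> a l \<le> n"
    and ax: "\<And>l. l \<le> Suc k \<Longrightarrow> real (a l) \<le> y l \<and> y l < real (a l) + 1" and a0: "a 0 = 0"
    and R: "\<And>b c. b \<le> n \<Longrightarrow> c \<le> n \<Longrightarrow> \<bar>rect_sum G b c\<bar> \<le> B"
    and id: "id0 0 = 1" "\<And>l. l \<ge> 1 \<Longrightarrow> l \<le> Suc k \<Longrightarrow> id0 l = a l"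
  shows "\<bar>(\<Sum>l\<in>{1..k}. \<Sum>i\<in>{id0 (l - 1) + 1..id0 l}. \<Sum>j\<in>{id0 l + 1..id0 (Suc l)}. H i j)
      - (\<Sum>l\<in>{1..k}. (y (Suc l) - y l) * ((\<Sum>i\<in>{1..a l}. u i) - (\<Sum>i\<in>{1..a (l-1)}. u i))
          + (y l - y (l-1)) * ((\<Sum>i\<in>{1..a (Suc l)}. v i) - (\<Sum>i\<in>{1..a l}. v i)))\<bar>
    \<le> (\<Sum>j\<in>{1..n}. \<bar>H 1 j\<bar>) + real k * ((\<Sum>i\<in>{1..n}. \<bar>u i\<bar>) + (\<Sum>i\<in>{1..n}. \<bar>v i\<bar>) + 4 * B)"
proof -
  define T where "T b l = (\<Sum>i\<in>{b + 1..a l}. \<Sum>j\<in>{a l + 1..a (Suc l)}. H i j)" for b l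
  define L where "L l = (y (Suc l) - y l) * ((\<Sum>i\<in>{1..a l}. u i) - (\<Sum>i\<in>{1..a (l-1)}. u i))
          + (y l - y (l-1)) * ((\<Sum>i\<in>{1..a (Suc l)}. v i) - (\<Sum>i\<in>{1..a l}. v i))" for l
  let ?U = "\<Sum>i\<in>{1..n}. \<bar>u i\<bar>" and ?V = "\<Sum>i\<in>{1..n}. \<bar>v i\<bar>"
  have e: "(\<Sum>l\<in>{1..k}. \<Sum>i\<in>{id0 (l - 1) + 1..id0 l}. \<Sum>j\<in>{id0 l + 1..id0 (Suc l)}. H i j) = (\<Sum>l\<in>{1..k}. T (id0 (l-1)) l)"
    by (intro sum.cong refl) (simp add: T_def id(2))
  \<comment> \<open>Only the term l = 1 sees the difference between \<open>id0 0 = 1\<close> and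
    \<open>a 0 = 0\<close>.\<close>
  have e2: "(\<Sum>l\<in>{1..k}. T (id0 (l-1)) l) = T 1 1 + (\<Sum>l\<in>{2..k}. T (a (l-1)) l)"
    using k id by (subst sum.atLeast_Suc_atMost) (auto simp: numeral_2_eq_2 intro!: sum.cong)
  have e3: "(\<Sum>l\<in>{1..k}. T (a (l-1)) l) = T 0 1 + (\<Sum>l\<in>{2..k}. T (a (l-1)) l)"
    using k a0 by (subst sum.atLeast_Suc_atMost) (auto simp: numeral_2_eq_2)
  have d1: "\<bar>T 1 1 - T 0 1\<bar> \<le> (\<Sum>j\<in>{1..n}. \<bar>H 1 j\<bar>)"
  proof (cases "a 1 = 0")
    case True
    then show ?thesis by (simp add: T_def sum_nonneg)
  next
    case False
    then have "{0 + 1..a 1} = insert 1 {1 + 1..a 1}" by auto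
    then have "T 0 1 = (\<Sum>j\<in>{a 1 + 1..a (Suc 1)}. H 1 j) + T 1 1" unfolding T_def by simp
    moreover have "\<bar>\<Sum>j\<in>{a 1 + 1..a (Suc 1)}. H 1 j\<bar> \<le> (\<Sum>j\<in>{1..n}. \<bar>H 1 j\<bar>)"
      using an[of "Suc 1"] k by (intro abs_sum_block_le) auto
    ultimately show ?thesis by linarith
  qed
  have d2: "\<bar>T (a (l-1)) l - L l\<bar> \<le> ?U + ?V + 4 * B" if l: "l \<in> {1..k}" for l
  proof -
    have m: "a (l-1) \<le> a l" "a l \<le> a (Suc l)" using mono[of "l-1"] mono[of l] l by auto
    have n: "a (l-1) \<le> n" "a l \<le> n" "a (Suc l) \<le> n" using an[of "l-1"] an[of l] an[of "Suc l"] l by auto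
    define \<Delta>u where "\<Delta>u = (\<Sum>i\<in>{a (l-1) + 1..a l}. u i)"
    define \<Delta>v where "\<Delta>v = (\<Sum>i\<in>{a l + 1..a (Suc l)}. v i)"
    define g where "g = rect_sum G (a l) (a (Suc l)) - rect_sum G (a (l-1)) (a (Suc l)) - rect_sum G (a l) (a l) + rect_sum G (a (l-1)) (a l)"
    define A where "A = (real (a (Suc l)) - real (a l)) - (y (Suc l) - y l)"
    define C where "C = (real (a l) - real (a (l-1))) - (y l - y (l-1))"
    have "T (a (l-1)) l = (real (a (Suc l)) - real (a l)) * \<Delta>u + (real (a l) - real (a (l-1))) * \<Delta>v + g"
      unfolding T_def H \<Delta>u_def \<Delta>v_def g_def by (rule block_identity[OF m])
    moreover have "L l = (y (Suc l) - y l) * \<Delta>u + (y l - y (l-1)) * \<Delta>v"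
      unfolding L_def \<Delta>u_def \<Delta>v_def sum_block[OF m(1)] sum_block[OF m(2)] ..
    ultimately have d: "T (a (l-1)) l - L l = A * \<Delta>u + C * \<Delta>v + g" unfolding A_def C_def by (simp add: left_diff_distrib)
    have "l - 1 \<le> Suc k" "l \<le> Suc k" "Suc l \<le> Suc k" using l by auto
    note ax3 = ax[OF this(1)] ax[OF this(2)] ax[OF this(3)]
    \<comment> \<open>Each y exceeds its integer part by less than 1, so differences of y and
      differences of the integer parts are at most 1 apart.\<close>
    have AC: "\<bar>A\<bar> \<le> 1" "\<bar>C\<bar> \<le> 1" unfolding A_def C_def using ax3 by linarith+
    have "\<bar>A * \<Delta>u\<bar> \<le> 1 * ?U" unfolding abs_mult \<Delta>u_def using AC n by (intro mult_mono abs_sum_block_le) auto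
    moreover have "\<bar>C * \<Delta>v\<bar> \<le> 1 * ?V" unfolding abs_mult \<Delta>v_def using AC n by (intro mult_mono abs_sum_block_le) auto
    moreover have "\<bar>g\<bar> \<le> 4 * B" unfolding g_def
      using R[OF n(2) n(3)] R[OF n(1) n(3)] R[OF n(2) n(2)] R[OF n(1) n(2)] by linarith
    ultimately show ?thesis unfolding d by linarith
  qed
  have "\<bar>(\<Sum>l\<in>{1..k}. T (a (l-1)) l) - (\<Sum>l\<in>{1..k}. L l)\<bar> \<le> (\<Sum>l\<in>{1..k}. ?U + ?V + 4 * B)"
    unfolding sum_subtractf[symmetric] by (rule order_trans[OF sum_abs sum_mono]) (rule d2)
  then have "\<bar>(\<Sum>l\<in>{1..k}. T (a (l-1)) l) - (\<Sum>l\<in>{1..k}. L l)\<bar> \<le> real k * (?U + ?V + 4 * B)" by simp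
  then show ?thesis using d1 unfolding e L_def[symmetric] e2 e3 by linarith
qed

section \<open>The process and its approximation by partial sums\<close>

lemma Zn_bounded_on:
  assumes k: "k \<ge> 1"
  shows "bounded_on (cube k) (Zn k h \<theta> X n \<omega>)"
  unfolding bounded_on_def
proof (rule bdd_aboveI2)
  fix t
  let ?S = "\<Sum>i\<in>{1..n+1}. \<Sum>j\<in>{1..n+1}. \<bar>h (X i \<omega>) (X j \<omega>) - \<theta>\<bar>"
  have S0: "?S \<ge> 0" by (intro sum_nonneg) auto
  show "\<bar>Zn k h \<theta> X n \<omega> t\<bar> \<le> real n powr (-3/2) * (real k * ?S)"
  proof (cases "t \<in> Theta k")
    case False
    then show ?thesis using S0 by (simp add: Zn_def)
  next
    case True
    have c: "\<And>l. l \<in> {1..k} \<Longrightarrow> t l \<le> 1" using True unfolding Theta_def cube_def by blast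
    \<comment> \<open>\<open>n + 1\<close> and not n, because the starting index 1 exceeds n when n
      = 0.\<close>
    have i: "idx k n t l \<le> n + 1" if "l \<le> Suc k" for l
    proof (cases "l = 0 \<or> l = Suc k")
      case True then show ?thesis by (auto simp: idx_def)
    next
      case False
      then have "real n * t l \<le> real n" using c[of l] that by (intro mult_left_le) auto
      then have "\<lfloor>real n * t l\<rfloor> \<le> int n" by linarith
      then show ?thesis using False by (auto simp: idx_def)
    qed
    have "\<bar>\<Sum>l\<in>{1..k}. \<Sum>i\<in>{idx k n t (l - 1) + 1 .. idx k n t l}. \<Sum>j\<in>{idx k n t l + 1 .. idx k n t (Suc l)}. (h (X i \<omega>) (X j \<omega>) - \<theta>)\<bar> \<le> (\<Sum>l\<in>{1..k}. ?S)"
    proof (rule order_trans[OF sum_abs sum_mono])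
      fix l assume l: "l \<in> {1..k}"
      have "\<bar>\<Sum>i\<in>{idx k n t (l - 1) + 1 .. idx k n t l}. \<Sum>j\<in>{idx k n t l + 1 .. idx k n t (Suc l)}. (h (X i \<omega>) (X j \<omega>) - \<theta>)\<bar>
        \<le> (\<Sum>i\<in>{idx k n t (l - 1) + 1 .. idx k n t l}. \<Sum>j\<in>{1..n+1}. \<bar>h (X i \<omega>) (X j \<omega>) - \<theta>\<bar>)"
        by (rule order_trans[OF sum_abs sum_mono], rule abs_sum_block_le) (use i[of "Suc l"] l in auto)
      also have "\<dots> \<le> ?S" using i[of l] l by (intro sum_mono2) (auto intro: sum_nonneg)
      finally show "\<bar>\<Sum>i\<in>{idx k n t (l - 1) + 1 .. idx k n t l}. \<Sum>j\<in>{idx k n t l + 1 .. idx k n t (Suc l)}. (h (X i \<omega>) (X j \<omega>) - \<theta>)\<bar> \<le> ?S" .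
    qed
    then have "\<bar>\<Sum>l\<in>{1..k}. \<Sum>i\<in>{idx k n t (l - 1) + 1 .. idx k n t l}. \<Sum>j\<in>{idx k n t l + 1 .. idx k n t (Suc l)}. (h (X i \<omega>) (X j \<omega>) - \<theta>)\<bar> \<le> real k * ?S" by simp
    then show ?thesis using True unfolding Zn_def by (simp only: if_True abs_mult abs_of_nonneg[OF powr_ge_zero]) (intro mult_left_mono, auto)
  qed
qed

context ustat_kernel
begin

lemma Zn_Zlim_le:
  assumes k: "k \<ge> 1" and n: "n \<ge> 1" and t: "t \<in> cube k" and B: "B \<ge> 0"
    and R: "\<And>b c. b \<le> n \<Longrightarrow> c \<le> n \<Longrightarrow> \<bar>rect_sum (\<lambda>i j. gk (X i \<omega>) (X j \<omega>)) b c\<bar> \<le> B"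
  shows "\<bar>Zn k h th X n \<omega> t - Zlim k (mp.wn n) \<omega> t\<bar> \<le> real n powr (-3/2) *
    ((\<Sum>j\<in>{1..n}. \<bar>h (X 1 \<omega>) (X j \<omega>) - th\<bar>) + real k * ((\<Sum>i\<in>{1..n}. \<bar>hF h mu 1 (X i \<omega>)\<bar>) + (\<Sum>i\<in>{1..n}. \<bar>hF h mu 2 (X i \<omega>)\<bar>) + 4 * B))"
    (is "_ \<le> _ * ?E")
proof (cases "t \<in> Theta k")
  case False
  have "?E \<ge> 0" using B by (intro add_nonneg_nonneg mult_nonneg_nonneg sum_nonneg) auto
  then show ?thesis using False by (simp add: Zn_def Zlim_def)
next
  case True
  define x where "x = text_ext k t"
  define a where "a l = nat \<lfloor>real n * x l\<rfloor>" for l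
  define c where "c = real n powr (-3/2)"
  have x: "0 \<le> x l" "x l \<le> 1" if "l \<le> Suc k" for l unfolding x_def using Theta_ext[OF k True, of l] that by auto
  have xm: "x l \<le> x (Suc l)" if "l \<le> k" for l unfolding x_def by (rule Theta_ext(3)[OF k True that])
  define S where "S p m = (\<Sum>i\<in>{1..m}. hF h mu p (X i \<omega>))" for p :: nat and m :: nat
  \<comment> \<open>Of the factor n^(-3/2), one power of n is spent on the weights, which are n
    times differences of the t_l, and n^(-1/2) normalises the partial sums.\<close>
  have cn: "c * real n = 1 / sqrt (real n)"
  proof -
    have "real n powr (-3/2) * real n powr 1 = real n powr (-3/2 + 1)" by (rule powr_add[symmetric])
    then have "c * real n = real n powr - (1/2)" using n by (simp add: c_def)
    then show ?thesis by (simp add: powr_minus powr_half_sqrt inverse_eq_divide)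
  qed
  have wn: "mp.wn n p (x l) \<omega> = S p (a l) / sqrt (real n)" for p l
  proof -
    have "{0<..m} = {1..m}" for m :: nat by auto
    then show ?thesis unfolding mp.wn_def S_def a_def by simp
  qed
  define L where "L = (\<Sum>l\<in>{1..k}. (real n * x (Suc l) - real n * x l) * (S 1 (a l) - S 1 (a (l-1))) + (real n * x l - real n * x (l-1)) * (S 2 (a (Suc l)) - S 2 (a l)))"
  have zl: "Zlim k (mp.wn n) \<omega> t = c * L"
    unfolding Zlim_def if_P[OF True] x_def[symmetric] wn L_def sum_distrib_left
  proof (intro sum.cong refl)
    fix l
    have e: "z * (r / sqrt (real n) - s / sqrt (real n)) = c * (real n * z * (r - s))" for z r s
    proof -
      have "z * (r / sqrt (real n) - s / sqrt (real n)) = (1 / sqrt (real n)) * (z * (r - s))" by (simp add: diff_divide_distrib algebra_simps)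
      also have "\<dots> = c * (real n * z * (r - s))" unfolding cn[symmetric] by simp
      finally show ?thesis .
    qed
    show "(x (Suc l) - x l) * (S 1 (a l) / sqrt (real n) - S 1 (a (l - 1)) / sqrt (real n)) + (x l - x (l - 1)) * (S 2 (a (Suc l)) / sqrt (real n) - S 2 (a l) / sqrt (real n))
      = c * ((real n * x (Suc l) - real n * x l) * (S 1 (a l) - S 1 (a (l-1))) + (real n * x l - real n * x (l-1)) * (S 2 (a (Suc l)) - S 2 (a l)))"
      unfolding e by (simp add: right_diff_distrib distrib_left)
  qed
  define Z where "Z = (\<Sum>l\<in>{1..k}. \<Sum>i\<in>{idx k n t (l - 1) + 1 .. idx k n t l}. \<Sum>j\<in>{idx k n t l + 1 .. idx k n t (Suc l)}. (h (X i \<omega>) (X j \<omega>) - th))"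
  have zn: "Zn k h th X n \<omega> t = c * Z" unfolding Zn_def if_P[OF True] c_def Z_def ..
  have "\<bar>Z - L\<bar> \<le> ?E" unfolding Z_def L_def S_def
  proof (rule block_approx[where G = "\<lambda>i j. gk (X i \<omega>) (X j \<omega>)"])
    show "1 \<le> k" by (rule k)
    show "h (X i \<omega>) (X j \<omega>) - th = hF h mu 1 (X i \<omega>) + hF h mu 2 (X j \<omega>) + gk (X i \<omega>) (X j \<omega>)" for i j
      by (simp add: gk_def)
    show "a l \<le> a (Suc l)" if "l \<le> k" for l
      unfolding a_def by (intro nat_mono floor_mono mult_left_mono xm that) simp
    show "a l \<le> n" if "l \<le> Suc k" for l
    proof -
      have "real n * x l \<le> real n" using x[OF that] by (intro mult_left_le) auto
      then have "\<lfloor>real n * x l\<rfloor> \<le> int n" by linarith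
      then show ?thesis by (simp add: a_def)
    qed
    show "real (a l) \<le> real n * x l \<and> real n * x l < real (a l) + 1" if "l \<le> Suc k" for l
    proof -
      have "0 \<le> real n * x l" using x[OF that] by simp
      then have "real (a l) = of_int \<lfloor>real n * x l\<rfloor>" by (simp add: a_def)
      then show ?thesis by linarith
    qed
    show "a 0 = 0" by (simp add: a_def x_def text_ext_def)
    show "\<bar>rect_sum (\<lambda>i j. gk (X i \<omega>) (X j \<omega>)) b c\<bar> \<le> B" if "b \<le> n" "c \<le> n" for b c by (rule R[OF that])
    show "idx k n t 0 = 1" by (simp add: idx_def)
    show "idx k n t l = a l" if "l \<ge> 1" "l \<le> Suc k" for l
      using that by (auto simp: idx_def a_def x_def text_ext_def)
  qed
  then have "c * \<bar>Z - L\<bar> \<le> c * ?E" by (rule mult_left_mono) (simp add: c_def)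
  moreover have "Zn k h th X n \<omega> t - Zlim k (mp.wn n) \<omega> t = c * (Z - L)" unfolding zl zn by (simp add: right_diff_distrib)
  moreover have "c \<ge> 0" by (simp add: c_def)
  ultimately show ?thesis unfolding c_def[symmetric] by (simp add: abs_mult)
qed

lemma h_X_int: assumes "i \<ge> 1" "j \<ge> 1"
  shows "integrable M (\<lambda>\<omega>. h (X i \<omega>) (X j \<omega>))" "(\<integral>\<omega>. \<bar>h (X i \<omega>) (X j \<omega>)\<bar> \<partial>M) \<le> 1 + D"
proof -
  have n: "(\<integral>\<^sup>+\<omega>. ennreal (\<bar>h (X i \<omega>) (X j \<omega>)\<bar> powr q) \<partial>M) \<le> ennreal D" by (rule hq[OF assms])
  have i: "integrable M (\<lambda>\<omega>. \<bar>h (X i \<omega>) (X j \<omega>)\<bar> powr q)"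
    by (rule integrableI_nonneg) (use n in \<open>auto intro: le_less_trans\<close>)
  have le: "\<bar>h (X i \<omega>) (X j \<omega>)\<bar> \<le> 1 + \<bar>h (X i \<omega>) (X j \<omega>)\<bar> powr q" for \<omega> using powr_one_abs_le[of q] q by auto
  show ih: "integrable M (\<lambda>\<omega>. h (X i \<omega>) (X j \<omega>))"
    by (rule Bochner_Integration.integrable_bound[of _ "\<lambda>\<omega>. 1 + \<bar>h (X i \<omega>) (X j \<omega>)\<bar> powr q"]) (use i le in auto)
  have "(\<integral>\<omega>. \<bar>h (X i \<omega>) (X j \<omega>)\<bar> \<partial>M) \<le> (\<integral>\<omega>. 1 + \<bar>h (X i \<omega>) (X j \<omega>)\<bar> powr q \<partial>M)"
    by (rule integral_mono) (use i ih le in auto)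
  also have "\<dots> = 1 + (\<integral>\<omega>. \<bar>h (X i \<omega>) (X j \<omega>)\<bar> powr q \<partial>M)" using i by (simp add: prob_space)
  also have "ennreal (\<integral>\<omega>. \<bar>h (X i \<omega>) (X j \<omega>)\<bar> powr q \<partial>M) \<le> ennreal D"
    using n nn_integral_eq_integral[OF i] by simp
  then have "(\<integral>\<omega>. \<bar>h (X i \<omega>) (X j \<omega>)\<bar> powr q \<partial>M) \<le> D" using D by simp
  finally show "(\<integral>\<omega>. \<bar>h (X i \<omega>) (X j \<omega>)\<bar> \<partial>M) \<le> 1 + D" by simp
qed

lemma hF_X_abs: assumes "i \<ge> 1" shows "(\<integral>\<omega>. \<bar>hF h mu p (X i \<omega>)\<bar> \<partial>M) = (\<integral>x. \<bar>hF h mu p x\<bar> \<partial>mu)"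
  using integral_distr[of "X i" M borel "\<lambda>x. \<bar>hF h mu p x\<bar>"] unfolding X_law[OF assms] by simp

text \<open>The bound of \<open>Zn_Zlim_le\<close> with the square root of the chaining variable
  \<open>Q n\<close> in the place of \<open>B\<close>, hence uniform in t. Its mean is of order
  n^(-1/2) from the linear terms, plus a multiple of the square root of E Q / n^3 from the
  degenerate ones; Markov's inequality finishes.\<close>

lemma approx_error:
  assumes k: "k \<ge> 1"
  shows "\<exists>Er. (\<forall>n. Er n \<in> borel_measurable M)
    \<and> (\<forall>n \<omega> t. n \<ge> 1 \<longrightarrow> t \<in> cube k \<longrightarrow> \<bar>Zn k h th X n \<omega> t - Zlim k (mp.wn n) \<omega> t\<bar> \<le> Er n \<omega>)
    \<and> (\<forall>\<epsilon>>0. (\<lambda>n. prob {\<omega>\<in>space M. Er n \<omega> > \<epsilon>}) \<longlonglongrightarrow> 0)"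
proof -
  obtain D' where D': "degenerate_kernel M X \<tau> Cb gk q D'" using degenerate by blast
  interpret dk: degenerate_kernel M X \<tau> Cb gk q D' by (rule D')
  obtain Q where Qi: "\<And>n. integrable M (Q n)" and Qb: "\<And>n a b \<omega>. a \<le> n \<Longrightarrow> b \<le> n \<Longrightarrow> (\<Sum>j<b. \<Sum>i<a. dk.yg i j \<omega>)\<^sup>2 \<le> Q n \<omega>"
    and Q0: "(\<lambda>n. expectation (Q n) / real n ^ 3) \<longlonglongrightarrow> 0"
    using dk.degenerate_negligible by blast
  have Qp: "0 \<le> Q n \<omega>" for n \<omega> using Qb[of 0 n 0 \<omega>] by simp
  have Qm[measurable]: "Q n \<in> borel_measurable M" for n using Qi by (rule borel_measurable_integrable)
  have rs: "rect_sum (\<lambda>i j. gk (X i \<omega>) (X j \<omega>)) a b = (\<Sum>j<b. \<Sum>i<a. dk.yg i j \<omega>)" for a b \<omega>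
    unfolding rect_sum_def dk.yg_def by (simp add: sum.atLeast1_atMost_eq)
  have R: "\<bar>rect_sum (\<lambda>i j. gk (X i \<omega>) (X j \<omega>)) b c\<bar> \<le> sqrt (Q n \<omega>)" if "b \<le> n" "c \<le> n" for b c n \<omega>
    unfolding rs by (rule real_le_rsqrt) (use Qb[OF that] in simp)
  have sq: "integrable M (\<lambda>\<omega>. sqrt (Q n \<omega>))" "(\<integral>\<omega>. sqrt (Q n \<omega>) \<partial>M) \<le> sqrt (expectation (Q n))" for n
    using expectation_abs_le_sqrt[of "\<lambda>\<omega>. sqrt (Q n \<omega>)"] Qi[of n] Qp[of n] by simp_all
  define Er where "Er n \<omega> = real n powr (-3/2) *
    ((\<Sum>j\<in>{1..n}. \<bar>h (X 1 \<omega>) (X j \<omega>) - th\<bar>) + real k * ((\<Sum>i\<in>{1..n}. \<bar>hF h mu 1 (X i \<omega>)\<bar>) + (\<Sum>i\<in>{1..n}. \<bar>hF h mu 2 (X i \<omega>)\<bar>) + 4 * sqrt (Q n \<omega>)))" for n \<omega>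
  define c1 where "c1 = 1 + D + \<bar>th\<bar>"
  define c2 where "c2 p = (\<integral>x. \<bar>hF h mu p x\<bar> \<partial>mu)" for p :: nat
  have i1: "integrable M (\<lambda>\<omega>. \<bar>h (X 1 \<omega>) (X j \<omega>) - th\<bar>)" if "j \<in> {1..n}" for j n
    using h_X_int(1)[of 1 j] that by (intro integrable_abs Bochner_Integration.integrable_diff) auto
  have i2: "integrable M (\<lambda>\<omega>. \<bar>hF h mu p (X i \<omega>)\<bar>)" if "p \<in> {1,2}" "i \<in> {1..n}" for i n p
    using hFX(1)[of p i] that by (intro integrable_abs) auto
  have b1: "(\<integral>\<omega>. \<bar>h (X 1 \<omega>) (X j \<omega>) - th\<bar> \<partial>M) \<le> c1" if "j \<in> {1..n}" for j n
  proof -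
    have ij: "integrable M (\<lambda>\<omega>. h (X 1 \<omega>) (X j \<omega>))" by (rule h_X_int(1)) (use that in auto)
    have "(\<integral>\<omega>. \<bar>h (X 1 \<omega>) (X j \<omega>) - th\<bar> \<partial>M) \<le> (\<integral>\<omega>. \<bar>h (X 1 \<omega>) (X j \<omega>)\<bar> + \<bar>th\<bar> \<partial>M)"
      by (rule integral_mono[OF i1[OF that]]) (use ij in auto)
    also have "\<dots> = (\<integral>\<omega>. \<bar>h (X 1 \<omega>) (X j \<omega>)\<bar> \<partial>M) + \<bar>th\<bar>" using ij by (simp add: prob_space)
    also have "\<dots> \<le> c1" unfolding c1_def using h_X_int(2)[of 1 j] that by simp
    finally show ?thesis .
  qed
  have Ei: "integrable M (Er n)" for n unfolding Er_def[abs_def]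
    by (intro integrable_mult_right Bochner_Integration.integrable_add Bochner_Integration.integrable_sum sq(1)) (use i1[of _ n] i2[of _ _ n] in auto)
  have En: "0 \<le> Er n \<omega>" for n \<omega> unfolding Er_def using Qp[of n \<omega>]
    by (intro mult_nonneg_nonneg add_nonneg_nonneg sum_nonneg) auto
  have EE: "expectation (Er n) \<le> real n powr (-3/2) * (real n * c1 + real k * (real n * c2 1 + real n * c2 2 + 4 * sqrt (expectation (Q n))))" for n
  proof -
    have s1: "(\<integral>\<omega>. (\<Sum>j\<in>{1..n}. \<bar>h (X 1 \<omega>) (X j \<omega>) - th\<bar>) \<partial>M) \<le> real n * c1"
    proof -
      have "(\<integral>\<omega>. (\<Sum>j\<in>{1..n}. \<bar>h (X 1 \<omega>) (X j \<omega>) - th\<bar>) \<partial>M) = (\<Sum>j\<in>{1..n}. (\<integral>\<omega>. \<bar>h (X 1 \<omega>) (X j \<omega>) - th\<bar> \<partial>M))"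
        by (rule Bochner_Integration.integral_sum) (rule i1)
      also have "\<dots> \<le> (\<Sum>j\<in>{1..n}. c1)" by (rule sum_mono) (rule b1)
      finally show ?thesis by simp
    qed
    have s2: "(\<integral>\<omega>. (\<Sum>i\<in>{1..n}. \<bar>hF h mu p (X i \<omega>)\<bar>) \<partial>M) = real n * c2 p" if p: "p \<in> {1,2}" for p
    proof -
      have "(\<integral>\<omega>. (\<Sum>i\<in>{1..n}. \<bar>hF h mu p (X i \<omega>)\<bar>) \<partial>M) = (\<Sum>i\<in>{1..n}. (\<integral>\<omega>. \<bar>hF h mu p (X i \<omega>)\<bar> \<partial>M))"
        by (rule Bochner_Integration.integral_sum) (rule i2[OF p])
      also have "\<dots> = (\<Sum>i\<in>{1..n}. c2 p)" by (rule sum.cong[OF refl]) (simp add: hF_X_abs c2_def)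
      finally show ?thesis by simp
    qed
    let ?A = "\<lambda>\<omega>. \<Sum>j\<in>{1..n}. \<bar>h (X 1 \<omega>) (X j \<omega>) - th\<bar>" and ?U = "\<lambda>p \<omega>. \<Sum>i\<in>{1..n}. \<bar>hF h mu p (X i \<omega>)\<bar>"
    have ia: "integrable M ?A" by (rule Bochner_Integration.integrable_sum) (rule i1)
    have iu: "integrable M (?U p)" if "p \<in> {1,2}" for p by (rule Bochner_Integration.integrable_sum) (rule i2[OF that])
    have "expectation (Er n) = real n powr (-3/2) * (expectation ?A + real k * (expectation (?U 1) + expectation (?U 2) + 4 * (\<integral>\<omega>. sqrt (Q n \<omega>) \<partial>M)))"
    proof -
      have iu1: "integrable M (?U 1)" and iu2: "integrable M (?U 2)" by (rule iu, simp)+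
      have 1: "integrable M (\<lambda>\<omega>. ?U 1 \<omega> + ?U 2 \<omega>)" by (rule Bochner_Integration.integrable_add[OF iu1 iu2])
      have 2: "integrable M (\<lambda>\<omega>. 4 * sqrt (Q n \<omega>))" using sq(1) by (rule integrable_mult_right)
      have 3: "integrable M (\<lambda>\<omega>. real k * (?U 1 \<omega> + ?U 2 \<omega> + 4 * sqrt (Q n \<omega>)))"
        by (rule integrable_mult_right[OF Bochner_Integration.integrable_add[OF 1 2]])
      show ?thesis unfolding Er_def[abs_def] integral_mult_right_zero
        Bochner_Integration.integral_add[OF ia 3] Bochner_Integration.integral_add[OF 1 2]
        Bochner_Integration.integral_add[OF iu1 iu2] ..
    qed
    also have "\<dots> \<le> real n powr (-3/2) * (real n * c1 + real k * (real n * c2 1 + real n * c2 2 + 4 * sqrt (expectation (Q n))))"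
      using s1 s2[of 1] s2[of 2] sq(2)[of n] by (intro mult_left_mono add_mono) auto
    finally show ?thesis .
  qed
  define C where "C = c1 + real k * (c2 1 + c2 2)"
  have EE': "expectation (Er n) \<le> C / sqrt (real n) + 4 * real k * sqrt (expectation (Q n) / real n ^ 3)" if n: "n \<ge> 1" for n
  proof -
    have "real n powr (-3/2) * real n powr 1 = real n powr (-3/2 + 1)" by (rule powr_add[symmetric])
    then have p1: "real n powr (-3/2) * real n = 1 / sqrt (real n)" using n by (simp add: powr_minus powr_half_sqrt inverse_eq_divide)
    have "sqrt (real n ^ 3) = real n powr (3/2)"
    proof -
      have "real n ^ 3 = real n powr 3" using n by (simp add: powr_numeral)
      then have "sqrt (real n ^ 3) = (real n powr 3) powr (1/2)" by (simp only: powr_half_sqrt powr_ge_zero)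
      also have "\<dots> = real n powr (3 * (1/2))" by (rule powr_powr)
      finally show ?thesis by simp
    qed
    then have p2: "real n powr (-3/2) = 1 / sqrt (real n ^ 3)" by (simp add: powr_minus inverse_eq_divide)
    have "real n powr (-3/2) * (real n * c1 + real k * (real n * c2 1 + real n * c2 2 + 4 * sqrt (expectation (Q n))))
      = (real n powr (-3/2) * real n) * C + 4 * real k * (real n powr (-3/2) * sqrt (expectation (Q n)))"
      unfolding C_def by (simp only: algebra_simps)
    also have "\<dots> = C / sqrt (real n) + 4 * real k * sqrt (expectation (Q n) / real n ^ 3)"
      unfolding p1 unfolding p2 by (simp only: real_sqrt_divide times_divide_eq_left mult_1_left)
    finally show ?thesis using EE[of n] by simp
  qed
  have lim: "(\<lambda>n. C / sqrt (real n) + 4 * real k * sqrt (expectation (Q n) / real n ^ 3)) \<longlonglongrightarrow> 0"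
  proof -
    have "(\<lambda>n. C / sqrt (real n)) \<longlonglongrightarrow> 0" by real_asymp
    moreover have "(\<lambda>n. 4 * real k * sqrt (expectation (Q n) / real n ^ 3)) \<longlonglongrightarrow> 4 * real k * sqrt 0"
      by (intro tendsto_intros Q0)
    ultimately show ?thesis using tendsto_add[of _ 0 _ _ "4 * real k * sqrt 0"] by fastforce
  qed
  have pr: "(\<lambda>n. prob {\<omega>\<in>space M. Er n \<omega> > \<epsilon>}) \<longlonglongrightarrow> 0" if \<epsilon>: "\<epsilon> > 0" for \<epsilon>
  proof (rule tendsto_sandwich[OF _ _ tendsto_const])
    show "\<forall>\<^sub>F n in sequentially. 0 \<le> prob {\<omega>\<in>space M. Er n \<omega> > \<epsilon>}" by simp
    show "\<forall>\<^sub>F n in sequentially. prob {\<omega>\<in>space M. Er n \<omega> > \<epsilon>} \<le> (C / sqrt (real n) + 4 * real k * sqrt (expectation (Q n) / real n ^ 3)) / \<epsilon>"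
    proof (rule eventually_mono[OF eventually_ge_at_top[of 1]])
      fix n :: nat assume n: "n \<ge> 1"
      have [measurable]: "Er n \<in> borel_measurable M" using Ei by (rule borel_measurable_integrable)
      have "prob {\<omega>\<in>space M. Er n \<omega> > \<epsilon>} \<le> prob {\<omega>\<in>space M. Er n \<omega> \<ge> \<epsilon>}"
        by (rule finite_measure_mono) (auto, measurable)
      also have "\<dots> \<le> expectation (Er n) / \<epsilon>"
        by (rule integral_Markov_inequality_measure[OF Ei, of "{}"]) (use \<epsilon> En in auto)
      also have "\<dots> \<le> (C / sqrt (real n) + 4 * real k * sqrt (expectation (Q n) / real n ^ 3)) / \<epsilon>"
        using EE'[OF n] \<epsilon> by (intro divide_right_mono) auto
      finally show "prob {\<omega>\<in>space M. Er n \<omega> > \<epsilon>} \<le> (C / sqrt (real n) + 4 * real k * sqrt (expectation (Q n) / real n ^ 3)) / \<epsilon>" .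
    qed
    show "(\<lambda>n. (C / sqrt (real n) + 4 * real k * sqrt (expectation (Q n) / real n ^ 3)) / \<epsilon>) \<longlonglongrightarrow> 0"
      using tendsto_divide[OF lim tendsto_const[of \<epsilon>]] \<epsilon> by simp
  qed
  have bd: "\<bar>Zn k h th X n \<omega> t - Zlim k (mp.wn n) \<omega> t\<bar> \<le> Er n \<omega>" if "n \<ge> 1" "t \<in> cube k" for n \<omega> t
    unfolding Er_def by (rule Zn_Zlim_le[OF k that _ R]) (auto simp: Qp)
  have em: "Er n \<in> borel_measurable M" for n using Ei by (rule borel_measurable_integrable)
  show ?thesis by (intro exI[of _ Er] conjI allI impI em bd pr)
qed

lemma conv_dist_ustat:
  assumes k: "k \<ge> 1" and W: "brownian2 N W (lrv M X h)"
  shows "conv_dist (cube k) M (\<lambda>n. Zn k h th X n) N (Zlim k W)"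
proof -
  have pl: "pair_limit M X \<tau> Cb (hF h mu) q N W"
  proof (intro pair_limit.intro pair_limit_axioms.intro mp.mixing_pair_axioms)
    note W' = W[unfolded brownian2_def]
    show "prob_space N" using W' by (rule conjunct1)
    show "W p t \<in> borel_measurable N" if "p \<in> {1,2}" "t \<in> {0..1}" for p t
      using conjunct1[OF conjunct2[OF W']] that by (auto simp only:)
    show "continuous_on {0..1} (\<lambda>t. W p t \<omega>)" if "p \<in> {1,2}" "\<omega> \<in> space N" for p \<omega>
      using conjunct1[OF conjunct2[OF conjunct2[OF W']]] that by (auto simp only:)
    fix n :: nat and a :: "nat \<Rightarrow> real" and qq :: "nat \<Rightarrow> nat" and s :: "nat \<Rightarrow> real"
    assume as: "\<forall>j<n. qq j \<in> {1,2} \<and> s j \<in> {0..1}"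
    have "distr N borel (\<lambda>\<omega>. \<Sum>j<n. a j * W (qq j) (s j) \<omega>)
      = centered_gauss (\<Sum>j<n. \<Sum>m<n. a j * a m * min (s j) (s m) * lrv M X h (qq j) (qq m))"
      using conjunct2[OF conjunct2[OF conjunct2[OF W']]] as by (simp only:)
    also have "(\<Sum>j<n. \<Sum>m<n. a j * a m * min (s j) (s m) * lrv M X h (qq j) (qq m)) = (\<Sum>j<n. \<Sum>m<n. a j * a m * min (s j) (s m) * mp.sg (qq j) (qq m))"
    proof (intro sum.cong refl)
      fix j m assume "j \<in> {..<n}" "m \<in> {..<n}"
      then show "a j * a m * min (s j) (s m) * lrv M X h (qq j) (qq m) = a j * a m * min (s j) (s m) * mp.sg (qq j) (qq m)"
        using lrv_sg[of "qq j" "qq m"] as by simp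
    qed
    finally show "distr N borel (\<lambda>\<omega>. \<Sum>j<n. a j * W (qq j) (s j) \<omega>)
      = centered_gauss (\<Sum>j<n. \<Sum>m<n. a j * a m * min (s j) (s m) * mp.sg (qq j) (qq m))" .
  qed
  from approx_error[OF k] show ?thesis
  proof (elim exE conjE)
    fix Er assume Er: "\<forall>n. Er n \<in> borel_measurable M"
      "\<forall>n \<omega> t. 1 \<le> n \<longrightarrow> t \<in> cube k \<longrightarrow> \<bar>Zn k h th X n \<omega> t - Zlim k (mp.wn n) \<omega> t\<bar> \<le> Er n \<omega>"
      "\<forall>\<epsilon>>0. (\<lambda>n. prob {\<omega>\<in>space M. Er n \<omega> > \<epsilon>}) \<longlonglongrightarrow> 0"
    show ?thesis
    proof (rule pair_limit.conv_main[OF pl k Zn_bounded_on[OF k]])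
      show "Er n \<in> borel_measurable M" for n using Er(1) by (rule spec)
      show "\<bar>Zn k h th X n \<omega> t - Zlim k (mp.wn n) \<omega> t\<bar> \<le> Er n \<omega>" if "1 \<le> n" "t \<in> cube k" for n \<omega> t
        using Er(2)[rule_format, OF that] .
      show "(\<lambda>n. prob {\<omega>\<in>space M. Er n \<omega> > \<epsilon>}) \<longlonglongrightarrow> 0" if "0 < \<epsilon>" for \<epsilon>
        using Er(3)[rule_format, OF that] .
    qed
  qed
qed

end

theorem theorem1:
  fixes M :: "'a measure" and X :: "nat \<Rightarrow> 'a \<Rightarrow> real" and h :: "real \<Rightarrow> real \<Rightarrow> real"
    and k :: nat and Y :: "nat \<Rightarrow> nat \<Rightarrow> 'a \<Rightarrow> real" and dotF :: "nat \<Rightarrow> real \<Rightarrow> real"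
  assumes P: "prob_space M"
    and k: "k \<ge> 1"
    and h_meas: "(\<lambda>(x, y). h x y) \<in> borel_measurable (borel \<Otimes>\<^sub>M borel)"
    and X_rv: "\<forall>i. X i \<in> borel_measurable M"
    \<comment> \<open>(A1)\<close>
    and A1_stat: "stationary_seq M X"
    and A1_reg: "geom_abs_regular M X"
    \<comment> \<open>(A2)\<close>
    and A2_cdf1: "dotF 1 = cdf (distr M borel (X 1))"
    and A2_cdfs: "\<forall>l\<in>{1..k}. \<exists>\<mu>. real_distribution \<mu> \<and> dotF l = cdf \<mu>"
    and A2_Y_rv: "\<forall>l\<in>{1..k}. \<forall>i. Y l i \<in> borel_measurable M"
    and A2_Y_stat: "\<forall>l\<in>{1..k}. stationary_seq M (Y l) \<and> geom_abs_regular M (Y l)"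
    and A2_Y_cdf: "\<forall>l\<in>{1..k}. \<forall>i\<ge>1. cdf (distr M borel (Y l i)) = dotF l"
    and A2_Y1: "\<forall>I. finite I \<and> I \<subseteq> {1..} \<longrightarrow> fdd M (Y 1) I = fdd M X I"
    \<comment> \<open>H_0\<close>
    and H0: "\<forall>i\<ge>1. cdf (distr M borel (X i)) = cdf (distr M borel (X 1))"
    \<comment> \<open>moment condition\<close>
    and mom: "\<exists>\<delta>>0.
        (SUP ij\<in>{1..} \<times> {1..}. \<integral>\<^sup>+ \<omega>. ennreal (\<bar>h (X (fst ij) \<omega>) (X (snd ij) \<omega>)\<bar> powr (2 + \<delta>)) \<partial>M) < \<infinity> \<and>
        (\<integral>\<^sup>+ x. \<integral>\<^sup>+ y. ennreal (\<bar>h x y\<bar> powr (2 + \<delta>)) \<partial>(distr M borel (X 1)) \<partial>(distr M borel (X 1))) < \<infinity>"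
  shows "(\<forall>p\<in>{1,2}. \<forall>r\<in>{1,2}. lrv_finite M X h p r) \<and>
    ((\<forall>p\<in>{1,2}. \<forall>r\<in>{1,2}. lrv M X h p r > 0) \<longrightarrow>
      (\<forall>(N :: 'b measure) W. brownian2 N W (lrv M X h) \<longrightarrow>
         conv_dist (cube k) M
           (\<lambda>n. Zn k h (theta_h h (distr M borel (X 1)) (distr M borel (X 1))) X n)
           N (Zlim k W)))"
proof -
  interpret prob_space M by (rule P)
  have X[measurable]: "X i \<in> borel_measurable M" for i using X_rv by blast
  obtain \<tau> Cb where ms: "mixing_seq M X \<tau> Cb"
    using mixing_seq_of_geom_abs_regular[OF P X A1_stat A1_reg] by blast
  obtain \<delta> where \<delta>: "\<delta> > 0"
    and s1: "(SUP ij\<in>{1..} \<times> {1..}. \<integral>\<^sup>+ \<omega>. ennreal (\<bar>h (X (fst ij) \<omega>) (X (snd ij) \<omega>)\<bar> powr (2 + \<delta>)) \<partial>M) < \<infinity>" (is "?S1 < _")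
    and s2: "(\<integral>\<^sup>+ x. \<integral>\<^sup>+ y. ennreal (\<bar>h x y\<bar> powr (2 + \<delta>)) \<partial>(distr M borel (X 1)) \<partial>(distr M borel (X 1))) < \<infinity>" (is "?S2 < _")
    using mom by (elim exE conjE)
  have hc[measurable]: "(\<lambda>x. h (f x) (f' x)) \<in> borel_measurable K" if "f \<in> borel_measurable K" "f' \<in> borel_measurable K" for f f' and K :: "'a measure"
    using measurable_compose[OF measurable_Pair h_meas, of f K f'] that by simp
  \<comment> \<open>The exponent is lowered into the interval from 2 to 3; as |z|^q is at most 1 +
    |z|^(2+\<delta>), the moment bounds survive with an additive constant, which \<open>D\<close>
    contains.\<close>
  define q where "q = 2 + min \<delta> 1"
  define D where "D = 2 + enn2real ?S1 + enn2real ?S2"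
  have le: "ennreal (\<bar>z\<bar> powr q) \<le> 1 + ennreal (\<bar>z\<bar> powr (2 + \<delta>))" for z :: real
  proof -
    have "\<bar>z\<bar> powr q \<le> 1 + \<bar>z\<bar> powr (2 + \<delta>)" using \<delta> by (intro powr_le_one_plus_powr) (auto simp: q_def)
    then have "ennreal (\<bar>z\<bar> powr q) \<le> ennreal (1 + \<bar>z\<bar> powr (2 + \<delta>))" by (rule ennreal_leI)
    then show ?thesis by (simp add: ennreal_plus)
  qed
  have D1: "1 + ?S1 \<le> ennreal D"
  proof -
    have "1 + ?S1 = ennreal (1 + enn2real ?S1)" using s1 by (simp add: ennreal_plus)
    also have "\<dots> \<le> ennreal D" unfolding D_def by (intro ennreal_leI) simp
    finally show ?thesis .
  qed
  have D2: "1 + ?S2 \<le> ennreal D"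
  proof -
    have "1 + ?S2 = ennreal (1 + enn2real ?S2)" using s2 by (simp add: ennreal_plus)
    also have "\<dots> \<le> ennreal D" unfolding D_def by (intro ennreal_leI) simp
    finally show ?thesis .
  qed
  have uk: "ustat_kernel M X \<tau> Cb h q D"
  proof (intro ustat_kernel.intro ustat_kernel_axioms.intro ms)
    show "case_prod h \<in> borel_measurable (borel \<Otimes>\<^sub>M borel)" using h_meas by simp
    show "2 < q" "q \<le> 3" using \<delta> by (auto simp: q_def)
    show "0 \<le> D" by (simp add: D_def)
    show "(\<integral>\<^sup>+\<omega>. ennreal (\<bar>h (X i \<omega>) (X j \<omega>)\<bar> powr q) \<partial>M) \<le> ennreal D" if "1 \<le> i" "1 \<le> j" for i j
    proof -
      have "(\<integral>\<^sup>+\<omega>. ennreal (\<bar>h (X i \<omega>) (X j \<omega>)\<bar> powr q) \<partial>M) \<le> (\<integral>\<^sup>+\<omega>. 1 + ennreal (\<bar>h (X i \<omega>) (X j \<omega>)\<bar> powr (2 + \<delta>)) \<partial>M)"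
        by (intro nn_integral_mono le)
      also have "\<dots> = 1 + (\<integral>\<^sup>+\<omega>. ennreal (\<bar>h (X i \<omega>) (X j \<omega>)\<bar> powr (2 + \<delta>)) \<partial>M)"
        by (simp add: nn_integral_add emeasure_space_1)
      also have "(\<integral>\<^sup>+\<omega>. ennreal (\<bar>h (X i \<omega>) (X j \<omega>)\<bar> powr (2 + \<delta>)) \<partial>M) \<le> ?S1"
        using that by (intro SUP_upper2[of "(i, j)"]) auto
      finally show ?thesis using D1 by (auto intro: order_trans)
    qed
    let ?m = "distr M borel (X 1)"
    interpret m: prob_space ?m by (rule prob_space_distr) simp
    have hm: "case_prod h \<in> borel_measurable (?m \<Otimes>\<^sub>M ?m)" using h_meas by (simp cong: measurable_cong_sets)
    have hs[measurable]: "h x \<in> borel_measurable borel" for x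
      using measurable_compose[OF measurable_Pair1' h_meas, of x] by simp
    have im: "(\<lambda>x. \<integral>\<^sup>+y. ennreal (\<bar>h x y\<bar> powr (2 + \<delta>)) \<partial>?m) \<in> borel_measurable ?m"
    proof -
      have "(\<lambda>z. ennreal (\<bar>case_prod h z\<bar> powr (2 + \<delta>))) \<in> borel_measurable (?m \<Otimes>\<^sub>M ?m)" using hm by measurable
      then have "(\<lambda>(x, y). ennreal (\<bar>h x y\<bar> powr (2 + \<delta>))) \<in> borel_measurable (?m \<Otimes>\<^sub>M ?m)" by (simp add: case_prod_unfold)
      then show ?thesis by (rule m.borel_measurable_nn_integral)
    qed
    have u1: "emeasure ?m UNIV = 1" using m.emeasure_space_1 by simp
    have "(\<integral>\<^sup>+x. \<integral>\<^sup>+y. ennreal (\<bar>h x y\<bar> powr q) \<partial>?m \<partial>?m) \<le> (\<integral>\<^sup>+x. \<integral>\<^sup>+y. 1 + ennreal (\<bar>h x y\<bar> powr (2 + \<delta>)) \<partial>?m \<partial>?m)"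
      by (intro nn_integral_mono le)
    also have "\<dots> = (\<integral>\<^sup>+x. 1 + (\<integral>\<^sup>+y. ennreal (\<bar>h x y\<bar> powr (2 + \<delta>)) \<partial>?m) \<partial>?m)"
      by (simp add: nn_integral_add u1[unfolded One_nat_def])
    also have "\<dots> = 1 + ?S2" using nn_integral_add[OF _ im, of "\<lambda>_. 1"] by (simp add: u1[unfolded One_nat_def])
    also have "\<dots> \<le> ennreal D" by (rule D2)
    finally show "(\<integral>\<^sup>+x. \<integral>\<^sup>+y. ennreal (\<bar>h x y\<bar> powr q) \<partial>?m \<partial>?m) \<le> ennreal D" .
  qed
  interpret u: ustat_kernel M X \<tau> Cb h q D by (rule uk)
  have th: "theta_h h (distr M borel (X 1)) (distr M borel (X 1)) = u.th" by (simp add: u.th_def u.mu_def)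
  show ?thesis unfolding th
  proof (intro conjI ballI impI allI)
    show "lrv_finite M X h p r" if "p \<in> {1,2}" "r \<in> {1,2}" for p r by (rule u.lrv_finite[OF that])
    fix N :: "'b measure" and W assume "brownian2 N W (lrv M X h)"
    then show "conv_dist (cube k) M (\<lambda>n. Zn k h u.th X n) N (Zlim k W)" by (rule u.conv_dist_ustat[OF k])
  qed
qed

end
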